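(* Let $n\ge1$ and $p\ge1$. Let $K$ and $L$ be smooth uniformly h-convex bounded domains in $\mathbb{H}^{n+1}$. Then $$\mathcal{V}_p(K,L)\ \ge\ \mathcal{V}^{\frac{n+1-p}{n+1}}(K)\,\mathcal{V}^{\frac p{n+1}}(L).$$ When $p=1$, equality holds if $K$ and $L$ are hyperbolic dilates. When $p>1$, equality holds if and only if $K$ and $L$ are hyperbolic dilates.
   Context: $\mathbb{R}^{n+1,1}$ is $\mathbb{R}^{n+2}$ with $\langle X,Y\rangle=\sum_{i=0}^nx_iy_i-x_{n+1}y_{n+1}$; $\mathbb{H}^{n+1}=\{X=(x,x_{n+1}):\langle X,X\rangle=-1,x_{n+1}>0\}$ with origin $N=(0,1)$; $\mathbb{S}^n\subset\mathbb{R}^{n+1}$ is the unit sphere. A smooth bounded domain (compact, connected, nonempty interior, smooth boundary) is uniformly h-convex if for some $\delta>0$ all principal curvatures $\kappa_i$ of its boundary (outward unit normal $\nu$) exceed $1+\delta$. Horospherical support function: $u_\Omega(z)=\sup_{X\in\Omega}\log(-\langle X,(z,1)\rangle)$, $\varphi_\Omega=e^{u_\Omega}$. The horospherical Gauss map of $K$ sends $X\in\partial K$ to the $z\in\mathbb{S}^n$ with $X-\nu=\varphi_K(z)^{-1}(z,1)$. For $c\ge1$, $c\cdot_1K$ is the domain with horospherical support function $u_K+\log c$; $K$ and $L$ are hyperbolic dilates if $K=c\cdot_1L$ or $L=c\cdot_1K$ for some $c\ge1$. With $r$ the distance to $N$, $\tilde u=\langle\sinh r\,\partial_r,\nu\rangle$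 and $p_n(\cosh r\,\kappa-\tilde u)=\prod_{i=1}^n(\cosh r\,\kappa_i-\tilde u)$, $$\mathcal{V}(K)=\frac1{n+1}\int_{\partial K}\frac{p_n(\cosh r\,\kappa-\tilde u)}{(\cosh r-\tilde u)^{n+1}}\,d\mu,\qquad\mathcal{V}_p(K,L)=\frac1{n+1}\int_{\partial K}\varphi_L^p(z)\,\frac{p_n(\cosh r\,\kappa-\tilde u)}{(\cosh r-\tilde u)^{n+1-p}}\,d\mu,$$ where $z$ is the horospherical Gauss image of the point of $\partial K$. *)

theory Defs
  imports "HOL-Analysis.Analysis"
begin

section \<open>The hyperboloid model\<close>

text \<open>
  With \<open>n = CARD('n) \<ge> 1\<close>, the space \<open>\<real>\<^sup>n\<^sup>+\<^sup>1\<close> is \<open>real ^ 'n \<times> real\<close> (with its standard inner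
  product), and \<open>\<real>\<^sup>n\<^sup>+\<^sup>1\<^sup>,\<^sup>1\<close> is \<open>(real ^ 'n \<times> real) \<times> real\<close>, a point being written
  \<open>X = (x, x\<^sub>n\<^sub>+\<^sub>1)\<close>. This way the coordinate space \<open>real ^ 'n\<close> of the \<open>n\<close>-dimensional hypersurfaces
  is available as a type as well.
\<close>

type_synonym 'n espace = "(real, 'n) vec \<times> real"
type_synonym 'n minkowski = "'n espace \<times> real"

definition mink :: "'n::finite minkowski \<Rightarrow> 'n minkowski \<Rightarrow> real" where
  "mink X Y = fst X \<bullet> fst Y - snd X * snd Y"

definition hyp_space :: "'n::finite minkowski set" where
  "hyp_space = {X. mink X X = -1 \<and> snd X > 0}"

definition hyp_origin :: "'n::finite minkowski" where
  "hyp_origin = (0, 1)"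

definition hyp_tangent :: "'n::finite minkowski \<Rightarrow> 'n minkowski set" where
  "hyp_tangent X = {w. mink X w = 0}"

definition hyp_dist :: "'n::finite minkowski \<Rightarrow> 'n minkowski \<Rightarrow> real" where
  "hyp_dist X Y = arcosh (- mink X Y)"

abbreviation hyp_radius :: "'n::finite minkowski \<Rightarrow> real" where
  "hyp_radius X \<equiv> hyp_dist X hyp_origin"

text \<open>
  The radial field \<open>\<partial>\<^sub>r\<close>: the \<open>r\<close>-derivative of the polar parametrization
  \<open>X = (sinh r *\<^sub>R \<theta>, cosh r)\<close>, where \<open>\<theta> = sgn (fst X)\<close> is the unit vector in direction \<open>fst X\<close>.
  Its value at the origin, where \<open>\<partial>\<^sub>r\<close> is undefined, is irrelevant: it only occurs multiplied
  by \<open>sinh r\<close>.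
\<close>
definition radial_field :: "'n::finite minkowski \<Rightarrow> 'n minkowski" where
  "radial_field X = (cosh (hyp_radius X) *\<^sub>R sgn (fst X), sinh (hyp_radius X))"

section \<open>Smooth bounded domains\<close>

text \<open>\<open>C\<^sup>k\<close> maps; used only for open \<open>S\<close>.\<close>
fun Ck_on :: "nat \<Rightarrow> ('a::euclidean_space \<Rightarrow> 'b::euclidean_space) \<Rightarrow> 'a set \<Rightarrow> bool" where
  "Ck_on 0 f S \<longleftrightarrow> continuous_on S f"
| "Ck_on (Suc k) f S \<longleftrightarrow>
     (\<forall>x\<in>S. f differentiable (at x)) \<and> (\<forall>v. Ck_on k (\<lambda>x. frechet_derivative f (at x) v) S)"

definition smooth_on :: "('a::euclidean_space \<Rightarrow> 'b::euclidean_space) \<Rightarrow> 'a set \<Rightarrow> bool" where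
  "smooth_on f S \<longleftrightarrow> (\<forall>k. Ck_on k f S)"

abbreviation hyp_boundary :: "'n::finite minkowski set \<Rightarrow> 'n minkowski set" where
  "hyp_boundary K \<equiv> top_of_set hyp_space frontier_of K"

text \<open>
  \<open>\<rho>\<close> is a smooth function on the ambient neighbourhood \<open>W\<close> of \<open>X\<close> such that \<open>K\<close> is
  \<open>{\<rho> \<le> 0}\<close> inside \<open>W \<inter> hyp_space\<close>, and the differential at \<open>X\<close> of its restriction to the
  hyperbolic space is nonzero.
\<close>
definition local_defining_function ::
    "'n::finite minkowski set \<Rightarrow> 'n minkowski \<Rightarrow> 'n minkowski set \<Rightarrow> ('n minkowski \<Rightarrow> real) \<Rightarrow> bool" where
  "local_defining_function K X W \<rho> \<longleftrightarrow>
     open W \<and> X \<in> W \<and> smooth_on \<rho> W \<and>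
     K \<inter> W = {Y \<in> hyp_space \<inter> W. \<rho> Y \<le> 0} \<and> \<rho> X = 0 \<and>
     (\<exists>w\<in>hyp_tangent X. frechet_derivative \<rho> (at X) w \<noteq> 0)"

definition smooth_bounded_domain :: "'n::finite minkowski set \<Rightarrow> bool" where
  "smooth_bounded_domain K \<longleftrightarrow>
     K \<subseteq> hyp_space \<and> compact K \<and> connected K \<and> top_of_set hyp_space interior_of K \<noteq> {} \<and>
     (\<forall>X\<in>hyp_boundary K. \<exists>W \<rho>. local_defining_function K X W \<rho>)"

section \<open>Outward normal and principal curvatures\<close>

text \<open>
  The unit vector tangent to the hyperbolic space at \<open>X\<close>, orthogonal to the boundary (whose tangent
  space is the kernel of \<open>d\<rho>\<close>), and pointing out of \<open>K = {\<rho> \<le> 0}\<close>. It does not depend on the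
  choice of \<open>\<rho>\<close>.
\<close>
definition outward_normal :: "'n::finite minkowski set \<Rightarrow> 'n minkowski \<Rightarrow> 'n minkowski" where
  "outward_normal K X = (THE \<nu>. \<exists>W \<rho>. local_defining_function K X W \<rho> \<and>
     \<nu> \<in> hyp_tangent X \<and> mink \<nu> \<nu> = 1 \<and>
     (\<forall>w\<in>hyp_tangent X. frechet_derivative \<rho> (at X) w = 0 \<longrightarrow> mink w \<nu> = 0) \<and>
     frechet_derivative \<rho> (at X) \<nu> > 0)"

definition boundary_tangent :: "'n::finite minkowski set \<Rightarrow> 'n minkowski \<Rightarrow> 'n minkowski set" where
  "boundary_tangent K X = {w \<in> hyp_tangent X. mink w (outward_normal K X) = 0}"

text \<open>
  The Weingarten map \<open>w \<mapsto> D\<^sub>w\<nu>\<close>. The derivative of \<open>\<nu>\<close> within the boundary is unique on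
  \<open>boundary_tangent K X\<close> only, and it is only used there. The flat derivative \<open>D\<^sub>w\<nu>\<close> agrees with the
  hyperbolic one: by \<open>\<langle>\<nu>, X\<rangle> = 0\<close> and \<open>\<langle>\<nu>, w\<rangle> = 0\<close> it has no component along \<open>X\<close>.
  Geodesic balls of radius \<open>r\<close> have principal curvatures \<open>coth r\<close>.
\<close>
definition shape_operator ::
    "'n::finite minkowski set \<Rightarrow> 'n minkowski \<Rightarrow> 'n minkowski \<Rightarrow> 'n minkowski" where
  "shape_operator K X = frechet_derivative (outward_normal K) (at X within hyp_boundary K)"

definition curvature_space ::
    "'n::finite minkowski set \<Rightarrow> 'n minkowski \<Rightarrow> real \<Rightarrow> 'n minkowski set" where
  "curvature_space K X k = {w \<in> boundary_tangent K X. shape_operator K X w = k *\<^sub>R w}"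

text \<open>
  \<open>\<kappa>\<^sub>1, \<dots>, \<kappa>\<^sub>n\<close>: the eigenvalues of the (self-adjoint) Weingarten map, repeated according to
  multiplicity.
\<close>
definition principal_curvatures :: "'n::finite minkowski set \<Rightarrow> 'n minkowski \<Rightarrow> real multiset" where
  "principal_curvatures K X =
     (\<Sum>k | curvature_space K X k \<noteq> {0}. replicate_mset (dim (curvature_space K X k)) k)"

definition uniformly_h_convex :: "'n::finite minkowski set \<Rightarrow> bool" where
  "uniformly_h_convex K \<longleftrightarrow>
     (\<exists>\<delta>>0. \<forall>X\<in>hyp_boundary K. \<forall>k\<in>#principal_curvatures K X. k > 1 + \<delta>)"

definition uniformly_h_convex_domain :: "'n::finite minkowski set \<Rightarrow> bool" where
  "uniformly_h_convex_domain K \<longleftrightarrow> smooth_bounded_domain K \<and> uniformly_h_convex K"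

section \<open>Horospherical support function, Gauss map and dilation\<close>

definition horo_support :: "'n::finite minkowski set \<Rightarrow> 'n espace \<Rightarrow> real" where
  "horo_support K z = (SUP X\<in>K. ln (- mink X (z, 1)))"

definition horo_phi :: "'n::finite minkowski set \<Rightarrow> 'n espace \<Rightarrow> real" where
  "horo_phi K z = exp (horo_support K z)"

definition horo_gauss :: "'n::finite minkowski set \<Rightarrow> 'n minkowski \<Rightarrow> 'n espace" where
  "horo_gauss K X =
     (THE z. z \<in> sphere 0 1 \<and> X - outward_normal K X = inverse (horo_phi K z) *\<^sub>R (z, 1))"

text \<open>
  \<open>is_hyp_dilation c K D\<close> says that \<open>D\<close> is \<open>c \<cdot>\<^sub>1 K\<close>, the domain with horospherical support function
  \<open>u\<^sub>K + log c\<close>. It is a relation because a uniformly h-convex domain is determined by its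
  horospherical support function.
\<close>
definition is_hyp_dilation :: "real \<Rightarrow> 'n::finite minkowski set \<Rightarrow> 'n minkowski set \<Rightarrow> bool" where
  "is_hyp_dilation c K D \<longleftrightarrow>
     uniformly_h_convex_domain D \<and> (\<forall>z\<in>sphere 0 1. horo_support D z = horo_support K z + ln c)"

definition hyp_dilates :: "'n::finite minkowski set \<Rightarrow> 'n minkowski set \<Rightarrow> bool" where
  "hyp_dilates K L \<longleftrightarrow> (\<exists>c\<ge>1. is_hyp_dilation c L K \<or> is_hyp_dilation c K L)"

section \<open>The area measure of a hypersurface\<close>

definition regular_param ::
    "'n::finite minkowski set \<Rightarrow> (real ^ 'n) set \<Rightarrow> (real ^ 'n \<Rightarrow> 'n minkowski) \<Rightarrow> bool" where
  "regular_param M U F \<longleftrightarrow>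
     open U \<and> Ck_on 1 F U \<and> (\<forall>x\<in>U. inj (frechet_derivative F (at x))) \<and>
     openin (top_of_set M) (F ` U) \<and> (\<exists>G. homeomorphism U (F ` U) F G)"

text \<open>\<open>sqrt (det (g\<^sub>i\<^sub>j))\<close> for the metric induced by the Minkowski product\<close>
definition area_density :: "(real ^ 'n \<Rightarrow> 'n::finite minkowski) \<Rightarrow> real ^ 'n \<Rightarrow> real" where
  "area_density F x =
     sqrt (det (\<chi> i j. mink (frechet_derivative F (at x) (axis i 1))
                            (frechet_derivative F (at x) (axis j 1))))"

text \<open>
  The Riemannian measure of \<open>M\<close>: the unique Borel measure on \<open>M\<close> that is
  \<open>sqrt (det (g\<^sub>i\<^sub>j)) dx\<close> in every local parametrization.
\<close>
definition area_measure :: "'n::finite minkowski set \<Rightarrow> 'n minkowski measure" where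
  "area_measure M = (THE \<mu>. sets \<mu> = sets (restrict_space borel M) \<and>
     (\<forall>U F B. regular_param M U F \<and> B \<in> sets borel \<and> B \<subseteq> U \<longrightarrow>
        emeasure \<mu> (F ` B) = (\<integral>\<^sup>+x\<in>B. ennreal (area_density F x) \<partial>lborel)))"

section \<open>The functionals\<close>

definition u_tilde :: "'n::finite minkowski set \<Rightarrow> 'n minkowski \<Rightarrow> real" where
  "u_tilde K X = mink (sinh (hyp_radius X) *\<^sub>R radial_field X) (outward_normal K X)"

definition shifted_curvature_product :: "'n::finite minkowski set \<Rightarrow> 'n minkowski \<Rightarrow> real" where
  "shifted_curvature_product K X =
     (\<Prod>k\<in>#principal_curvatures K X. cosh (hyp_radius X) * k - u_tilde K X)"

definition hyp_V :: "'n::finite minkowski set \<Rightarrow> real" where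
  "hyp_V K = 1 / (real CARD('n) + 1) *
     (\<integral>X. shifted_curvature_product K X / (cosh (hyp_radius X) - u_tilde K X) ^ (CARD('n) + 1)
        \<partial>area_measure (hyp_boundary K))"

definition hyp_Vp :: "real \<Rightarrow> 'n::finite minkowski set \<Rightarrow> 'n minkowski set \<Rightarrow> real" where
  "hyp_Vp p K L = 1 / (real CARD('n) + 1) *
     (\<integral>X. horo_phi L (horo_gauss K X) powr p *
          (shifted_curvature_product K X /
             (cosh (hyp_radius X) - u_tilde K X) powr (real CARD('n) + 1 - p))
        \<partial>area_measure (hyp_boundary K))"

end

theory Submission
  imports Defs
begin

text \<open>
  On the sphere, \<open>\<phi>\<^sub>K\<close> is the Euclidean support function of the union \<open>B\<^sub>K\<close> of the balls with centre
  \<open>- x\<close> and radius \<open>x\<^sub>n\<^sub>+\<^sub>1\<close>, where \<open>(x, x\<^sub>n\<^sub>+\<^sub>1)\<close> ranges over \<open>K\<close>. The point of \<open>\<partial>B\<^sub>K\<close> with outer normal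
  \<open>z\<close>, the horospherical Gauss image of \<open>X \<in> \<partial>K\<close>, is \<open>Y(X) = x\<^sub>n\<^sub>+\<^sub>1 z - x\<close>. The differential of \<open>Y\<close> is a
  multiple of the shifted Weingarten map, so the integrand of \<open>\<V>(K)\<close> times the area measure is the
  cone-volume measure \<open>m\<close> of \<open>B\<^sub>K\<close>. Hence \<open>\<V>(K)\<close> is the Lebesgue measure of \<open>B\<^sub>K\<close>, and
  \<open>\<V>\<^sub>p(K, L)\<close> is the integral of \<open>(\<phi>\<^sub>L / \<phi>\<^sub>K)\<^sup>p\<close> over \<open>m\<close>. The theorem thus becomes the \<open>L\<^sub>p\<close> Minkowski
  inequality. For \<open>p = 1\<close> it follows from the Brunn--Minkowski inequality: the sum \<open>B\<^sub>K + t B\<^sub>L\<close> is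
  contained in the set that is star-shaped about \<open>0\<close> and whose boundary is obtained from \<open>\<partial>B\<^sub>K\<close> by
  the radial factor \<open>1 + t \<phi>\<^sub>L / \<phi>\<^sub>K\<close>, and \<open>t\<close> tends to \<open>0\<close>. For \<open>p > 1\<close> Jensen's inequality is applied
  to \<open>s \<mapsto> s\<^sup>p\<close>; its strict convexity forces \<open>\<phi>\<^sub>L / \<phi>\<^sub>K\<close> to be constant in the equality case.

  That each \<open>X \<in> \<partial>K\<close> maximizes the horospherical height in direction \<open>z\<close> over all of \<open>K\<close> is seen
  by projecting along \<open>(z, 1)\<close>: curvatures greater than \<open>1\<close> make the image of \<open>K\<close> locally
  strictly convex, hence convex, as \<open>K\<close> is connected.
\<close>

section \<open>Analytic preliminaries\<close>

text \<open>Over the ball with centre \<open>- x\<close> and radius \<open>t\<close> the linear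
  function given by a unit vector z has maximum \<open>t - x \<bullet> z\<close>, which is minus the
  Minkowski product of \<open>(x, t)\<close> and \<open>(z, 1)\<close>: hence the balls. The null
  vector X - \<nu> carries everything else: its direction is the Gauss image, and its last
  coordinate is both cosh r minus \<open>u_tilde\<close> and 1 / \<open>\<phi>\<^sub>K(z)\<close>.
  What shapes the development is that normal, Gauss image and area are given by descriptions, which
  must first be shown to single out one object. The normal is pinned down by the curves that enter
  or leave K, the Gauss image by the support property of horoballs, and the area measure is obtained
  from the measure m by dividing by its density, so that no local measures have to be glued. The
  factor 1 / (n + 1) is the integral of s^n over the unit interval in the radial direction. The sum
  of the two bodies is only bounded from outside, so the ratio of the support functions enters
  merely as a continuous function.\<close>

lemma second_difference_estimate:
  fixes f :: "'a::real_inner \<Rightarrow> real" and g H :: "'a \<Rightarrow> 'a"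
  assumes "open W" "x \<in> W"
    and f: "\<And>y. y \<in> W \<Longrightarrow> (f has_derivative (\<lambda>w. g y \<bullet> w)) (at y)"
    and g: "(g has_derivative H) (at x)" and "e > 0"
  shows "\<exists>d>0. \<forall>t. 0 < t \<and> t < d \<longrightarrow>
    \<bar>(f (x + t *\<^sub>R u + t *\<^sub>R v) - f (x + t *\<^sub>R u) - f (x + t *\<^sub>R v) + f x) - t\<^sup>2 * (H v \<bullet> u)\<bar> \<le> e * t\<^sup>2"
proof -
  have lin: "linear H" using g has_derivative_linear by blast
  \<comment> \<open>\<open>2 * norm u + norm v\<close> bounds, up to the factor \<open>t\<close>,
    the total distance of the two evaluation points from \<open>x\<close>; the further factor
    \<open>norm u\<close> comes from Cauchy-Schwarz. Adding 1 keeps \<open>C\<close> positive when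
    \<open>u\<close> vanishes.\<close>
  define C where "C = (2 * norm u + norm v) * norm u + 1"
  have C: "C > 0" unfolding C_def by (simp add: add_nonneg_pos)
  obtain r where r: "r > 0" "ball x r \<subseteq> W"
    using assms(1,2) open_contains_ball by blast
  have "e / C > 0" using C \<open>e > 0\<close> by simp
  then obtain d0 where d0: "d0 > 0"
    and est: "\<And>y. norm (y - x) < d0 \<Longrightarrow> norm (g y - g x - H (y - x)) \<le> e / C * norm (y - x)"
    using g unfolding has_derivative_at_alt by meson
  define M where "M = norm u + norm v + 1"
  have M: "M > 0" unfolding M_def by (simp add: add_nonneg_pos)
  show ?thesis
  proof (intro exI conjI allI impI)
    show "min r d0 / M > 0" using r d0 M by simp
    fix t :: real assume t: "0 < t \<and> t < min r d0 / M"
    then have tM: "t * M < r" "t * M < d0" using M by (auto simp: pos_less_divide_eq)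
    have small: "norm (a *\<^sub>R u + b *\<^sub>R v) < r \<and> norm (a *\<^sub>R u + b *\<^sub>R v) < d0"
      if "0 \<le> a" "a \<le> t" "0 \<le> b" "b \<le> t" for a b
    proof -
      have "norm (a *\<^sub>R u + b *\<^sub>R v) \<le> a * norm u + b * norm v"
        using norm_triangle_ineq[of "a *\<^sub>R u" "b *\<^sub>R v"] that by simp
      also have "\<dots> \<le> t * norm u + t * norm v"
        using that by (intro add_mono mult_right_mono) auto
      also have "\<dots> \<le> t * M" using t unfolding M_def by (simp add: algebra_simps)
      finally show ?thesis using tM by linarith
    qed
    \<comment> \<open>The second difference is the increment of \<open>h\<close> over [0, t]. The
      mean value theorem takes care of one derivative; the second one is a linearization of
      \<open>g\<close> at the single point \<open>x\<close>.\<close>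
    define h where "h = (\<lambda>s. f (x + t *\<^sub>R v + s *\<^sub>R u) - f (x + s *\<^sub>R u))"
    have der: "DERIV h s :> (g (x + t *\<^sub>R v + s *\<^sub>R u) - g (x + s *\<^sub>R u)) \<bullet> u" if "0 \<le> s" "s \<le> t" for s
    proof -
      have 1: "x + t *\<^sub>R v + s *\<^sub>R u \<in> W" "x + s *\<^sub>R u \<in> W"
        using small[of s t] small[of s 0] that t r(2)
        by (auto simp: subset_iff mem_ball dist_norm norm_minus_commute algebra_simps
              simp del: norm_scaleR)
      have "(h has_derivative (\<lambda>k. g (x + t *\<^sub>R v + s *\<^sub>R u) \<bullet> (k *\<^sub>R u) - g (x + s *\<^sub>R u) \<bullet> (k *\<^sub>R u))) (at s)"
        unfolding h_def
        by (rule has_derivative_diff; rule has_derivative_compose[OF _ f]; (rule 1)?)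
          (auto intro!: derivative_eq_intros)
      then show ?thesis
        by (rule has_derivative_imp_has_field_derivative) (simp add: inner_diff_left algebra_simps)
    qed
    obtain s where s: "0 < s" "s < t" and
      eq: "h t - h 0 = (t - 0) * ((g (x + t *\<^sub>R v + s *\<^sub>R u) - g (x + s *\<^sub>R u)) \<bullet> u)"
      using MVT2[of 0 t h, OF _ der] t by auto
    let ?A = "x + t *\<^sub>R v + s *\<^sub>R u" and ?B = "x + s *\<^sub>R u"
    have e1: "norm (g ?A - g x - H (?A - x)) \<le> e / C * norm (?A - x)"
      using small[of s t] s t by (intro est) (auto simp: algebra_simps)
    have e2: "norm (g ?B - g x - H (?B - x)) \<le> e / C * norm (?B - x)"
      using small[of s 0] s t by (intro est) (auto simp: algebra_simps)
    have HA: "H (?A - x) - H (?B - x) = t *\<^sub>R H v"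
      using lin by (simp add: linear_add linear_scale linear_diff)
    have "norm (g ?A - g ?B - t *\<^sub>R H v) \<le> e / C * norm (?A - x) + e / C * norm (?B - x)"
    proof -
      have "g ?A - g ?B - t *\<^sub>R H v = (g ?A - g x - H (?A - x)) - (g ?B - g x - H (?B - x))"
        unfolding HA[symmetric] by (simp only: diff_diff_eq2) (simp add: algebra_simps)
      then have "norm (g ?A - g ?B - t *\<^sub>R H v) \<le> norm (g ?A - g x - H (?A - x)) + norm (g ?B - g x - H (?B - x))"
        by (simp only: norm_triangle_ineq4)
      then show ?thesis using e1 e2 by linarith
    qed
    also have "\<dots> \<le> e / C * (t * (2 * norm u + norm v))"
    proof -
      have "norm (?A - x) \<le> t * norm v + s * norm u"
        using norm_triangle_ineq[of "t *\<^sub>R v" "s *\<^sub>R u"] s t by (simp add: algebra_simps)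
      moreover have "norm (?B - x) = s * norm u" using s by simp
      moreover have "s * norm u \<le> t * norm u" using s by (intro mult_right_mono) auto
      ultimately have "norm (?A - x) + norm (?B - x) \<le> t * (2 * norm u + norm v)"
        unfolding distrib_left by linarith
      then have "e / C * (norm (?A - x) + norm (?B - x)) \<le> e / C * (t * (2 * norm u + norm v))"
        using \<open>e / C > 0\<close> by (intro mult_left_mono) auto
      then show ?thesis by (simp only: distrib_left)
    qed
    finally have n1: "norm (g ?A - g ?B - t *\<^sub>R H v) \<le> e / C * (t * (2 * norm u + norm v))" .
    have "\<bar>(g ?A - g ?B - t *\<^sub>R H v) \<bullet> u\<bar> \<le> e / C * (t * (2 * norm u + norm v)) * norm u"
      using Cauchy_Schwarz_ineq2[of "g ?A - g ?B - t *\<^sub>R H v" u] n1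
      by (meson mult_right_mono norm_ge_zero order_trans)
    also have "\<dots> = e * t * ((C - 1) / C)" unfolding C_def by simp
    also have "\<dots> \<le> e * t * 1" using C \<open>e > 0\<close> t by (intro mult_left_mono) auto
    finally have n2: "\<bar>(g ?A - g ?B - t *\<^sub>R H v) \<bullet> u\<bar> \<le> e * t" by simp
    have "f (x + t *\<^sub>R u + t *\<^sub>R v) - f (x + t *\<^sub>R u) - f (x + t *\<^sub>R v) + f x = h t - h 0"
      unfolding h_def by (simp add: algebra_simps)
    then have "(f (x + t *\<^sub>R u + t *\<^sub>R v) - f (x + t *\<^sub>R u) - f (x + t *\<^sub>R v) + f x) - t\<^sup>2 * (H v \<bullet> u)
        = t * ((g ?A - g ?B - t *\<^sub>R H v) \<bullet> u)"
      unfolding eq by (simp add: inner_diff_left algebra_simps power2_eq_square)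
    then show "\<bar>(f (x + t *\<^sub>R u + t *\<^sub>R v) - f (x + t *\<^sub>R u) - f (x + t *\<^sub>R v) + f x) - t\<^sup>2 * (H v \<bullet> u)\<bar> \<le> e * t\<^sup>2"
      using n2 t by (simp add: abs_mult power2_eq_square mult.left_commute)
  qed
qed

text \<open>The second difference is symmetric in \<open>u\<close> and \<open>v\<close>, so its two
  limits agree. Differentiability of the gradient at the one point \<open>x\<close>
  suffices.\<close>

lemma second_derivative_symmetric:
  fixes f :: "'a::real_inner \<Rightarrow> real" and g H :: "'a \<Rightarrow> 'a"
  assumes "open W" "x \<in> W"
    and f: "\<And>y. y \<in> W \<Longrightarrow> (f has_derivative (\<lambda>w. g y \<bullet> w)) (at y)"
    and g: "(g has_derivative H) (at x)"
  shows "H u \<bullet> v = H v \<bullet> u"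
proof -
  have "\<bar>H u \<bullet> v - H v \<bullet> u\<bar> \<le> e" if "e > 0" for e
  proof -
    obtain d1 where d1: "d1 > 0" "\<And>t. 0 < t \<Longrightarrow> t < d1 \<Longrightarrow>
      \<bar>(f (x + t *\<^sub>R u + t *\<^sub>R v) - f (x + t *\<^sub>R u) - f (x + t *\<^sub>R v) + f x) - t\<^sup>2 * (H v \<bullet> u)\<bar> \<le> e / 2 * t\<^sup>2"
      using second_difference_estimate[OF assms, of "e / 2" u v] \<open>e > 0\<close> by auto
    obtain d2 where d2: "d2 > 0" "\<And>t. 0 < t \<Longrightarrow> t < d2 \<Longrightarrow>
      \<bar>(f (x + t *\<^sub>R v + t *\<^sub>R u) - f (x + t *\<^sub>R v) - f (x + t *\<^sub>R u) + f x) - t\<^sup>2 * (H u \<bullet> v)\<bar> \<le> e / 2 * t\<^sup>2"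
      using second_difference_estimate[OF assms, of "e / 2" v u] \<open>e > 0\<close> by auto
    define t where "t = min d1 d2 / 2"
    have t: "0 < t" "t < d1" "t < d2" using d1(1) d2(1) by (auto simp: t_def)
    have sw: "x + t *\<^sub>R v + t *\<^sub>R u = x + t *\<^sub>R u + t *\<^sub>R v" by simp
    have "\<bar>t\<^sup>2 * (H u \<bullet> v) - t\<^sup>2 * (H v \<bullet> u)\<bar> \<le> e * t\<^sup>2"
      using d1(2)[OF t(1,2)] d2(2)[OF t(1,3)] unfolding sw by linarith
    then have "t\<^sup>2 * \<bar>H u \<bullet> v - H v \<bullet> u\<bar> \<le> t\<^sup>2 * e"
      by (metis abs_mult abs_power2 mult.commute right_diff_distrib)
    then show ?thesis using t by simp
  qed
  then show ?thesis
    by (metis abs_le_zero_iff dense_ge right_minus_eq)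
qed

section \<open>From local strict convexity to convexity\<close>

text \<open>Pairs of points of \<open>S\<close> whose segment stays in \<open>S\<close> form a
  closed subset of \<open>S \<times> S\<close>. It is also relatively open: the inner points of such
  a segment are interior points of \<open>S\<close> and survive a small move of the ends, while near
  the ends local strict convexity takes over. Connectedness of \<open>S \<times> S\<close> finishes
  the argument.\<close>

lemma convex_if_locally_strictly_convex:
  fixes S :: "'a::euclidean_space set"
  assumes "compact S" "connected S"
    and loc: "\<And>x. x \<in> S \<Longrightarrow> \<exists>e>0. \<forall>a\<in>S \<inter> ball x e. \<forall>b\<in>S \<inter> ball x e.
        a \<noteq> b \<longrightarrow> open_segment a b \<subseteq> interior S"
  shows "convex S"
proof -
  define pt where "pt = (\<lambda>a b t. (1 - t) *\<^sub>R a + t *\<^sub>R (b::'a))"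
  define C where "C = {(a, b). a \<in> S \<and> b \<in> S \<and> (\<forall>t\<in>{0..1}. pt a b t \<in> S)}"
  have cont: "continuous_on UNIV (\<lambda>q::('a \<times> 'a) \<times> real. pt (fst (fst q)) (snd (fst q)) (snd q))"
    unfolding pt_def by (intro continuous_intros)
  have "closed S" using assms(1) compact_imp_closed by blast
  have clos: "closed C"
  proof -
    have "C = (S \<times> S) \<inter> (\<Inter>t\<in>{0..1}. {q. pt (fst q) (snd q) t \<in> S})"
      unfolding C_def by auto
    moreover have "closed {q. pt (fst q) (snd q) t \<in> S}" for t
    proof -
      have "closed ((\<lambda>q. pt (fst q) (snd q) t) -` S)"
        unfolding pt_def by (intro closed_vimage \<open>closed S\<close> continuous_intros)
      then show ?thesis by (simp add: vimage_def)
    qed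
    ultimately show ?thesis
      using \<open>closed S\<close> by (simp only:) (intro closed_Int closed_Times closed_INT ballI)
  qed
  \<comment> \<open>The point is the midpoint of two nearby points of the same segment;
    \<open>d\<close> keeps both of them inside the segment and inside the ball of strict
    convexity.\<close>
  have inner: "pt a b t \<in> interior S" if ab: "(a, b) \<in> C" "a \<noteq> b" and t: "0 < t" "t < 1" for a b t
  proof -
    have "pt a b t \<in> S" using ab t unfolding C_def by auto
    then obtain e where e: "e > 0" and sc: "\<And>p q. p \<in> S \<inter> ball (pt a b t) e \<Longrightarrow>
        q \<in> S \<inter> ball (pt a b t) e \<Longrightarrow> p \<noteq> q \<Longrightarrow> open_segment p q \<subseteq> interior S"
      using loc by meson
    define d where "d = min (min t (1 - t)) (e / (2 * norm (b - a)))"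
    have nz: "norm (b - a) > 0" using ab by simp
    have d: "d > 0" "d \<le> t" "d \<le> 1 - t" "d \<le> e / (2 * norm (b - a))"
      using t e nz by (auto simp: d_def)
    have dn: "d * norm (b - a) < e"
    proof -
      have "d * norm (b - a) \<le> e / (2 * norm (b - a)) * norm (b - a)"
        using d(4) nz by (intro mult_right_mono) auto
      also have "\<dots> = e / 2" using nz by simp
      finally show ?thesis using e by simp
    qed
    have pm: "pt a b t - pt a b (t - d) = d *\<^sub>R (b - a)" "pt a b t - pt a b (t + d) = - (d *\<^sub>R (b - a))"
      unfolding pt_def by (auto simp: algebra_simps)
    have "pt a b (t - d) \<in> S \<inter> ball (pt a b t) e" "pt a b (t + d) \<in> S \<inter> ball (pt a b t) e"
      using ab d dn pm unfolding C_def by (auto simp: dist_norm)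
    moreover have "pt a b (t - d) \<noteq> pt a b (t + d)"
    proof
      assume "pt a b (t - d) = pt a b (t + d)"
      then have "d *\<^sub>R (b - a) = - (d *\<^sub>R (b - a))" using pm by metis
      then show False using d ab by (metis eq_neg_iff_add_eq_0 real_vector.scale_eq_0_iff scaleR_2 zero_neq_numeral right_minus_eq less_irrefl)
    qed
    moreover have "pt a b t \<in> open_segment (pt a b (t - d)) (pt a b (t + d))"
    proof -
      have "pt a b t = midpoint (pt a b (t - d)) (pt a b (t + d))"
      proof -
        have "pt a b (t - d) = pt a b t - d *\<^sub>R (b - a)" "pt a b (t + d) = pt a b t + d *\<^sub>R (b - a)"
          unfolding pt_def by (simp_all add: algebra_simps)
        then have "pt a b (t - d) + pt a b (t + d) = 2 *\<^sub>R pt a b t"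
          by (simp add: scaleR_2)
        then show ?thesis unfolding midpoint_def by simp
      qed
      then show ?thesis using calculation(3) by simp
    qed
    ultimately show ?thesis using sc by blast
  qed
  \<comment> \<open>For \<open>(a', b')\<close> near \<open>(a, b)\<close> the initial piece ends at
    \<open>pt a' b' s\<close>, which is still interior and still close to \<open>a\<close>; so the
    piece is covered by the local hypothesis at \<open>a\<close>.\<close>
  have near: "\<exists>s>0. \<exists>V. open V \<and> (a, b) \<in> V \<and> (\<forall>a' b' t. (a', b') \<in> V \<longrightarrow> a' \<in> S \<longrightarrow> b' \<in> S \<longrightarrow> 0 \<le> t \<longrightarrow> t \<le> s \<longrightarrow> pt a' b' t \<in> S)"
    if ab: "(a, b) \<in> C" "a \<noteq> b" for a b
  proof -
    have "a \<in> S" using ab unfolding C_def by auto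
    then obtain e where e: "e > 0" and sc: "\<And>p q. p \<in> S \<inter> ball a e \<Longrightarrow>
        q \<in> S \<inter> ball a e \<Longrightarrow> p \<noteq> q \<Longrightarrow> open_segment p q \<subseteq> interior S"
      using loc by meson
    have nz: "norm (b - a) > 0" using ab by simp
    define s where "s = min (1/2) (e / (2 * norm (b - a)))"
    have s: "s > 0" "s < 1" using e nz by (auto simp: s_def)
    have "s * norm (b - a) < e"
    proof -
      have "s * norm (b - a) \<le> e / (2 * norm (b - a)) * norm (b - a)"
        using nz unfolding s_def by (intro mult_right_mono) auto
      also have "\<dots> = e / 2" using nz by simp
      finally show ?thesis using e by simp
    qed
    moreover have "pt a b s - a = s *\<^sub>R (b - a)" unfolding pt_def by (simp add: algebra_simps)
    ultimately have "dist (pt a b s) a < e" using s by (simp add: dist_norm)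
    then have ps: "pt a b s \<in> ball a e" by (simp add: dist_commute)
    define V where "V = {q. fst q \<in> ball a e} \<inter> {q. pt (fst q) (snd q) s \<in> ball a e \<inter> interior S}"
    have "open V"
    proof -
      have "open (fst -` ball a e :: ('a \<times> 'a) set)" by (intro open_vimage continuous_intros) auto
      moreover have "open ((\<lambda>q. pt (fst q) (snd q) s) -` (ball a e \<inter> interior S))"
        unfolding pt_def by (intro open_vimage continuous_intros) auto
      ultimately show ?thesis unfolding V_def by (auto simp: vimage_def)
    qed
    moreover have "(a, b) \<in> V" using ps inner[OF ab s] e unfolding V_def by auto
    moreover have "pt a' b' t \<in> S"
      if V: "(a', b') \<in> V" and S: "a' \<in> S" "b' \<in> S" and t: "0 \<le> t" "t \<le> s" for a' b' t
    proof -
      let ?q = "pt a' b' s"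
      have q: "?q \<in> S \<inter> ball a e" "a' \<in> S \<inter> ball a e" "?q \<in> interior S"
        using V S interior_subset unfolding V_def by auto
      consider "t = 0" | "t = s" | "a' = ?q" | "0 < t" "t < s" "a' \<noteq> ?q" using t by linarith
      then show ?thesis
      proof cases
        case 1 then show ?thesis using S by (simp add: pt_def)
      next
        case 2 then show ?thesis using q by auto
      next
        case 3
        then have "s *\<^sub>R (b' - a') = 0" unfolding pt_def by (auto simp: algebra_simps)
        then have "a' = b'" using s by simp
        then show ?thesis using S by (simp add: pt_def flip: scaleR_add_left)
      next
        case 4
        have "pt a' b' t = (1 - t / s) *\<^sub>R a' + (t / s) *\<^sub>R ?q"
          using s unfolding pt_def by (simp add: algebra_simps)
        then have "pt a' b' t \<in> open_segment a' ?q"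
          unfolding in_segment using 4 s by (intro conjI exI[of _ "t / s"]) auto
        then show ?thesis using sc[OF q(2,1)] 4 interior_subset by blast
      qed
    qed
    ultimately show ?thesis using s by blast
  qed
  have sym: "(b, a) \<in> C" if "(a, b) \<in> C" for a b
  proof -
    have "pt b a t = pt a b (1 - t)" for t unfolding pt_def by simp
    then show ?thesis using that unfolding C_def by auto
  qed
  have opn: "\<exists>V. open V \<and> p \<in> V \<and> V \<inter> (S \<times> S) \<subseteq> C" if pC: "p \<in> C" for p
  proof (cases "fst p = snd p")
    case True
    then have "fst p \<in> S" using pC unfolding C_def by auto
    then obtain e where e: "e > 0" and sc: "\<And>q r. q \<in> S \<inter> ball (fst p) e \<Longrightarrow>
        r \<in> S \<inter> ball (fst p) e \<Longrightarrow> q \<noteq> r \<Longrightarrow> open_segment q r \<subseteq> interior S"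
      using loc by meson
    have "(a, b) \<in> C" if "a \<in> S" "b \<in> S" "a \<in> ball (fst p) e" "b \<in> ball (fst p) e" for a b
    proof -
      have "closed_segment a b \<subseteq> S"
        using sc[of a b] that interior_subset[of S]
        by (cases "a = b") (auto simp: closed_segment_eq_open)
      moreover have "pt a b t \<in> closed_segment a b" if "t \<in> {0..1}" for t
        using that unfolding pt_def in_segment by auto
      ultimately show ?thesis using that unfolding C_def by auto
    qed
    then have "(ball (fst p) e \<times> ball (fst p) e) \<inter> (S \<times> S) \<subseteq> C" by auto
    moreover have "p \<in> ball (fst p) e \<times> ball (fst p) e" using True e by (cases p) auto
    moreover have "open (ball (fst p) e \<times> ball (fst p) e)" by (intro open_Times open_ball)
    ultimately show ?thesis by (intro exI[of _ "ball (fst p) e \<times> ball (fst p) e"] conjI)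
  next
    case False
    obtain a b where p: "p = (a, b)" by (cases p)
    have ab: "(a, b) \<in> C" "a \<noteq> b" using pC False p by auto
    obtain s1 V1 where 1: "s1 > 0" "open V1" "(a, b) \<in> V1"
      "\<And>a' b' t. (a', b') \<in> V1 \<Longrightarrow> a' \<in> S \<Longrightarrow> b' \<in> S \<Longrightarrow> 0 \<le> t \<Longrightarrow> t \<le> s1 \<Longrightarrow> pt a' b' t \<in> S"
      using near[OF ab] by metis
    obtain s2 V2 where 2: "s2 > 0" "open V2" "(b, a) \<in> V2"
      "\<And>a' b' t. (a', b') \<in> V2 \<Longrightarrow> a' \<in> S \<Longrightarrow> b' \<in> S \<Longrightarrow> 0 \<le> t \<Longrightarrow> t \<le> s2 \<Longrightarrow> pt a' b' t \<in> S"
      using near[OF sym[OF ab(1)]] ab(2) by metis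
    \<comment> \<open>The parameters away from both ends form a compact interval on which the
      segment is interior; the tube lemma makes this uniform in the end points. Halving
      \<open>s1\<close> and \<open>s2\<close> lets the three parameter ranges overlap.\<close>
    define O3 where "O3 = (\<lambda>q::('a \<times> 'a) \<times> real. pt (fst (fst q)) (snd (fst q)) (snd q)) -` interior S"
    have "open O3" unfolding O3_def by (intro open_vimage cont) auto
    moreover have "{(a, b)} \<times> {s1/2..1-s2/2} \<subseteq> O3"
      using inner[OF ab] 1(1) 2(1) unfolding O3_def by auto
    ultimately obtain V3 where 3: "(a, b) \<in> V3" "open V3" "V3 \<times> {s1/2..1-s2/2} \<subseteq> O3"
      using Elementary_Topology.tube_lemma[of "{s1/2..1-s2/2}" O3 "(a, b)"] by blast
    define V where "V = V1 \<inter> prod.swap -` V2 \<inter> V3"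
    have "open V" unfolding V_def
      using 1 2 3 by (intro open_Int open_vimage) (auto intro!: continuous_intros simp: prod.swap_def)
    moreover have "p \<in> V" using 1 2 3 p unfolding V_def by auto
    moreover have "(a', b') \<in> C" if V: "(a', b') \<in> V" and S: "a' \<in> S" "b' \<in> S" for a' b'
    proof -
      have "pt a' b' t \<in> S" if t: "0 \<le> t" "t \<le> 1" for t
      proof -
        consider "t \<le> s1" | "1 - t \<le> s2" | "s1/2 \<le> t" "t \<le> 1 - s2/2"
          using \<open>s1 > 0\<close> \<open>s2 > 0\<close> by linarith
        then show ?thesis
        proof cases
          case 1 then show ?thesis using V S t \<open>(a, b) \<in> V1\<close> \<open>\<And>a' b' t. (a', b') \<in> V1 \<Longrightarrow> a' \<in> S \<Longrightarrow> b' \<in> S \<Longrightarrow> 0 \<le> t \<Longrightarrow> t \<le> s1 \<Longrightarrow> pt a' b' t \<in> S\<close>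
            unfolding V_def by auto
        next
          case c2: 2
          have "pt b' a' (1 - t) \<in> S" using 2(4)[of b' a' "1 - t"] V S t c2 unfolding V_def by auto
          moreover have "pt b' a' (1 - t) = pt a' b' t" by (simp add: pt_def)
          ultimately show ?thesis by simp
        next
          case c3: 3
          have "((a', b'), t) \<in> O3" using 3(3) V c3 unfolding V_def by auto
          then show ?thesis unfolding O3_def using interior_subset by auto
        qed
      qed
      then show ?thesis unfolding C_def using S by auto
    qed
    ultimately show ?thesis by (intro exI[of _ V]) auto
  qed
  have "C \<subseteq> S \<times> S" unfolding C_def by auto
  have "S \<times> S \<subseteq> C"
  proof (cases "S = {}")
    case False
    then obtain a where "a \<in> S" by auto
    then have "(a, a) \<in> C" unfolding C_def pt_def by (auto simp flip: scaleR_add_left)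
    have con: "connected (S \<times> S)" using assms(2) connected_Times by blast
    have "openin (top_of_set (S \<times> S)) C"
      unfolding openin_subopen[of _ C]
    proof
      fix p assume "p \<in> C"
      then obtain V where V: "open V" "p \<in> V" "V \<inter> (S \<times> S) \<subseteq> C" using opn by blast
      have "openin (top_of_set (S \<times> S)) ((S \<times> S) \<inter> V)" using V(1) by (simp add: openin_open_Int)
      then show "\<exists>T. openin (top_of_set (S \<times> S)) T \<and> p \<in> T \<and> T \<subseteq> C"
        using V \<open>p \<in> C\<close> \<open>C \<subseteq> S \<times> S\<close> by (intro exI[of _ "(S \<times> S) \<inter> V"]) auto
    qed
    moreover have "closedin (top_of_set (S \<times> S)) C"
      using clos \<open>C \<subseteq> S \<times> S\<close> closed_subset by blast
    ultimately show ?thesis using con \<open>(a, a) \<in> C\<close> connected_clopen by blast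
  qed simp
  then show ?thesis
    unfolding convex_alt C_def pt_def by auto
qed

section \<open>The spectral theorem\<close>

text \<open>An eigenvector is a maximizer of the quadratic form on the unit sphere of
  \<open>V\<close>: there the first variation vanishes in every orthogonal direction.\<close>

lemma self_adjoint_has_eigenvector:
  fixes f :: "'a::euclidean_space \<Rightarrow> 'a"
  assumes "linear f" and sym: "\<And>v w. f v \<bullet> w = v \<bullet> f w"
    and V: "subspace V" "V \<noteq> {0}" "f ` V \<subseteq> V"
  shows "\<exists>b\<in>V. norm b = 1 \<and> (\<exists>k. f b = k *\<^sub>R b)"
proof -
  interpret linear f by fact
  have cf: "continuous_on A f" for A
    using assms(1) linear_continuous_on linear_conv_bounded_linear by blast
  have "closed V" using V(1) closed_subspace by blast
  then have "compact (sphere 0 1 \<inter> V)" by (intro compact_Int_closed) auto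
  moreover have "sphere 0 1 \<inter> V \<noteq> {}"
  proof -
    obtain v where "v \<in> V" "v \<noteq> 0" using V subspace_0 by blast
    then have "(1 / norm v) *\<^sub>R v \<in> V" "norm ((1 / norm v) *\<^sub>R v) = 1"
      using V(1) by (simp_all add: subspace_scale)
    then show ?thesis by (metis IntI empty_iff mem_sphere_0)
  qed
  moreover have "continuous_on (sphere 0 1 \<inter> V) (\<lambda>v. f v \<bullet> v)"
    by (intro continuous_intros cf)
  ultimately obtain b where b: "b \<in> sphere 0 1 \<inter> V"
    and max: "\<And>v. v \<in> sphere 0 1 \<inter> V \<Longrightarrow> f v \<bullet> v \<le> f b \<bullet> b"
    using continuous_attains_sup[of "sphere 0 1 \<inter> V" "\<lambda>v. f v \<bullet> v"] by blast
  define k where "k = f b \<bullet> b"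
  have nb: "norm b = 1" "b \<bullet> b = 1" using b by (auto simp: norm_eq_1)
  have le: "f v \<bullet> v \<le> k * (v \<bullet> v)" if "v \<in> V" for v
  proof (cases "v = 0")
    case True then show ?thesis by (simp add: zero)
  next
    case False
    let ?u = "(1 / norm v) *\<^sub>R v"
    have "?u \<in> sphere 0 1 \<inter> V" using that V(1) False by (simp add: subspace_scale)
    then have "f ?u \<bullet> ?u \<le> k" using max k_def by blast
    then have "f v \<bullet> v / (norm v * norm v) \<le> k" by (simp add: scale)
    then show ?thesis using False by (simp add: divide_le_eq dot_square_norm power2_eq_square)
  qed
  have orth: "f b \<bullet> v = 0" if v: "v \<in> V" "b \<bullet> v = 0" for v
  proof -
    \<comment> \<open>Linear and quadratic coefficients of the variation along
      \<open>b + t *\<^sub>R v\<close>. Since \<open>t * A\<close> stays below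
      \<open>t\<^sup>2 * B\<close> for all \<open>t\<close>, testing with
      \<open>t = A / (B + 1)\<close> forces \<open>A = 0\<close>.\<close>
    define A where "A = 2 * (f b \<bullet> v)"
    define B where "B = k * (v \<bullet> v) - f v \<bullet> v"
    have q: "t * A \<le> t\<^sup>2 * B" for t
    proof -
      have "b + t *\<^sub>R v \<in> V" using b v V(1) by (auto intro: subspace_add subspace_scale)
      from le[OF this] have "f b \<bullet> b + t * (f b \<bullet> v) + t * (f v \<bullet> b) + t\<^sup>2 * (f v \<bullet> v)
          \<le> k * (1 + 2 * t * (b \<bullet> v) + t\<^sup>2 * (v \<bullet> v))"
        using nb by (simp add: add scale inner_add_left inner_add_right algebra_simps power2_eq_square inner_commute)
      moreover have "f v \<bullet> b = f b \<bullet> v" by (metis inner_commute sym)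
      ultimately show ?thesis using v(2) unfolding A_def B_def k_def by (simp add: algebra_simps)
    qed
    have "B \<ge> 0" using le[OF v(1)] by (simp add: B_def)
    have "A = 0"
    proof (rule ccontr)
      assume "A \<noteq> 0"
      have "(A / (B + 1)) * A \<le> (A / (B + 1))\<^sup>2 * B" by (rule q)
      then have "A\<^sup>2 / (B + 1) * 1 \<le> A\<^sup>2 / (B + 1) * (B / (B + 1))"
        by (simp add: power2_eq_square)
      moreover have "A\<^sup>2 / (B + 1) > 0" using \<open>A \<noteq> 0\<close> \<open>B \<ge> 0\<close> by simp
      ultimately have "1 \<le> B / (B + 1)" by (rule mult_left_le_imp_le)
      then show False using \<open>B \<ge> 0\<close> by (simp add: le_divide_eq)
    qed
    then show ?thesis by (simp add: A_def)
  qed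
  \<comment> \<open>This vector is orthogonal to \<open>b\<close>, hence by \<open>orth\<close> to
    \<open>f b\<close>, hence to itself.\<close>
  have "f b - k *\<^sub>R b \<in> V" using b V by (auto intro!: subspace_diff subspace_scale)
  moreover have "b \<bullet> (f b - k *\<^sub>R b) = 0" using nb by (simp add: inner_diff_right k_def inner_commute)
  ultimately have "f b \<bullet> (f b - k *\<^sub>R b) = 0" "b \<bullet> (f b - k *\<^sub>R b) = 0" using orth by blast+
  then have "(f b - k *\<^sub>R b) \<bullet> (f b - k *\<^sub>R b) = 0" by (simp add: inner_diff_left)
  then have "f b = k *\<^sub>R b" by simp
  then show ?thesis using b nb by auto
qed

text \<open>Induction on the dimension: by self-adjointness the orthogonal complement of an
  eigenvector in \<open>V\<close> is again invariant.\<close>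

lemma self_adjoint_eigenbasis_subspace:
  fixes f :: "'a::euclidean_space \<Rightarrow> 'a"
  assumes "linear f" and sym: "\<And>v w. f v \<bullet> w = v \<bullet> f w"
    and V: "subspace V" "f ` V \<subseteq> V"
  shows "\<exists>B k. B \<subseteq> V \<and> finite B \<and> card B = dim V \<and> pairwise orthogonal B \<and>
     (\<forall>b\<in>B. norm b = 1 \<and> f b = k b *\<^sub>R b)"
  using V
proof (induction "dim V" arbitrary: V)
  case 0
  then show ?case by (intro exI[of _ "{}"]) auto
next
  case (Suc d)
  interpret linear f by fact
  have "V \<noteq> {0}" using Suc.hyps(2) by auto
  from self_adjoint_has_eigenvector[OF assms(1) sym Suc.prems(1) this Suc.prems(2)]
  obtain b l where b: "b \<in> V" "norm b = 1" "f b = l *\<^sub>R b" by blast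
  let ?U = "V \<inter> {v. b \<bullet> v = 0}"
  have sU: "subspace ?U" by (intro subspace_inter subspace_hyperplane Suc.prems(1))
  have fU: "f ` ?U \<subseteq> ?U"
  proof -
    have "b \<bullet> f v = 0" if "b \<bullet> v = 0" for v
      using that b(3) sym[of b v] by simp
    then show ?thesis using Suc.prems(2) by auto
  qed
  have V: "V = span (insert b ?U)"
  proof
    show "span (insert b ?U) \<subseteq> V" using b Suc.prems(1) by (intro span_minimal) auto
    show "V \<subseteq> span (insert b ?U)"
    proof
      fix v assume v: "v \<in> V"
      have "v - (b \<bullet> v) *\<^sub>R b \<in> ?U"
        using v b Suc.prems(1) by (auto intro!: subspace_diff subspace_scale simp: inner_diff_right norm_eq_1)
      then have "(b \<bullet> v) *\<^sub>R b + (v - (b \<bullet> v) *\<^sub>R b) \<in> span (insert b ?U)"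
        by (intro span_add span_scale span_base) auto
      then show "v \<in> span (insert b ?U)" by simp
    qed
  qed
  have "b \<notin> span ?U"
  proof
    assume "b \<in> span ?U"
    then have "b \<in> ?U" by (simp only: span_eq_iff[THEN iffD2, OF sU])
    then have "b \<bullet> b = 0" by (simp only: Int_iff mem_Collect_eq)
    then show False using b(2) by simp
  qed
  then have dsp: "dim (span (insert b ?U)) = Suc (dim ?U)"
    by (simp only: dim_span dim_insert if_False Suc_eq_plus1)
  have dV: "dim V = Suc (dim ?U)" by (rule trans[OF arg_cong[OF V, of dim] dsp])
  then have "d = dim ?U" using Suc.hyps(2) by simp
  from Suc.hyps(1)[OF this sU fU]
  obtain B k where B: "B \<subseteq> ?U" "finite B" "card B = dim ?U" "pairwise orthogonal B"
    "\<forall>c\<in>B. norm c = 1 \<and> f c = k c *\<^sub>R c"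
    by (elim exE conjE) (rule that)
  have "b \<notin> B" using \<open>b \<notin> span ?U\<close> B(1) span_superset[of ?U] by blast
  show ?case
  proof (intro exI[of _ "insert b B"] exI[of _ "k(b := l)"] conjI)
    show "card (insert b B) = dim V" using \<open>b \<notin> B\<close> B(2,3) dV by simp
    show "pairwise orthogonal (insert b B)"
      using B(1,4) by (auto simp: pairwise_insert orthogonal_def inner_commute)
    show "\<forall>c\<in>insert b B. norm c = 1 \<and> f c = (k(b := l)) c *\<^sub>R c"
      using B(5) b by auto
  qed (use B(1,2) b in auto)
qed

lemma self_adjoint_eigenbasis:
  fixes f :: "real^'n::finite \<Rightarrow> real^'n"
  assumes "linear f" and "\<And>v w. f v \<bullet> w = v \<bullet> f w"
  obtains e :: "'n \<Rightarrow> real^'n" and k :: "'n \<Rightarrow> real"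
  where "\<And>i j. e i \<bullet> e j = (if i = j then 1 else 0)" "\<And>i. f (e i) = k i *\<^sub>R e i"
proof -
  obtain B k where B: "finite B" "card B = CARD('n)" "pairwise orthogonal B"
     "\<forall>b\<in>B. norm b = 1 \<and> f b = k b *\<^sub>R b"
    using self_adjoint_eigenbasis_subspace[OF assms, of UNIV] by auto
  obtain e where e: "bij_betw e (UNIV :: 'n set) B"
    using finite_same_card_bij[of "UNIV :: 'n set" B] B by auto
  show ?thesis
  proof (rule that[of e "k \<circ> e"])
    fix i j
    show "e i \<bullet> e j = (if i = j then 1 else 0)"
      using e B(3,4) unfolding pairwise_def orthogonal_def bij_betw_def inj_on_def
      by (metis UNIV_I image_eqI norm_eq_1)
    show "f (e i) = (k \<circ> e) i *\<^sub>R e i" using e B(4) by (auto simp: bij_betw_def)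
  qed
qed

lemma orthonormal_expansion:
  fixes e :: "'n::finite \<Rightarrow> real^'n"
  assumes e: "\<And>i j. e i \<bullet> e j = (if i = j then 1 else 0)"
  shows "v = (\<Sum>i\<in>UNIV. (v \<bullet> e i) *\<^sub>R e i)"
proof -
  have inj: "inj e" using e by (metis injI zero_neq_one)
  have "independent (range e)"
  proof (rule pairwise_orthogonal_independent)
    show "pairwise orthogonal (range e)" using e by (auto simp: pairwise_def orthogonal_def)
    show "0 \<notin> range e" using e by (metis imageE inner_zero_left zero_neq_one)
  qed
  moreover have "card (range e) = CARD('n)" using inj card_image by blast
  ultimately have sp: "span (range e) = UNIV"
    using dim_eq_full[of "range e"] by (simp add: dim_eq_card_independent)
  define w where "w = v - (\<Sum>i\<in>UNIV. (v \<bullet> e i) *\<^sub>R e i)"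
  have "w \<bullet> e j = 0" for j
    unfolding w_def by (simp add: inner_diff_left inner_sum_left e if_distrib cong: if_cong)
  then have "orthogonal w x" if "x \<in> range e" for x using that by (auto simp: orthogonal_def)
  then have "orthogonal w w" using sp orthogonal_to_span[of w "range e" w] by auto
  then show ?thesis unfolding w_def orthogonal_def by simp
qed

text \<open>With the eigenvectors as columns of \<open>P\<close> the matrix is conjugate to a
  diagonal one; orthonormality makes \<open>P\<close> invertible.\<close>

lemma det_eigenbasis:
  fixes f :: "real^'n::finite \<Rightarrow> real^'n" and e :: "'n \<Rightarrow> real^'n"
  assumes "linear f" and e: "\<And>i j. e i \<bullet> e j = (if i = j then 1 else 0)"
    and fe: "\<And>i. f (e i) = k i *\<^sub>R e i"
  shows "det (matrix f) = (\<Prod>i\<in>UNIV. k i)"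
proof -
  define P where "P = (\<chi> i j. e j $ i)"
  define D :: "real^'n^'n" where "D = (\<chi> i j. if i = j then k i else 0)"
  have "transpose P ** P = mat 1"
    unfolding P_def transpose_def matrix_matrix_mult_def mat_def
    using e by (simp add: vec_eq_iff inner_vec_def)
  then have dP: "det P \<noteq> 0"
    by (metis det_I det_mul mult_zero_right zero_neq_one)
  have "matrix f ** P = P ** D"
  proof -
    have "(matrix f ** P) $ i $ j = (f (e j)) $ i" for i j
    proof -
      have "(matrix f ** P) $ i $ j = (matrix f *v (e j)) $ i"
        unfolding P_def by (simp add: matrix_matrix_mult_def matrix_vector_mult_def)
      then show ?thesis using assms(1) by simp
    qed
    moreover have "(P ** D) $ i $ j = (k j *\<^sub>R e j) $ i" for i j
      unfolding P_def D_def by (simp add: matrix_matrix_mult_def if_distrib cong: if_cong)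
    ultimately show ?thesis by (simp add: vec_eq_iff fe)
  qed
  then have "det (matrix f) * det P = det P * det D" by (metis det_mul)
  then have "det (matrix f) = det D" using dP by simp
  also have "\<dots> = (\<Prod>i\<in>UNIV. k i)"
    unfolding D_def by (subst det_diagonal) auto
  finally show ?thesis .
qed

text \<open>Links two ways of counting: \<open>principal_curvatures\<close> repeats an eigenvalue
  according to the dimension of its eigenspace, whereas a product over an eigenbasis repeats it once
  per basis vector.\<close>

lemma dim_eigenspace:
  fixes f :: "real^'n::finite \<Rightarrow> real^'n" and e :: "'n \<Rightarrow> real^'n"
  assumes "linear f" and e: "\<And>i j. e i \<bullet> e j = (if i = j then 1 else 0)"
    and fe: "\<And>i. f (e i) = k i *\<^sub>R e i"
  shows "dim {v. f v = c *\<^sub>R v} = card {i. k i = c}"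
proof -
  interpret linear f by fact
  have inj: "inj e" using e by (metis injI zero_neq_one)
  have "{v. f v = c *\<^sub>R v} = span (e ` {i. k i = c})"
  proof
    have "subspace {v. f v = c *\<^sub>R v}"
      by (auto simp: subspace_def add scale scaleR_add_right zero)
    then show "span (e ` {i. k i = c}) \<subseteq> {v. f v = c *\<^sub>R v}"
      using fe by (intro span_minimal) auto
    show "{v. f v = c *\<^sub>R v} \<subseteq> span (e ` {i. k i = c})"
    proof
      fix v assume "v \<in> {v. f v = c *\<^sub>R v}"
      then have fv: "f v = c *\<^sub>R v" by simp
      have z: "v \<bullet> e j = 0" if "k j \<noteq> c" for j
      proof -
        have "f v = (\<Sum>i\<in>UNIV. (v \<bullet> e i) *\<^sub>R f (e i))"
          by (subst orthonormal_expansion[OF e, of v]) (simp add: sum scale)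
        then have "f v \<bullet> e j = (v \<bullet> e j) * k j"
          by (simp add: inner_sum_left fe e if_distrib cong: if_cong)
        moreover have "f v \<bullet> e j = c * (v \<bullet> e j)" using fv by simp
        ultimately show ?thesis using that by (metis mult.commute mult_right_cancel)
      qed
      have "v = (\<Sum>i\<in>UNIV. (v \<bullet> e i) *\<^sub>R e i)" by (rule orthonormal_expansion[OF e])
      also have "\<dots> \<in> span (e ` {i. k i = c})"
      proof (rule span_sum)
        fix i show "(v \<bullet> e i) *\<^sub>R e i \<in> span (e ` {i. k i = c})"
        proof (cases "k i = c")
          case True then show ?thesis by (intro span_scale span_base) auto
        qed (simp add: z span_zero)
      qed
      finally show "v \<in> span (e ` {i. k i = c})" .
    qed
  qed
  moreover have "independent (e ` {i. k i = c})"
  proof (rule pairwise_orthogonal_independent)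
    show "pairwise orthogonal (e ` {i. k i = c})" using e by (auto simp: pairwise_def orthogonal_def)
    show "0 \<notin> e ` {i. k i = c}" using e by (metis imageE inner_zero_left zero_neq_one)
  qed
  ultimately show ?thesis
    using inj by (simp add: dim_eq_card_independent card_image inj_on_subset)
qed

section \<open>The Brunn--Minkowski inequality\<close>

abbreviation vol :: "'a::euclidean_space set \<Rightarrow> real" where
  "vol \<equiv> measure lborel"

abbreviation set_sum :: "'a::plus set \<Rightarrow> 'a set \<Rightarrow> 'a set" where
  "set_sum A B \<equiv> {x + y |x y. x \<in> A \<and> y \<in> B}"

text \<open>Open boxes, so that neighbours may share a face and still be disjoint; nonempty ones, so
  that every member has positive volume and counts in the induction.\<close>

definition box_family :: "'a::euclidean_space set set \<Rightarrow> bool" where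
  "box_family I \<longleftrightarrow> finite I \<and> disjoint I \<and> (\<forall>X\<in>I. X \<noteq> {} \<and> (\<exists>a b. X = box a b))"

lemma set_sum_commute: "set_sum A B = set_sum B (A :: 'a::ab_semigroup_add set)"
  by (auto; metis add.commute)

lemma open_set_sum:
  fixes A B :: "'a::real_normed_vector set"
  assumes "open A"
  shows "open (set_sum A B)"
proof -
  have "set_sum A B = (\<Union>y\<in>B. (+) y ` A)" by (force simp: add.commute)
  then show ?thesis using assms by (auto intro: open_translation)
qed

lemma bounded_set_sum:
  fixes A B :: "'a::real_normed_vector set"
  assumes "bounded A" "bounded B"
  shows "bounded (set_sum A B)"
  using bounded_plus[OF assms] by (rule bounded_subset) force

lemma emeasure_lborel_bounded: "bounded A \<Longrightarrow> emeasure lborel A < top"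
  using emeasure_bounded_finite[of A] by auto

lemma vol_mono:
  fixes A B :: "'a::euclidean_space set"
  assumes "A \<subseteq> B" "A \<in> sets borel" "B \<in> sets borel" "bounded B"
  shows "vol A \<le> vol B"
  using assms by (intro measure_mono_fmeasurable) (auto simp: fmeasurable_def emeasure_lborel_bounded)

lemma vol_disjoint_Un:
  fixes A B :: "'a::euclidean_space set"
  assumes "A \<in> sets borel" "B \<in> sets borel" "bounded A" "bounded B" "A \<inter> B = {}"
  shows "vol (A \<union> B) = vol A + vol B"
  using assms by (intro measure_Union) (auto dest: emeasure_lborel_bounded)

lemma box_familyE:
  assumes "box_family I" "X \<in> I"
  obtains a b where "X = box a b" "box a b \<noteq> {}"
  using assms unfolding box_family_def by metis

lemma box_family_open: "box_family I \<Longrightarrow> open (\<Union>I)"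
  unfolding box_family_def by (metis open_Union open_box)

lemma box_family_bounded: "box_family I \<Longrightarrow> bounded (\<Union>I)"
  unfolding box_family_def by (metis bounded_Union bounded_box)

lemma box_family_vol_pos:
  assumes "box_family I" "I \<noteq> {}"
  shows "vol (\<Union>I) > 0"
proof -
  obtain X where X: "X \<in> I" using assms by auto
  then obtain a b where ab: "X = box a b" "box a b \<noteq> {}" using assms unfolding box_family_def by metis
  then have "0 < vol X" by (auto simp: measure_lborel_box_eq box_ne_empty less_imp_le intro!: prod_pos simp: inner_diff_left)
  also have "\<dots> \<le> vol (\<Union>I)"
    using X ab(1) box_family_open[OF assms(1)] box_family_bounded[OF assms(1)] by (intro vol_mono) auto
  finally show ?thesis .
qed

lemma box_Int_halfspace:
  fixes a b :: "'a::euclidean_space"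
  assumes i: "i \<in> Basis"
  shows "\<exists>b'. box a b \<inter> {x. x \<bullet> i < c} = box a b'" "\<exists>a'. box a b \<inter> {x. c < x \<bullet> i} = box a' b"
proof -
  have b: "(b + (min (b \<bullet> i) c - b \<bullet> i) *\<^sub>R i) \<bullet> j = (if j = i then min (b \<bullet> i) c else b \<bullet> j)"
    "(a + (max (a \<bullet> i) c - a \<bullet> i) *\<^sub>R i) \<bullet> j = (if j = i then max (a \<bullet> i) c else a \<bullet> j)"
    if "j \<in> Basis" for j
    using that i by (auto simp: inner_add_left inner_Basis)
  have "box a b \<inter> {x. x \<bullet> i < c} = box a (b + (min (b \<bullet> i) c - b \<bullet> i) *\<^sub>R i)"
    using i by (auto simp: box_def b split: if_splits)
  then show "\<exists>b'. box a b \<inter> {x. x \<bullet> i < c} = box a b'" by blast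
  have "box a b \<inter> {x. c < x \<bullet> i} = box (a + (max (a \<bullet> i) c - a \<bullet> i) *\<^sub>R i) b"
    using i by (auto simp: box_def b split: if_splits)
  then show "\<exists>a'. box a b \<inter> {x. c < x \<bullet> i} = box a' b" by blast
qed

text \<open>Empty intersections are discarded: this keeps the result a \<open>box_family\<close> and
  makes its cardinality drop as soon as one box lies on the far side of the cut.\<close>

definition cut_family :: "'a set set \<Rightarrow> 'a set \<Rightarrow> 'a set set" where
  "cut_family I H = (\<lambda>X. X \<inter> H) ` I - {{}}"

lemma Union_cut_family: "\<Union>(cut_family I H) = \<Union>I \<inter> H"
  unfolding cut_family_def by auto

lemma card_cut_family_le: "finite I \<Longrightarrow> card (cut_family I H) \<le> card I"
  unfolding cut_family_def by (metis card_Diff1_le card_image_le finite_imageI le_trans)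

lemma card_cut_family_less:
  assumes "finite I" "X \<in> I" "X \<inter> H = {}"
  shows "card (cut_family I H) < card I"
proof -
  have "{} \<in> (\<lambda>X. X \<inter> H) ` I" using assms(2,3) by (intro image_eqI[of _ _ X]) auto
  then have "card (cut_family I H) < card ((\<lambda>X. X \<inter> H) ` I)"
    unfolding cut_family_def using assms(1) by (intro card_Diff1_less) auto
  then show ?thesis using card_image_le[OF assms(1), of "\<lambda>X. X \<inter> H"] by linarith
qed

lemma box_family_cut:
  assumes "box_family I" "\<And>a b. \<exists>a' b'. box a b \<inter> H = box a' b'"
  shows "box_family (cut_family I H)"
proof -
  have "disjoint (cut_family I H)"
    using assms(1) unfolding box_family_def cut_family_def disjoint_def by (auto; blast)
  moreover have "\<exists>a b. X = box a b" if X: "X \<in> cut_family I H" for X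
  proof -
    obtain Y where "Y \<in> I" "X = Y \<inter> H" using X unfolding cut_family_def by blast
    then show ?thesis using assms unfolding box_family_def by metis
  qed
  ultimately show ?thesis
    using assms(1) unfolding box_family_def by (auto simp: cut_family_def)
qed

lemma vol_halfspace_split:
  fixes A :: "'a::euclidean_space set"
  assumes "open A" "bounded A" and i: "i \<in> Basis"
  shows "vol A = vol (A \<inter> {x. x \<bullet> i < c}) + vol (A \<inter> {x. c < x \<bullet> i})"
proof -
  have m: "{x. x \<bullet> i < c} \<in> sets borel" "{x. c < x \<bullet> i} \<in> sets borel" "{x. x \<bullet> i = c} \<in> sets borel"
    by (intro borel_open borel_closed open_halfspace_component_lt open_halfspace_component_gt
        closed_Collect_eq continuous_intros)+
  have "negligible {x. x \<bullet> i = c}" using negligible_standard_hyperplane[OF i] .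
  then have "{x. x \<bullet> i = c} \<in> null_sets lebesgue" by (simp add: negligible_iff_null_sets)
  then have n: "{x. x \<bullet> i = c} \<in> null_sets lborel" using m(3) by (auto simp: null_sets_def)
  have "vol A = vol (A - {x. x \<bullet> i = c})"
    using n assms(1) by (subst measure_Diff_null_set) auto
  also have "A - {x. x \<bullet> i = c} = (A \<inter> {x. x \<bullet> i < c}) \<union> (A \<inter> {x. c < x \<bullet> i})" by auto
  also have "vol \<dots> = vol (A \<inter> {x. x \<bullet> i < c}) + vol (A \<inter> {x. c < x \<bullet> i})"
    using m assms by (intro vol_disjoint_Un) (auto intro: bounded_subset)
  finally show ?thesis .
qed

lemma vol_slab_le:
  fixes A :: "'a::euclidean_space set"
  assumes "bounded A" and i: "i \<in> Basis"
  shows "\<exists>C\<ge>0. \<forall>c d. c \<le> d \<longrightarrow> (\<forall>S \<in> sets borel. S \<subseteq> A \<inter> {x. c \<le> x \<bullet> i \<and> x \<bullet> i \<le> d} \<longrightarrow> vol S \<le> C * (d - c))"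
proof -
  obtain w where w: "A \<subseteq> cbox (-w) w" using assms(1) bounded_subset_cbox_symmetric by blast
  define C where "C = (\<Prod>j\<in>Basis - {i}. \<bar>2 * (w \<bullet> j)\<bar>)"
  have "vol S \<le> C * (d - c)"
    if "c \<le> d" "S \<in> sets borel" and S: "S \<subseteq> A \<inter> {x. c \<le> x \<bullet> i \<and> x \<bullet> i \<le> d}" for c d S
  proof -
    define u v where "u = - w + (c + w \<bullet> i) *\<^sub>R i" and "v = w + (d - w \<bullet> i) *\<^sub>R i"
    have uv: "u \<bullet> j = (if j = i then c else - (w \<bullet> j))" "v \<bullet> j = (if j = i then d else w \<bullet> j)" if "j \<in> Basis" for j
      using that i by (auto simp: u_def v_def inner_add_left inner_diff_left inner_Basis)
    have "S \<subseteq> cbox u v"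
      using S w by (fastforce simp: cbox_def uv)
    then have "vol S \<le> vol (cbox u v)" using that by (intro vol_mono) auto
    also have "\<dots> \<le> (\<Prod>j\<in>Basis. \<bar>v \<bullet> j - u \<bullet> j\<bar>)"
      by (auto simp: measure_lborel_cbox_eq inner_diff_left intro!: prod_mono prod_nonneg)
    also have "\<dots> = \<bar>d - c\<bar> * C"
      unfolding C_def by (subst prod.remove[OF _ i]) (auto simp: uv i intro!: prod.cong)
    finally show ?thesis using that(1) by (simp add: mult.commute)
  qed
  moreover have "C \<ge> 0" unfolding C_def by (intro prod_nonneg) auto
  ultimately show ?thesis by (intro exI[of _ C]) auto
qed

text \<open>The volume cut off is, by the slab estimate, a Lipschitz function of the position
  \<open>c\<close>, and it runs from 0 to \<open>vol A\<close>.\<close>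

lemma vol_halfspace_intermediate:
  fixes A :: "'a::euclidean_space set"
  assumes A: "open A" "bounded A" and i: "i \<in> Basis" and t: "0 \<le> t" "t \<le> vol A"
  shows "\<exists>c. vol (A \<inter> {x. x \<bullet> i < c}) = t"
proof -
  obtain w where w: "A \<subseteq> cbox (-w) w" using assms(2) bounded_subset_cbox_symmetric by blast
  define g where "g = (\<lambda>c. vol (A \<inter> {x. x \<bullet> i < c}))"
  have mb: "A \<inter> {x. x \<bullet> i < c} \<in> sets borel" for c
    by (intro borel_open open_Int A(1) open_halfspace_component_lt)
  obtain C where C0: "C \<ge> 0" and C1: "\<forall>c d. c \<le> d \<longrightarrow> (\<forall>S \<in> sets borel.
      S \<subseteq> A \<inter> {x. c \<le> x \<bullet> i \<and> x \<bullet> i \<le> d} \<longrightarrow> vol S \<le> C * (d - c))"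
    using vol_slab_le[OF A(2) i] by (elim exE conjE) (rule that)
  note C = C0 C1[rule_format]
  have bd: "bounded (A \<inter> S)" for S using A(2) by (auto intro: bounded_subset)
  have lip: "\<bar>g d - g c\<bar> \<le> C * \<bar>d - c\<bar>" for c d
  proof -
    have *: "0 \<le> g d - g c \<and> g d - g c \<le> C * (d - c)" if "c \<le> d" for c d
    proof -
      let ?S = "(A \<inter> {x. x \<bullet> i < d}) - (A \<inter> {x. x \<bullet> i < c})"
      have eq: "A \<inter> {x. x \<bullet> i < d} = (A \<inter> {x. x \<bullet> i < c}) \<union> ?S" using that by auto
      have "g d = g c + vol ?S"
        unfolding g_def using mb bd[of "{x. x \<bullet> i < c}"] bd[of "{x. x \<bullet> i < d}"]
        by (subst eq, intro vol_disjoint_Un) (auto intro: bounded_subset)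
      moreover have "vol ?S \<le> C * (d - c)" using mb that by (intro C(2)) auto
      ultimately show ?thesis by simp
    qed
    show ?thesis using *[of c d] *[of d c] by (cases "c \<le> d") auto
  qed
  have "continuous_on UNIV g"
  proof -
    have "C-lipschitz_on UNIV g"
      using lip C(1) by (intro lipschitz_onI) (auto simp: dist_real_def)
    then show ?thesis by (rule lipschitz_on_continuous_on)
  qed
  moreover have "g (- (w \<bullet> i)) = 0"
  proof -
    have "A \<inter> {x. x \<bullet> i < - (w \<bullet> i)} = {}" using w i by (fastforce simp: cbox_def)
    then show ?thesis by (simp add: g_def)
  qed
  moreover have "g (max (- (w \<bullet> i)) (w \<bullet> i) + 1) = vol A"
  proof -
    have "A \<inter> {x. x \<bullet> i < max (- (w \<bullet> i)) (w \<bullet> i) + 1} = A" using w i by (fastforce simp: cbox_def)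
    then show ?thesis by (simp add: g_def)
  qed
  ultimately have "\<exists>c\<ge>- (w \<bullet> i). c \<le> max (- (w \<bullet> i)) (w \<bullet> i) + 1 \<and> g c = t"
    using t by (intro IVT') (auto intro: continuous_on_subset)
  then show ?thesis unfolding g_def by blast
qed

section \<open>The inequality for boxes and for finite unions of boxes\<close>

lemma Brunn_Minkowski_boxes:
  fixes a b c d :: "'a::euclidean_space"
  assumes "box a b \<noteq> {}" "box c d \<noteq> {}"
  shows "(vol (box a b) powr (1 / DIM('a)) + vol (box c d) powr (1 / DIM('a))) powr DIM('a)
    \<le> vol (set_sum (box a b) (box c d))"
proof -
  define u v where "u = (\<lambda>j. b \<bullet> j - a \<bullet> j)" and "v = (\<lambda>j. d \<bullet> j - c \<bullet> j)"
  have uv: "u j > 0" "v j > 0" if "j \<in> Basis" for j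
    using assms that by (auto simp: box_ne_empty u_def v_def)
  let ?r = "1 / real DIM('a)"
  have vb: "vol (box a b) = prod u Basis" "vol (box c d) = prod v Basis"
    using assms by (auto simp: measure_lborel_box_eq box_ne_empty less_imp_le u_def v_def inner_diff_left)
  have "box (a + c) (b + d) \<subseteq> set_sum (box a b) (box c d)"
  proof
    fix x assume x: "x \<in> box (a + c) (b + d)"
    \<comment> \<open>The relative position of \<open>x\<close> in the large box; the same relative
      position is used in both small boxes.\<close>
    define l where "l = (\<lambda>j. (x \<bullet> j - a \<bullet> j - c \<bullet> j) / (u j + v j))"
    have l: "0 < l j \<and> l j < 1" if "j \<in> Basis" for j
      using x uv[OF that] that by (auto simp: l_def mem_box inner_add_left u_def v_def divide_less_eq)
    define y where "y = (\<Sum>j\<in>Basis. (a \<bullet> j + l j * u j) *\<^sub>R j)"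
    have y: "y \<bullet> j = a \<bullet> j + l j * u j" if "j \<in> Basis" for j using that by (simp add: y_def)
    have "y \<in> box a b"
    proof -
      have "l j * u j < u j" "0 < l j * u j" if "j \<in> Basis" for j using l uv that by auto
      then have "a \<bullet> j < y \<bullet> j \<and> y \<bullet> j < b \<bullet> j" if "j \<in> Basis" for j
        using that y[OF that] unfolding u_def by fastforce
      then show ?thesis by (auto simp: mem_box)
    qed
    moreover have "x - y \<in> box c d"
    proof -
      have "x \<bullet> j - y \<bullet> j = c \<bullet> j + l j * v j" if "j \<in> Basis" for j
      proof -
        have "l j * (u j + v j) = x \<bullet> j - a \<bullet> j - c \<bullet> j" using uv[OF that] by (simp add: l_def)
        then show ?thesis using y[OF that] by (simp add: algebra_simps)
      qed
      moreover have "l j * v j < v j" "0 < l j * v j" if "j \<in> Basis" for j using l uv that by auto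
      ultimately have "c \<bullet> j < (x - y) \<bullet> j \<and> (x - y) \<bullet> j < d \<bullet> j" if "j \<in> Basis" for j
        using that unfolding v_def inner_diff_left by fastforce
      then show ?thesis by (auto simp: mem_box)
    qed
    ultimately show "x \<in> set_sum (box a b) (box c d)" by (intro CollectI exI[of _ y] exI[of _ "x - y"]) auto
  qed
  then have "vol (box (a + c) (b + d)) \<le> vol (set_sum (box a b) (box c d))"
    by (intro vol_mono borel_open open_set_sum bounded_set_sum bounded_box open_box)
  moreover have "vol (box (a + c) (b + d)) = (\<Prod>j\<in>Basis. u j + v j)"
  proof -
    have "\<forall>j\<in>Basis. (a + c) \<bullet> j \<le> (b + d) \<bullet> j" using uv by (force simp: u_def v_def inner_add_left)
    then show ?thesis by (auto simp: measure_lborel_box_eq u_def v_def inner_diff_left inner_add_left intro!: prod.cong)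
  qed
  \<comment> \<open>The inequality of arithmetic and geometric means for the factors
    \<open>u j / (u j + v j)\<close> and for \<open>v j / (u j + v j)\<close>: in each coordinate
    the two add up to 1, so the two means add up to 1.\<close>
  moreover have "(prod u Basis powr ?r + prod v Basis powr ?r) powr DIM('a) \<le> (\<Prod>j\<in>Basis. u j + v j)"
  proof -
    let ?P = "\<Prod>j\<in>(Basis::'a set). u j + v j"
    have P: "?P > 0" using uv by (intro prod_pos) (auto simp: add_pos_pos)
    have ag: "(\<Prod>j\<in>Basis. f j / (u j + v j)) powr ?r \<le> (\<Sum>j\<in>Basis. f j / (u j + v j) / DIM('a))"
      if "\<And>j. j \<in> Basis \<Longrightarrow> f j > 0" for f
      using that uv by (intro arith_geom_mean) (auto intro!: less_imp_le divide_pos_pos add_pos_pos)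
    have "(prod u Basis / ?P) powr ?r + (prod v Basis / ?P) powr ?r
       \<le> (\<Sum>j\<in>Basis. u j / (u j + v j) / DIM('a)) + (\<Sum>j\<in>Basis. v j / (u j + v j) / DIM('a))"
      using ag[of u] ag[of v] uv by (simp add: prod_dividef)
    also have "\<dots> = (\<Sum>j\<in>(Basis::'a set). 1 / DIM('a))"
      unfolding sum.distrib[symmetric]
    proof (rule sum.cong[OF refl])
      fix j :: 'a assume "j \<in> Basis"
      then have "u j + v j > 0" using uv by (simp add: add_pos_pos)
      then have "u j / (u j + v j) + v j / (u j + v j) = 1" by (simp flip: add_divide_distrib)
      then show "u j / (u j + v j) / DIM('a) + v j / (u j + v j) / DIM('a) = 1 / DIM('a)"
        by (metis add_divide_distrib)
    qed
    also have "\<dots> = 1" by simp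
    finally have "(prod u Basis powr ?r + prod v Basis powr ?r) / ?P powr ?r \<le> 1"
      using P uv by (simp add: powr_divide prod_nonneg less_imp_le add_divide_distrib)
    moreover have Pr: "?P powr ?r > 0" by (simp only: powr_gt_zero) (use P in linarith)
    ultimately have "prod u Basis powr ?r + prod v Basis powr ?r \<le> ?P powr ?r"
      by (simp only: pos_divide_le_eq[OF Pr] mult_1)
    then have "(prod u Basis powr ?r + prod v Basis powr ?r) powr DIM('a) \<le> (?P powr ?r) powr DIM('a)"
      by (intro powr_mono2) auto
    then show ?thesis using P by (simp add: powr_powr)
  qed
  ultimately show ?thesis unfolding vb by linarith
qed

text \<open>The exact homogeneity behind proportional cuts and inner approximation.\<close>

lemma Brunn_Minkowski_scaled:
  fixes x y :: real
  assumes "0 < a" "0 \<le> x" "0 \<le> y" "0 < r"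
  shows "((a * x) powr (1 / r) + (a * y) powr (1 / r)) powr r = a * (x powr (1 / r) + y powr (1 / r)) powr r"
proof -
  have "(a * x) powr (1 / r) + (a * y) powr (1 / r) = a powr (1 / r) * (x powr (1 / r) + y powr (1 / r))"
    using assms by (simp add: powr_mult algebra_simps)
  then show ?thesis using assms by (simp add: powr_mult powr_powr)
qed

text \<open>The argument of Hadwiger and Ohmann. A hyperplane separating two boxes of one family is
  matched with a parallel hyperplane that cuts the other union in the same proportion. Both halves
  have fewer boxes in total, and by homogeneity their inequalities add up.\<close>

lemma Brunn_Minkowski_box_families:
  fixes I J :: "'a::euclidean_space set set"
  assumes "box_family I" "box_family J" "I \<noteq> {}" "J \<noteq> {}"
  shows "(vol (\<Union>I) powr (1 / DIM('a)) + vol (\<Union>J) powr (1 / DIM('a))) powr DIM('a)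
    \<le> vol (set_sum (\<Union>I) (\<Union>J))"
  using assms
proof (induction "card I + card J" arbitrary: I J rule: less_induct)
  case less
  let ?r = "1 / real DIM('a)"
  \<comment> \<open>Stated for renamed families so that it also applies with the two roles
    exchanged.\<close>
  have step: "(vol (\<Union>I') powr ?r + vol (\<Union>J') powr ?r) powr DIM('a) \<le> vol (set_sum (\<Union>I') (\<Union>J'))"
    if bf: "box_family I'" "box_family J'" "I' \<noteq> {}" "J' \<noteq> {}" "card I' + card J' = card I + card J"
      and two: "X \<in> I'" "Y \<in> I'" "X \<noteq> Y" for I' J' :: "'a set set" and X Y
  proof -
    have fin: "finite I'" "finite J'" using bf by (auto simp: box_family_def)
    have "X \<inter> Y = {}" using two bf(1) by (auto simp: box_family_def disjoint_def)
    moreover obtain a b c d where ab: "X = box a b" "Y = box c d" "box a b \<noteq> {}" "box c d \<noteq> {}"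
      using two bf(1) unfolding box_family_def by metis
    \<comment> \<open>Disjoint open boxes are separated in some coordinate; \<open>k\<close> below
      is the position of the separating hyperplane, with \<open>Z1\<close> and \<open>Z2\<close> on
      its two sides.\<close>
    ultimately obtain i where i: "i \<in> Basis" and sep: "b \<bullet> i \<le> c \<bullet> i \<or> d \<bullet> i \<le> a \<bullet> i"
      using disjoint_interval(4)[of a b c d] by (auto simp: box_ne_empty not_le[symmetric])
    from sep obtain k Z1 Z2 where k: "Z1 \<in> I'" "Z2 \<in> I'" "Z1 \<inter> {x. k < x \<bullet> i} = {}" "Z2 \<inter> {x. x \<bullet> i < k} = {}"
    proof
      assume "b \<bullet> i \<le> c \<bullet> i"
      then show ?thesis using that[of X Y "b \<bullet> i"] two ab i by (force simp: box_def)
    next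
      assume "d \<bullet> i \<le> a \<bullet> i"
      then show ?thesis using that[of Y X "d \<bullet> i"] two ab i by (force simp: box_def)
    qed
    define Hl Hg where "Hl = (\<lambda>c. {x::'a. x \<bullet> i < c})" and "Hg = (\<lambda>c. {x::'a. c < x \<bullet> i})"
    have cutb: "\<exists>a' b'. box a b \<inter> Hl c = box a' b'" "\<exists>a' b'. box a b \<inter> Hg c = box a' b'" for a b c
      using box_Int_halfspace[OF i] unfolding Hl_def Hg_def by blast+
    define A B where "A = \<Union>I'" and "B = \<Union>J'"
    have AB: "open A" "open B" "bounded A" "bounded B" "vol A > 0" "vol B > 0"
      using bf box_family_open box_family_bounded box_family_vol_pos by (auto simp: A_def B_def)
    define Il Ig where "Il = cut_family I' (Hl k)" and "Ig = cut_family I' (Hg k)"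
    have I1: "box_family Il" "box_family Ig" "\<Union>Il = A \<inter> Hl k" "\<Union>Ig = A \<inter> Hg k"
      unfolding Il_def Ig_def A_def using bf cutb by (auto intro: box_family_cut simp: Union_cut_family)
    have cI: "card Il < card I'" "card Ig < card I'"
      unfolding Il_def Ig_def using card_cut_family_less[OF fin(1)] k by (auto simp: Hl_def Hg_def)
    have "Il \<noteq> {}" "Ig \<noteq> {}"
    proof -
      have ne: "W \<noteq> {}" "open W" if "W \<in> I'" for W using that bf(1) unfolding box_family_def by auto
      have "\<exists>x\<in>W. x \<bullet> i \<noteq> k" if W: "W \<in> I'" for W
      proof (rule ccontr)
        assume *: "\<not> ?thesis"
        obtain x where "x \<in> W" using ne[OF W] by auto
        then obtain e where e: "e > 0" "ball x e \<subseteq> W" using ne(2)[OF W] open_contains_ball by blast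
        have "x + (e / 2) *\<^sub>R i \<in> ball x e" using e(1) i by (simp add: dist_norm)
        then have "(x + (e / 2) *\<^sub>R i) \<bullet> i = k" "x \<bullet> i = k" using e(2) * \<open>x \<in> W\<close> by auto
        then show False using e(1) i by (simp add: inner_add_left)
      qed
      then obtain x1 x2 where "x1 \<in> Z1" "x1 \<bullet> i \<noteq> k" "x2 \<in> Z2" "x2 \<bullet> i \<noteq> k" using k by metis
      then have "x1 \<in> Z1 \<inter> Hl k" "x2 \<in> Z2 \<inter> Hg k" using k unfolding Hl_def Hg_def by fastforce+
      then show "Il \<noteq> {}" "Ig \<noteq> {}" unfolding Il_def Ig_def cut_family_def using k by blast+
    qed
    define s where "s = vol (A \<inter> Hl k) / vol A"
    have vA: "vol A = vol (A \<inter> Hl k) + vol (A \<inter> Hg k)"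
      unfolding Hl_def Hg_def by (rule vol_halfspace_split[OF AB(1,3) i])
    have pos: "vol (A \<inter> Hl k) > 0" "vol (A \<inter> Hg k) > 0"
      using box_family_vol_pos[OF I1(1) \<open>Il \<noteq> {}\<close>] box_family_vol_pos[OF I1(2) \<open>Ig \<noteq> {}\<close>] I1 by auto
    have s: "0 < s" "s < 1" "vol (A \<inter> Hl k) = s * vol A" "vol (A \<inter> Hg k) = (1 - s) * vol A"
      using pos vA AB by (auto simp: s_def field_simps)
    obtain m where m: "vol (B \<inter> Hl m) = s * vol B"
      using vol_halfspace_intermediate[OF AB(2,4) i, of "s * vol B"] s AB unfolding Hl_def by auto
    have vB: "vol B = vol (B \<inter> Hl m) + vol (B \<inter> Hg m)"
      unfolding Hl_def Hg_def by (rule vol_halfspace_split[OF AB(2,4) i])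
    then have m2: "vol (B \<inter> Hg m) = (1 - s) * vol B" using m by (simp add: algebra_simps)
    define Jl Jg where "Jl = cut_family J' (Hl m)" and "Jg = cut_family J' (Hg m)"
    have J1: "box_family Jl" "box_family Jg" "\<Union>Jl = B \<inter> Hl m" "\<Union>Jg = B \<inter> Hg m"
      unfolding Jl_def Jg_def B_def using bf cutb by (auto intro: box_family_cut simp: Union_cut_family)
    have cJ: "card Jl \<le> card J'" "card Jg \<le> card J'"
      unfolding Jl_def Jg_def using card_cut_family_le[OF fin(2)] by auto
    have "Jl \<noteq> {}" "Jg \<noteq> {}" using m m2 J1 s AB by force+
    have "card Il + card Jl < card I + card J" "card Ig + card Jg < card I + card J"
      using cI cJ bf(5) by linarith+
    note IH = less.hyps[OF this(1) I1(1) J1(1) \<open>Il \<noteq> {}\<close> \<open>Jl \<noteq> {}\<close>]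
              less.hyps[OF this(2) I1(2) J1(2) \<open>Ig \<noteq> {}\<close> \<open>Jg \<noteq> {}\<close>]
    let ?X = "(vol A powr ?r + vol B powr ?r) powr DIM('a)"
    have 1: "s * ?X \<le> vol (set_sum (A \<inter> Hl k) (B \<inter> Hl m))"
      using IH(1) unfolding I1 J1 s(3) m using s(1) AB by (subst (asm) Brunn_Minkowski_scaled) auto
    have 2: "(1 - s) * ?X \<le> vol (set_sum (A \<inter> Hg k) (B \<inter> Hg m))"
      using IH(2) unfolding I1 J1 s(4) m2 using s(2) AB by (subst (asm) Brunn_Minkowski_scaled) auto
    have oH: "open (Hl c)" "open (Hg c)" for c
      unfolding Hl_def Hg_def by (auto simp: open_halfspace_component_lt open_halfspace_component_gt)
    have opens: "open (set_sum (A \<inter> Hl k) (B \<inter> Hl m))" "open (set_sum (A \<inter> Hg k) (B \<inter> Hg m))"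
      "open (set_sum A B)"
      by (intro open_set_sum open_Int AB oH)+
    have bds: "bounded (set_sum A B)" by (intro bounded_set_sum AB)
    have sub: "set_sum (A \<inter> Hl k) (B \<inter> Hl m) \<subseteq> set_sum A B" "set_sum (A \<inter> Hg k) (B \<inter> Hg m) \<subseteq> set_sum A B"
      by blast+
    \<comment> \<open>The two partial sums lie on opposite sides of the hyperplane at position
      \<open>k + m\<close>, so their volumes add.\<close>
    have "set_sum (A \<inter> Hl k) (B \<inter> Hl m) \<inter> set_sum (A \<inter> Hg k) (B \<inter> Hg m) = {}"
    proof -
      have "x \<bullet> i < k + m" if "x \<in> set_sum (A \<inter> Hl k) (B \<inter> Hl m)" for x
        using that by (auto simp: Hl_def inner_add_left)
      moreover have "x \<bullet> i > k + m" if "x \<in> set_sum (A \<inter> Hg k) (B \<inter> Hg m)" for x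
        using that by (auto simp: Hg_def inner_add_left)
      ultimately show ?thesis by (meson disjoint_iff less_asym)
    qed
    then have "vol (set_sum (A \<inter> Hl k) (B \<inter> Hl m)) + vol (set_sum (A \<inter> Hg k) (B \<inter> Hg m))
        = vol (set_sum (A \<inter> Hl k) (B \<inter> Hl m) \<union> set_sum (A \<inter> Hg k) (B \<inter> Hg m))"
      using opens bds sub by (intro vol_disjoint_Un[symmetric]) (auto intro: bounded_subset)
    also have "\<dots> \<le> vol (set_sum A B)" using sub opens bds by (intro vol_mono) auto
    finally have "s * ?X + (1 - s) * ?X \<le> vol (set_sum A B)" using 1 2 by linarith
    then show ?thesis unfolding A_def B_def by (simp add: algebra_simps)
  qed
  show ?case
  proof (cases "\<exists>X\<in>I. \<exists>Y\<in>I. X \<noteq> Y")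
    case True
    then show ?thesis using step[OF less.prems refl] by blast
  next
    case nI: False
    show ?thesis
    proof (cases "\<exists>X\<in>J. \<exists>Y\<in>J. X \<noteq> Y")
      case True
      then obtain X Y where XY: "X \<in> J" "Y \<in> J" "X \<noteq> Y" by blast
      have "set_sum (\<Union>J) (\<Union>I) = set_sum (\<Union>I) (\<Union>J)"
        by (rule set_sum_commute)
      then show ?thesis
        using step[OF less.prems(2,1,4,3) add.commute XY] by (simp only: add.commute)
    next
      case False
      obtain X Y where XY: "X \<in> I" "Y \<in> J" using less.prems(3,4) by blast
      have "I \<subseteq> {X}" using nI XY(1) by (intro subsetI) (simp only: bex_simps singleton_iff, metis)
      then have I1: "I = {X}" using XY(1) by blast
      have "J \<subseteq> {Y}" using False XY(2) by (intro subsetI) (simp only: bex_simps singleton_iff, metis)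
      then have J1: "J = {Y}" using XY(2) by blast
      obtain a b where ab: "X = box a b" "box a b \<noteq> {}" by (rule box_familyE[OF less.prems(1) XY(1)])
      obtain c d where cd: "Y = box c d" "box c d \<noteq> {}" by (rule box_familyE[OF less.prems(2) XY(2)])
      have "\<Union>I = box a b" "\<Union>J = box c d" by (simp_all add: I1 J1 ab(1) cd(1))
      then show ?thesis using Brunn_Minkowski_boxes[OF ab(2) cd(2)] by (simp only:)
    qed
  qed
qed

section \<open>Inner approximation and the inequality for bounded open sets\<close>

lemma inner_box_family:
  fixes U :: "'a::euclidean_space set"
  assumes U: "open U" "bounded U" and t: "t < vol U"
  shows "\<exists>I. box_family I \<and> \<Union>I \<subseteq> U \<and> t < vol (\<Union>I)"
proof (cases "U = {}")
  case True
  then show ?thesis using t by (intro exI[of _ "{}"]) (auto simp: box_family_def)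
next
  case False
  obtain w where "U \<subseteq> box (-w) w" using U(2) bounded_subset_box_symmetric by blast
  then have w: "U \<subseteq> cbox (-w) w" "box (-w) w \<noteq> {}" using box_subset_cbox False by blast+
  \<comment> \<open>With this gauge a covering box tagged by a point of \<open>U\<close> must lie in
    \<open>U\<close>.\<close>
  define g where "g = (\<lambda>x. if x \<in> U then U else UNIV)"
  have g: "gauge g" using U(1) by (auto simp: gauge_def g_def)
  have "\<exists>D. countable D \<and> (\<forall>K\<in>D. interior K \<noteq> {} \<and> (\<exists>c d. K = cbox c d)) \<and>
      pairwise (\<lambda>A B. interior A \<inter> interior B = {}) D \<and> (\<forall>K\<in>D. \<exists>x\<in>U \<inter> K. K \<subseteq> g x) \<and> U \<subseteq> \<Union>D"
  proof (rule covering_lemma[OF w g])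
    fix D assume D: "countable D" "\<And>K. K \<in> D \<Longrightarrow> interior K \<noteq> {} \<and> (\<exists>c d. K = cbox c d)"
      "pairwise (\<lambda>A B. interior A \<inter> interior B = {}) D"
      "\<And>K. K \<in> D \<Longrightarrow> \<exists>x\<in>U \<inter> K. K \<subseteq> g x" "U \<subseteq> \<Union>D"
    show ?thesis
      by (rule exI[of _ D], intro conjI ballI D(1,3,5)) (rule D(2)[THEN conjunct1] D(2)[THEN conjunct2] D(4); assumption)+
  qed
  then obtain D where D: "countable D" and D2: "\<forall>K\<in>D. interior K \<noteq> {} \<and> (\<exists>c d. K = cbox c d)"
    and D3: "pairwise (\<lambda>A B. interior A \<inter> interior B = {}) D" and D4: "\<forall>K\<in>D. \<exists>x\<in>U \<inter> K. K \<subseteq> g x"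
    and D5: "U \<subseteq> \<Union>D"
    by (elim exE conjE) (rule that)
  note D = D D2[rule_format] D3 D4[rule_format] D5
  have DU: "K \<subseteq> U" if "K \<in> D" for K using D4 that by (auto simp: g_def)
  have "D \<noteq> {}" using D(5) False by auto
  define K where "K = from_nat_into D"
  have K: "K n \<in> D" for n using \<open>D \<noteq> {}\<close> by (simp add: K_def from_nat_into)
  have rK: "range K = D" using D(1) \<open>D \<noteq> {}\<close> by (simp add: K_def range_from_nat_into)
  \<comment> \<open>The interiors of the covering boxes are pairwise disjoint and miss only faces, a
    null set; so finitely many of them exhaust the volume up to any error.\<close>
  define V where "V = (\<lambda>n. \<Union>k\<le>n. interior (K k))"
  have inc: "incseq V" unfolding V_def incseq_def by fastforce
  have VU: "V n \<subseteq> U" for n using DU K interior_subset unfolding V_def by blast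
  have bV: "range V \<subseteq> sets lborel" unfolding V_def by (auto intro!: borel_open)
  have null: "U - (\<Union>n. V n) \<in> null_sets lborel"
  proof -
    have "U - (\<Union>n. V n) \<subseteq> (\<Union>n. K n - interior (K n))"
      using D(5) rK unfolding V_def by blast
    moreover have "K n - interior (K n) \<in> null_sets lborel" for n
    proof -
      obtain c d where cd: "K n = cbox c d" using D(2) K by metis
      then have "negligible (K n - interior (K n))" using negligible_frontier_interval by (simp add: interior_cbox)
      moreover have "K n - interior (K n) \<in> sets borel" using cd by auto
      ultimately show ?thesis by (auto simp: negligible_iff_null_sets null_sets_def)
    qed
    then have "(\<Union>n. K n - interior (K n)) \<in> null_sets lborel" by (intro null_sets_UN) auto
    moreover have "U - (\<Union>n. V n) \<in> sets lborel" using U(1) bV by auto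
    ultimately show ?thesis using null_sets_subset by blast
  qed
  have fin: "emeasure lborel U \<noteq> \<infinity>" using U(2) emeasure_bounded_finite by (metis infinity_ennreal_def less_irrefl)
  have un: "(\<Union>n. V n) = U - (U - (\<Union>n. V n))" using VU by blast
  have "vol (\<Union>n. V n) = vol U"
    by (subst un, subst measure_Diff_null_set) (use null U in auto)
  moreover have "(\<lambda>n. vol (V n)) \<longlonglongrightarrow> vol (\<Union>n. V n)"
  proof (rule Lim_measure_incseq[OF bV inc])
    have "(\<Union>n. V n) \<subseteq> U" using VU by blast
    then have "bounded (\<Union>n. V n)" using U(2) bounded_subset by blast
    then show "emeasure lborel (\<Union>n. V n) \<noteq> \<infinity>" by (metis emeasure_bounded_finite infinity_ennreal_def less_irrefl)
  qed
  ultimately have "(\<lambda>n. vol (V n)) \<longlonglongrightarrow> vol U" by simp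
  then have "eventually (\<lambda>n. t < vol (V n)) sequentially" using t by (rule order_tendstoD)
  then obtain n where n: "t < vol (V n)" by (metis eventually_sequentially order_refl)
  define I where "I = (\<lambda>k. interior (K k)) ` {..n}"
  have "\<Union>I = V n" by (simp add: I_def V_def)
  moreover have "box_family I"
    unfolding box_family_def
  proof (intro conjI ballI)
    show "disjoint I"
      unfolding disjoint_def
    proof (intro ballI impI)
      fix X Y assume "X \<in> I" "Y \<in> I" "X \<noteq> Y"
      then obtain k l where "X = interior (K k)" "Y = interior (K l)" unfolding I_def by blast
      moreover have "K k \<noteq> K l" using calculation \<open>X \<noteq> Y\<close> by metis
      ultimately show "X \<inter> Y = {}" using pairwiseD[OF D(3) K K] by simp
    qed
    fix X assume "X \<in> I"
    then obtain k where k: "X = interior (K k)" by (auto simp: I_def)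
    obtain c d where "K k = cbox c d" "interior (K k) \<noteq> {}" using D(2)[OF K[of k]] by (elim exE conjE) (rule that)
    then have Xcd: "X \<noteq> {} \<and> X = box c d" using k by (simp add: interior_cbox)
    then show "X \<noteq> {}" by (rule conjunct1)
    show "\<exists>a b. X = box a b" using Xcd by blast
  qed (simp add: I_def)
  ultimately show ?thesis using n VU[of n] by (intro exI[of _ I]) simp
qed

theorem Brunn_Minkowski:
  fixes A B :: "'a::euclidean_space set"
  assumes "open A" "open B" "bounded A" "bounded B" "A \<noteq> {}" "B \<noteq> {}"
  shows "(vol A powr (1 / DIM('a)) + vol B powr (1 / DIM('a))) powr DIM('a) \<le> vol (set_sum A B)"
proof -
  have pos: "vol U > 0" if U: "open U" "bounded U" "U \<noteq> {}" for U :: "'a set"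
  proof -
    obtain a b where "box a b \<subseteq> U" "box a b \<noteq> {}"
      using U(1,3) open_contains_box by (metis all_not_in_conv emptyE)
    then have "vol (box a b) > 0"
      using box_family_vol_pos[of "{box a b}"] by (auto simp: box_family_def disjoint_def)
    also have "\<dots> \<le> vol U" using \<open>box a b \<subseteq> U\<close> U by (intro vol_mono) auto
    finally show ?thesis .
  qed
  let ?X = "(vol A powr (1 / DIM('a)) + vol B powr (1 / DIM('a))) powr DIM('a)"
  \<comment> \<open>Inner families holding more than the fraction \<open>s\<close> of both volumes
    cost, by homogeneity, a factor \<open>s\<close>, which then tends to 1.\<close>
  have "s * ?X \<le> vol (set_sum A B)" if s: "0 < s" "s < 1" for s
  proof -
    have "s * vol A < vol A" "s * vol B < vol B" using pos assms s by auto
    then obtain I J where I: "box_family I" "\<Union>I \<subseteq> A" "s * vol A < vol (\<Union>I)"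
      and J: "box_family J" "\<Union>J \<subseteq> B" "s * vol B < vol (\<Union>J)"
      using inner_box_family assms by metis
    have ne: "I \<noteq> {}" "J \<noteq> {}" using I(3) J(3) s by (auto simp: mult_less_0_iff not_le[symmetric])
    have "s * ?X = ((s * vol A) powr (1 / DIM('a)) + (s * vol B) powr (1 / DIM('a))) powr DIM('a)"
      using s by (intro Brunn_Minkowski_scaled[symmetric]) auto
    also have "\<dots> \<le> (vol (\<Union>I) powr (1 / DIM('a)) + vol (\<Union>J) powr (1 / DIM('a))) powr DIM('a)"
      using I J s by (intro powr_mono2 add_mono) auto
    also have "\<dots> \<le> vol (set_sum (\<Union>I) (\<Union>J))"
      by (rule Brunn_Minkowski_box_families[OF I(1) J(1) ne])
    also have "\<dots> \<le> vol (set_sum A B)"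
      using I J assms box_family_open[OF I(1)] by (intro vol_mono borel_open open_set_sum bounded_set_sum) blast+
    finally show ?thesis .
  qed
  then show ?thesis by (rule field_le_mult_one_interval)
qed

section \<open>Change of variables on a product with the real line\<close>

text \<open>The entries of row \<open>k\<close> off the diagonal vanish, so only permutations fixing
  \<open>k\<close> contribute; \<open>f\<close> transports them to permutations of the smaller index
  type.\<close>

lemma det_bordered:
  fixes A :: "'a::comm_ring_1 ^ 'm::finite ^ 'm" and f :: "'n::finite \<Rightarrow> 'm"
  assumes f: "inj f" "range f = UNIV - {k}" and z: "\<And>j. j \<noteq> k \<Longrightarrow> A $ k $ j = 0"
  shows "det A = A $ k $ k * det (\<chi> i j. A $ f i $ f j)"
proof -
  let ?t = "\<lambda>p. of_int (sign p) * (\<Prod>i\<in>UNIV. A $ i $ p i)"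
  let ?P = "{p. p permutes range f}"
  have bf: "bij_betw f UNIV (range f)" using f(1) by (simp add: inj_on_imp_bij_betw)
  have fixk: "p k = k" if "p permutes range f" for p
    using that f(2) by (simp add: permutes_def)
  have "det A = sum ?t {p. p permutes UNIV}" unfolding det_def ..
  also have "\<dots> = sum ?t ?P"
  proof (rule sum.mono_neutral_right)
    show "finite {p. p permutes (UNIV :: 'm set)}" by (simp add: finite_permutations)
    show "?P \<subseteq> {p. p permutes UNIV}" using permutes_subset by blast
    show "\<forall>p\<in>{p. p permutes UNIV} - ?P. ?t p = 0"
    proof
      fix p assume p: "p \<in> {p. p permutes UNIV} - ?P"
      have "p k \<noteq> k"
      proof
        assume "p k = k"
        then have "p permutes range f"
          using p f(2) by (auto intro: permutes_superset[of p UNIV])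
        then show False using p by simp
      qed
      then have "A $ k $ p k = 0" using z by simp
      then have "(\<Prod>i\<in>UNIV. A $ i $ p i) = 0" by (intro prod_zero) auto
      then show "?t p = 0" by simp
    qed
  qed
  also have "\<dots> = (\<Sum>q\<in>{q. q permutes UNIV}. A $ k $ k * (of_int (sign q) * (\<Prod>i\<in>UNIV. A $ f i $ f (q i))))"
  proof (rule sum.reindex_bij_witness[where i = "map_permutation UNIV f" and j = "map_permutation (range f) (inv f)"])
    fix p assume p: "p \<in> ?P"
    have ib: "bij_betw (inv f) (range f) UNIV" using f(1) by (simp add: bij_betw_inv_into bf)
    show "map_permutation UNIV f (map_permutation (range f) (inv f) p) = p"
      using p f(1) ib by (intro map_permutation_compose_inv) (auto simp: f_inv_into_f)
    show q: "map_permutation (range f) (inv f) p \<in> {q. q permutes UNIV}"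
      using p ib by (auto intro: map_permutation_permutes)
    let ?q = "map_permutation (range f) (inv f) p"
    have sg: "sign ?q = sign p" using p f(1) by (intro sign_map_permutation) (auto intro: inj_on_inv_into)
    have pf: "p (f i) = f (?q i)" for i
    proof -
      have "map_permutation (range f) (inv f) p (inv f (f i)) = inv f (p (f i))"
        by (intro map_permutation_apply) (auto intro: inj_on_inv_into)
      moreover have "p (f i) \<in> range f" using p permutes_in_image by fastforce
      ultimately show ?thesis using f(1) by (simp add: f_inv_into_f)
    qed
    have "(\<Prod>i\<in>UNIV. A $ i $ p i) = A $ k $ p k * (\<Prod>i\<in>UNIV - {k}. A $ i $ p i)"
      by (rule prod.remove) auto
    also have "(\<Prod>i\<in>UNIV - {k}. A $ i $ p i) = (\<Prod>i\<in>UNIV. A $ f i $ p (f i))"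
      unfolding f(2)[symmetric] using f(1) by (subst prod.reindex) auto
    finally have prod: "(\<Prod>i\<in>UNIV. A $ i $ p i) = A $ k $ p k * (\<Prod>i\<in>UNIV. A $ f i $ p (f i))" .
    have pk: "p k = k" using fixk p by simp
    show "A $ k $ k * (of_int (sign ?q) * (\<Prod>i\<in>UNIV. A $ f i $ f (?q i))) = ?t p"
      unfolding prod pk by (simp add: sg pf mult.left_commute)
  next
    fix q :: "'n \<Rightarrow> 'n" assume q: "q \<in> {q. q permutes UNIV}"
    show "map_permutation (range f) (inv f) (map_permutation UNIV f q) = q"
      using q f(1) bf by (intro map_permutation_compose_inv) auto
    show "map_permutation UNIV f q \<in> ?P" using q bf by (auto intro: map_permutation_permutes)
  qed
  also have "\<dots> = A $ k $ k * det (\<chi> i j. A $ f i $ f j)"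
    unfolding det_def by (simp add: sum_distrib_left)
  finally show ?thesis .
qed

text \<open>
  The change of variables theorem of the library needs a well-ordered index type; this is an index
  type of that kind with one element more than \<open>'n\<close>.
\<close>
typedef ('n::finite) ext_index = "{..CARD('n)}" by auto

instantiation ext_index :: (finite) linorder
begin
definition less_eq_ext_index :: "'a ext_index \<Rightarrow> 'a ext_index \<Rightarrow> bool" where
  "less_eq_ext_index x y \<longleftrightarrow> Rep_ext_index x \<le> Rep_ext_index y"
definition less_ext_index :: "'a ext_index \<Rightarrow> 'a ext_index \<Rightarrow> bool" where
  "less_ext_index x y \<longleftrightarrow> Rep_ext_index x < Rep_ext_index y"
instance
  by standard (auto simp: less_eq_ext_index_def less_ext_index_def Rep_ext_index_inject)
end

instance ext_index :: (finite) wellorder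
proof
  fix P :: "'a ext_index \<Rightarrow> bool" and a
  assume step: "\<And>x. (\<And>y. y < x \<Longrightarrow> P y) \<Longrightarrow> P x"
  show "P a"
    by (induction a rule: measure_induct_rule[of Rep_ext_index]) (metis step less_ext_index_def)
qed

lemma card_ext_index: "card (UNIV :: 'n::finite ext_index set) = Suc CARD('n)"
  using type_definition.card[OF type_definition_ext_index] by simp

instance ext_index :: (finite) finite
proof
  show "finite (UNIV :: 'a ext_index set)"
    using card_ext_index[where 'n = 'a] by (metis card.infinite nat.distinct(1))
qed

definition ext_last :: "'n::finite ext_index" where
  "ext_last = Abs_ext_index 0"

text \<open>Any bijection will do: a determinant is unchanged when rows and columns are renumbered
  together.\<close>

definition ext_emb :: "'n::finite \<Rightarrow> 'n ext_index" where
  "ext_emb = (SOME f. bij_betw f UNIV (UNIV - {ext_last}))"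

lemma bij_ext_emb: "bij_betw ext_emb (UNIV :: 'n::finite set) (UNIV - {ext_last})"
proof -
  have "card (UNIV - {ext_last :: 'n ext_index}) = CARD('n)"
    by (subst card_Diff_singleton) (auto simp: card_ext_index)
  then have "\<exists>f. bij_betw f (UNIV :: 'n set) (UNIV - {ext_last :: 'n ext_index})"
    by (intro finite_same_card_bij) auto
  then show ?thesis unfolding ext_emb_def by (rule someI_ex)
qed

lemma inj_ext_emb: "inj ext_emb" and range_ext_emb: "range ext_emb = UNIV - {ext_last}"
  using bij_ext_emb by (auto simp: bij_betw_def)

lemma ext_emb_neq [simp]: "ext_emb i \<noteq> ext_last" "ext_last \<noteq> ext_emb i"
  using range_ext_emb by (metis DiffE insertI1 rangeI)+

lemma ext_emb_eq_iff [simp]: "ext_emb i = ext_emb j \<longleftrightarrow> i = j"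
  using inj_ext_emb by (auto simp: inj_def)

lemma ext_index_cases:
  obtains "i = ext_last" | j where "i = ext_emb j"
  using range_ext_emb by (metis DiffI UNIV_I imageE singletonD)

lemma UNIV_ext_index: "(UNIV :: 'n::finite ext_index set) = insert ext_last (range ext_emb)"
  using range_ext_emb by auto

text \<open>An isometry onto a Cartesian space with the added coordinate \<open>ext_last\<close>; it
  carries Lebesgue measure and Jacobian determinants across.\<close>

definition to_ext :: "(real, 'n::finite) vec \<times> real \<Rightarrow> (real, 'n ext_index) vec" where
  "to_ext p = (\<chi> i. if i = ext_last then snd p else fst p $ inv ext_emb i)"

definition of_ext :: "(real, 'n::finite ext_index) vec \<Rightarrow> (real, 'n) vec \<times> real" where
  "of_ext w = (\<chi> j. w $ ext_emb j, w $ ext_last)"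

lemma to_ext_nth [simp]: "to_ext p $ ext_last = snd p" "to_ext p $ ext_emb j = fst p $ j"
  by (simp_all add: to_ext_def inv_f_f[OF inj_ext_emb])

lemma ext_vec_eq_iff: "v = w \<longleftrightarrow> v $ ext_last = w $ ext_last \<and> (\<forall>j. v $ ext_emb j = w $ ext_emb j)"
  by (metis ext_index_cases vec_eq_iff)

lemma of_to_ext [simp]: "of_ext (to_ext p) = p"
  by (simp add: of_ext_def prod_eq_iff vec_eq_iff)

lemma to_of_ext [simp]: "to_ext (of_ext w) = w"
  by (simp add: ext_vec_eq_iff) (simp add: of_ext_def)

lemma linear_to_ext: "linear to_ext"
  by (rule linearI) (auto simp: ext_vec_eq_iff)

lemma linear_of_ext: "linear of_ext"
  by (rule linearI) (auto simp: of_ext_def prod_eq_iff vec_eq_iff)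

lemma sum_ext_index:
  "(\<Sum>i\<in>UNIV. h i) = h ext_last + (\<Sum>j\<in>UNIV. h (ext_emb (j :: 'n::finite)))"
proof -
  have "(\<Sum>i\<in>UNIV. h i) = h ext_last + (\<Sum>i\<in>range (ext_emb :: 'n \<Rightarrow> _). h i)"
    unfolding UNIV_ext_index by (subst sum.insert) auto
  then show ?thesis by (simp add: sum.reindex[OF inj_ext_emb])
qed

lemma inner_to_ext: "to_ext p \<bullet> to_ext q = p \<bullet> q"
  by (simp add: inner_vec_def sum_ext_index inner_prod_def)

lemma inner_of_ext: "of_ext v \<bullet> of_ext w = v \<bullet> w"
  by (metis inner_to_ext to_of_ext)

lemma inner_to_ext_of_ext: "to_ext p \<bullet> w = p \<bullet> of_ext w"
  by (metis inner_to_ext to_of_ext)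

lemma to_ext_axis: "to_ext (axis j 1, 0) = axis (ext_emb j) 1" "to_ext (0, 1) = axis ext_last 1"
  by (simp_all add: ext_vec_eq_iff axis_def)

lemma of_ext_axis: "of_ext (axis (ext_emb j) 1) = (axis j 1, 0)" "of_ext (axis ext_last 1) = (0, 1)"
  by (simp_all add: of_ext_def vec_eq_iff axis_def)

lemma bij_to_ext_Basis: "bij_betw to_ext Basis Basis"
proof (rule bij_betw_byWitness[where f' = of_ext])
  show "to_ext ` Basis \<subseteq> Basis"
    by (auto simp: Basis_prod_def Basis_vec_def to_ext_axis)
  show "of_ext ` Basis \<subseteq> (Basis :: ((real, 'a) vec \<times> real) set)"
  proof
    fix p :: "(real, 'a) vec \<times> real" assume "p \<in> of_ext ` Basis"
    then obtain i where "p = of_ext (axis i 1)" by (auto simp: Basis_vec_def)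
    then show "p \<in> Basis"
      by (cases i rule: ext_index_cases) (auto simp: of_ext_axis Basis_prod_def Basis_vec_def)
  qed
qed auto

lemma continuous_on_to_ext: "continuous_on A to_ext" and continuous_on_of_ext: "continuous_on B of_ext"
  by (simp_all add: linear_continuous_on linear_to_ext linear_of_ext linear_conv_bounded_linear[symmetric])

text \<open>The standard basis goes onto the standard basis, so preimages of boxes are boxes with
  the same side lengths.\<close>

lemma lborel_distr_to_ext: "distr lborel borel to_ext = lborel"
proof (rule lborel_eqI[symmetric])
  have m [measurable]: "to_ext \<in> borel_measurable borel"
    by (intro borel_measurable_continuous_onI continuous_on_to_ext)
  fix l u :: "(real, 'a ext_index) vec"
  assume le: "\<And>b. b \<in> Basis \<Longrightarrow> l \<bullet> b \<le> u \<bullet> b"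
  have ib: "of_ext w \<bullet> b = w \<bullet> to_ext b" for w and b :: "(real, 'a) vec \<times> real"
    by (metis inner_commute inner_to_ext_of_ext)
  have bB: "to_ext b \<in> Basis" if "b \<in> Basis" for b :: "(real, 'a) vec \<times> real"
    using bij_to_ext_Basis that by (auto simp: bij_betw_def)
  have "to_ext -` box l u = box (of_ext l) (of_ext u)"
  proof (intro set_eqI)
    fix p :: "(real, 'a) vec \<times> real"
    have "(\<forall>c\<in>Basis. l \<bullet> c < to_ext p \<bullet> c \<and> to_ext p \<bullet> c < u \<bullet> c) \<longleftrightarrow>
        (\<forall>b\<in>Basis. l \<bullet> to_ext b < to_ext p \<bullet> to_ext b \<and> to_ext p \<bullet> to_ext b < u \<bullet> to_ext b)"
      unfolding bij_to_ext_Basis[where 'a = 'a, unfolded bij_betw_def, THEN conjunct2, symmetric]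
      by (simp only: ball_simps)
    then show "p \<in> to_ext -` box l u \<longleftrightarrow> p \<in> box (of_ext l) (of_ext u)"
      by (simp add: mem_box ib inner_to_ext)
  qed
  then have "emeasure (distr lborel borel to_ext) (box l u) = emeasure lborel (box (of_ext l) (of_ext u))"
    by (simp add: emeasure_distr)
  also have "\<dots> = (\<Prod>b\<in>Basis. (of_ext u - of_ext l) \<bullet> b)"
    using le bB by (intro emeasure_lborel_box) (simp add: ib)
  also have "(\<Prod>b\<in>Basis. (of_ext u - of_ext l) \<bullet> b) = (\<Prod>b\<in>Basis. (u - l) \<bullet> to_ext b)"
    by (simp add: ib inner_diff_left)
  also have "\<dots> = (\<Prod>b\<in>Basis. (u - l) \<bullet> b)"
    by (rule prod.reindex_bij_betw[OF bij_to_ext_Basis])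
  finally show "emeasure (distr lborel borel to_ext) (box l u) = (\<Prod>b\<in>Basis. (u - l) \<bullet> b)" .
qed simp

definition prod_det :: "((real, 'n::finite) vec \<times> real \<Rightarrow> (real, 'n) vec \<times> real) \<Rightarrow> real" where
  "prod_det L = det (matrix (to_ext \<circ> L \<circ> of_ext))"

lemma prod_det_compose:
  assumes "linear L" "linear M"
  shows "prod_det (L \<circ> M) = prod_det L * prod_det M"
proof -
  have "to_ext \<circ> (L \<circ> M) \<circ> of_ext = (to_ext \<circ> L \<circ> of_ext) \<circ> (to_ext \<circ> M \<circ> of_ext)"
    by (auto simp: fun_eq_iff)
  moreover have "linear (to_ext \<circ> L \<circ> of_ext)" "linear (to_ext \<circ> M \<circ> of_ext)"
    using assms by (auto intro!: linear_compose linear_to_ext linear_of_ext)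
  ultimately show ?thesis unfolding prod_det_def by (simp add: matrix_compose det_mul)
qed

lemma prod_det_orthogonal:
  assumes "linear R" "\<And>p q. R p \<bullet> R q = p \<bullet> q"
  shows "\<bar>prod_det R\<bar> = 1"
proof -
  have "orthogonal_transformation (to_ext \<circ> R \<circ> of_ext)"
    unfolding orthogonal_transformation_def
    by (intro conjI allI linear_compose linear_to_ext linear_of_ext assms(1))
       (simp only: o_apply inner_to_ext assms(2) inner_of_ext)
  then have "orthogonal_matrix (matrix (to_ext \<circ> R \<circ> of_ext))"
    by (simp add: orthogonal_transformation_matrix)
  from det_orthogonal_matrix[OF this] show ?thesis unfolding prod_det_def by auto
qed

text \<open>The last row of the matrix vanishes off the diagonal, which is the case of
  \<open>det_bordered\<close>.\<close>

lemma prod_det_block: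
  fixes M :: "real^'n::finite \<Rightarrow> real^'n"
  assumes "linear M"
  shows "prod_det (\<lambda>p. (M (fst p) + snd p *\<^sub>R y, c * snd p)) = c * det (matrix M)"
proof -
  interpret M: linear M by fact
  let ?A = "matrix (to_ext \<circ> (\<lambda>p. (M (fst p) + snd p *\<^sub>R y, c * snd p)) \<circ> of_ext)"
  have "?A $ ext_last $ j = 0" if "j \<noteq> ext_last" for j
    using that by (cases j rule: ext_index_cases) (auto simp: matrix_def of_ext_axis)
  then have "det ?A = ?A $ ext_last $ ext_last * det (\<chi> i j. ?A $ ext_emb i $ ext_emb j)"
    by (intro det_bordered inj_ext_emb range_ext_emb)
  moreover have "?A $ ext_last $ ext_last = c" by (simp add: matrix_def of_ext_axis)
  moreover have "(\<chi> i j. ?A $ ext_emb i $ ext_emb j) = matrix M"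
    by (simp add: matrix_def of_ext_axis)
  ultimately show ?thesis unfolding prod_det_def by simp
qed

text \<open>Boundedness of the image makes its measure finite, so the gauge integral of the Jacobian
  given by the change of variables theorem can be read as a nonnegative Lebesgue integral.\<close>

lemma emeasure_differentiable_image:
  fixes g :: "(real, 'n::finite) vec \<times> real \<Rightarrow> (real, 'n) vec \<times> real"
  assumes S: "S \<in> sets borel" and gS: "g ` S \<in> sets borel" "bounded (g ` S)"
    and der: "\<And>x. x \<in> S \<Longrightarrow> (g has_derivative g' x) (at x within S)" and inj: "inj_on g S"
    and meas: "(\<lambda>x. indicator S x * \<bar>prod_det (g' x)\<bar>) \<in> borel_measurable borel"
  shows "emeasure lborel (g ` S) = (\<integral>\<^sup>+x. ennreal (indicator S x * \<bar>prod_det (g' x)\<bar>) \<partial>lborel)"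
proof -
  have mt [measurable]: "to_ext \<in> borel_measurable borel"
    by (intro borel_measurable_continuous_onI continuous_on_to_ext)
  have mo [measurable]: "of_ext \<in> borel_measurable borel"
    by (intro borel_measurable_continuous_onI continuous_on_of_ext)
  have bt: "bounded_linear to_ext" "bounded_linear of_ext"
    using linear_to_ext linear_of_ext linear_conv_bounded_linear by blast+
  define T where "T = of_ext -` S"
  define G where "G = to_ext \<circ> g \<circ> of_ext"
  have T: "T \<in> sets borel" using S mo unfolding T_def by (metis borel_measurable_vimage measurable_sets_borel)
  have oT: "of_ext ` T = S" unfolding T_def by (auto intro: image_eqI[of _ of_ext "to_ext _"])
  have GT: "G ` T = of_ext -` (g ` S)"
  proof (intro set_eqI iffI)
    fix x assume "x \<in> G ` T"
    then show "x \<in> of_ext -` (g ` S)" unfolding G_def T_def by auto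
  next
    fix x assume "x \<in> of_ext -` (g ` S)"
    then obtain y where y: "y \<in> S" "of_ext x = g y" by auto
    then have "x = G (to_ext y)" unfolding G_def by (metis comp_apply of_to_ext to_of_ext)
    then show "x \<in> G ` T" using y(1) unfolding T_def by (intro image_eqI[of _ _ "to_ext y"]) auto
  qed
  have GTb: "G ` T \<in> sets borel" unfolding GT using gS(1) mo by (metis measurable_sets_borel)
  have Gbd: "bounded (G ` T)"
    unfolding G_def image_comp[symmetric] oT using gS(2) bt(1) bounded_linear_image by blast
  define D where "D = (\<lambda>x. \<bar>det (matrix (to_ext \<circ> g' (of_ext x) \<circ> of_ext))\<bar>)"
  have D: "D x = \<bar>prod_det (g' (of_ext x))\<bar>" for x by (simp add: D_def prod_det_def)
  have derG: "(G has_derivative (to_ext \<circ> g' (of_ext x) \<circ> of_ext)) (at x within T)" if "x \<in> T" for x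
  proof -
    have 1: "(of_ext has_derivative of_ext) (at x within T)"
      by (rule bounded_linear_imp_has_derivative[OF bt(2)])
    have 2: "(g has_derivative g' (of_ext x)) (at (of_ext x) within of_ext ` T)"
      unfolding oT using der that by (auto simp: T_def)
    have 3: "(to_ext has_derivative to_ext) (at (g (of_ext x)) within g ` (of_ext ` T))"
      by (rule bounded_linear_imp_has_derivative[OF bt(1)])
    show ?thesis unfolding G_def
      using diff_chain_within[OF 1 diff_chain_within[OF 2 3]] by (simp add: o_def)
  qed
  have injG: "inj_on G T"
    using inj unfolding G_def T_def by (auto simp: inj_on_def) (metis of_to_ext to_of_ext)
  have lm: "G ` T \<in> lmeasurable"
    using GTb Gbd by (intro bounded_set_imp_lmeasurable) auto
  have "T \<in> sets lebesgue" using T by auto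
  then have hi: "(D has_integral measure lebesgue (G ` T)) T"
    using has_measure_differentiable_image[OF _ derG injG, of "measure lebesgue (G ` T)"] lm
    unfolding D_def by blast
  have mD: "(\<lambda>x. indicator T x * D x) \<in> borel_measurable borel"
  proof -
    have "(\<lambda>x. (\<lambda>x. indicator S x * \<bar>prod_det (g' x)\<bar>) (of_ext x)) \<in> borel_measurable borel"
      using meas mo by (rule measurable_compose[rotated])
    then show ?thesis by (simp add: D T_def indicator_vimage)
  qed
  have "(\<integral>\<^sup>+x. ennreal (indicator T x * D x) \<partial>lborel) = ennreal (measure lebesgue (G ` T))"
    by (rule nn_integral_has_integral_lebesgue[OF _ hi]) (simp add: D)
  also have "\<dots> = emeasure lborel (G ` T)"
    using GTb emeasure_bounded_finite[OF Gbd] by (simp add: emeasure_eq_ennreal_measure)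
  also have "\<dots> = emeasure (distr lborel borel to_ext) (G ` T)" by (simp add: lborel_distr_to_ext)
  also have "\<dots> = emeasure lborel (to_ext -` (G ` T))"
    using GTb by (subst emeasure_distr) auto
  also have "to_ext -` (G ` T) = g ` S" unfolding GT by auto
  finally have "emeasure lborel (g ` S) = (\<integral>\<^sup>+x. ennreal (indicator T x * D x) \<partial>lborel)" by simp
  also have "\<dots> = (\<integral>\<^sup>+x. ennreal (indicator T x * D x) \<partial>distr lborel borel to_ext)" by (simp add: lborel_distr_to_ext)
  also have "\<dots> = (\<integral>\<^sup>+x. ennreal (indicator T (to_ext x) * D (to_ext x)) \<partial>lborel)"
    using mD by (subst nn_integral_distr) auto
  also have "\<dots> = (\<integral>\<^sup>+x. ennreal (indicator S x * \<bar>prod_det (g' x)\<bar>) \<partial>lborel)"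
    by (simp add: D T_def indicator_vimage[symmetric] indicator_def)
  finally show ?thesis .
qed

section \<open>Minkowski algebra\<close>

lemma mink_add_left: "mink (X + Y) Z = mink X Z + mink Y Z"
  and mink_add_right: "mink X (Y + Z) = mink X Y + mink X Z"
  and mink_diff_left: "mink (X - Y) Z = mink X Z - mink Y Z"
  and mink_diff_right: "mink X (Y - Z) = mink X Y - mink X Z"
  and mink_scaleR_left: "mink (c *\<^sub>R X) Z = c * mink X Z"
  and mink_scaleR_right: "mink X (c *\<^sub>R Z) = c * mink X Z"
  and mink_minus_left: "mink (- X) Z = - mink X Z"
  and mink_minus_right: "mink X (- Z) = - mink X Z"
  and mink_zero: "mink 0 Z = 0" "mink X 0 = 0"
  unfolding mink_def
  by (simp_all add: inner_add_left inner_add_right inner_diff_left inner_diff_right algebra_simps)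

lemmas mink_simps = mink_add_left mink_add_right mink_diff_left mink_diff_right
  mink_scaleR_left mink_scaleR_right mink_minus_left mink_minus_right mink_zero

lemma mink_commute: "mink X Y = mink Y X"
  unfolding mink_def by (simp add: inner_commute mult.commute)

lemma bounded_bilinear_mink: "bounded_bilinear (mink :: 'n::finite minkowski \<Rightarrow> 'n minkowski \<Rightarrow> real)"
proof
  show "\<exists>K. \<forall>a b :: 'n minkowski. norm (mink a b) \<le> norm a * norm b * K"
  proof (intro exI allI)
    fix a b :: "((real, 'n) vec \<times> real) \<times> real"
    have "norm (mink a b) \<le> \<bar>fst a \<bullet> fst b\<bar> + \<bar>snd a * snd b\<bar>"
      unfolding mink_def by simp
    also have "\<dots> \<le> norm (fst a) * norm (fst b) + norm (snd a) * norm (snd b)"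
      by (intro add_mono Cauchy_Schwarz_ineq2) (simp add: abs_mult)
    also have "\<dots> \<le> norm a * norm b + norm a * norm b"
      using norm_fst_le[of "fst a" "snd a"] norm_fst_le[of "fst b" "snd b"]
        norm_snd_le[of "snd a" "fst a"] norm_snd_le[of "snd b" "fst b"]
      by (intro add_mono mult_mono) auto
    finally show "norm (mink a b) \<le> norm a * norm b * 2" by simp
  qed
qed (simp_all add: mink_simps)

lemmas continuous_on_mink [continuous_intros] = bounded_bilinear.continuous_on[OF bounded_bilinear_mink]
lemmas has_derivative_mink = bounded_bilinear.FDERIV[OF bounded_bilinear_mink]

text \<open>Turns a Euclidean gradient into the gradient for the Minkowski product.\<close>

definition mink_flip :: "'n::finite minkowski \<Rightarrow> 'n minkowski" where
  "mink_flip w = (fst w, - snd w)"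

lemma mink_flip [simp]: "mink (mink_flip a) w = a \<bullet> w"
  by (simp add: mink_def mink_flip_def inner_prod_def)

lemma bounded_linear_mink_flip: "bounded_linear mink_flip"
  unfolding mink_flip_def
  by (intro bounded_linear_Pair bounded_linear_fst bounded_linear_minus bounded_linear_snd)

lemma hyp_space_iff: "X \<in> hyp_space \<longleftrightarrow> snd X = sqrt (1 + fst X \<bullet> fst X)"
proof
  assume "X \<in> hyp_space"
  then have "(snd X)\<^sup>2 = 1 + fst X \<bullet> fst X" "snd X > 0"
    by (auto simp: hyp_space_def mink_def power2_eq_square)
  then show "snd X = sqrt (1 + fst X \<bullet> fst X)" by (metis less_imp_le real_sqrt_unique)
next
  assume s: "snd X = sqrt (1 + fst X \<bullet> fst X)"
  have p: "1 + fst X \<bullet> fst X > 0" by (simp add: add_pos_nonneg)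
  then have "snd X * snd X = 1 + fst X \<bullet> fst X" unfolding s by simp
  then show "X \<in> hyp_space" using p s by (simp add: hyp_space_def mink_def)
qed

lemma hyp_spaceD:
  assumes "X \<in> hyp_space"
  shows "mink X X = -1" "snd X > 0" "snd X * snd X = 1 + fst X \<bullet> fst X" "norm (fst X) < snd X" "snd X \<ge> 1"
proof -
  show 1: "mink X X = -1" "snd X > 0" using assms by (auto simp: hyp_space_def)
  then show 2: "snd X * snd X = 1 + fst X \<bullet> fst X" by (simp add: mink_def)
  then have "(norm (fst X))\<^sup>2 < (snd X)\<^sup>2" unfolding power2_norm_eq_inner by (simp add: power2_eq_square)
  then show "norm (fst X) < snd X" using 1 by (meson less_imp_le power2_less_imp_less)
  have "1\<^sup>2 \<le> (snd X)\<^sup>2" using 2 by (simp add: power2_eq_square)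
  then show "snd X \<ge> 1" using 1 by (meson less_imp_le power2_le_imp_le)
qed

text \<open>The orthogonal complement of a timelike vector is spacelike: otherwise Cauchy-Schwarz
  for the spatial parts, with \<open>fst X \<bullet> fst X = snd X * snd X - 1\<close>, would force
  \<open>w = 0\<close>.\<close>

lemma hyp_tangent_pos:
  assumes X: "X \<in> hyp_space" and w: "w \<in> hyp_tangent X" "w \<noteq> 0"
  shows "mink w w > 0"
proof (rule ccontr)
  assume "\<not> mink w w > 0"
  then have le: "fst w \<bullet> fst w \<le> snd w * snd w" by (simp add: mink_def)
  have t: "fst X \<bullet> fst w = snd X * snd w" using w by (simp add: hyp_tangent_def mink_def)
  have "(snd X * snd w)\<^sup>2 \<le> (fst X \<bullet> fst X) * (fst w \<bullet> fst w)"
    using Cauchy_Schwarz_ineq[of "fst X" "fst w"] t by simp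
  also have "\<dots> \<le> (fst X \<bullet> fst X) * (snd w * snd w)" using le by (intro mult_left_mono) auto
  also have "fst X \<bullet> fst X = snd X * snd X - 1" using hyp_spaceD(3)[OF X] by simp
  finally have "snd w * snd w \<le> 0" by (simp add: power2_eq_square algebra_simps)
  then have "snd w = 0" by (simp add: mult_le_0_iff order_antisym_conv) auto
  then have "fst w = 0" using le
    by (metis inner_eq_zero_iff inner_ge_zero mult_zero_left order_antisym)
  with \<open>snd w = 0\<close> show False using w(2) by (simp add: prod_eq_iff)
qed

lemma subspace_hyp_tangent: "subspace (hyp_tangent X)"
  unfolding hyp_tangent_def subspace_def by (simp add: mink_simps)

text \<open>The square of \<open>u - v\<close> is 2 minus twice the product of \<open>u\<close> and
  \<open>v\<close>, hence at most 0, and tangent spaces are positive definite.\<close>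

lemma hyp_tangent_unit_eq:
  assumes "X \<in> hyp_space" "u \<in> hyp_tangent X" "v \<in> hyp_tangent X" "mink u u = 1" "mink v v = 1" "mink u v \<ge> 1"
  shows "u = v"
proof (rule ccontr)
  assume "u \<noteq> v"
  then have "mink (u - v) (u - v) > 0"
    using assms(1,2,3) by (intro hyp_tangent_pos[of X] subspace_diff subspace_hyp_tangent) simp_all
  then show False using assms mink_commute[of u v] by (simp add: mink_simps)
qed

section \<open>The hyperboloid as a graph\<close>

definition hyp_graph :: "'n::finite espace \<Rightarrow> 'n minkowski" where
  "hyp_graph x = (x, sqrt (1 + x \<bullet> x))"

lemma one_plus_inner_pos: "1 + x \<bullet> x > (0::real)" for x :: "'a::real_inner"
  by (simp add: add_pos_nonneg)

lemma hyp_graph_in: "hyp_graph x \<in> hyp_space"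
  by (simp add: hyp_space_iff hyp_graph_def)

lemma fst_hyp_graph [simp]: "fst (hyp_graph x) = x"
  by (simp add: hyp_graph_def)

lemma hyp_graph_fst: "X \<in> hyp_space \<Longrightarrow> hyp_graph (fst X) = X"
  by (simp add: hyp_space_iff hyp_graph_def prod_eq_iff)

definition hyp_graph_deriv :: "'n::finite espace \<Rightarrow> 'n espace \<Rightarrow> 'n minkowski" where
  "hyp_graph_deriv x v = (v, (x \<bullet> v) / sqrt (1 + x \<bullet> x))"

lemma has_derivative_hyp_graph: "(hyp_graph has_derivative hyp_graph_deriv x) (at x within S)"
proof -
  have "((\<lambda>x::'a espace. sqrt (1 + x \<bullet> x)) has_derivative (\<lambda>v. (x \<bullet> v + v \<bullet> x) / 2 / sqrt (1 + x \<bullet> x))) (at x within S)"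
    using one_plus_inner_pos[of x]
    by (intro derivative_eq_intros | simp add: field_simps)+
  then have "((\<lambda>x::'a espace. sqrt (1 + x \<bullet> x)) has_derivative (\<lambda>v. (x \<bullet> v) / sqrt (1 + x \<bullet> x))) (at x within S)"
    by (simp add: inner_commute)
  then show ?thesis
    unfolding hyp_graph_def hyp_graph_deriv_def by (intro has_derivative_Pair has_derivative_ident)
qed

lemma continuous_on_hyp_graph: "continuous_on S hyp_graph"
  unfolding hyp_graph_def by (intro continuous_intros)

lemma hyp_graph_deriv_tangent:
  assumes "X \<in> hyp_space" "w \<in> hyp_tangent X"
  shows "hyp_graph_deriv (fst X) (fst w) = w"
proof -
  have "snd X = sqrt (1 + fst X \<bullet> fst X)" "snd X > 0"
    using assms(1) hyp_space_iff[of X] hyp_spaceD(2)[of X] by simp_all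
  moreover have "fst X \<bullet> fst w = snd X * snd w" using assms by (simp add: hyp_tangent_def mink_def)
  ultimately show ?thesis by (simp add: hyp_graph_deriv_def prod_eq_iff field_simps)
qed

section \<open>Second-order data of a smooth function\<close>

text \<open>Repackages iterated derivatives in fixed directions as a gradient \<open>g\<close> and a
  Hessian map \<open>H\<close>; continuity of \<open>H\<close> is stated one direction at a time, as
  \<open>Ck_on\<close> delivers it.\<close>

lemma smooth_on_second_order:
  fixes f :: "'a::euclidean_space \<Rightarrow> real"
  assumes "smooth_on f W"
  shows "\<exists>g H. (\<forall>y\<in>W. (f has_derivative (\<lambda>w. g y \<bullet> w)) (at y)) \<and>
    (\<forall>y\<in>W. (g has_derivative H y) (at y)) \<and> (\<forall>w. continuous_on W (\<lambda>y. H y w))"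
proof -
  define D where "D = (\<lambda>b y. frechet_derivative f (at y) b)"
  define E where "E = (\<lambda>b y w. frechet_derivative (D b) (at y) w)"
  have "Ck_on (Suc (Suc 0)) f W" using assms unfolding smooth_on_def by blast
  then have f: "\<And>y. y \<in> W \<Longrightarrow> f differentiable (at y)"
    and Df: "\<And>b y. y \<in> W \<Longrightarrow> D b differentiable (at y)"
    and Ec: "\<And>b w. continuous_on W (\<lambda>y. E b y w)"
    unfolding D_def E_def by auto
  define g where "g = (\<lambda>y. \<Sum>b\<in>Basis. D b y *\<^sub>R b)"
  define H where "H = (\<lambda>y w. \<Sum>b\<in>Basis. E b y w *\<^sub>R b)"
  have "(f has_derivative (\<lambda>w. g y \<bullet> w)) (at y)" if "y \<in> W" for y
  proof -
    have d: "(f has_derivative frechet_derivative f (at y)) (at y)"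
      using f[OF that] by (simp only: frechet_derivative_works)
    then have lin: "linear (frechet_derivative f (at y))" using has_derivative_linear by blast
    have "frechet_derivative f (at y) w = g y \<bullet> w" for w
    proof -
      have "frechet_derivative f (at y) w = frechet_derivative f (at y) (\<Sum>b\<in>Basis. (w \<bullet> b) *\<^sub>R b)"
        by (simp add: euclidean_representation)
      also have "\<dots> = (\<Sum>b\<in>Basis. (w \<bullet> b) * D b y)"
        using lin by (simp add: linear_sum linear_scale D_def)
      also have "\<dots> = g y \<bullet> w" unfolding g_def
        by (simp add: inner_sum_left inner_commute[of w] mult.commute[of "_ \<bullet> _"])
      finally show ?thesis .
    qed
    then have "frechet_derivative f (at y) = (\<lambda>w. g y \<bullet> w)" by auto
    then show ?thesis using d by simp
  qed
  moreover have "(g has_derivative H y) (at y)" if "y \<in> W" for y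
  proof -
    have "(D b has_derivative E b y) (at y)" for b
      using Df[OF that] unfolding E_def by (simp only: frechet_derivative_works)
    then show ?thesis unfolding g_def H_def
      by (intro has_derivative_sum has_derivative_scaleR_left)
  qed
  moreover have "continuous_on W (\<lambda>y. H y w)" for w
    unfolding H_def by (intro continuous_intros Ec)
  ultimately show ?thesis by blast
qed

section \<open>The outward normal near a boundary point\<close>

text \<open>\<open>K\<close> is closed, so its frontier is what remains of it after removing the
  relatively interior points.\<close>

lemma hyp_boundary_iff:
  assumes "K \<subseteq> hyp_space" "compact K"
  shows "X \<in> hyp_boundary K \<longleftrightarrow> X \<in> K \<and> (\<forall>V. open V \<longrightarrow> X \<in> V \<longrightarrow> \<not> V \<inter> hyp_space \<subseteq> K)"
proof -
  have "closedin (top_of_set hyp_space) K"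
    using assms by (simp add: closed_subset compact_imp_closed)
  then have "hyp_boundary K = K - top_of_set hyp_space interior_of K"
    unfolding frontier_of_def by (simp add: closure_of_closedin)
  moreover have "X \<in> top_of_set hyp_space interior_of K \<longleftrightarrow> (\<exists>V. open V \<and> X \<in> V \<and> V \<inter> hyp_space \<subseteq> K)" if "X \<in> K"
    unfolding interior_of_def openin_open using that assms(1) by (auto simp: Int_commute)
  ultimately show ?thesis by blast
qed

text \<open>Describes the outward unit normal through the points of \<open>K\<close> alone:
  directions with negative product enter \<open>K\<close>, those with positive product leave it. No
  defining function occurs, so independence of its choice is built in.\<close>

definition is_normal :: "'n::finite minkowski set \<Rightarrow> 'n minkowski \<Rightarrow> 'n minkowski \<Rightarrow> bool" where
  "is_normal K X u \<longleftrightarrow> u \<in> hyp_tangent X \<and> mink u u = 1 \<and>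
     (\<forall>w\<in>hyp_tangent X. mink u w < 0 \<longrightarrow> (\<forall>\<^sub>F t in at_right 0. hyp_graph (fst X + t *\<^sub>R fst w) \<in> K)) \<and>
     (\<forall>w\<in>hyp_tangent X. mink u w > 0 \<longrightarrow> (\<forall>\<^sub>F t in at_right 0. hyp_graph (fst X + t *\<^sub>R fst w) \<notin> K))"

text \<open>For distinct unit vectors the difference \<open>v - u\<close> has negative product with
  \<open>u\<close> and positive product with \<open>v\<close>. The one-sided hypothesis on
  \<open>v\<close> also fits the normals found by maximizing a linear function.\<close>

lemma is_normal_unique:
  assumes X: "X \<in> hyp_space" and u: "is_normal K X u" and v: "v \<in> hyp_tangent X" "mink v v = 1"
    and vw: "\<And>w. w \<in> hyp_tangent X \<Longrightarrow> mink u w < 0 \<Longrightarrow> mink v w \<le> 0"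
  shows "u = v"
proof (rule ccontr)
  assume "u \<noteq> v"
  have uT: "u \<in> hyp_tangent X" "mink u u = 1" using u by (auto simp: is_normal_def)
  then have uv: "mink u v < 1" using hyp_tangent_unit_eq[OF X uT(1) v(1)] v \<open>u \<noteq> v\<close> by fastforce
  have "v - u \<in> hyp_tangent X" using uT v by (intro subspace_diff subspace_hyp_tangent)
  moreover have "mink u (v - u) < 0" using uv uT by (simp add: mink_simps)
  moreover have "mink v (v - u) > 0" using uv v by (simp add: mink_simps mink_commute)
  ultimately show False using vw by fastforce
qed

lemma is_normal_unique':
  assumes "X \<in> hyp_space" "is_normal K X u" "is_normal K X v"
  shows "u = v"
proof (rule is_normal_unique[OF assms(1,2)])
  show "v \<in> hyp_tangent X" "mink v v = 1" using assms(3) by (auto simp: is_normal_def)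
  fix w assume w: "w \<in> hyp_tangent X" "mink u w < 0"
  then have 1: "\<forall>\<^sub>F t in at_right 0. hyp_graph (fst X + t *\<^sub>R fst w) \<in> K"
    using assms(2) by (auto simp: is_normal_def)
  show "mink v w \<le> 0"
  proof (rule ccontr)
    assume "\<not> mink v w \<le> 0"
    then have "\<forall>\<^sub>F t in at_right 0. hyp_graph (fst X + t *\<^sub>R fst w) \<notin> K"
      using assms(3) w by (auto simp: is_normal_def)
    with 1 have "\<forall>\<^sub>F t in at_right (0::real). False" by eventually_elim auto
    then show False by simp
  qed
qed

text \<open>\<open>mink_flip (g Y)\<close> is the ambient Minkowski gradient; as \<open>Y\<close>
  has square -1 on the hyperboloid, adding \<open>(g Y \<bullet> Y) *\<^sub>R Y\<close> projects it
  onto the tangent space.\<close>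

definition tangential_gradient :: "('n::finite minkowski \<Rightarrow> 'n minkowski) \<Rightarrow> 'n minkowski \<Rightarrow> 'n minkowski" where
  "tangential_gradient g Y = mink_flip (g Y) + (g Y \<bullet> Y) *\<^sub>R Y"

lemma tangential_gradient_tangent:
  assumes "Y \<in> hyp_space"
  shows "tangential_gradient g Y \<in> hyp_tangent Y"
  using hyp_spaceD(1)[OF assms]
  by (simp add: hyp_tangent_def tangential_gradient_def mink_simps mink_commute[of Y "mink_flip _"])

lemma mink_tangential_gradient:
  assumes "w \<in> hyp_tangent Y"
  shows "mink (tangential_gradient g Y) w = g Y \<bullet> w"
  using assms by (simp add: hyp_tangent_def tangential_gradient_def mink_simps)

section \<open>Defining functions and the normal field\<close>

text \<open>A defining function on a neighbourhood so small that its tangential gradient is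
  spacelike throughout; then \<open>N\<close> extends the normal field to an open subset of the
  ambient space and can be differentiated there.\<close>

locale boundary_piece =
  fixes K :: "'n::finite minkowski set" and W and \<rho> :: "'n minkowski \<Rightarrow> real"
    and g :: "'n minkowski \<Rightarrow> 'n minkowski" and H :: "'n minkowski \<Rightarrow> 'n minkowski \<Rightarrow> 'n minkowski"
  assumes K: "K \<subseteq> hyp_space" "compact K"
    and W: "open W" and KW: "K \<inter> W = {Y \<in> hyp_space \<inter> W. \<rho> Y \<le> 0}"
    and der: "\<And>Y. Y \<in> W \<Longrightarrow> (\<rho> has_derivative (\<lambda>w. g Y \<bullet> w)) (at Y)"
    and derg: "\<And>Y. Y \<in> W \<Longrightarrow> (g has_derivative H Y) (at Y)"
    and contH: "\<And>w. continuous_on W (\<lambda>Y. H Y w)"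
    and nondeg: "\<And>Y. Y \<in> W \<Longrightarrow> mink (tangential_gradient g Y) (tangential_gradient g Y) > 0"
begin

abbreviation "G \<equiv> tangential_gradient g"

definition "N Y = (1 / sqrt (mink (G Y) (G Y))) *\<^sub>R G Y"

lemma cont_g: "continuous_on W g"
  by (intro continuous_at_imp_continuous_on ballI) (rule has_derivative_continuous[OF derg])

lemma cont_rho: "continuous_on W \<rho>"
  by (intro continuous_at_imp_continuous_on ballI) (rule has_derivative_continuous[OF der])

lemma curve:
  assumes X: "X \<in> hyp_space" "X \<in> W" and w: "w \<in> hyp_tangent X"
  shows "((\<lambda>t. \<rho> (hyp_graph (fst X + t *\<^sub>R fst w))) has_real_derivative g X \<bullet> w) (at 0)"
    "open V \<Longrightarrow> X \<in> V \<Longrightarrow> \<forall>\<^sub>F t in at_right 0. hyp_graph (fst X + t *\<^sub>R fst w) \<in> V"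
proof -
  let ?c = "\<lambda>t. hyp_graph (fst X + t *\<^sub>R fst w)"
  have c0: "?c 0 = X" using X by (simp add: hyp_graph_fst)
  have "((\<lambda>t. fst X + t *\<^sub>R fst w) has_derivative (\<lambda>t. t *\<^sub>R fst w)) (at 0)"
    by (auto intro!: derivative_eq_intros)
  from has_derivative_compose[OF this has_derivative_hyp_graph]
  have dc: "(?c has_derivative (\<lambda>t. hyp_graph_deriv (fst X + 0 *\<^sub>R fst w) (t *\<^sub>R fst w))) (at 0)" .
  have "(\<rho> has_derivative (\<lambda>w. g X \<bullet> w)) (at (?c 0))" using der[OF X(2)] c0 by simp
  from has_derivative_compose[OF dc this]
  have "((\<lambda>t. \<rho> (?c t)) has_derivative (\<lambda>t. g X \<bullet> hyp_graph_deriv (fst X) (t *\<^sub>R fst w))) (at 0)" by simp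
  moreover have "hyp_graph_deriv (fst X) (t *\<^sub>R fst w) = t *\<^sub>R w" for t
    using hyp_graph_deriv_tangent[OF X(1) subspace_scale[OF subspace_hyp_tangent w, of t]] by simp
  ultimately show "((\<lambda>t. \<rho> (?c t)) has_real_derivative g X \<bullet> w) (at 0)"
    by (simp add: has_field_derivative_def mult_commute_abs)
  assume V: "open V" "X \<in> V"
  have "continuous_on UNIV ?c"
    by (intro continuous_on_compose2[OF continuous_on_hyp_graph[of UNIV]] continuous_intros) auto
  then have "open (?c -` V)" using V by (intro open_vimage)
  moreover have "0 \<in> ?c -` V" using V c0 by simp
  ultimately have "\<forall>\<^sub>F t in at 0. t \<in> ?c -` V" by (intro eventually_at_in_open')
  then show "\<forall>\<^sub>F t in at_right 0. ?c t \<in> V"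
    by (simp add: eventually_at_split)
qed

lemma curve_in:
  assumes X: "X \<in> hyp_space" "X \<in> W" "\<rho> X = 0" and w: "w \<in> hyp_tangent X" "g X \<bullet> w < 0"
  shows "\<forall>\<^sub>F t in at_right 0. hyp_graph (fst X + t *\<^sub>R fst w) \<in> K"
proof -
  let ?c = "\<lambda>t. hyp_graph (fst X + t *\<^sub>R fst w)"
  obtain d where d: "d > 0" "\<And>h. 0 < h \<Longrightarrow> h < d \<Longrightarrow> \<rho> (?c (0 + h)) < \<rho> (?c 0)"
    using DERIV_neg_dec_right[OF curve(1)[OF X(1,2) w(1)] w(2)] by blast
  have "\<forall>\<^sub>F t in at_right 0. t < d" "\<forall>\<^sub>F t in at_right (0::real). 0 < t"
    using d(1) by (auto simp: eventually_at_right_less eventually_at_right)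
  then show ?thesis using curve(2)[OF X(1,2) w(1) W X(2)]
  proof eventually_elim
    case (elim t)
    then have "\<rho> (?c t) < 0" using d(2)[of t] X by (simp add: hyp_graph_fst)
    then have "?c t \<in> {Y \<in> hyp_space \<inter> W. \<rho> Y \<le> 0}" using elim hyp_graph_in by simp
    then show ?case unfolding KW[symmetric] by simp
  qed
qed

lemma curve_out:
  assumes X: "X \<in> hyp_space" "X \<in> W" "\<rho> X = 0" and w: "w \<in> hyp_tangent X" "g X \<bullet> w > 0"
  shows "\<forall>\<^sub>F t in at_right 0. hyp_graph (fst X + t *\<^sub>R fst w) \<notin> K"
proof -
  let ?c = "\<lambda>t. hyp_graph (fst X + t *\<^sub>R fst w)"
  obtain d where d: "d > 0" "\<And>h. 0 < h \<Longrightarrow> h < d \<Longrightarrow> \<rho> (?c 0) < \<rho> (?c (0 + h))"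
    using DERIV_pos_inc_right[OF curve(1)[OF X(1,2) w(1)] w(2)] by blast
  have "\<forall>\<^sub>F t in at_right 0. t < d" "\<forall>\<^sub>F t in at_right (0::real). 0 < t"
    using d(1) by (auto simp: eventually_at_right_less eventually_at_right)
  then show ?thesis using curve(2)[OF X(1,2) w(1) W X(2)]
  proof eventually_elim
    case (elim t)
    then have "\<rho> (?c t) > 0" using d(2)[of t] X by (simp add: hyp_graph_fst)
    then have "?c t \<notin> {Y \<in> hyp_space \<inter> W. \<rho> Y \<le> 0}" by simp
    then show ?case unfolding KW[symmetric] using elim by simp
  qed
qed

text \<open>Where \<rho> is negative a whole neighbourhood in the hyperboloid belongs to
  \<open>K\<close>; where it vanishes, moving along the tangential gradient leaves \<open>K\<close>
  at once.\<close>

lemma boundary_iff: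
  assumes "Y \<in> W"
  shows "Y \<in> hyp_boundary K \<longleftrightarrow> Y \<in> hyp_space \<and> \<rho> Y = 0"
proof
  assume Y: "Y \<in> hyp_boundary K"
  note Yb = Y[unfolded hyp_boundary_iff[OF K]]
  have "Y \<in> K \<inter> W" using Yb assms by simp
  then have le: "Y \<in> hyp_space" "\<rho> Y \<le> 0" unfolding KW by simp_all
  have "\<not> \<rho> Y < 0"
  proof
    assume "\<rho> Y < 0"
    have "open (\<rho> -` {..<0} \<inter> W)" using cont_rho by (simp add: continuous_on_open_vimage[OF W])
    moreover have "\<rho> -` {..<0} \<inter> W \<inter> hyp_space \<subseteq> K"
    proof
      fix Z assume "Z \<in> \<rho> -` {..<0} \<inter> W \<inter> hyp_space"
      then have "Z \<in> K \<inter> W" unfolding KW by simp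
      then show "Z \<in> K" by simp
    qed
    ultimately show False using Yb assms \<open>\<rho> Y < 0\<close> by simp
  qed
  then show "Y \<in> hyp_space \<and> \<rho> Y = 0" using le by auto
next
  assume Y: "Y \<in> hyp_space \<and> \<rho> Y = 0"
  have GT: "G Y \<in> hyp_tangent Y" using Y by (intro tangential_gradient_tangent) simp
  have "g Y \<bullet> G Y > 0" using nondeg[OF assms] mink_tangential_gradient[OF GT] by metis
  then have out: "\<forall>\<^sub>F t in at_right 0. hyp_graph (fst Y + t *\<^sub>R fst (G Y)) \<notin> K"
    by (intro curve_out assms GT conjunct1[OF Y] conjunct2[OF Y])
  have "\<not> V \<inter> hyp_space \<subseteq> K" if V: "open V" "Y \<in> V" for V
  proof
    assume sub: "V \<inter> hyp_space \<subseteq> K"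
    have "\<forall>\<^sub>F t in at_right 0. hyp_graph (fst Y + t *\<^sub>R fst (G Y)) \<in> V"
      by (intro curve(2) assms GT V conjunct1[OF Y])
    with out have "\<forall>\<^sub>F t in at_right (0::real). False"
    proof eventually_elim
      case (elim t)
      then show ?case using subsetD[OF sub IntI[OF _ hyp_graph_in]] by simp
    qed
    then show False by simp
  qed
  moreover have "Y \<in> K \<inter> W" unfolding KW using Y assms by simp
  ultimately show "Y \<in> hyp_boundary K" unfolding hyp_boundary_iff[OF K] by simp
qed

lemma N_props:
  assumes "Y \<in> W" "Y \<in> hyp_space"
  shows "N Y \<in> hyp_tangent Y" "mink (N Y) (N Y) = 1"
    "w \<in> hyp_tangent Y \<Longrightarrow> sqrt (mink (G Y) (G Y)) * mink (N Y) w = g Y \<bullet> w" "g Y \<bullet> N Y > 0"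
proof -
  have p: "mink (G Y) (G Y) > 0" using nondeg assms by blast
  show 1: "N Y \<in> hyp_tangent Y" unfolding N_def
    by (intro subspace_scale subspace_hyp_tangent tangential_gradient_tangent assms)
  show 2: "mink (N Y) (N Y) = 1" unfolding N_def using p by (simp add: mink_simps)
  show 3: "sqrt (mink (G Y) (G Y)) * mink (N Y) w = g Y \<bullet> w" if "w \<in> hyp_tangent Y" for w
    using p mink_tangential_gradient[OF that] unfolding N_def by (simp add: mink_simps)
  have "sqrt (mink (G Y) (G Y)) > 0" using p by simp
  then show "g Y \<bullet> N Y > 0" using 3[OF 1] unfolding 2 by linarith
qed

lemma N_is_normal:
  assumes "Y \<in> W" "Y \<in> hyp_boundary K"
  shows "is_normal K Y (N Y)"
proof -
  have Y: "Y \<in> hyp_space" "\<rho> Y = 0" using boundary_iff[OF assms(1)] assms(2) by simp_all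
  have p: "sqrt (mink (G Y) (G Y)) > 0" using nondeg assms by simp
  have sg: "(mink (N Y) w < 0 \<longrightarrow> g Y \<bullet> w < 0) \<and> (mink (N Y) w > 0 \<longrightarrow> g Y \<bullet> w > 0)" if "w \<in> hyp_tangent Y" for w
    using N_props(3)[OF assms(1) Y(1) that] p by (metis mult_pos_neg mult_pos_pos)
  show ?thesis unfolding is_normal_def
    using N_props(1,2)[OF assms(1) Y(1)] sg curve_in[OF Y(1) assms(1) Y(2)] curve_out[OF Y(1) assms(1) Y(2)] by blast
qed

lemma N_unique:
  assumes "Y \<in> W" "Y \<in> hyp_space" and v: "v \<in> hyp_tangent Y" "mink v v = 1"
    "\<And>w. w \<in> hyp_tangent Y \<Longrightarrow> g Y \<bullet> w = 0 \<Longrightarrow> mink w v = 0" "g Y \<bullet> v > 0"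
  shows "v = N Y"
proof -
  \<comment> \<open>The part of \<open>v\<close> orthogonal to \<open>N Y\<close> lies in the kernel
    of the differential, so it is orthogonal to \<open>v\<close> as well. It thus has square 0 and
    vanishes, the tangent space being definite.\<close>
  let ?w = "v - mink (N Y) v *\<^sub>R N Y"
  note n = N_props[OF assms(1,2)]
  have wT: "?w \<in> hyp_tangent Y" using v(1) n(1) by (intro subspace_diff subspace_scale subspace_hyp_tangent)
  have 0: "mink (N Y) ?w = 0" using n(2) by (simp add: mink_simps)
  then have "g Y \<bullet> ?w = 0" using n(3)[OF wT] by simp
  then have "mink ?w v = 0" using v(3) wT by blast
  then have "mink ?w ?w = 0" using 0 by (simp add: mink_diff_right mink_scaleR_right mink_commute[of ?w "N Y"])
  then have "?w = 0" using hyp_tangent_pos[OF assms(2) wT] by auto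
  then have vN: "v = mink (N Y) v *\<^sub>R N Y" by simp
  then have "mink v v = (mink (N Y) v)\<^sup>2" using n(2) by (metis mink_scaleR_left power2_eq_square)
  then have "mink (N Y) v = 1 \<or> mink (N Y) v = -1" using v(2) by (metis power2_eq_1_iff)
  moreover have "sqrt (mink (G Y) (G Y)) * mink (N Y) v > 0" using n(3)[OF v(1)] v(4) by simp
  then have "mink (N Y) v > 0" using nondeg[OF assms(1)] by (simp add: zero_less_mult_iff)
  ultimately have "mink (N Y) v = 1" by auto
  then show ?thesis using vN by simp
qed

end

text \<open>By continuity, the tangential gradient stays spacelike on a smaller
  neighbourhood.\<close>

lemma boundary_piece_exists:
  assumes K: "K \<subseteq> hyp_space" "compact K" and l: "local_defining_function K X W \<rho>" and X: "X \<in> hyp_space"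
  shows "\<exists>V g H. X \<in> V \<and> V \<subseteq> W \<and> boundary_piece K V \<rho> g H"
proof -
  have W: "open W" "X \<in> W" "smooth_on \<rho> W" "K \<inter> W = {Y \<in> hyp_space \<inter> W. \<rho> Y \<le> 0}"
    "\<exists>w\<in>hyp_tangent X. frechet_derivative \<rho> (at X) w \<noteq> 0"
    using l by (auto simp: local_defining_function_def)
  obtain g H where gH0: "\<forall>Y\<in>W. (\<rho> has_derivative (\<lambda>w. g Y \<bullet> w)) (at Y)"
    "\<forall>Y\<in>W. (g has_derivative H Y) (at Y)" "\<forall>w. continuous_on W (\<lambda>Y. H Y w)"
    using smooth_on_second_order[OF W(3)] by (elim exE conjE) (rule that)
  note gH = gH0(1)[rule_format] gH0(2)[rule_format] gH0(3)[rule_format]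
  let ?q = "\<lambda>Y. mink (tangential_gradient g Y) (tangential_gradient g Y)"
  have cg: "continuous_on W g"
    by (intro continuous_at_imp_continuous_on ballI) (rule has_derivative_continuous[OF gH(2)])
  have cG: "continuous_on W (tangential_gradient g)"
    unfolding tangential_gradient_def
    by (intro continuous_intros cg bounded_linear.continuous_on[OF bounded_linear_mink_flip])
  define V where "V = W \<inter> ?q -` {0<..}"
  have "continuous_on W ?q" by (intro continuous_intros cG)
  then have "open V" unfolding V_def by (simp add: continuous_on_open_vimage[OF W(1)] Int_commute[of W])
  have "X \<in> V"
  proof -
    obtain w where w: "w \<in> hyp_tangent X" "g X \<bullet> w \<noteq> 0"
      using W(5) frechet_derivative_at[OF gH(1)[OF W(2)]] by metis
    then have "tangential_gradient g X \<noteq> 0"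
      using mink_tangential_gradient[OF w(1), of g] by (auto simp: mink_zero)
    then show ?thesis unfolding V_def
      using W(2) hyp_tangent_pos[OF X tangential_gradient_tangent[OF X]] by simp
  qed
  moreover have "boundary_piece K V \<rho> g H"
  proof
    show "K \<inter> V = {Y \<in> hyp_space \<inter> V. \<rho> Y \<le> 0}" using W(4) unfolding V_def by blast
    show "continuous_on V (\<lambda>Y. H Y w)" for w
      by (rule continuous_on_subset[OF gH(3)]) (simp add: V_def)
    fix Y assume "Y \<in> V"
    then have Y: "Y \<in> W" "?q Y > 0" unfolding V_def by simp_all
    show "(\<rho> has_derivative (\<lambda>w. g Y \<bullet> w)) (at Y)" by (rule gH(1)[OF Y(1)])
    show "(g has_derivative H Y) (at Y)" by (rule gH(2)[OF Y(1)])
    show "?q Y > 0" by (rule Y(2))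
  qed (rule K \<open>open V\<close>)+
  moreover have "V \<subseteq> W" unfolding V_def by simp
  ultimately show ?thesis by (intro exI conjI)
qed

lemma outward_normal_is_normal:
  assumes K: "smooth_bounded_domain K" and X: "X \<in> hyp_boundary K"
  shows "is_normal K X (outward_normal K X)"
proof -
  have K1: "K \<subseteq> hyp_space" "compact K" using K by (auto simp: smooth_bounded_domain_def)
  have XH: "X \<in> hyp_space" using X K1 hyp_boundary_iff[OF K1] by blast
  obtain W \<rho> where l: "local_defining_function K X W \<rho>"
    using K X unfolding smooth_bounded_domain_def by blast
  define P where "P = (\<lambda>v W \<rho>. local_defining_function K X W \<rho> \<and>
     v \<in> hyp_tangent X \<and> mink v v = 1 \<and>
     (\<forall>w\<in>hyp_tangent X. frechet_derivative \<rho> (at X) w = 0 \<longrightarrow> mink w v = 0) \<and>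
     frechet_derivative \<rho> (at X) v > 0)"
  have nrm: "is_normal K X v" if P: "P v W \<rho>" for v W \<rho>
  proof -
    have l: "local_defining_function K X W \<rho>" using P by (simp add: P_def)
    obtain V g H where V: "X \<in> V" "V \<subseteq> W" "boundary_piece K V \<rho> g H"
      using boundary_piece_exists[OF K1 l XH] by (elim exE conjE) (rule that)
    interpret boundary_piece K V \<rho> g H by fact
    have "frechet_derivative \<rho> (at X) = (\<lambda>w. g X \<bullet> w)"
      using frechet_derivative_at[OF der[OF V(1)]] by simp
    then have "v = N X" using P unfolding P_def by (intro N_unique V(1) XH) simp_all
    then show ?thesis using N_is_normal[OF V(1) X] by simp
  qed
  have "\<exists>!v. \<exists>W \<rho>. P v W \<rho>"
  proof (rule ex_ex1I)
    obtain V g H where V: "X \<in> V" "V \<subseteq> W" "boundary_piece K V \<rho> g H"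
      using boundary_piece_exists[OF K1 l XH] by (elim exE conjE) (rule that)
    interpret boundary_piece K V \<rho> g H by fact
    have fd: "frechet_derivative \<rho> (at X) = (\<lambda>w. g X \<bullet> w)"
      using frechet_derivative_at[OF der[OF V(1)]] by simp
    have "mink w (N X) = 0" if "w \<in> hyp_tangent X" "g X \<bullet> w = 0" for w
      using N_props(3)[OF V(1) XH that(1)] that(2) nondeg[OF V(1)] by (simp add: mink_commute)
    then have "P (N X) W \<rho>"
      unfolding P_def fd using l N_props(1,2,4)[OF V(1) XH] by simp
    then show "\<exists>v W \<rho>. P v W \<rho>" by blast
    show "u = v" if "\<exists>W \<rho>. P u W \<rho>" "\<exists>W \<rho>. P v W \<rho>" for u v
      using that nrm is_normal_unique'[OF XH] by blast
  qed
  then have "\<exists>W \<rho>. P (THE v. \<exists>W \<rho>. P v W \<rho>) W \<rho>" by (rule theI')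
  moreover have "outward_normal K X = (THE v. \<exists>W \<rho>. P v W \<rho>)" unfolding outward_normal_def P_def ..
  ultimately show ?thesis using nrm by metis
qed

lemma (in boundary_piece) outward_normal_eq:
  assumes "smooth_bounded_domain K" "Y \<in> W" "Y \<in> hyp_boundary K"
  shows "outward_normal K Y = N Y"
  using is_normal_unique'[OF _ outward_normal_is_normal[OF assms(1,3)] N_is_normal[OF assms(2,3)]]
    boundary_iff assms(2,3) by blast

section \<open>Local parametrizations of the boundary\<close>

text \<open>
  The Householder reflection interchanging \<open>(0, 1)\<close> and the unit vector \<open>z\<close>; it is the identity for
  \<open>z = (0, 1)\<close>, where the quotient is \<open>0 / 0 = 0\<close>.
\<close>
definition swap_to :: "'n::finite espace \<Rightarrow> 'n espace \<Rightarrow> 'n espace" where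
  "swap_to z v = v - (2 * (v \<bullet> ((0, 1) - z)) / (((0, 1) - z) \<bullet> ((0, 1) - z))) *\<^sub>R ((0, 1) - z)"

lemma linear_swap_to: "linear (swap_to z)"
proof (rule linearI)
  fix a b :: "'a espace" and r
  show "swap_to z (a + b) = swap_to z a + swap_to z b"
    unfolding swap_to_def by (simp only: inner_add_left distrib_left add_divide_distrib scaleR_add_left) simp
  have "2 * (r *\<^sub>R a \<bullet> u) / q = r * (2 * (a \<bullet> u) / q)" for u q by simp
  then show "swap_to z (r *\<^sub>R a) = r *\<^sub>R swap_to z a"
    unfolding swap_to_def by (simp only: scaleR_diff_right scaleR_scaleR)
qed

lemma bounded_linear_swap_to: "bounded_linear (swap_to z)"
  using linear_swap_to linear_conv_bounded_linear by blast

lemma swap_to_inner: "swap_to z v \<bullet> swap_to z w = v \<bullet> w"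
proof -
  define u :: "'a espace" where "u = (0, 1) - z"
  have e: "swap_to z v = v - (2 * (v \<bullet> u) / (u \<bullet> u)) *\<^sub>R u" for v unfolding swap_to_def u_def ..
  show ?thesis
  proof (cases "u = 0")
    case True then show ?thesis unfolding e by simp
  next
    case False
    then have q: "u \<bullet> u \<noteq> 0" by simp
    have "swap_to z v \<bullet> swap_to z w = v \<bullet> w - (2 * (w \<bullet> u) / (u \<bullet> u)) * (v \<bullet> u)
        - (2 * (v \<bullet> u) / (u \<bullet> u)) * (u \<bullet> w) + (2 * (v \<bullet> u) / (u \<bullet> u)) * (2 * (w \<bullet> u) / (u \<bullet> u)) * (u \<bullet> u)"
      unfolding e inner_diff_left inner_diff_right inner_scaleR_left inner_scaleR_right by (simp only: algebra_simps)
    moreover have "- (2 * b / r) * a - (2 * a / r) * b + (2 * a / r) * (2 * b / r) * r = 0"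
      if "r \<noteq> 0" for a b r :: real using that by (simp add: field_simps)
    from this[OF q, of "w \<bullet> u" "v \<bullet> u"] have "- (2 * (w \<bullet> u) / (u \<bullet> u)) * (v \<bullet> u)
        - (2 * (v \<bullet> u) / (u \<bullet> u)) * (u \<bullet> w) + (2 * (v \<bullet> u) / (u \<bullet> u)) * (2 * (w \<bullet> u) / (u \<bullet> u)) * (u \<bullet> u) = 0"
      by (simp only: inner_commute[of u w])
    ultimately show ?thesis by linarith
  qed
qed

lemma swap_to_swap_to [simp]: "swap_to z (swap_to z v) = v"
proof -
  define u :: "'a espace" where "u = (0, 1) - z"
  have e: "swap_to z v = v - (2 * (v \<bullet> u) / (u \<bullet> u)) *\<^sub>R u" for v unfolding swap_to_def u_def ..
  show ?thesis
  proof (cases "u = 0")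
    case True then show ?thesis unfolding e by simp
  next
    case False
    then have "swap_to z v \<bullet> u = - (v \<bullet> u)" unfolding e by (simp add: inner_diff_left)
    then show ?thesis unfolding e[of "swap_to z v"] by (simp add: e)
  qed
qed

lemma swap_to_inner_commute: "swap_to z v \<bullet> w = v \<bullet> swap_to z w"
  by (metis swap_to_inner swap_to_swap_to)

lemma swap_to_unit:
  assumes "norm z = 1"
  shows "swap_to z (0, 1) = z" "swap_to z z = (0, 1)"
proof -
  define u :: "'a espace" where "u = (0, 1) - z"
  have e: "swap_to z v = v - (2 * (v \<bullet> u) / (u \<bullet> u)) *\<^sub>R u" for v unfolding swap_to_def u_def ..
  have zz: "z \<bullet> z = 1" using assms by (simp add: norm_eq_1)
  have 1: "2 * ((0, 1) \<bullet> u) = u \<bullet> u" unfolding u_def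
    using zz by (simp add: inner_diff_left inner_diff_right inner_commute inner_Pair)
  show a: "swap_to z (0, 1) = z"
  proof (cases "u = 0")
    case True then show ?thesis unfolding e by (simp add: u_def)
  next
    case False
    then show ?thesis unfolding e 1 by (simp add: u_def)
  qed
  show "swap_to z z = (0, 1)" by (metis a swap_to_swap_to)
qed

lemma snd_swap_to:
  assumes "norm z = 1"
  shows "snd (swap_to z v) = z \<bullet> v"
proof -
  have "snd (swap_to z v) = (0, 1) \<bullet> swap_to z v" by (simp add: inner_prod_def)
  also have "\<dots> = z \<bullet> v" using swap_to_unit[OF assms] swap_to_inner_commute[of z "(0, 1)" v] by simp
  finally show ?thesis .
qed

lemma has_derivative_zero_if_constant:
  assumes "open T" "x \<in> T" "(f has_derivative f') (at x)" "\<And>y. y \<in> T \<Longrightarrow> f y = c"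
  shows "f' = (\<lambda>_. 0)"
proof -
  have "((\<lambda>_. c) has_derivative f') (at x)"
    using has_derivative_transform_within_open[OF assms(3,1,2)] assms(4) by auto
  then show ?thesis using has_derivative_unique[OF _ has_derivative_const] by blast
qed

lemma sqrt_one_plus_inner_neq_0: "sqrt (1 + x \<bullet> x) \<noteq> (0::real)" for x :: "'a::real_inner"
  using one_plus_inner_pos[of x] by simp

context boundary_piece
begin

definition "graph_gradient x = fst (g (hyp_graph x)) + (snd (g (hyp_graph x)) / sqrt (1 + x \<bullet> x)) *\<^sub>R x"

lemma graph_gradient: "graph_gradient x \<bullet> v = g (hyp_graph x) \<bullet> hyp_graph_deriv x v"
  unfolding graph_gradient_def hyp_graph_deriv_def inner_prod_def[of "g (hyp_graph x)"]
  by (simp add: inner_add_left)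

text \<open>The implicit function theorem in graph coordinates: take \<rho> as last coordinate, the
  directions orthogonal to its gradient at the base point as the first n, and invert.\<close>

lemma chart_exists:
  assumes XW: "X \<in> W" and Xb: "X \<in> hyp_boundary K"
  shows "\<exists>U F. regular_param (hyp_boundary K) U F \<and> X \<in> F ` U"
proof -
  have X: "X \<in> hyp_space" "\<rho> X = 0" using boundary_iff[OF XW] Xb by simp_all
  define \<Omega> where "\<Omega> = hyp_graph -` W"
  have o\<Omega>: "open \<Omega>" unfolding \<Omega>_def by (intro open_vimage W continuous_on_hyp_graph)
  have cgg: "continuous_on \<Omega> (\<lambda>x. g (hyp_graph x))"
    by (rule continuous_on_compose2[OF cont_g continuous_on_hyp_graph]) (auto simp: \<Omega>_def)
  have cgr: "continuous_on \<Omega> graph_gradient"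
    unfolding graph_gradient_def
    by (intro continuous_intros cgg ballI sqrt_one_plus_inner_neq_0)
  let ?x0 = "fst X"
  have x0: "hyp_graph ?x0 = X" "?x0 \<in> \<Omega>" using X XW by (simp_all add: hyp_graph_fst \<Omega>_def)
  \<comment> \<open>The reflection \<open>swap_to e\<close> turns the gradient direction at the base
    point into the last axis, so dropping the last coordinate projects along the gradient.\<close>
  define e where "e = (1 / norm (graph_gradient ?x0)) *\<^sub>R graph_gradient ?x0"
  have gr0: "graph_gradient ?x0 \<noteq> 0"
  proof
    assume 0: "graph_gradient ?x0 = 0"
    have GT: "G X \<in> hyp_tangent X" by (rule tangential_gradient_tangent[OF X(1)])
    have "graph_gradient ?x0 \<bullet> fst (G X) = g X \<bullet> G X"
      unfolding graph_gradient x0 by (simp add: hyp_graph_deriv_tangent[OF X(1) GT])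
    also have "\<dots> = mink (G X) (G X)" using mink_tangential_gradient[OF GT] by simp
    finally show False using 0 nondeg[OF XW] by simp
  qed
  have ne: "norm e = 1" "graph_gradient ?x0 \<bullet> e > 0"
    using gr0 by (simp_all add: e_def dot_square_norm power2_eq_square)
  let ?R = "swap_to e"
  define \<Omega>1 where "\<Omega>1 = (\<lambda>x. graph_gradient x \<bullet> e) -` {0<..} \<inter> \<Omega>"
  have o1: "open \<Omega>1"
  proof -
    have "continuous_on \<Omega> (\<lambda>x. graph_gradient x \<bullet> e)" by (intro continuous_intros cgr)
    then show ?thesis unfolding \<Omega>1_def by (simp add: continuous_on_open_vimage[OF o\<Omega>])
  qed
  have x01: "?x0 \<in> \<Omega>1" using x0 ne by (simp add: \<Omega>1_def)
  define \<Theta> where "\<Theta> = (\<lambda>x. (fst (?R x), \<rho> (hyp_graph x)))"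
  define \<Theta>' where "\<Theta>' = (\<lambda>x. Blinfun (\<lambda>v. (fst (?R v), graph_gradient x \<bullet> v)))"
  have bl: "bounded_linear (\<lambda>v. (fst (?R v), graph_gradient x \<bullet> v))" for x
    by (intro bounded_linear_Pair bounded_linear_inner_right
        bounded_linear_compose[OF bounded_linear_fst bounded_linear_swap_to])
  have \<Theta>'a: "blinfun_apply (\<Theta>' x) v = (fst (?R v), graph_gradient x \<bullet> v)" for x v
    unfolding \<Theta>'_def by (simp add: bounded_linear_Blinfun_apply[OF bl])
  have der\<Theta>: "(\<Theta> has_derivative blinfun_apply (\<Theta>' x)) (at x)" if "x \<in> \<Omega>1" for x
  proof -
    have hW: "hyp_graph x \<in> W" using that by (simp add: \<Omega>1_def \<Omega>_def)
    have "((\<lambda>x. \<rho> (hyp_graph x)) has_derivative (\<lambda>v. g (hyp_graph x) \<bullet> hyp_graph_deriv x v)) (at x)"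
      by (rule has_derivative_compose[OF has_derivative_hyp_graph der[OF hW]])
    then have 1: "((\<lambda>x. \<rho> (hyp_graph x)) has_derivative (\<lambda>v. graph_gradient x \<bullet> v)) (at x)"
      by (simp add: graph_gradient)
    have 2: "((\<lambda>x. fst (?R x)) has_derivative (\<lambda>v. fst (?R v))) (at x)"
      by (intro bounded_linear_imp_has_derivative bounded_linear_compose[OF bounded_linear_fst bounded_linear_swap_to])
    show ?thesis unfolding \<Theta>_def \<Theta>'a by (rule has_derivative_Pair[OF 2 1])
  qed
  have cont\<Theta>': "continuous_on \<Omega>1 \<Theta>'"
  proof (rule continuous_on_blinfun_componentwise)
    fix i :: "'n espace" assume "i \<in> Basis"
    show "continuous_on \<Omega>1 (\<lambda>x. blinfun_apply (\<Theta>' x) i)"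
      unfolding \<Theta>'a by (intro continuous_intros continuous_on_subset[OF cgr]) (simp add: \<Omega>1_def)
  qed
  \<comment> \<open>The explicit inverse of the differential: the component along \<open>e\<close>
    is fixed by the prescribed value of the gradient. The closed formula shows continuous dependence
    on the point, from which \<open>F\<close> is seen to be of class C^1.\<close>
  define inv\<Theta> where "inv\<Theta> = (\<lambda>x p. ?R (fst p, (snd p - graph_gradient x \<bullet> ?R (fst p, 0)) / (graph_gradient x \<bullet> e)))"
  have Rsplit: "?R (a, t) = ?R (a, 0) + t *\<^sub>R e" for a t
  proof -
    have "?R (a, t) = ?R ((a, 0) + t *\<^sub>R (0, 1))" by simp
    also have "\<dots> = ?R (a, 0) + t *\<^sub>R ?R (0, 1)"
      by (simp only: linear_add[OF linear_swap_to] linear_scale[OF linear_swap_to])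
    finally show ?thesis using swap_to_unit[OF ne(1)] by simp
  qed
  have left: "inv\<Theta> x (blinfun_apply (\<Theta>' x) v) = v" if "x \<in> \<Omega>1" for x v
  proof -
    have p: "graph_gradient x \<bullet> e > 0" using that by (simp add: \<Omega>1_def)
    have "v = ?R (fst (?R v), snd (?R v))" by simp
    also have "\<dots> = ?R (fst (?R v), 0) + snd (?R v) *\<^sub>R e" by (rule Rsplit)
    finally have "graph_gradient x \<bullet> v = graph_gradient x \<bullet> ?R (fst (?R v), 0) + snd (?R v) * (graph_gradient x \<bullet> e)"
      by (metis inner_add_right inner_scaleR_right)
    then show ?thesis unfolding inv\<Theta>_def \<Theta>'a using p by simp
  qed
  have right: "blinfun_apply (\<Theta>' x) (inv\<Theta> x p) = p" if "x \<in> \<Omega>1" for x p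
  proof -
    have p: "graph_gradient x \<bullet> e > 0" using that by (simp add: \<Omega>1_def)
    have "graph_gradient x \<bullet> inv\<Theta> x p = snd p"
      unfolding inv\<Theta>_def Rsplit[of "fst p" "_ / _"] using p by (simp add: inner_add_right)
    moreover have "fst (?R (inv\<Theta> x p)) = fst p" unfolding inv\<Theta>_def by simp
    ultimately show ?thesis unfolding \<Theta>'a by simp
  qed
  have bli: "bounded_linear (inv\<Theta> x)" if x: "x \<in> \<Omega>1" for x
  proof -
    have li: "linear (inv\<Theta> x)"
    proof (rule linearI)
      have lb: "linear (blinfun_apply (\<Theta>' x))" by (rule bounded_linear.linear[OF blinfun.bounded_linear_right])
      fix p q :: "'n espace" and r
      show "inv\<Theta> x (p + q) = inv\<Theta> x p + inv\<Theta> x q"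
        using left[OF x, of "inv\<Theta> x p + inv\<Theta> x q"] right[OF x] by (simp add: linear_add[OF lb])
      show "inv\<Theta> x (r *\<^sub>R p) = r *\<^sub>R inv\<Theta> x p"
        using left[OF x, of "r *\<^sub>R inv\<Theta> x p"] right[OF x] by (simp add: linear_scale[OF lb])
    qed
    then show ?thesis by (simp add: linear_conv_bounded_linear)
  qed
  have invc: "Blinfun (inv\<Theta> ?x0) o\<^sub>L \<Theta>' ?x0 = id_blinfun"
    by (rule blinfun_eqI) (simp add: bounded_linear_Blinfun_apply[OF bli[OF x01]] left[OF x01])
  have "\<exists>U' V \<gamma> \<gamma>'. open U' \<and> U' \<subseteq> \<Omega>1 \<and> ?x0 \<in> U' \<and> open V \<and> \<Theta> ?x0 \<in> V \<and> homeomorphism U' V \<Theta> \<gamma> \<and>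
      (\<forall>y\<in>V. (\<gamma> has_derivative \<gamma>' y) (at y)) \<and> (\<forall>y\<in>V. \<gamma>' y = inv (blinfun_apply (\<Theta>' (\<gamma> y))))"
  proof (rule inverse_function_theorem[OF o1 _ cont\<Theta>' x01 invc])
    fix U' V \<gamma> \<gamma>' assume a: "open U'" "U' \<subseteq> \<Omega>1" "?x0 \<in> U'" "open V" "\<Theta> ?x0 \<in> V" "homeomorphism U' V \<Theta> \<gamma>"
      "\<And>y. y \<in> V \<Longrightarrow> (\<gamma> has_derivative \<gamma>' y) (at y)" "\<And>y. y \<in> V \<Longrightarrow> \<gamma>' y = inv (blinfun_apply (\<Theta>' (\<gamma> y)))"
    show ?thesis by (rule exI[of _ U'], rule exI[of _ V], rule exI[of _ \<gamma>], rule exI[of _ \<gamma>'])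
        (intro conjI ballI a; assumption)
  qed (rule der\<Theta>)
  then obtain U' V \<gamma> \<gamma>' where U': "open U'" "U' \<subseteq> \<Omega>1" "?x0 \<in> U'" and V: "open V" "\<Theta> ?x0 \<in> V"
    and hom: "homeomorphism U' V \<Theta> \<gamma>" and d\<gamma>0: "\<forall>y\<in>V. (\<gamma> has_derivative \<gamma>' y) (at y)"
    and \<gamma>'0: "\<forall>y\<in>V. \<gamma>' y = inv (blinfun_apply (\<Theta>' (\<gamma> y)))"
    by (elim exE conjE) (rule that)
  note d\<gamma> = d\<gamma>0[rule_format] and \<gamma>' = \<gamma>'0[rule_format]
  have \<gamma>U: "\<gamma> y \<in> U'" "\<Theta> (\<gamma> y) = y" if "y \<in> V" for y
    using hom that by (auto simp: homeomorphism_def)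
  have \<Theta>V: "\<Theta> x \<in> V" "\<gamma> (\<Theta> x) = x" if "x \<in> U'" for x
    using hom that by (auto simp: homeomorphism_def)
  have \<gamma>'eq: "\<gamma>' y = inv\<Theta> (\<gamma> y)" if "y \<in> V" for y
  proof -
    have "\<gamma> y \<in> \<Omega>1" using \<gamma>U(1)[OF that] U'(2) by blast
    then show ?thesis unfolding \<gamma>'[OF that] using left right by (intro inv_equality)
  qed
  define U where "U = (\<lambda>u::real^'n. (u, 0::real)) -` V"
  define F where "F = (\<lambda>u. hyp_graph (\<gamma> (u, 0)))"
  define DF where "DF = (\<lambda>u v. hyp_graph_deriv (\<gamma> (u, 0)) (inv\<Theta> (\<gamma> (u, 0)) (v, 0)))"
  have oU: "open U" unfolding U_def by (intro open_vimage V continuous_intros)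
  have dF: "(F has_derivative DF u) (at u)" if u: "u \<in> U" for u
  proof -
    have uV: "(u, 0) \<in> V" using u by (simp add: U_def)
    have 1: "((\<lambda>u::real^'n. (u, 0::real)) has_derivative (\<lambda>v. (v, 0))) (at u)"
      by (intro has_derivative_Pair has_derivative_ident has_derivative_const)
    have 2: "((\<lambda>u. \<gamma> (u, 0)) has_derivative (\<lambda>v. inv\<Theta> (\<gamma> (u, 0)) (v, 0))) (at u)"
      using has_derivative_compose[OF 1 d\<gamma>[OF uV]] unfolding \<gamma>'eq[OF uV] .
    show ?thesis unfolding F_def DF_def
      by (rule has_derivative_compose[OF 2 has_derivative_hyp_graph])
  qed
  have c\<gamma>: "continuous_on U (\<lambda>u. \<gamma> (u, 0))"
    by (rule continuous_on_compose2[of V \<gamma>]) (use hom in \<open>auto simp: homeomorphism_def U_def intro!: continuous_intros\<close>)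
  have \<gamma>1: "\<gamma> (u, 0) \<in> U'" "\<gamma> (u, 0) \<in> \<Omega>1" "\<gamma> (u, 0) \<in> \<Omega>" if "u \<in> U" for u
    using \<gamma>U(1)[of "(u, 0)"] that U'(2) by (auto simp: U_def \<Omega>1_def)
  have c1: "Ck_on 1 F U"
  proof -
    have "continuous_on U (\<lambda>u. frechet_derivative F (at u) v)" for v
    proof -
      have cg2: "continuous_on U (\<lambda>u. graph_gradient (\<gamma> (u, 0)))"
        by (rule continuous_on_compose2[OF cgr c\<gamma>]) (use \<gamma>1 in auto)
      have "graph_gradient (\<gamma> (u, 0)) \<bullet> e \<noteq> 0" if "u \<in> U" for u
        using \<gamma>1(2)[OF that] by (auto simp: \<Omega>1_def)
      then have ci: "continuous_on U (\<lambda>u. inv\<Theta> (\<gamma> (u, 0)) (v, 0))"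
        unfolding inv\<Theta>_def
        by (intro bounded_linear.continuous_on[OF bounded_linear_swap_to] continuous_intros cg2) auto
      have "continuous_on U (\<lambda>u. DF u v)"
        unfolding DF_def hyp_graph_deriv_def
        by (intro continuous_intros c\<gamma> ci ballI sqrt_one_plus_inner_neq_0)
      moreover have "DF u v = frechet_derivative F (at u) v" if "u \<in> U" for u
        using frechet_derivative_at[OF dF[OF that]] by simp
      ultimately show ?thesis by (simp cong: continuous_on_cong)
    qed
    moreover have "F differentiable (at u)" if "u \<in> U" for u
      using dF[OF that] by (auto simp: differentiable_def)
    ultimately show ?thesis by simp
  qed
  have immersion: "inj (frechet_derivative F (at u))" if u: "u \<in> U" for u
  proof -
    have fd: "frechet_derivative F (at u) = DF u" using frechet_derivative_at[OF dF[OF u]] by simp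
    \<comment> \<open>The first n coordinates of \<Theta> read the parameter back, so the
      differential has a left inverse.\<close>
    have "fst (?R (fst (DF u v))) = v" for v
      unfolding DF_def hyp_graph_deriv_def inv\<Theta>_def by simp
    then show ?thesis unfolding fd by (metis injI)
  qed
  have Fin: "F u \<in> W" "F u \<in> hyp_space" "\<rho> (F u) = 0" if "u \<in> U" for u
  proof -
    show "F u \<in> W" using \<gamma>1(3)[OF that] by (simp add: F_def \<Omega>_def)
    show "F u \<in> hyp_space" by (simp add: F_def hyp_graph_in)
    have "\<Theta> (\<gamma> (u, 0)) = (u, 0)" using \<gamma>U(2) that by (simp add: U_def)
    then show "\<rho> (F u) = 0" by (simp add: \<Theta>_def F_def)
  qed
  have img: "F ` U = hyp_boundary K \<inter> fst -` U'"
  proof (intro set_eqI iffI)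
    fix Y assume "Y \<in> F ` U"
    then obtain u where u: "u \<in> U" "Y = F u" by blast
    then show "Y \<in> hyp_boundary K \<inter> fst -` U'"
      using boundary_iff[OF Fin(1)[OF u(1)]] Fin(2,3)[OF u(1)] \<gamma>1(1)[OF u(1)] by (simp add: F_def)
  next
    fix Y assume Y: "Y \<in> hyp_boundary K \<inter> fst -` U'"
    then have Yb: "Y \<in> hyp_boundary K" by simp
    then have YK: "Y \<in> K" unfolding hyp_boundary_iff[OF K] by simp
    then have YH: "Y \<in> hyp_space" using K by blast
    then have hg: "hyp_graph (fst Y) = Y" by (rule hyp_graph_fst)
    have fU: "fst Y \<in> U'" using Y by simp
    then have "hyp_graph (fst Y) \<in> W" using U'(2) by (auto simp: \<Omega>1_def \<Omega>_def)
    then have "\<rho> Y = 0" using boundary_iff[of Y] Y hg by simp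
    then have t: "\<Theta> (fst Y) = (fst (?R (fst Y)), 0)" by (simp add: \<Theta>_def hg)
    then have "fst (?R (fst Y)) \<in> U" using \<Theta>V(1)[OF fU] by (simp add: U_def)
    moreover have "F (fst (?R (fst Y))) = Y" unfolding F_def t[symmetric] \<Theta>V(2)[OF fU] hg ..
    ultimately show "Y \<in> F ` U" by (metis imageI)
  qed
  have "openin (top_of_set (hyp_boundary K)) (F ` U)"
    unfolding img by (intro openin_open_Int open_vimage U'(1) continuous_on_fst continuous_on_id)
  moreover have "homeomorphism U (F ` U) F (\<lambda>Y. fst (?R (fst Y)))"
    unfolding homeomorphism_def
  proof (intro conjI ballI)
    have inv: "fst (?R (fst (F u))) = u" if "u \<in> U" for u
    proof -
      have "\<Theta> (\<gamma> (u, 0)) = (u, 0)" using \<gamma>U(2) that by (simp add: U_def)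
      then show ?thesis by (simp add: \<Theta>_def F_def)
    qed
    show "fst (?R (fst (F u))) = u" if "u \<in> U" for u by (rule inv[OF that])
    show "F (fst (?R (fst Y))) = Y" if Y: "Y \<in> F ` U" for Y using Y inv by auto
    show "(\<lambda>Y. fst (?R (fst Y))) ` F ` U = U" by (simp add: image_image inv)
    show "continuous_on U F" unfolding F_def
      by (rule continuous_on_compose2[OF continuous_on_hyp_graph c\<gamma>]) auto
    show "continuous_on (F ` U) (\<lambda>Y. fst (?R (fst Y)))"
      by (intro continuous_on_fst bounded_linear.continuous_on[OF bounded_linear_swap_to] continuous_on_id)
  qed simp
  moreover have "X \<in> F ` U" unfolding img using Xb U'(3) by simp
  ultimately show ?thesis unfolding regular_param_def
    using oU c1 immersion by (intro exI[of _ U] exI[of _ F]) blast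
qed

text \<open>Differentiating the normalizing factor yields a multiple of \<open>G X\<close>, and
  differentiating the coefficient of \<open>Y\<close> in the tangential gradient a multiple of
  \<open>X\<close>. Both are orthogonal to \<open>w'\<close>, so only the Hessian and a multiple of
  the metric remain.\<close>

lemma N_derivative:
  assumes "X \<in> W"
  shows "\<exists>DN. (N has_derivative DN) (at X) \<and> (\<forall>w w'. w' \<in> hyp_tangent X \<longrightarrow> mink (N X) w' = 0 \<longrightarrow>
     mink (DN w) w' = (H X w \<bullet> w' + (g X \<bullet> X) * mink w w') / sqrt (mink (G X) (G X)))"
proof -
  let ?DG = "\<lambda>w. mink_flip (H X w) + ((g X \<bullet> X) *\<^sub>R w + (g X \<bullet> w + H X w \<bullet> X) *\<^sub>R X)"
  have dG: "(G has_derivative ?DG) (at X)"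
    unfolding tangential_gradient_def
    by (intro has_derivative_add has_derivative_scaleR has_derivative_inner has_derivative_ident
        bounded_linear.has_derivative[OF bounded_linear_mink_flip] derg[OF assms])
  have dm: "((\<lambda>Y. mink (G Y) (G Y)) has_derivative (\<lambda>w. mink (G X) (?DG w) + mink (?DG w) (G X))) (at X)"
    by (rule has_derivative_mink[OF dG dG])
  have p: "mink (G X) (G X) > 0" using nondeg[OF assms] .
  then have "\<exists>D. ((\<lambda>t. 1 / sqrt t) has_real_derivative D) (at (mink (G X) (G X)))"
    by (auto intro!: exI derivative_eq_intros)
  then obtain D where D: "((\<lambda>t. 1 / sqrt t) has_derivative (\<lambda>h. D * h)) (at (mink (G X) (G X)))"
    unfolding has_field_derivative_def by blast
  have dq: "((\<lambda>Y. 1 / sqrt (mink (G Y) (G Y))) has_derivative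
      (\<lambda>w. D * (mink (G X) (?DG w) + mink (?DG w) (G X)))) (at X)"
    by (rule has_derivative_compose[OF dm D])
  let ?DN = "\<lambda>w. (1 / sqrt (mink (G X) (G X))) *\<^sub>R ?DG w + (D * (mink (G X) (?DG w) + mink (?DG w) (G X))) *\<^sub>R G X"
  have "(N has_derivative ?DN) (at X)"
    unfolding N_def by (rule has_derivative_scaleR[OF dq dG])
  moreover have "mink (?DN w) w' = (H X w \<bullet> w' + (g X \<bullet> X) * mink w w') / sqrt (mink (G X) (G X))"
    if w': "w' \<in> hyp_tangent X" "mink (N X) w' = 0" for w w'
  proof -
    have "mink (G X) w' = 0" using w'(2) p unfolding N_def by (simp add: mink_simps)
    moreover have "mink X w' = 0" using w'(1) by (simp add: hyp_tangent_def)
    ultimately have "mink (?DN w) w' = (1 / sqrt (mink (G X) (G X))) * mink (?DG w) w'"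
      by (simp only: mink_add_left[of _ "(D * _) *\<^sub>R G X"] mink_scaleR_left mult_zero_right add_0_right)
    also have "mink (?DG w) w' = H X w \<bullet> w' + (g X \<bullet> X) * mink w w'"
      using \<open>mink X w' = 0\<close> by (simp add: mink_simps)
    finally show ?thesis by simp
  qed
  ultimately show ?thesis by blast
qed

lemma H_symmetric: "X \<in> W \<Longrightarrow> H X u \<bullet> v = H X v \<bullet> u"
  by (rule second_derivative_symmetric[OF W _ der derg])

end

section \<open>The shape operator\<close>

lemma smooth_bounded_domainD:
  assumes "smooth_bounded_domain K"
  shows "K \<subseteq> hyp_space" "compact K" "connected K"
    "X \<in> hyp_boundary K \<Longrightarrow> X \<in> K" "X \<in> hyp_boundary K \<Longrightarrow> X \<in> hyp_space"
proof -
  show K: "K \<subseteq> hyp_space" "compact K" "connected K" using assms by (auto simp: smooth_bounded_domain_def)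
  show b: "X \<in> K" if "X \<in> hyp_boundary K" using that unfolding hyp_boundary_iff[OF K(1,2)] by simp
  then show "X \<in> hyp_space" if "X \<in> hyp_boundary K" using that K(1) by blast
qed

lemma boundary_pieceE:
  assumes "smooth_bounded_domain K" "X \<in> hyp_boundary K"
  obtains W \<rho> g H where "X \<in> W" "boundary_piece K W \<rho> g H"
proof -
  note d = smooth_bounded_domainD[OF assms(1)]
  obtain W \<rho> where l: "local_defining_function K X W \<rho>"
    using assms unfolding smooth_bounded_domain_def by blast
  obtain V g H where "X \<in> V" "V \<subseteq> W" "boundary_piece K V \<rho> g H"
    using boundary_piece_exists[OF d(1,2) l d(5)[OF assms(2)]] by (elim exE conjE) (rule that)
  then show ?thesis using that by blast
qed

lemma outward_normal_props:
  assumes "smooth_bounded_domain K" "X \<in> hyp_boundary K"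
  shows "outward_normal K X \<in> hyp_tangent X" "mink (outward_normal K X) (outward_normal K X) = 1"
    "mink X (outward_normal K X) = 0" "mink (outward_normal K X) X = 0"
  using outward_normal_is_normal[OF assms]
  by (simp_all add: is_normal_def hyp_tangent_def mink_commute)

text \<open>The future null vector \<open>X - \<nu>\<close> is \<open>gauss_speed K X *\<^sub>R (gauss_dir K X, 1)\<close>.\<close>
definition gauss_speed :: "'n::finite minkowski set \<Rightarrow> 'n minkowski \<Rightarrow> real" where
  "gauss_speed K X = snd (X - outward_normal K X)"

definition gauss_dir :: "'n::finite minkowski set \<Rightarrow> 'n minkowski \<Rightarrow> 'n espace" where
  "gauss_dir K X = inverse (gauss_speed K X) *\<^sub>R fst (X - outward_normal K X)"

text \<open>\<open>X\<close> and \<nu> have squares -1 and 1 and product 0, so X - \<nu> is null.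
  Its product with \<open>X\<close> is -1, which excludes the past light cone.\<close>

lemma gauss_dir_props:
  assumes dom: "smooth_bounded_domain K" and X: "X \<in> hyp_boundary K"
  shows "gauss_speed K X > 0" "norm (gauss_dir K X) = 1"
    "X - outward_normal K X = gauss_speed K X *\<^sub>R (gauss_dir K X, 1)"
    "- mink X (gauss_dir K X, 1) = inverse (gauss_speed K X)"
proof -
  define l where "l = X - outward_normal K X"
  note n = outward_normal_props[OF dom X] and XH = smooth_bounded_domainD(5)[OF dom X]
  have ll: "mink l l = 0" unfolding l_def using n hyp_spaceD(1)[OF XH] by (simp add: mink_simps)
  have Xl: "mink X l = -1" unfolding l_def using n hyp_spaceD(1)[OF XH] by (simp add: mink_simps)
  have nl: "(norm (fst l))\<^sup>2 = (snd l)\<^sup>2" unfolding power2_norm_eq_inner using ll by (simp add: mink_def power2_eq_square)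
  then have nl': "norm (fst l) = \<bar>snd l\<bar>" by (metis abs_norm_cancel power2_eq_iff_nonneg abs_ge_zero norm_ge_zero power2_abs)
  show a: "gauss_speed K X > 0"
  proof (rule ccontr)
    assume "\<not> gauss_speed K X > 0"
    then have s: "snd l \<le> 0" by (simp add: gauss_speed_def l_def)
    have "fst X \<bullet> fst l \<ge> - (norm (fst X) * norm (fst l))"
      using Cauchy_Schwarz_ineq2[of "fst X" "fst l"] by linarith
    moreover have "norm (fst X) * norm (fst l) \<le> snd X * norm (fst l)"
      using hyp_spaceD(4)[OF XH] by (intro mult_right_mono) auto
    ultimately have "mink X l \<ge> 0" using s unfolding mink_def nl' by simp
    then show False using Xl by simp
  qed
  have s: "snd l > 0" using a by (simp add: gauss_speed_def l_def)
  show "norm (gauss_dir K X) = 1"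
    unfolding gauss_dir_def gauss_speed_def l_def[symmetric] using s nl' by simp
  show e: "X - outward_normal K X = gauss_speed K X *\<^sub>R (gauss_dir K X, 1)"
    unfolding gauss_dir_def gauss_speed_def l_def[symmetric] using s by (simp add: prod_eq_iff)
  have "mink X (X - outward_normal K X) = gauss_speed K X * mink X (gauss_dir K X, 1)"
    unfolding e by (rule mink_scaleR_right)
  then show "- mink X (gauss_dir K X, 1) = inverse (gauss_speed K X)"
    using Xl a unfolding l_def by (simp add: field_simps)
qed

lemma mink_null_le_0:
  assumes "norm z \<le> 1" "norm z' \<le> 1"
  shows "mink (z, 1) (z', 1) \<le> 0"
proof -
  have "z \<bullet> z' \<le> norm z * norm z'" by (rule norm_cauchy_schwarz)
  also have "\<dots> \<le> 1" using assms by (simp add: mult_le_one)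
  finally show ?thesis by (simp add: mink_def)
qed

lemma mink_hyp_null_neg:
  assumes "X \<in> hyp_space" "norm z = 1"
  shows "mink X (z, 1) < 0"
proof -
  have "fst X \<bullet> z \<le> norm (fst X) * norm z" by (rule norm_cauchy_schwarz)
  then show ?thesis using assms hyp_spaceD(4)[OF assms(1)] by (simp add: mink_def)
qed

lemma boundary_tangent_iff:
  "w \<in> boundary_tangent K X \<longleftrightarrow> mink X w = 0 \<and> mink w (outward_normal K X) = 0"
  by (simp add: boundary_tangent_def hyp_tangent_def)

lemma subspace_boundary_tangent: "subspace (boundary_tangent K X)"
  unfolding subspace_def by (simp add: boundary_tangent_iff mink_simps)

text \<open>Orthogonality to \<open>X\<close> and \<nu> is the same as orthogonality to
  \<open>X\<close> and the null vector X - \<nu>.\<close>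

lemma boundary_tangent_null:
  assumes "smooth_bounded_domain K" "X \<in> hyp_boundary K"
  shows "w \<in> boundary_tangent K X \<longleftrightarrow> mink X w = 0 \<and> gauss_dir K X \<bullet> fst w = snd w"
proof -
  have "mink (X - outward_normal K X) w = gauss_speed K X * (gauss_dir K X \<bullet> fst w - snd w)"
    unfolding gauss_dir_props(3)[OF assms] by (simp add: mink_scaleR_left mink_def right_diff_distrib)
  then show ?thesis using gauss_dir_props(1)[OF assms]
    by (auto simp: boundary_tangent_iff mink_simps mink_commute[of w])
qed

section \<open>Isometric coordinates on the tangent spaces of the boundary\<close>

text \<open>Subtracts the multiple of the null vector \<open>(z, 1)\<close> that kills the last
  coordinate. For the Gauss image \<open>z\<close>, tangent vectors of the boundary are orthogonal
  to \<open>(z, 1)\<close>, so lengths are kept and the image is orthogonal to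
  \<open>z\<close>.\<close>

definition tangent_proj :: "'n::finite espace \<Rightarrow> 'n minkowski \<Rightarrow> 'n espace" where
  "tangent_proj z w = fst w - snd w *\<^sub>R z"

definition tangent_coord :: "'n::finite espace \<Rightarrow> 'n minkowski \<Rightarrow> real ^ 'n" where
  "tangent_coord z w = fst (swap_to z (tangent_proj z w))"

text \<open>The inverse of \<open>tangent_coord\<close>: adding a multiple of \<open>(z, 1)\<close>
  does not change the projection, and \<open>c\<close> is the multiple for which the sum is
  orthogonal to \<open>X\<close>.\<close>

definition tangent_lift :: "'n::finite espace \<Rightarrow> 'n minkowski \<Rightarrow> real ^ 'n \<Rightarrow> 'n minkowski" where
  "tangent_lift z X v = (let y = swap_to z (v, 0); c = (fst X \<bullet> y) / (- mink X (z, 1)) in (y + c *\<^sub>R z, c))"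

lemma linear_tangent_proj: "linear (tangent_proj z)"
  by (rule linearI) (auto simp: tangent_proj_def algebra_simps)

lemma linear_tangent_coord: "linear (tangent_coord z)"
  by (rule linearI)
     (simp_all add: tangent_coord_def linear_add[OF linear_tangent_proj] linear_scale[OF linear_tangent_proj]
       linear_add[OF linear_swap_to] linear_scale[OF linear_swap_to])

lemma linear_tangent_lift: "linear (tangent_lift z X)"
proof (rule linearI)
  fix a b :: "real^'a" and r
  have "swap_to z (a + b, 0) = swap_to z (a, 0) + swap_to z (b, 0)"
    using linear_add[OF linear_swap_to, of z "(a, 0)" "(b, 0)"] by simp
  then show "tangent_lift z X (a + b) = tangent_lift z X a + tangent_lift z X b"
    by (simp add: tangent_lift_def Let_def inner_add_right add_divide_distrib scaleR_add_left)
  have "swap_to z (r *\<^sub>R a, 0) = r *\<^sub>R swap_to z (a, 0)"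
    using linear_scale[OF linear_swap_to, of z r "(a, 0)"] by simp
  then show "tangent_lift z X (r *\<^sub>R a) = r *\<^sub>R tangent_lift z X a"
    by (simp add: tangent_lift_def Let_def scaleR_add_right scaleR_diff_right)
qed

context
  fixes K :: "'n::finite minkowski set" and X z
  assumes dom: "smooth_bounded_domain K" and X: "X \<in> hyp_boundary K"
  defines "z \<equiv> gauss_dir K X"
begin

lemma tangent_proj_inner:
  assumes "w \<in> boundary_tangent K X" "w' \<in> boundary_tangent K X"
  shows "tangent_proj z w \<bullet> tangent_proj z w' = mink w w'"
proof -
  have "z \<bullet> fst w = snd w" "z \<bullet> fst w' = snd w'" "z \<bullet> z = 1"
    using assms boundary_tangent_null[OF dom X] gauss_dir_props(2)[OF dom X] unfolding z_def
    by (simp_all add: norm_eq_1)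
  moreover have "tangent_proj z w \<bullet> tangent_proj z w' =
      fst w \<bullet> fst w' - snd w' * (z \<bullet> fst w) - snd w * (z \<bullet> fst w') + snd w * snd w' * (z \<bullet> z)"
    unfolding tangent_proj_def inner_diff_left inner_diff_right inner_scaleR_left inner_scaleR_right
      inner_commute[of "fst w" z] by (simp add: algebra_simps)
  ultimately show ?thesis by (simp add: mink_def)
qed

lemma snd_swap_tangent_proj:
  assumes "w \<in> boundary_tangent K X"
  shows "snd (swap_to z (tangent_proj z w)) = 0"
proof -
  have nz: "norm z = 1" using gauss_dir_props(2)[OF dom X] by (simp add: z_def)
  have "z \<bullet> fst w = snd w" "z \<bullet> z = 1"
    using assms boundary_tangent_null[OF dom X] nz unfolding z_def by (simp_all add: norm_eq_1)
  then show ?thesis by (simp add: snd_swap_to[OF nz] tangent_proj_def inner_diff_right)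
qed

lemma tangent_coord_inner:
  assumes "w \<in> boundary_tangent K X" "w' \<in> boundary_tangent K X"
  shows "tangent_coord z w \<bullet> tangent_coord z w' = mink w w'"
proof -
  have "tangent_coord z w \<bullet> tangent_coord z w' = swap_to z (tangent_proj z w) \<bullet> swap_to z (tangent_proj z w')"
    unfolding tangent_coord_def inner_prod_def[of "swap_to z _"]
    by (simp add: snd_swap_tangent_proj assms)
  then show ?thesis using tangent_proj_inner[OF assms] by (simp add: swap_to_inner)
qed

lemma tangent_coord_inj:
  assumes "w \<in> boundary_tangent K X" "w' \<in> boundary_tangent K X" "tangent_coord z w = tangent_coord z w'"
  shows "w = w'"
proof (rule ccontr)
  assume "w \<noteq> w'"
  have bt: "w - w' \<in> boundary_tangent K X" using assms by (intro subspace_diff subspace_boundary_tangent)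
  then have "mink (w - w') (w - w') > 0"
    using \<open>w \<noteq> w'\<close> smooth_bounded_domainD(5)[OF dom X]
    by (intro hyp_tangent_pos[of X]) (simp_all add: boundary_tangent_def)
  moreover have "tangent_coord z (w - w') = 0"
    using assms(3) by (simp add: linear_diff[OF linear_tangent_coord])
  ultimately show False using tangent_coord_inner[OF bt bt] by simp
qed

lemma tangent_lift_in: "tangent_lift z X v \<in> boundary_tangent K X"
  and tangent_coord_lift: "tangent_coord z (tangent_lift z X v) = v"
proof -
  have nz: "norm z = 1" using gauss_dir_props(2)[OF dom X] by (simp add: z_def)
  have zz: "z \<bullet> z = 1" using nz by (simp add: norm_eq_1)
  define y where "y = swap_to z (v, 0)"
  define c where "c = (fst X \<bullet> y) / (- mink X (z, 1))"
  have l: "tangent_lift z X v = (y + c *\<^sub>R z, c)" by (simp add: tangent_lift_def Let_def y_def c_def)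
  have h: "mink X (z, 1) < 0" using mink_hyp_null_neg[OF smooth_bounded_domainD(5)[OF dom X] nz] .
  have zy: "z \<bullet> y = 0" unfolding y_def using snd_swap_to[OF nz, of "swap_to z (v, 0)"] by simp
  have "mink X (y + c *\<^sub>R z, c) = fst X \<bullet> y + c * mink X (z, 1)"
    by (simp add: mink_def inner_add_right algebra_simps)
  also have "\<dots> = 0" using h by (simp add: c_def)
  finally have 1: "mink X (y + c *\<^sub>R z, c) = 0" .
  show "tangent_lift z X v \<in> boundary_tangent K X"
    unfolding boundary_tangent_null[OF dom X] l z_def[symmetric] using 1 zy zz by (simp add: inner_add_right)
  show "tangent_coord z (tangent_lift z X v) = v"
    unfolding tangent_coord_def tangent_proj_def l by (simp add: y_def)
qed

lemma tangent_lift_coord: "w \<in> boundary_tangent K X \<Longrightarrow> tangent_lift z X (tangent_coord z w) = w"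
  by (rule tangent_coord_inj[OF tangent_lift_in _ tangent_coord_lift])

end

lemma regular_paramD:
  assumes "regular_param M U F"
  shows "open U" "x \<in> U \<Longrightarrow> F x \<in> M" "x \<in> U \<Longrightarrow> (F has_derivative frechet_derivative F (at x)) (at x)"
    "x \<in> U \<Longrightarrow> inj (frechet_derivative F (at x))" "continuous_on U F"
proof -
  show "open U" using assms by (simp add: regular_param_def)
  have "F ` U \<subseteq> M" using assms openin_imp_subset unfolding regular_param_def by blast
  then show "x \<in> U \<Longrightarrow> F x \<in> M" by blast
  have "Ck_on (Suc 0) F U" using assms by (simp add: regular_param_def)
  then have "F differentiable (at x)" if "x \<in> U" for x using that by simp
  then show d: "(F has_derivative frechet_derivative F (at x)) (at x)" if "x \<in> U" for x
    using that by (simp only: frechet_derivative_works)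
  show "x \<in> U \<Longrightarrow> inj (frechet_derivative F (at x))" using assms by (simp add: regular_param_def)
  show "continuous_on U F"
    by (intro continuous_at_imp_continuous_on ballI) (rule has_derivative_continuous[OF d])
qed

lemma boundary_chart:
  assumes "smooth_bounded_domain K" "X \<in> hyp_boundary K"
  shows "\<exists>U F. regular_param (hyp_boundary K) U F \<and> X \<in> F ` U"
  by (rule boundary_pieceE[OF assms]) (rule boundary_piece.chart_exists[OF _ _ assms(2)])

text \<open>Within the boundary, \<nu> is the restriction of the differentiable field
  \<open>N\<close>. A derivative within the boundary is ambiguous in normal directions; the values
  on tangent vectors are later fixed by the chain rule in charts.\<close>

lemma outward_normal_has_derivative:
  assumes dom: "smooth_bounded_domain K" and X: "X \<in> hyp_boundary K"
  shows "(outward_normal K has_derivative shape_operator K X) (at X within hyp_boundary K)"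
proof -
  obtain W \<rho> g H where XW: "X \<in> W" and bp: "boundary_piece K W \<rho> g H" using boundary_pieceE[OF dom X] .
  interpret boundary_piece K W \<rho> g H by fact
  obtain DN where DN: "(N has_derivative DN) (at X)" using N_derivative[OF XW] by blast
  obtain d where d: "d > 0" "ball X d \<subseteq> W" using XW W open_contains_ball by blast
  have "(outward_normal K has_derivative DN) (at X within hyp_boundary K)"
  proof (rule has_derivative_transform_within[OF has_derivative_at_withinI[OF DN] d(1) X])
    fix Y assume "Y \<in> hyp_boundary K" "dist Y X < d"
    then show "N Y = outward_normal K Y"
      using d(2) by (intro outward_normal_eq[symmetric] dom) (auto simp: dist_commute)
  qed
  then show ?thesis unfolding shape_operator_def
    by (metis differentiable_def frechet_derivative_works)
qed

section \<open>The Weingarten map in charts\<close>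

context
  fixes K :: "'n::finite minkowski set" and U F and x :: "real ^ 'n"
  assumes dom: "smooth_bounded_domain K" and F: "regular_param (hyp_boundary K) U F" and x: "x \<in> U"
begin

abbreviation (input) "DF \<equiv> frechet_derivative F (at x)"

lemma param_normal_derivative:
  "((\<lambda>y. outward_normal K (F y)) has_derivative (\<lambda>v. shape_operator K (F x) (DF v))) (at x)"
proof -
  note p = regular_paramD[OF F]
  have "F ` U \<subseteq> hyp_boundary K" using p(2) by blast
  then have 1: "(outward_normal K has_derivative shape_operator K (F x)) (at (F x) within F ` U)"
    using outward_normal_has_derivative[OF dom p(2)[OF x]] has_derivative_subset by blast
  have "(F has_derivative DF) (at x within U)" using p(3)[OF x] by (rule has_derivative_at_withinI)
  from diff_chain_within[OF this 1]
  have "((outward_normal K \<circ> F) has_derivative (shape_operator K (F x) \<circ> DF)) (at x within U)" .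
  then show ?thesis using p(1) x by (simp add: o_def at_within_open[of x U])
qed

text \<open>Differentiate the constant functions \<open>mink (F y) (F y)\<close> and
  \<open>\<rho> (F y)\<close>.\<close>

lemma param_derivative_tangent: "DF v \<in> boundary_tangent K (F x)"
proof -
  note p = regular_paramD[OF F]
  have Fx: "F x \<in> hyp_boundary K" "F x \<in> hyp_space" using p(2)[OF x] smooth_bounded_domainD(5)[OF dom] by blast+
  have "mink (F x) (DF v) + mink (DF v) (F x) = 0"
  proof -
    have "((\<lambda>y. mink (F y) (F y)) has_derivative (\<lambda>v. mink (F x) (DF v) + mink (DF v) (F x))) (at x)"
      by (rule has_derivative_mink[OF p(3)[OF x] p(3)[OF x]])
    then show ?thesis
      by (rule fun_cong[OF has_derivative_zero_if_constant[OF p(1) x]])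
         (rule hyp_spaceD(1)[OF smooth_bounded_domainD(5)[OF dom p(2)]])
  qed
  then have 1: "DF v \<in> hyp_tangent (F x)" by (simp add: hyp_tangent_def mink_commute)
  obtain W \<rho> g H where XW: "F x \<in> W" and bp: "boundary_piece K W \<rho> g H" using boundary_pieceE[OF dom Fx(1)] .
  interpret boundary_piece K W \<rho> g H by fact
  have "open (F -` W \<inter> U)" using p(5) W by (simp add: continuous_on_open_vimage[OF p(1)])
  moreover have "x \<in> F -` W \<inter> U" using x XW by simp
  moreover have "((\<lambda>y. \<rho> (F y)) has_derivative (\<lambda>v. g (F x) \<bullet> DF v)) (at x)"
    by (rule has_derivative_compose[OF p(3)[OF x] der[OF XW]])
  ultimately have "(\<lambda>v. g (F x) \<bullet> DF v) = (\<lambda>_. 0)"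
  proof (rule has_derivative_zero_if_constant[where c = 0])
    fix y assume "y \<in> F -` W \<inter> U"
    then show "\<rho> (F y) = 0" using boundary_iff[of "F y"] p(2)[of y] by simp
  qed
  then have "g (F x) \<bullet> DF v = 0" by meson
  then have "mink (N (F x)) (DF v) = 0" using N_props(3)[OF XW Fx(2) 1] nondeg[OF XW] by simp
  then show ?thesis
    using 1 outward_normal_eq[OF dom XW Fx(1)] by (simp add: boundary_tangent_def mink_commute)
qed

text \<open>In \<open>tangent_coord\<close> the differential of the chart is an injective linear map
  of \<real>^n into itself, hence onto.\<close>

lemma param_derivative_range: "w \<in> boundary_tangent K (F x) \<Longrightarrow> \<exists>v. DF v = w"
proof -
  assume w: "w \<in> boundary_tangent K (F x)"
  note p = regular_paramD[OF F] and Fx = regular_paramD(2)[OF F x]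
  let ?q = "tangent_coord (gauss_dir K (F x))"
  have lin: "linear DF" using p(3)[OF x] has_derivative_linear by blast
  have "linear (?q \<circ> DF)" by (intro linear_compose lin linear_tangent_coord)
  moreover have "inj (?q \<circ> DF)"
  proof (rule injI)
    fix a b assume "(?q \<circ> DF) a = (?q \<circ> DF) b"
    then have "DF a = DF b"
      using tangent_coord_inj[OF dom Fx param_derivative_tangent param_derivative_tangent] by simp
    then show "a = b" using p(4)[OF x] by (simp add: inj_eq)
  qed
  ultimately have "surj (?q \<circ> DF)" by (rule linear_injective_imp_surjective) (rule refl)
  then obtain v where "?q w = (?q \<circ> DF) v" by (metis surjD)
  then have "DF v = w" using tangent_coord_inj[OF dom Fx param_derivative_tangent w] by simp
  then show ?thesis by blast
qed

text \<open>Differentiate the constant products of \<nu> with itself and with the position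
  vector.\<close>

lemma param_shape_tangent: "shape_operator K (F x) (DF v) \<in> boundary_tangent K (F x)"
proof -
  note p = regular_paramD[OF F] and Fx = regular_paramD(2)[OF F x]
  note pn = param_normal_derivative
  let ?n = "\<lambda>y. outward_normal K (F y)" and ?W = "\<lambda>v. shape_operator K (F x) (DF v)"
  have "((\<lambda>y. mink (?n y) (?n y)) has_derivative (\<lambda>v. mink (?n x) (?W v) + mink (?W v) (?n x))) (at x)"
    by (rule has_derivative_mink[OF pn pn])
  then have 1: "mink (?n x) (?W v) + mink (?W v) (?n x) = 0"
    by (rule fun_cong[OF has_derivative_zero_if_constant[OF p(1) x]]) (rule outward_normal_props(2)[OF dom p(2)])
  have "((\<lambda>y. mink (?n y) (F y)) has_derivative (\<lambda>v. mink (?n x) (DF v) + mink (?W v) (F x))) (at x)"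
    by (rule has_derivative_mink[OF pn p(3)[OF x]])
  then have 2: "mink (?n x) (DF v) + mink (?W v) (F x) = 0"
    by (rule fun_cong[OF has_derivative_zero_if_constant[OF p(1) x]]) (rule outward_normal_props(4)[OF dom p(2)])
  have "mink (?n x) (DF v) = 0"
    using param_derivative_tangent[of v] by (simp add: boundary_tangent_iff mink_commute)
  then show ?thesis using 1 2 by (simp add: boundary_tangent_iff mink_commute[of "F x"] mink_commute[of "?n x"])
qed

end

lemma shape_operator_tangent:
  assumes dom: "smooth_bounded_domain K" and X: "X \<in> hyp_boundary K" and w: "w \<in> boundary_tangent K X"
  shows "shape_operator K X w \<in> boundary_tangent K X"
proof -
  obtain U F x where F: "regular_param (hyp_boundary K) U F" "x \<in> U" "X = F x"
    using boundary_chart[OF dom X] by blast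
  have w': "w \<in> boundary_tangent K (F x)" using w F(3) by simp
  obtain v where "frechet_derivative F (at x) v = w" using param_derivative_range[OF dom F(1,2) w'] by blast
  then show ?thesis using param_shape_tangent[OF dom F(1,2), of v] F(3) by simp
qed

text \<open>Along a chart \<nu> and \<open>N\<close> coincide, so uniqueness of the derivative on an
  open set of parameters identifies the shape operator with the derivative of \<open>N\<close> on
  tangent vectors.\<close>

lemma (in boundary_piece) shape_operator_form:
  assumes dom: "smooth_bounded_domain K" and X: "X \<in> W" "X \<in> hyp_boundary K"
    and w: "w \<in> boundary_tangent K X" "w' \<in> boundary_tangent K X"
  shows "mink (shape_operator K X w) w' = (H X w \<bullet> w' + (g X \<bullet> X) * mink w w') / sqrt (mink (G X) (G X))"
proof -
  obtain U F x where F: "regular_param (hyp_boundary K) U F" "x \<in> U" "X = F x"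
    using boundary_chart[OF dom X(2)] by blast
  note p = regular_paramD[OF F(1)]
  have w1: "w \<in> boundary_tangent K (F x)" using w(1) F(3) by simp
  obtain v where v: "frechet_derivative F (at x) v = w" using param_derivative_range[OF dom F(1,2) w1] by blast
  obtain DN where DN: "(N has_derivative DN) (at X)"
    and DNf: "\<forall>w w'. w' \<in> hyp_tangent X \<longrightarrow> mink (N X) w' = 0 \<longrightarrow>
     mink (DN w) w' = (H X w \<bullet> w' + (g X \<bullet> X) * mink w w') / sqrt (mink (G X) (G X))"
    using N_derivative[OF X(1)] by (elim exE conjE) (rule that)
  have "open (F -` W \<inter> U)" using p(5) W by (simp add: continuous_on_open_vimage[OF p(1)])
  moreover have xO: "x \<in> F -` W \<inter> U" using F X by simp
  moreover have "((\<lambda>y. N (F y)) has_derivative (\<lambda>v. DN (frechet_derivative F (at x) v))) (at x)"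
    using has_derivative_compose[OF p(3)[OF F(2)]] DN F(3) by simp
  ultimately have "((\<lambda>y. outward_normal K (F y)) has_derivative (\<lambda>v. DN (frechet_derivative F (at x) v))) (at x)"
    using has_derivative_transform_within_open[of "\<lambda>y. N (F y)" _ x UNIV "F -` W \<inter> U" "\<lambda>y. outward_normal K (F y)"]
      outward_normal_eq[OF dom _ p(2)] by simp
  from fun_cong[OF has_derivative_unique[OF this param_normal_derivative[OF dom F(1,2)]], of v]
  have "DN w = shape_operator K X w" using v F(3) by simp
  moreover have "w' \<in> hyp_tangent X" "mink (N X) w' = 0"
    using w(2) outward_normal_eq[OF dom X] by (simp_all add: boundary_tangent_def mink_commute)
  ultimately show ?thesis using DNf[rule_format, of w' w] by (simp only:)
qed

lemma shape_operator_symmetric: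
  assumes dom: "smooth_bounded_domain K" and X: "X \<in> hyp_boundary K"
    and w: "w \<in> boundary_tangent K X" "w' \<in> boundary_tangent K X"
  shows "mink (shape_operator K X w) w' = mink w (shape_operator K X w')"
proof -
  obtain W \<rho> g H where XW: "X \<in> W" and bp: "boundary_piece K W \<rho> g H" using boundary_pieceE[OF dom X] .
  interpret boundary_piece K W \<rho> g H by fact
  show ?thesis
    unfolding mink_commute[of w "shape_operator K X w'"] shape_operator_form[OF dom XW X w]
      shape_operator_form[OF dom XW X w(2,1)]
    by (simp add: H_symmetric[OF XW, of w w'] mink_commute[of w w'])
qed

lemma linear_shape_operator:
  assumes "smooth_bounded_domain K" "X \<in> hyp_boundary K"
  shows "linear (shape_operator K X)"
  using outward_normal_has_derivative[OF assms] has_derivative_linear by blast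

text \<open>Transports the shape operator to a self-adjoint map \<open>S\<close> of \<real>^n, where
  the spectral theorem applies, and recounts \<open>principal_curvatures\<close> as a family indexed
  by an eigenbasis.\<close>

lemma shape_operator_spectrum:
  fixes K :: "'n::finite minkowski set"
  assumes dom: "smooth_bounded_domain K" and X: "X \<in> hyp_boundary K"
  obtains S :: "real^'n \<Rightarrow> real^'n" and e k where "linear S"
    "\<And>w. w \<in> boundary_tangent K X \<Longrightarrow>
       tangent_coord (gauss_dir K X) (shape_operator K X w) = S (tangent_coord (gauss_dir K X) w)"
    "\<And>i j. e i \<bullet> e j = (if i = j then 1 else 0)" "\<And>i. S (e i) = k i *\<^sub>R e i"
    "principal_curvatures K X = image_mset k (mset_set (UNIV :: 'n set))"
proof -
  define z where "z = gauss_dir K X"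
  define Q where "Q = tangent_coord z"
  define L where "L = tangent_lift z X"
  define S where "S = Q \<circ> shape_operator K X \<circ> L"
  note tl = tangent_lift_in[OF dom X, folded z_def, folded L_def]
    and tcl = tangent_coord_lift[OF dom X, folded z_def, folded L_def Q_def]
    and tlc = tangent_lift_coord[OF dom X, folded z_def, folded L_def Q_def]
    and qi = tangent_coord_inner[OF dom X, folded z_def, folded Q_def]
  have lin: "linear S" unfolding S_def Q_def L_def
    by (intro linear_compose linear_tangent_coord linear_tangent_lift linear_shape_operator dom X)
  have SQ: "Q (shape_operator K X w) = S (Q w)" if "w \<in> boundary_tangent K X" for w
    unfolding S_def using tlc[OF that] by simp
  have sym: "S v \<bullet> w = v \<bullet> S w" for v w
  proof -
    have st: "shape_operator K X (L v) \<in> boundary_tangent K X" for v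
      by (rule shape_operator_tangent[OF dom X tl])
    have "S v \<bullet> w = Q (shape_operator K X (L v)) \<bullet> Q (L w)" unfolding S_def tcl by simp
    also have "\<dots> = Q (L v) \<bullet> Q (shape_operator K X (L w))"
      by (simp only: qi[OF st tl] qi[OF tl st] shape_operator_symmetric[OF dom X tl tl])
    finally show ?thesis unfolding S_def tcl by simp
  qed
  obtain e :: "'n \<Rightarrow> real^'n" and k where e: "\<And>i j. e i \<bullet> e j = (if i = j then 1 else 0)"
    and k: "\<And>i. S (e i) = k i *\<^sub>R e i"
    by (rule self_adjoint_eigenbasis[OF lin sym]) (rule that)
  have cs: "curvature_space K X c = L ` {v. S v = c *\<^sub>R v}" for c
  proof (intro set_eqI iffI)
    fix w assume "w \<in> curvature_space K X c"
    then have w: "w \<in> boundary_tangent K X" "shape_operator K X w = c *\<^sub>R w" by (auto simp: curvature_space_def)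
    have "S (Q w) = c *\<^sub>R Q w"
      using SQ[OF w(1)] w(2) by (simp add: Q_def linear_scale[OF linear_tangent_coord])
    then show "w \<in> L ` {v. S v = c *\<^sub>R v}" using tlc[OF w(1)] by (metis (mono_tags) imageI mem_Collect_eq)
  next
    fix w assume "w \<in> L ` {v. S v = c *\<^sub>R v}"
    then obtain v where v: "w = L v" "S v = c *\<^sub>R v" by blast
    have "Q (shape_operator K X (L v)) = Q (c *\<^sub>R L v)"
      using v(2) SQ[OF tl, of v] by (simp add: Q_def[symmetric] tcl) (simp add: Q_def linear_scale[OF linear_tangent_coord] tcl[unfolded Q_def])
    then have "shape_operator K X (L v) = c *\<^sub>R L v"
      using tangent_coord_inj[OF dom X, folded z_def, folded Q_def] shape_operator_tangent[OF dom X tl]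
        subspace_scale[OF subspace_boundary_tangent tl] by metis
    then show "w \<in> curvature_space K X c" using v(1) tl by (simp add: curvature_space_def)
  qed
  have linL: "linear L" unfolding L_def by (rule linear_tangent_lift)
  have injL: "inj L" using tcl by (metis injI)
  have dimc: "dim (curvature_space K X c) = card {i. k i = c}" for c
  proof -
    have "dim (L ` {v. S v = c *\<^sub>R v}) = dim {v. S v = c *\<^sub>R v}"
      using injL by (intro dim_image_eq linL) (auto intro: inj_on_subset)
    then show ?thesis unfolding cs using dim_eigenspace[OF lin e k] by simp
  qed
  have ne: "curvature_space K X c \<noteq> {0} \<longleftrightarrow> c \<in> range k" for c
  proof
    assume "c \<in> range k"
    then obtain i where "c = k i" by blast
    then have "L (e i) \<in> curvature_space K X c" unfolding cs using k by auto
    moreover have "L (e i) \<noteq> 0"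
    proof
      assume "L (e i) = 0"
      then have "e i = Q 0" using tcl by metis
      then have "e i = 0" by (simp add: Q_def linear_0[OF linear_tangent_coord])
      then show False using e[of i i] by simp
    qed
    ultimately show "curvature_space K X c \<noteq> {0}" by auto
  next
    assume ne0: "curvature_space K X c \<noteq> {0}"
    have "0 \<in> curvature_space K X c" unfolding cs
      using linear_0[OF linL] linear_0[OF lin] by (intro image_eqI[of _ _ 0]) auto
    then obtain w where "w \<in> curvature_space K X c" "w \<noteq> 0" using ne0 by blast
    then have "\<not> curvature_space K X c \<subseteq> {0}" by blast
    then have "dim (curvature_space K X c) \<noteq> 0" by (simp only: dim_eq_0) simp
    then have "{i. k i = c} \<noteq> {}" unfolding dimc by force
    then show "c \<in> range k" by auto
  qed
  have "principal_curvatures K X = (\<Sum>c\<in>range k. replicate_mset (card {i. k i = c}) c)"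
    unfolding principal_curvatures_def dimc ne by simp
  also have "\<dots> = image_mset k (mset_set UNIV)"
  proof (rule multiset_eqI)
    fix d
    have "count (\<Sum>c\<in>range k. replicate_mset (card {i. k i = c}) c) d
        = (\<Sum>c\<in>range k. if d = c then card {i. k i = c} else 0)"
      by (simp add: count_sum)
    also have "\<dots> = card {i. k i = d}"
    proof (cases "d \<in> range k")
      case False
      then have "{i. k i = d} = {}" by auto
      then show ?thesis using False by (simp only: sum.delta' finite card.empty finite_imageI if_False)
    qed (simp add: sum.delta')
    also have "\<dots> = count (image_mset k (mset_set UNIV)) d"
      by (simp add: count_image_mset vimage_def Collect_conj_eq)
    finally show "count (\<Sum>c\<in>range k. replicate_mset (card {i. k i = c}) c) d = count (image_mset k (mset_set UNIV)) d" .
  qed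
  finally have "principal_curvatures K X = image_mset k (mset_set UNIV)" .
  then show ?thesis
    using that[OF lin _ e k] SQ unfolding Q_def z_def by blast
qed

section \<open>Global horospherical convexity\<close>

text \<open>Expanded in an eigenbasis, the difference of the two sides is the sum of the squared
  coordinates with weights \<open>k i - 1\<close>, all of them positive.\<close>

lemma shape_operator_gt:
  fixes K :: "'n::finite minkowski set"
  assumes dom: "uniformly_h_convex_domain K" and X: "X \<in> hyp_boundary K"
    and w: "w \<in> boundary_tangent K X" "w \<noteq> 0"
  shows "mink (shape_operator K X w) w > mink w w"
proof -
  have d: "smooth_bounded_domain K" using dom by (simp add: uniformly_h_convex_domain_def)
  let ?Q = "tangent_coord (gauss_dir K X)"
  obtain S :: "real^'n \<Rightarrow> real^'n" and e :: "'n \<Rightarrow> real^'n" and k :: "'n \<Rightarrow> real" where S: "linear S" "\<And>w. w \<in> boundary_tangent K X \<Longrightarrow> ?Q (shape_operator K X w) = S (?Q w)"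
    and e: "\<And>i j. e i \<bullet> e j = (if i = j then 1 else 0)" and k: "\<And>i. S (e i) = k i *\<^sub>R e i"
    and pc: "principal_curvatures K X = image_mset k (mset_set UNIV)"
    by (rule shape_operator_spectrum[OF d X]) (rule that)
  obtain \<delta> where \<delta>: "\<delta> > 0" "\<And>k. k \<in># principal_curvatures K X \<Longrightarrow> k > 1 + \<delta>"
    using dom X unfolding uniformly_h_convex_domain_def uniformly_h_convex_def by blast
  have k1: "k i > 1" for i
  proof -
    have "k i > 1 + \<delta>" by (rule \<delta>(2)) (simp add: pc)
    then show ?thesis using \<delta>(1) by linarith
  qed
  define v where "v = ?Q w"
  have vw: "v \<bullet> v = mink w w" unfolding v_def by (rule tangent_coord_inner[OF d X w(1) w(1)])
  have "mink w w > 0"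
    using w smooth_bounded_domainD(5)[OF d X] by (intro hyp_tangent_pos[of X]) (simp_all add: boundary_tangent_def)
  then have "v \<noteq> 0" using vw by auto
  have Sv: "S v = (\<Sum>i\<in>UNIV. (v \<bullet> e i * k i) *\<^sub>R e i)"
    by (subst orthonormal_expansion[OF e, of v]) (simp add: linear_sum[OF S(1)] linear_scale[OF S(1)] k)
  have "S v \<bullet> v - v \<bullet> v = (\<Sum>i\<in>UNIV. v \<bullet> e i * k i * (e i \<bullet> v)) - (\<Sum>i\<in>UNIV. v \<bullet> e i * (e i \<bullet> v))"
  proof -
    have "S v \<bullet> v = (\<Sum>i\<in>UNIV. v \<bullet> e i * k i * (e i \<bullet> v))"
      unfolding Sv by (simp add: inner_sum_left)
    moreover have "v \<bullet> v = (\<Sum>i\<in>UNIV. (v \<bullet> e i) *\<^sub>R e i) \<bullet> v"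
      by (subst orthonormal_expansion[OF e, of v]) (rule refl)
    ultimately show ?thesis by (simp add: inner_sum_left)
  qed
  also have "\<dots> = (\<Sum>i\<in>UNIV. (k i - 1) * (v \<bullet> e i)\<^sup>2)"
    unfolding sum_subtractf[symmetric]
    by (intro sum.cong refl) (simp add: inner_commute[of "e _" v] power2_eq_square algebra_simps)
  also have "\<dots> > 0"
  proof -
    have "\<exists>i. v \<bullet> e i \<noteq> 0"
    proof (rule ccontr)
      assume "\<nexists>i. v \<bullet> e i \<noteq> 0"
      then have "v = 0" by (subst orthonormal_expansion[OF e, of v]) simp
      then show False using \<open>v \<noteq> 0\<close> by simp
    qed
    then obtain i where "v \<bullet> e i \<noteq> 0" by blast
    then show ?thesis using k1 by (intro sum_pos2[of _ i]) (simp_all add: less_imp_le)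
  qed
  finally have "S v \<bullet> v > v \<bullet> v" by simp
  moreover have "S v \<bullet> v = mink (shape_operator K X w) w"
    unfolding v_def S(2)[OF w(1), symmetric]
    by (rule tangent_coord_inner[OF d X shape_operator_tangent[OF d X w(1)] w(1)])
  ultimately show ?thesis using vw by simp
qed

lemma hyp_curve_derivative:
  assumes X: "X \<in> hyp_space" and w: "w \<in> hyp_tangent X"
  shows "((\<lambda>t. mink (hyp_graph (fst X + t *\<^sub>R fst w)) q) has_real_derivative mink w q) (at 0)"
proof -
  let ?c = "\<lambda>t. hyp_graph (fst X + t *\<^sub>R fst w)"
  have "((\<lambda>t. fst X + t *\<^sub>R fst w) has_derivative (\<lambda>t. t *\<^sub>R fst w)) (at 0)"
    by (auto intro!: derivative_eq_intros)
  from has_derivative_compose[OF this has_derivative_hyp_graph]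
  have "(?c has_derivative (\<lambda>t. hyp_graph_deriv (fst X) (t *\<^sub>R fst w))) (at 0)" by simp
  moreover have "hyp_graph_deriv (fst X) (t *\<^sub>R fst w) = t *\<^sub>R w" for t
    using hyp_graph_deriv_tangent[OF X subspace_scale[OF subspace_hyp_tangent w, of t]] by simp
  ultimately have "(?c has_derivative (\<lambda>t. t *\<^sub>R w)) (at 0)" by simp
  then have "((\<lambda>t. mink (?c t) q) has_derivative (\<lambda>t. mink (t *\<^sub>R w) q)) (at 0)"
    by (rule bounded_linear.has_derivative[OF bounded_bilinear.bounded_linear_left[OF bounded_bilinear_mink]])
  then show ?thesis by (simp add: has_field_derivative_def mink_scaleR_left mult_commute_abs)
qed

lemma hyp_curve_eventually:
  assumes X: "X \<in> hyp_space" and V: "open V" "X \<in> V"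
  shows "\<forall>\<^sub>F t in at_right 0. hyp_graph (fst X + t *\<^sub>R u) \<in> V"
proof -
  let ?c = "\<lambda>t::real. hyp_graph (fst X + t *\<^sub>R u)"
  have "continuous_on UNIV ?c"
    by (intro continuous_on_compose2[OF continuous_on_hyp_graph[of UNIV]] continuous_intros) auto
  then have "open (?c -` V)" using V by (intro open_vimage)
  moreover have "0 \<in> ?c -` V" using V X by (simp add: hyp_graph_fst)
  ultimately have "\<forall>\<^sub>F t in at 0. t \<in> ?c -` V" by (intro eventually_at_in_open')
  then show ?thesis by (simp add: eventually_at_split)
qed

text \<open>\<open>p\<close> is the tangential part at \<open>X\<close> of the linear function given
  by \<open>q\<close>. Maximality says that directions entering \<open>K\<close> do not increase it,
  which is the one-sided condition of \<open>is_normal_unique\<close>. Used with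
  \<open>q = - (z, 1)\<close> for the Gauss map and with \<open>q = (- P, 0)\<close> for rays from
  the origin.\<close>

lemma maximizer_normal:
  assumes dom: "smooth_bounded_domain K" and X: "X \<in> K" and max: "\<And>Y. Y \<in> K \<Longrightarrow> mink Y q \<le> mink X q"
    and p: "p = q + mink q X *\<^sub>R X" "p \<noteq> 0"
  shows "X \<in> hyp_boundary K" "outward_normal K X = (1 / sqrt (mink p p)) *\<^sub>R p" "mink p p > 0"
proof -
  note d = smooth_bounded_domainD[OF dom]
  have XH: "X \<in> hyp_space" using X d(1) by blast
  have pT: "p \<in> hyp_tangent X"
    unfolding p(1) hyp_tangent_def using hyp_spaceD(1)[OF XH] by (simp add: mink_simps mink_commute[of X q])
  show pp: "mink p p > 0" by (rule hyp_tangent_pos[OF XH pT p(2)])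
  have pw: "mink p w = mink w q" if "w \<in> hyp_tangent X" for w
    using that unfolding p(1) hyp_tangent_def by (simp add: mink_simps mink_commute[of w q])
  have le: "mink p w \<le> 0" if w: "w \<in> hyp_tangent X"
    and ev: "\<forall>\<^sub>F t in at_right 0. hyp_graph (fst X + t *\<^sub>R fst w) \<in> K" for w
  proof (rule ccontr)
    let ?c = "\<lambda>t. hyp_graph (fst X + t *\<^sub>R fst w)"
    assume "\<not> mink p w \<le> 0"
    then have "mink w q > 0" using pw[OF w] by simp
    from DERIV_pos_inc_right[OF hyp_curve_derivative[OF XH w] this]
    obtain e where e: "e > 0" "\<And>h. 0 < h \<Longrightarrow> h < e \<Longrightarrow> mink (?c 0) q < mink (?c (0 + h)) q" by blast
    have "\<forall>\<^sub>F t in at_right 0. t < e" "\<forall>\<^sub>F t in at_right (0::real). 0 < t"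
      using e(1) by (auto simp: eventually_at_right_less eventually_at_right)
    with ev have "\<forall>\<^sub>F t in at_right (0::real). False"
    proof eventually_elim
      case (elim t)
      then have "mink X q < mink (?c t) q" using e(2)[of t] XH by (simp add: hyp_graph_fst)
      then show ?case using max[OF elim(1)] by simp
    qed
    then show False by simp
  qed
  show Xb: "X \<in> hyp_boundary K"
  proof (rule ccontr)
    assume "X \<notin> hyp_boundary K"
    then obtain V where V: "open V" "X \<in> V" "V \<inter> hyp_space \<subseteq> K"
      using X unfolding hyp_boundary_iff[OF d(1,2)] by blast
    have "\<forall>\<^sub>F t in at_right 0. hyp_graph (fst X + t *\<^sub>R fst p) \<in> V" by (rule hyp_curve_eventually[OF XH V(1,2)])
    then have "\<forall>\<^sub>F t in at_right 0. hyp_graph (fst X + t *\<^sub>R fst p) \<in> K"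
      by eventually_elim (use V(3) hyp_graph_in in blast)
    then show False using le[OF pT] pp by simp
  qed
  show "outward_normal K X = (1 / sqrt (mink p p)) *\<^sub>R p"
  proof (rule is_normal_unique[OF XH outward_normal_is_normal[OF dom Xb]])
    show "(1 / sqrt (mink p p)) *\<^sub>R p \<in> hyp_tangent X" by (intro subspace_scale subspace_hyp_tangent pT)
    show "mink ((1 / sqrt (mink p p)) *\<^sub>R p) ((1 / sqrt (mink p p)) *\<^sub>R p) = 1"
      using pp by (simp add: mink_simps)
    fix w assume w: "w \<in> hyp_tangent X" "mink (outward_normal K X) w < 0"
    then have "mink p w \<le> 0"
      using outward_normal_is_normal[OF dom Xb] by (intro le) (auto simp: is_normal_def)
    then show "mink ((1 / sqrt (mink p p)) *\<^sub>R p) w \<le> 0"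
      using pp by (simp add: mink_scaleR_left divide_le_0_iff)
  qed
qed

text \<open>
  Projecting along the null direction \<open>(z, 1)\<close> maps the hyperboloid onto a half-space. Horoballs
  centred at \<open>z\<close> become half-spaces, and all other horoballs are convex in this chart.
\<close>
definition null_chart :: "'n::finite espace \<Rightarrow> 'n minkowski \<Rightarrow> 'n espace" where
  "null_chart z X = snd X *\<^sub>R z - fst X"

text \<open>The last coordinate of the point of the hyperboloid over \<open>y\<close>: the square of
  a vector \<open>(t *\<^sub>R z - y, t)\<close> is affine in \<open>t\<close> when \<open>z\<close>
  is a unit vector, and equals -1 for this value.\<close>

definition null_height :: "'n::finite espace \<Rightarrow> 'n espace \<Rightarrow> real" where
  "null_height z y = (1 + y \<bullet> y) / (2 * (y \<bullet> z))"

definition null_lift :: "'n::finite espace \<Rightarrow> 'n espace \<Rightarrow> 'n minkowski" where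
  "null_lift z y = (null_height z y *\<^sub>R z - y, null_height z y)"

text \<open>This and \<open>null_height_dd\<close> are the first and second derivative of the height
  at \<open>c\<close> along \<open>v\<close>.\<close>

definition null_height_d :: "'n::finite espace \<Rightarrow> 'n espace \<Rightarrow> 'n espace \<Rightarrow> real" where
  "null_height_d z c v = (c \<bullet> v) / (c \<bullet> z) - (1 + c \<bullet> c) * (v \<bullet> z) / (2 * (c \<bullet> z)\<^sup>2)"

definition null_height_dd :: "'n::finite espace \<Rightarrow> 'n espace \<Rightarrow> 'n espace \<Rightarrow> real" where
  "null_height_dd z c v = (v \<bullet> v) / (c \<bullet> z) - 2 * (c \<bullet> v) * (v \<bullet> z) / (c \<bullet> z)\<^sup>2
     + (1 + c \<bullet> c) * (v \<bullet> z)\<^sup>2 / (c \<bullet> z) ^ 3"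

definition null_lift_d :: "'n::finite espace \<Rightarrow> 'n espace \<Rightarrow> 'n espace \<Rightarrow> 'n minkowski" where
  "null_lift_d z c v = null_height_d z c v *\<^sub>R (z, 1) - (v, 0)"

context
  fixes z :: "'n::finite espace"
  assumes z: "norm z = 1"
begin

lemma zz: "z \<bullet> z = 1" using z by (simp add: norm_eq_1)

lemma null_chart_inner: "null_chart z X \<bullet> z = - mink X (z, 1)"
  by (simp add: null_chart_def mink_def inner_diff_left zz)

lemma null_chart_pos: "X \<in> hyp_space \<Longrightarrow> null_chart z X \<bullet> z > 0"
  using mink_hyp_null_neg[OF _ z] by (simp add: null_chart_inner)

lemma null_lift_chart:
  assumes "X \<in> hyp_space"
  shows "null_lift z (null_chart z X) = X"
proof -
  have p: "null_chart z X \<bullet> z > 0" using null_chart_pos[OF assms] .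
  have "1 + null_chart z X \<bullet> null_chart z X = 2 * (null_chart z X \<bullet> z) * snd X"
    using hyp_spaceD(3)[OF assms] zz
    by (simp add: null_chart_def inner_diff_left inner_diff_right inner_commute algebra_simps)
  then have "null_height z (null_chart z X) = snd X" unfolding null_height_def using p by simp
  then show ?thesis by (simp add: null_lift_def null_chart_def prod_eq_iff)
qed

lemma null_chart_lift: "null_chart z (null_lift z y) = y"
  by (simp add: null_chart_def null_lift_def)

lemma null_lift_in:
  assumes "y \<bullet> z > 0"
  shows "null_lift z y \<in> hyp_space"
proof -
  have h: "2 * (y \<bullet> z) * null_height z y = 1 + y \<bullet> y" using assms by (simp add: null_height_def)
  have "null_height z y > 0" unfolding null_height_def using assms one_plus_inner_pos[of y] by simp
  moreover have "mink (null_lift z y) (null_lift z y) = y \<bullet> y - 2 * (y \<bullet> z) * null_height z y"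
    using zz by (simp add: mink_def null_lift_def inner_diff_left inner_diff_right inner_commute algebra_simps)
  ultimately show ?thesis using h by (simp add: hyp_space_def null_lift_def)
qed

lemma null_lift_derivatives:
  assumes "(c + t *\<^sub>R v) \<bullet> z > 0"
  shows "((\<lambda>t. null_height z (c + t *\<^sub>R v)) has_real_derivative null_height_d z (c + t *\<^sub>R v) v) (at t)"
    and "((\<lambda>t. null_height_d z (c + t *\<^sub>R v) v) has_real_derivative null_height_dd z (c + t *\<^sub>R v) v) (at t)"
proof -
  let ?h = "\<lambda>t. (c + t *\<^sub>R v) \<bullet> z" and ?q = "\<lambda>t. (c + t *\<^sub>R v) \<bullet> (c + t *\<^sub>R v)" and ?b = "\<lambda>t. (c + t *\<^sub>R v) \<bullet> v"
  have dh: "(?h has_real_derivative v \<bullet> z) (at t)"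
    unfolding inner_add_left inner_scaleR_left by (auto intro!: derivative_eq_intros)
  have db: "(?b has_real_derivative v \<bullet> v) (at t)"
    unfolding inner_add_left inner_scaleR_left by (auto intro!: derivative_eq_intros)
  have q: "?q = (\<lambda>t. c \<bullet> c + 2 * t * (c \<bullet> v) + t\<^sup>2 * (v \<bullet> v))"
    by (rule ext) (simp add: inner_add_left inner_add_right inner_commute[of v c] power2_eq_square algebra_simps)
  have dq: "(?q has_real_derivative 2 * ?b t) (at t)"
    unfolding q by (auto intro!: derivative_eq_intros simp: inner_add_left)
  have nz: "?h t \<noteq> 0" using assms by simp
  have D1: "((\<lambda>t. (1 + ?q t) / (2 * ?h t)) has_real_derivative
      ((0 + 2 * ?b t) * (2 * ?h t) - (1 + ?q t) * (2 * (v \<bullet> z))) / ((2 * ?h t) * (2 * ?h t))) (at t)"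
    using nz by (intro DERIV_divide DERIV_add DERIV_const dq DERIV_cmult dh) simp
  have A1: "((0 + 2 * b) * (2 * h) - (1 + q) * (2 * k)) / ((2 * h) * (2 * h)) = b / h - (1 + q) * k / (2 * h\<^sup>2)"
    if "h \<noteq> 0" for b h q k :: real using that by (simp add: field_simps power2_eq_square)
  show "((\<lambda>t. null_height z (c + t *\<^sub>R v)) has_real_derivative null_height_d z (c + t *\<^sub>R v) v) (at t)"
    unfolding null_height_def null_height_d_def by (rule DERIV_cong[OF D1 A1[OF nz]])
  have D2: "((\<lambda>t. ?b t / ?h t - ((1 + ?q t) * (v \<bullet> z)) / (2 * (?h t)\<^sup>2)) has_real_derivative
      (v \<bullet> v * ?h t - ?b t * (v \<bullet> z)) / (?h t * ?h t) -
      (((0 + 2 * ?b t) * (v \<bullet> z)) * (2 * (?h t)\<^sup>2) - ((1 + ?q t) * (v \<bullet> z)) * (2 * (of_nat 2 * (v \<bullet> z * (?h t) ^ (2 - Suc 0))))) /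
        ((2 * (?h t)\<^sup>2) * (2 * (?h t)\<^sup>2))) (at t)"
    using nz by (intro DERIV_diff DERIV_divide db dh DERIV_cmult_right DERIV_add DERIV_const dq DERIV_cmult DERIV_power) simp_all
  have A2: "(n * h - b * k) / (h * h) - (((0 + 2 * b) * k) * (2 * h\<^sup>2) - ((1 + q) * k) * (2 * (of_nat 2 * (k * h ^ (2 - Suc 0))))) /
        ((2 * h\<^sup>2) * (2 * h\<^sup>2)) = n / h - 2 * b * k / h\<^sup>2 + (1 + q) * k\<^sup>2 / h ^ 3"
    if "h \<noteq> 0" for n b h q k :: real
    using that by (simp add: divide_simps power2_eq_square power3_eq_cube) (simp add: algebra_simps)
  show "((\<lambda>t. null_height_d z (c + t *\<^sub>R v) v) has_real_derivative null_height_dd z (c + t *\<^sub>R v) v) (at t)"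
    unfolding null_height_d_def null_height_dd_def by (rule DERIV_cong[OF D2 A2[OF nz]])
qed

lemma null_lift_curve:
  assumes "(c + t *\<^sub>R v) \<bullet> z > 0"
  shows "((\<lambda>t. null_lift z (c + t *\<^sub>R v)) has_derivative (\<lambda>s. s *\<^sub>R null_lift_d z (c + t *\<^sub>R v) v)) (at t)"
    and "((\<lambda>t. null_lift_d z (c + t *\<^sub>R v) v) has_derivative (\<lambda>s. s *\<^sub>R (null_height_dd z (c + t *\<^sub>R v) v *\<^sub>R (z, 1)))) (at t)"
proof -
  note d = null_lift_derivatives[OF assms]
  have e: "null_lift z y = null_height z y *\<^sub>R (z, 1) - (y, 0)" for y by (simp add: null_lift_def)
  have 1: "((\<lambda>t. (c + t *\<^sub>R v, 0::real)) has_derivative (\<lambda>s. (s *\<^sub>R v, 0))) (at t)"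
    by (auto intro!: derivative_eq_intros)
  have "((\<lambda>t. null_height z (c + t *\<^sub>R v) *\<^sub>R (z, 1::real) - (c + t *\<^sub>R v, 0)) has_derivative
      (\<lambda>s. (null_height_d z (c + t *\<^sub>R v) v * s) *\<^sub>R (z, 1) - (s *\<^sub>R v, 0))) (at t)"
    by (intro has_derivative_diff 1 has_derivative_scaleR_left d(1)[unfolded has_field_derivative_def])
  then show "((\<lambda>t. null_lift z (c + t *\<^sub>R v)) has_derivative (\<lambda>s. s *\<^sub>R null_lift_d z (c + t *\<^sub>R v) v)) (at t)"
    unfolding e null_lift_d_def by (simp add: algebra_simps)
  have "((\<lambda>t. null_height_d z (c + t *\<^sub>R v) v *\<^sub>R (z, 1::real) - (v, 0)) has_derivative
      (\<lambda>s. (null_height_dd z (c + t *\<^sub>R v) v * s) *\<^sub>R (z, 1) - 0)) (at t)"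
    by (intro has_derivative_diff has_derivative_const has_derivative_scaleR_left d(2)[unfolded has_field_derivative_def])
  then show "((\<lambda>t. null_lift_d z (c + t *\<^sub>R v) v) has_derivative (\<lambda>s. s *\<^sub>R (null_height_dd z (c + t *\<^sub>R v) v *\<^sub>R (z, 1)))) (at t)"
    unfolding null_lift_d_def by (simp add: mult.commute)
qed

text \<open>The second identity ties the metric to the height: differentiate the square of
  \<open>null_lift\<close> twice along a line. The second derivative of the lift is
  \<open>null_height_dd\<close> times \<open>(z, 1)\<close>, whose product with the lift is
  \<open>- (c \<bullet> z)\<close>.\<close>

lemma null_lift_d_props:
  assumes "c \<bullet> z > 0"
  shows "mink (null_lift z c) (null_lift_d z c v) = 0"
    and "mink (null_lift_d z c v) (null_lift_d z c v) = (c \<bullet> z) * null_height_dd z c v"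
    and "null_chart z (null_lift_d z c v) = v"
    and "mink (z, 1) (null_lift_d z c v) = - (v \<bullet> z)"
proof -
  have "mink (null_lift z c) (null_lift_d z c v) = c \<bullet> v - null_height z c * (v \<bullet> z) - null_height_d z c v * (c \<bullet> z)"
    using zz by (simp add: mink_def null_lift_def null_lift_d_def inner_diff_left inner_diff_right inner_commute algebra_simps)
  also have "\<dots> = 0" unfolding null_height_def null_height_d_def using assms
    by (simp add: divide_simps power2_eq_square)
  finally show "mink (null_lift z c) (null_lift_d z c v) = 0" .
  have "mink (null_lift_d z c v) (null_lift_d z c v) = v \<bullet> v - 2 * null_height_d z c v * (v \<bullet> z)"
    using zz by (simp add: mink_def null_lift_d_def inner_diff_left inner_diff_right inner_commute algebra_simps)
  also have "\<dots> = (c \<bullet> z) * null_height_dd z c v" unfolding null_height_d_def null_height_dd_def using assms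
    by (simp add: divide_simps power2_eq_square power3_eq_cube) (simp add: algebra_simps)
  finally show "mink (null_lift_d z c v) (null_lift_d z c v) = (c \<bullet> z) * null_height_dd z c v" .
  show "null_chart z (null_lift_d z c v) = v" by (simp add: null_chart_def null_lift_d_def)
  show "mink (z, 1) (null_lift_d z c v) = - (v \<bullet> z)"
    using zz by (simp add: mink_def null_lift_d_def inner_diff_right inner_commute)
qed

lemma continuous_on_null_lift: "continuous_on {y. y \<bullet> z > 0} (null_lift z)"
  unfolding null_lift_def null_height_def by (intro continuous_intros) auto

lemma open_half: "open {y. y \<bullet> z > 0}"
  by (intro open_Collect_less continuous_intros)

end

section \<open>Local strict convexity in the null chart\<close>

text \<open>A nonnegative value inside would give an interior maximum, a critical point with
  positive second derivative, and \<open>f\<close> would increase to the right of it. Only critical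
  points are tested because the second fundamental form speaks only about directions tangent to a
  level set.\<close>

lemma negative_between_zeros:
  fixes f :: "real \<Rightarrow> real"
  assumes f: "\<And>t. 0 \<le> t \<Longrightarrow> t \<le> 1 \<Longrightarrow> (f has_real_derivative f' t) (at t)"
    and f': "\<And>t. 0 \<le> t \<Longrightarrow> t \<le> 1 \<Longrightarrow> (f' has_real_derivative f'' t) (at t)"
    and crit: "\<And>t. 0 \<le> t \<Longrightarrow> t \<le> 1 \<Longrightarrow> f' t = 0 \<Longrightarrow> f'' t > 0"
    and ends: "f 0 \<le> 0" "f 1 \<le> 0" and t: "0 < t" "t < 1"
  shows "f t < 0"
proof (rule ccontr)
  assume nt: "\<not> f t < 0"
  have "continuous_on {0..1} f"
    by (intro continuous_at_imp_continuous_on ballI) (rule DERIV_isCont[OF f], auto)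
  then obtain s0 where s0: "s0 \<in> {0..1}" "\<And>y. y \<in> {0..1} \<Longrightarrow> f y \<le> f s0"
    using continuous_attains_sup[of "{0..1::real}" f] by auto
  \<comment> \<open>If the maximum sits at an end, its value is at most 0 and hence at most
    \<open>f t\<close>; then \<open>t\<close> is a maximum point too.\<close>
  define s where "s = (if s0 \<in> {0<..<1} then s0 else t)"
  have s: "0 < s" "s < 1" "\<And>y. y \<in> {0..1} \<Longrightarrow> f y \<le> f s"
  proof -
    show "0 < s" "s < 1" using t by (auto simp: s_def)
    show "f y \<le> f s" if y: "y \<in> {0..1}" for y
    proof (cases "s0 \<in> {0<..<1}")
      case True then show ?thesis using s0(2)[OF y] by (simp add: s_def)
    next
      case False
      then have "s0 = 0 \<or> s0 = 1" using s0(1) by auto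
      then have "f s0 \<le> f t" using ends nt by auto
      then show ?thesis using s0(2)[OF y] False by (simp add: s_def)
    qed
  qed
  have ds: "(f has_real_derivative f' s) (at s)" using s f by simp
  have "f' s = 0"
  proof (rule DERIV_local_max[OF ds, of "min s (1 - s)"])
    show "0 < min s (1 - s)" using s by simp
    show "\<forall>y. \<bar>s - y\<bar> < min s (1 - s) \<longrightarrow> f y \<le> f s" using s(3) by (auto simp: abs_less_iff)
  qed
  then have pos: "f'' s > 0" using crit s by simp
  obtain e where e: "e > 0" "\<And>h. 0 < h \<Longrightarrow> h < e \<Longrightarrow> f' s < f' (s + h)"
    using DERIV_pos_inc_right[OF f' pos] s by auto
  define h where "h = min (e / 2) ((1 - s) / 2)"
  have h: "0 < h" "h < e" "s + h \<le> 1" using e s by (auto simp: h_def min_def field_simps)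
  have "f s < f (s + h)"
  proof (rule DERIV_pos_imp_increasing_open[of s "s + h" f])
    show "\<exists>y. (f has_real_derivative y) (at x) \<and> 0 < y" if "s < x" "x < s + h" for x
      using f[of x] e(2)[of "x - s"] that s h \<open>f' s = 0\<close> by (intro exI[of _ "f' x"]) auto
    show "continuous_on {s..s + h} f"
      by (intro continuous_at_imp_continuous_on ballI) (rule DERIV_isCont[OF f], use s h in auto)
  qed (use h in simp)
  moreover have "s + h \<in> {0..1}" using s(1) h by simp
  ultimately show False using s(3) by fastforce
qed

context boundary_piece
begin

definition "chart_d1 z c v = g (null_lift z c) \<bullet> null_lift_d z c v"
text \<open>The second summand is due to the bending of the lift, whose second derivative along a
  line points in the direction \<open>(z, 1)\<close>.\<close>

definition "chart_d2 z c v = H (null_lift z c) (null_lift_d z c v) \<bullet> null_lift_d z c v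
   + null_height_dd z c v * (g (null_lift z c) \<bullet> (z, 1))"

lemma chart_derivatives:
  assumes z: "norm z = 1" and c: "(c + t *\<^sub>R v) \<bullet> z > 0" "null_lift z (c + t *\<^sub>R v) \<in> W"
  shows "((\<lambda>t. \<rho> (null_lift z (c + t *\<^sub>R v))) has_real_derivative chart_d1 z (c + t *\<^sub>R v) v) (at t)"
    and "((\<lambda>t. chart_d1 z (c + t *\<^sub>R v) v) has_real_derivative chart_d2 z (c + t *\<^sub>R v) v) (at t)"
proof -
  note d = null_lift_curve[OF z c(1)]
  have "((\<lambda>t. \<rho> (null_lift z (c + t *\<^sub>R v))) has_derivative
      (\<lambda>s. g (null_lift z (c + t *\<^sub>R v)) \<bullet> (s *\<^sub>R null_lift_d z (c + t *\<^sub>R v) v))) (at t)"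
    by (rule has_derivative_compose[OF d(1) der[OF c(2)]])
  then show "((\<lambda>t. \<rho> (null_lift z (c + t *\<^sub>R v))) has_real_derivative chart_d1 z (c + t *\<^sub>R v) v) (at t)"
    by (simp add: has_field_derivative_def chart_d1_def mult_commute_abs)
  have lH: "linear (H (null_lift z (c + t *\<^sub>R v)))" using derg[OF c(2)] by (rule has_derivative_linear)
  have "((\<lambda>t. g (null_lift z (c + t *\<^sub>R v))) has_derivative
      (\<lambda>s. H (null_lift z (c + t *\<^sub>R v)) (s *\<^sub>R null_lift_d z (c + t *\<^sub>R v) v))) (at t)"
    by (rule has_derivative_compose[OF d(1) derg[OF c(2)]])
  from has_derivative_inner[OF this d(2)]
  show "((\<lambda>t. chart_d1 z (c + t *\<^sub>R v) v) has_real_derivative chart_d2 z (c + t *\<^sub>R v) v) (at t)"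
    unfolding has_field_derivative_def chart_d1_def chart_d2_def
    by (rule back_subst[of "\<lambda>f. (_ has_derivative f) (at t)"])
       (rule ext, simp only: linear_scale[OF lH] inner_scaleR_left inner_scaleR_right, simp only: algebra_simps)
qed

text \<open>In a direction tangent to the boundary the second derivative is
  \<open>q * (II + m / h * mink (N X) (z, 1))\<close>, with \<open>m\<close> the squared length and
  \<open>II\<close> the second fundamental form of the lifted vector. Since X - \<nu> is future
  null, the product of \<nu> with \<open>(z, 1)\<close> is at least \<open>- h\<close>; curvatures
  greater than 1 outweigh this term.\<close>

lemma chart_d2_pos:
  assumes dom: "uniformly_h_convex_domain K" and X: "X \<in> W" "X \<in> hyp_boundary K" and z: "norm z = 1"
    and v: "v \<noteq> 0" "chart_d1 z (null_chart z X) v = 0"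
  shows "chart_d2 z (null_chart z X) v > 0"
proof -
  have d: "smooth_bounded_domain K" using dom by (simp add: uniformly_h_convex_domain_def)
  have XH: "X \<in> hyp_space" using smooth_bounded_domainD(5)[OF d X(2)] .
  define c where "c = null_chart z X"
  have c: "c \<bullet> z > 0" unfolding c_def by (rule null_chart_pos[OF z XH])
  have lc: "null_lift z c = X" unfolding c_def by (rule null_lift_chart[OF z XH])
  define w where "w = null_lift_d z c v"
  note wp = null_lift_d_props[OF z c, of v, folded w_def, unfolded lc]
  define h where "h = c \<bullet> z"
  have h: "h > 0" "mink X (z, 1) = - h" using c null_chart_inner[OF z, of X] by (simp_all add: h_def c_def)
  have wT: "w \<in> hyp_tangent X" using wp(1) by (simp add: hyp_tangent_def)
  have gw: "g X \<bullet> w = 0" using v(2) unfolding chart_d1_def c_def[symmetric] lc w_def .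
  have gG: "sqrt (mink (G X) (G X)) > 0" using nondeg[OF X(1)] by simp
  then have "mink (N X) w = 0" using N_props(3)[OF X(1) XH wT] gw by simp
  then have wB: "w \<in> boundary_tangent K X"
    using wT outward_normal_eq[OF d X] by (simp add: boundary_tangent_def mink_commute)
  have "w \<noteq> 0" using wp(3) v(1) by (auto simp: null_chart_def)
  define q where "q = sqrt (mink (G X) (G X))"
  define m where "m = mink w w"
  define II where "II = mink (shape_operator K X w) w"
  have IIm: "II > m" unfolding II_def m_def by (rule shape_operator_gt[OF dom X(2) wB \<open>w \<noteq> 0\<close>])
  have m: "m > 0" unfolding m_def by (rule hyp_tangent_pos[OF XH wT \<open>w \<noteq> 0\<close>])
  have Hw: "H X w \<bullet> w = q * II - (g X \<bullet> X) * m"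
    using shape_operator_form[OF d X wB wB] gG unfolding q_def II_def m_def by (simp add: field_simps)
  have gl: "g X \<bullet> (z, 1) = q * mink (N X) (z, 1) + (g X \<bullet> X) * h"
  proof -
    have "q *\<^sub>R N X = G X" unfolding N_def q_def using gG by simp
    then have "q * mink (N X) (z, 1) = mink (G X) (z, 1)" by (metis mink_scaleR_left)
    also have "\<dots> = g X \<bullet> (z, 1) + (g X \<bullet> X) * mink X (z, 1)"
      unfolding tangential_gradient_def by (simp only: mink_add_left mink_scaleR_left mink_flip)
    finally show ?thesis using h(2) by simp
  qed
  have Nl: "mink (N X) (z, 1) \<ge> - h"
  proof -
    note gp = gauss_dir_props[OF d X(2)]
    have "X - N X = gauss_speed K X *\<^sub>R (gauss_dir K X, 1)" using gp(3) outward_normal_eq[OF d X] by simp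
    then have "mink X (z, 1) - mink (N X) (z, 1) = gauss_speed K X * mink (gauss_dir K X, 1) (z, 1)"
      by (metis mink_diff_left mink_scaleR_left)
    also have "\<dots> \<le> 0" using gp(1,2) z mink_null_le_0[of "gauss_dir K X" z] by (simp add: mult_le_0_iff)
    finally show ?thesis using h(2) by simp
  qed
  have dd: "null_height_dd z c v = m / h" using wp(2) h(1) unfolding m_def h_def by simp
  \<comment> \<open>The terms with \<open>g X \<bullet> X\<close>, which depend on how \<rho> is
    extended off the hyperboloid, cancel.\<close>
  have "chart_d2 z c v = q * II - (g X \<bullet> X) * m + m / h * (q * mink (N X) (z, 1) + (g X \<bullet> X) * h)"
    unfolding chart_d2_def lc w_def[symmetric] Hw dd gl ..
  also have "\<dots> = q * (II + m / h * mink (N X) (z, 1))" using h(1) by (simp add: field_simps)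
  also have "\<dots> > 0"
  proof -
    have "m / h * mink (N X) (z, 1) \<ge> m / h * (- h)" using Nl m h(1) by (intro mult_left_mono) auto
    also have "m / h * (- h) = - m" using h(1) by simp
    finally have "II + m / h * mink (N X) (z, 1) > 0" using IIm by linarith
    then show ?thesis using gG unfolding q_def by simp
  qed
  finally show ?thesis unfolding c_def .
qed

text \<open>The condition that \<open>chart_d1\<close> is nonzero or \<open>chart_d2\<close>
  positive is open in point and direction. It holds at the boundary point for all unit directions,
  so by compactness on a whole ball; there \<rho> is negative on a chord between two points of the
  image.\<close>

lemma chart_locally_strictly_convex:
  assumes dom: "uniformly_h_convex_domain K" and X: "X \<in> W" "X \<in> hyp_boundary K" and z: "norm z = 1"
  shows "\<exists>e>0. \<forall>a\<in>null_chart z ` K \<inter> ball (null_chart z X) e. \<forall>b\<in>null_chart z ` K \<inter> ball (null_chart z X) e.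
        a \<noteq> b \<longrightarrow> open_segment a b \<subseteq> interior (null_chart z ` K)"
proof -
  have d: "smooth_bounded_domain K" using dom by (simp add: uniformly_h_convex_domain_def)
  have XH: "X \<in> hyp_space" using smooth_bounded_domainD(5)[OF d X(2)] .
  define c0 where "c0 = null_chart z X"
  define \<Omega> where "\<Omega> = null_lift z -` W \<inter> {y. y \<bullet> z > 0}"
  have o\<Omega>: "open \<Omega>" unfolding \<Omega>_def
    using continuous_on_null_lift[OF z] W by (simp add: continuous_on_open_vimage[OF open_half[OF z]])
  have c0: "c0 \<in> \<Omega>" unfolding c0_def \<Omega>_def using null_chart_pos[OF z XH] null_lift_chart[OF z XH] X(1) by simp
  let ?P = "\<Omega> \<times> (UNIV :: 'n espace set)"
  have cl: "continuous_on ?P (\<lambda>q. null_lift z (fst q))"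
    by (rule continuous_on_compose2[OF continuous_on_null_lift[OF z]]) (auto intro!: continuous_intros simp: \<Omega>_def)
  have cg: "continuous_on ?P (\<lambda>q. g (null_lift z (fst q)))"
    by (rule continuous_on_compose2[OF cont_g cl]) (auto simp: \<Omega>_def)
  have nz: "\<forall>q\<in>?P. fst q \<bullet> z \<noteq> 0" by (auto simp: \<Omega>_def)
  have chd: "continuous_on ?P (\<lambda>q. null_height_d z (fst q) (snd q))"
    unfolding null_height_d_def using nz by (intro continuous_intros) auto
  have chdd: "continuous_on ?P (\<lambda>q. null_height_dd z (fst q) (snd q))"
    unfolding null_height_dd_def using nz by (intro continuous_intros) auto
  have cd: "continuous_on ?P (\<lambda>q. null_lift_d z (fst q) (snd q))"
    unfolding null_lift_d_def by (intro continuous_intros chd)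
  have cH: "continuous_on ?P (\<lambda>q. H (null_lift z (fst q)) (null_lift_d z (fst q) (snd q)))"
  proof -
    have eq: "H (null_lift z (fst q)) w = (\<Sum>b\<in>Basis. (w \<bullet> b) *\<^sub>R H (null_lift z (fst q)) b)" if "q \<in> ?P" for q w
    proof -
      have "null_lift z (fst q) \<in> W" using that by (auto simp: \<Omega>_def)
      then have lH: "linear (H (null_lift z (fst q)))" using derg has_derivative_linear by blast
      have "H (null_lift z (fst q)) w = H (null_lift z (fst q)) (\<Sum>b\<in>Basis. (w \<bullet> b) *\<^sub>R b)"
        by (simp add: euclidean_representation)
      then show ?thesis by (simp add: linear_sum[OF lH] linear_scale[OF lH])
    qed
    have "continuous_on ?P (\<lambda>q. H (null_lift z (fst q)) b)" for b
      by (rule continuous_on_compose2[OF contH cl]) (auto simp: \<Omega>_def)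
    then have "continuous_on ?P (\<lambda>q. \<Sum>b\<in>Basis. (null_lift_d z (fst q) (snd q) \<bullet> b) *\<^sub>R H (null_lift z (fst q)) b)"
      by (intro continuous_intros cd)
    then show ?thesis by (rule continuous_on_eq) (rule eq[symmetric])
  qed
  have c1: "continuous_on ?P (\<lambda>q. chart_d1 z (fst q) (snd q))"
    unfolding chart_d1_def by (intro continuous_intros cg cd)
  have c2: "continuous_on ?P (\<lambda>q. chart_d2 z (fst q) (snd q))"
    unfolding chart_d2_def by (intro continuous_intros cg cd cH chdd)
  define Good where "Good = ((\<lambda>q. chart_d1 z (fst q) (snd q)) -` (- {0}) \<inter> ?P) \<union> ((\<lambda>q. chart_d2 z (fst q) (snd q)) -` {0<..} \<inter> ?P)"
  have oP: "open ?P" by (intro open_Times o\<Omega>) simp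
  have oG: "open Good" unfolding Good_def
    using c1 c2 by (intro open_Un) (simp_all add: continuous_on_open_vimage[OF oP] open_Compl)
  have "{c0} \<times> sphere 0 1 \<subseteq> Good"
  proof
    fix q assume "q \<in> {c0} \<times> sphere (0::'n espace) 1"
    then have q: "fst q = c0" "snd q \<noteq> 0" by auto
    then have "chart_d1 z (fst q) (snd q) = 0 \<Longrightarrow> chart_d2 z (fst q) (snd q) > 0"
      using chart_d2_pos[OF dom X z, of "snd q"] unfolding c0_def by simp
    then show "q \<in> Good" unfolding Good_def using c0 q(1) by (cases q) auto
  qed
  from Elementary_Topology.tube_lemma[OF compact_sphere oG this]
  obtain X0 where X0: "c0 \<in> X0" "open X0" "X0 \<times> sphere 0 1 \<subseteq> Good" by blast
  have "open (X0 \<inter> \<Omega>)" using X0 o\<Omega> by blast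
  then obtain e where e: "e > 0" "ball c0 e \<subseteq> X0 \<inter> \<Omega>"
    using X0(1) c0 open_contains_ball by (metis IntI)
  \<comment> \<open>From unit directions to all directions: \<open>chart_d1\<close> is homogeneous
    of degree 1 and \<open>chart_d2\<close> of degree 2 in the direction.\<close>
  have crit: "chart_d2 z c v > 0" if c: "c \<in> ball c0 e" and v: "v \<noteq> 0" "chart_d1 z c v = 0" for c v
  proof -
    have cz: "c \<bullet> z \<noteq> 0" "null_lift z c \<in> W" using c e(2) by (auto simp: \<Omega>_def)
    define l where "l = 1 / norm v"
    have l: "l > 0" using v by (simp add: l_def)
    have sc: "null_lift_d z c (l *\<^sub>R v) = l *\<^sub>R null_lift_d z c v" "null_height_dd z c (l *\<^sub>R v) = l\<^sup>2 * null_height_dd z c v"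
      unfolding null_lift_d_def null_height_d_def null_height_dd_def
      by (simp_all add: algebra_simps power2_eq_square add_divide_distrib diff_divide_distrib)
    have lH: "linear (H (null_lift z c))" using derg[OF cz(2)] has_derivative_linear by blast
    have "(c, l *\<^sub>R v) \<in> Good" using X0(3) c e(2) v by (intro subsetD[OF X0(3)]) (auto simp: l_def)
    moreover have "chart_d1 z c (l *\<^sub>R v) = 0" unfolding chart_d1_def sc using v(2) by (simp add: chart_d1_def)
    ultimately have "chart_d2 z c (l *\<^sub>R v) > 0" unfolding Good_def by auto
    moreover have "chart_d2 z c (l *\<^sub>R v) = l\<^sup>2 * chart_d2 z c v"
      unfolding chart_d2_def sc by (simp add: linear_scale[OF lH] power2_eq_square algebra_simps)
    ultimately show ?thesis using l by (simp add: zero_less_mult_iff)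
  qed
  have Kin: "\<rho> (null_lift z y) \<le> 0" if y: "y \<in> null_chart z ` K" "y \<in> \<Omega>" for y
  proof -
    obtain Y where Y: "Y \<in> K" "y = null_chart z Y" using y(1) by blast
    then have "Y \<in> hyp_space" using K by blast
    then have "null_lift z y = Y" unfolding Y(2) by (rule null_lift_chart[OF z])
    then have "null_lift z y \<in> K \<inter> W" using y(2) Y(1) by (simp add: \<Omega>_def)
    then show ?thesis unfolding KW by simp
  qed
  have int: "y \<in> interior (null_chart z ` K)" if y: "y \<in> \<Omega>" "\<rho> (null_lift z y) < 0" for y
  proof -
    have "continuous_on \<Omega> (\<lambda>y. \<rho> (null_lift z y))"
      by (rule continuous_on_compose2[OF cont_rho continuous_on_subset[OF continuous_on_null_lift[OF z]]])
         (auto simp: \<Omega>_def)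
    then have o: "open ((\<lambda>y. \<rho> (null_lift z y)) -` {..<0} \<inter> \<Omega>)"
      by (simp add: continuous_on_open_vimage[OF o\<Omega>])
    have "(\<lambda>y. \<rho> (null_lift z y)) -` {..<0} \<inter> \<Omega> \<subseteq> null_chart z ` K"
    proof
      fix y assume "y \<in> (\<lambda>y. \<rho> (null_lift z y)) -` {..<0} \<inter> \<Omega>"
      then have "null_lift z y \<in> {Y \<in> hyp_space \<inter> W. \<rho> Y \<le> 0}"
        using null_lift_in[OF z, of y] by (simp add: \<Omega>_def)
      then have "null_lift z y \<in> K" unfolding KW[symmetric] by simp
      then show "y \<in> null_chart z ` K" using null_chart_lift[OF z, of y] by (metis imageI)
    qed
    then show ?thesis using o y by (intro interiorI) auto
  qed
  show ?thesis
  proof (intro exI[of _ e] conjI ballI impI subsetI)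
    fix a b p assume a: "a \<in> null_chart z ` K \<inter> ball (null_chart z X) e" and b: "b \<in> null_chart z ` K \<inter> ball (null_chart z X) e"
      and ab: "a \<noteq> b" and p: "p \<in> open_segment a b"
    obtain t where t: "0 < t" "t < 1" "p = (1 - t) *\<^sub>R a + t *\<^sub>R b" using p by (auto simp: in_segment)
    have line: "a + s *\<^sub>R (b - a) \<in> ball c0 e" if "0 \<le> s" "s \<le> 1" for s
    proof -
      have "(1 - s) *\<^sub>R a + s *\<^sub>R b \<in> ball c0 e"
        using convexD_alt[OF convex_ball] a b that unfolding c0_def by blast
      then show ?thesis by (simp add: algebra_simps)
    qed
    have lin\<Omega>: "a + s *\<^sub>R (b - a) \<in> \<Omega>" if "0 \<le> s" "s \<le> 1" for s using line[OF that] e(2) by blast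
    then have lW: "(a + s *\<^sub>R (b - a)) \<bullet> z > 0" "null_lift z (a + s *\<^sub>R (b - a)) \<in> W" if "0 \<le> s" "s \<le> 1" for s
      using that unfolding \<Omega>_def by blast+
    have "\<rho> (null_lift z (a + t *\<^sub>R (b - a))) < 0"
    proof (rule negative_between_zeros[where f = "\<lambda>s. \<rho> (null_lift z (a + s *\<^sub>R (b - a)))"
          and f' = "\<lambda>s. chart_d1 z (a + s *\<^sub>R (b - a)) (b - a)" and f'' = "\<lambda>s. chart_d2 z (a + s *\<^sub>R (b - a)) (b - a)"])
      show "\<rho> (null_lift z (a + 0 *\<^sub>R (b - a))) \<le> 0" using Kin[of a] a lin\<Omega>[of 0] by simp
      show "\<rho> (null_lift z (a + 1 *\<^sub>R (b - a))) \<le> 0" using Kin[of b] b lin\<Omega>[of 1] by simp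
      show "chart_d2 z (a + s *\<^sub>R (b - a)) (b - a) > 0"
        if "0 \<le> s" "s \<le> 1" "chart_d1 z (a + s *\<^sub>R (b - a)) (b - a) = 0" for s
        using crit[OF line[OF that(1,2)] _ that(3)] ab by simp
    qed (use t chart_derivatives[OF z lW] in simp_all)
    moreover have "a + t *\<^sub>R (b - a) = p" unfolding t(3) by (simp add: algebra_simps)
    ultimately show "p \<in> interior (null_chart z ` K)" using int lin\<Omega>[of t] t by simp
  qed (rule e(1))
qed

end

lemma convex_null_chart:
  assumes dom: "uniformly_h_convex_domain K" and z: "norm z = 1"
  shows "convex (null_chart z ` K)"
proof (rule convex_if_locally_strictly_convex)
  have d: "smooth_bounded_domain K" using dom by (simp add: uniformly_h_convex_domain_def)
  note sd = smooth_bounded_domainD[OF d]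
  have c: "continuous_on K (null_chart z)" unfolding null_chart_def by (intro continuous_intros)
  show "compact (null_chart z ` K)" by (rule compact_continuous_image[OF c sd(2)])
  show "connected (null_chart z ` K)" by (rule connected_continuous_image[OF c sd(3)])
  fix y assume "y \<in> null_chart z ` K"
  then obtain X where X: "X \<in> K" "y = null_chart z X" by blast
  have XH: "X \<in> hyp_space" using X sd(1) by blast
  show "\<exists>e>0. \<forall>a\<in>null_chart z ` K \<inter> ball y e. \<forall>b\<in>null_chart z ` K \<inter> ball y e. a \<noteq> b \<longrightarrow> open_segment a b \<subseteq> interior (null_chart z ` K)"
  proof (cases "X \<in> hyp_boundary K")
    case True
    obtain W \<rho> g H where XW: "X \<in> W" and bp: "boundary_piece K W \<rho> g H" using boundary_pieceE[OF d True] .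
    show ?thesis unfolding X(2) by (rule boundary_piece.chart_locally_strictly_convex[OF bp dom XW True z])
  next
    case False
    then obtain V where V: "open V" "X \<in> V" "V \<inter> hyp_space \<subseteq> K"
      using X unfolding hyp_boundary_iff[OF sd(1,2)] by blast
    let ?O = "null_lift z -` V \<inter> {y. y \<bullet> z > 0}"
    have "open ?O" using continuous_on_null_lift[OF z] V(1) by (simp add: continuous_on_open_vimage[OF open_half[OF z]])
    moreover have "y \<in> ?O" using null_chart_pos[OF z XH] null_lift_chart[OF z XH] V(2) X(2) by simp
    ultimately obtain e where e: "e > 0" "ball y e \<subseteq> ?O" using open_contains_ball by blast
    have "?O \<subseteq> null_chart z ` K"
    proof
      fix q assume q: "q \<in> ?O"
      then have "null_lift z q \<in> V \<inter> hyp_space" using null_lift_in[OF z, of q] by simp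
      then have "null_lift z q \<in> K" using V(3) by blast
      then show "q \<in> null_chart z ` K" using null_chart_lift[OF z, of q] by (metis imageI)
    qed
    then have "ball y e \<subseteq> interior (null_chart z ` K)"
      using e(2) by (intro interior_maximal) auto
    moreover have "open_segment a b \<subseteq> ball y e" if "a \<in> ball y e" "b \<in> ball y e" for a b
      using that convex_ball[of y e] by (meson convex_contains_open_segment)
    ultimately show ?thesis using e(1) by (intro exI[of _ e]) blast
  qed
qed

text \<open>In the chart for \<open>z = gauss_dir K X\<close> the height is the linear function
  \<open>y \<bullet> z\<close>, and its level set touches the image of \<open>K\<close> at
  \<open>X\<close>. A point of \<open>K\<close> above it would, by convexity, bring a segment
  starting at \<open>X\<close> into the image, although \<rho> increases along this segment.\<close>

lemma horoball_support:
  assumes dom: "uniformly_h_convex_domain K" and X: "X \<in> hyp_boundary K" and Y: "Y \<in> K"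
  shows "- mink Y (gauss_dir K X, 1) \<le> - mink X (gauss_dir K X, 1)"
proof (rule ccontr)
  assume neg: "\<not> ?thesis"
  have d: "smooth_bounded_domain K" using dom by (simp add: uniformly_h_convex_domain_def)
  note sd = smooth_bounded_domainD[OF d] and gp = gauss_dir_props[OF d X]
  define z where "z = gauss_dir K X"
  have z: "norm z = 1" using gp(2) by (simp add: z_def)
  have XH: "X \<in> hyp_space" by (rule sd(5)[OF X])
  obtain W \<rho> g H where XW: "X \<in> W" and bp: "boundary_piece K W \<rho> g H" using boundary_pieceE[OF d X] .
  interpret bp: boundary_piece K W \<rho> g H by fact
  define c where "c = null_chart z X"
  define v where "v = null_chart z Y - c"
  have vz: "v \<bullet> z > 0" unfolding v_def c_def inner_diff_left null_chart_inner[OF z]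
    using neg by (simp add: z_def)
  have c: "c \<bullet> z > 0" unfolding c_def by (rule null_chart_pos[OF z XH])
  have lc: "null_lift z c = X" unfolding c_def by (rule null_lift_chart[OF z XH])
  define w where "w = null_lift_d z c v"
  note wp = null_lift_d_props[OF z c, of v, folded w_def, unfolded lc]
  have wT: "w \<in> hyp_tangent X" using wp(1) by (simp add: hyp_tangent_def)
  \<comment> \<open>\<nu> is X minus a positive multiple of \<open>(z, 1)\<close>, and
    \<open>w\<close> is orthogonal to \<open>X\<close>; so the product of \<nu> and \<open>w\<close>
    has the sign of \<open>v \<bullet> z\<close>.\<close>
  have "mink (outward_normal K X) w = mink X w - mink (X - outward_normal K X) w" by (simp add: mink_diff_left)
  also have "\<dots> = gauss_speed K X * (v \<bullet> z)"
    unfolding gp(3) z_def[symmetric] mink_scaleR_left wp(4) using wp(1) by simp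
  finally have "mink (bp.N X) w > 0" using gp(1) vz bp.outward_normal_eq[OF d XW X] by simp
  moreover have "sqrt (mink (bp.G X) (bp.G X)) > 0" using bp.nondeg[OF XW] by simp
  ultimately have "g X \<bullet> w > 0" using bp.N_props(3)[OF XW XH wT] by (metis mult_pos_pos)
  then have d1: "bp.chart_d1 z (c + 0 *\<^sub>R v) v > 0" by (simp add: bp.chart_d1_def lc w_def)
  have der: "((\<lambda>t. \<rho> (null_lift z (c + t *\<^sub>R v))) has_real_derivative bp.chart_d1 z (c + 0 *\<^sub>R v) v) (at 0)"
    using c lc XW by (intro bp.chart_derivatives(1)[OF z]) simp_all
  obtain e where e: "e > 0" "\<And>h. 0 < h \<Longrightarrow> h < e \<Longrightarrow> \<rho> (null_lift z (c + 0 *\<^sub>R v)) < \<rho> (null_lift z (c + (0 + h) *\<^sub>R v))"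
    using DERIV_pos_inc_right[OF der d1] by blast
  have r0: "\<rho> X = 0" using bp.boundary_iff[OF XW] X by simp
  let ?O = "null_lift z -` W \<inter> {y. y \<bullet> z > 0}"
  have oO: "open ?O" using continuous_on_null_lift[OF z] bp.W by (simp add: continuous_on_open_vimage[OF open_half[OF z]])
  have "open ((\<lambda>t. c + t *\<^sub>R v) -` ?O)" by (intro open_vimage oO continuous_intros)
  moreover have "(0::real) \<in> (\<lambda>t. c + t *\<^sub>R v) -` ?O" using c lc XW by simp
  ultimately obtain r where r: "r > 0" "ball 0 r \<subseteq> (\<lambda>t. c + t *\<^sub>R v) -` ?O" using open_contains_ball by blast
  define t where "t = min (min (e / 2) (r / 2)) 1"
  have t: "0 < t" "t < e" "t < r" "t \<le> 1" using e(1) r(1) by (auto simp: t_def)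
  have tO: "c + t *\<^sub>R v \<in> ?O" using r(2) t by (auto simp: subset_iff)
  have "(1 - t) *\<^sub>R c + t *\<^sub>R null_chart z Y \<in> null_chart z ` K"
    using convexD_alt[OF convex_null_chart[OF dom z], of c "null_chart z Y" t] sd(4)[OF X] Y t
    unfolding c_def by simp
  moreover have "(1 - t) *\<^sub>R c + t *\<^sub>R null_chart z Y = c + t *\<^sub>R v" unfolding v_def by (simp add: algebra_simps)
  ultimately obtain Z where Z: "Z \<in> K" "c + t *\<^sub>R v = null_chart z Z" by auto
  then have "Z \<in> hyp_space" using sd(1) by blast
  then have "null_lift z (c + t *\<^sub>R v) = Z" unfolding Z(2) by (rule null_lift_chart[OF z])
  then have "null_lift z (c + t *\<^sub>R v) \<in> K \<inter> W" using tO Z(1) by simp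
  then have "\<rho> (null_lift z (c + t *\<^sub>R v)) \<le> 0" unfolding bp.KW by simp
  moreover have "\<rho> (null_lift z (c + t *\<^sub>R v)) > 0" using e(2)[of t] t r0 lc by simp
  ultimately show False by simp
qed

section \<open>The Euclidean body of a horospherically convex domain\<close>

definition horo_point :: "'n::finite minkowski set \<Rightarrow> 'n minkowski \<Rightarrow> 'n espace" where
  "horo_point K X = snd X *\<^sub>R gauss_dir K X - fst X"

text \<open>The half-space description of the body. For uniformly h-convex \<open>K\<close> it is
  the same set as the union of the balls: by \<open>horo_body_eq\<close> each of its points lies on
  a segment from 0 to some horo point, and the ball belonging to that boundary point contains both
  ends.\<close>

definition horo_body :: "'n::finite minkowski set \<Rightarrow> 'n espace set" where
  "horo_body K = {P. \<forall>\<omega>\<in>sphere 0 1. P \<bullet> \<omega> \<le> horo_phi K \<omega>}"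

text \<open>Unspecified at \<open>P = 0\<close>, which is removed in the definition of \<open>cone_measure\<close>.\<close>
definition horo_foot :: "'n::finite minkowski set \<Rightarrow> 'n espace \<Rightarrow> 'n minkowski" where
  "horo_foot K P = (THE X. X \<in> hyp_boundary K \<and> (\<exists>r>0. P = r *\<^sub>R horo_point K X))"

text \<open>Lebesgue measure on the body, pushed to the boundary along rays: a piece of the boundary
  weighs as much as the cone that it spans from the origin.\<close>

definition cone_measure :: "'n::finite minkowski set \<Rightarrow> 'n minkowski measure" where
  "cone_measure K = distr (restrict_space lborel (horo_body K - {0})) (restrict_space borel (hyp_boundary K)) (horo_foot K)"

lemma vol_box_pos:
  fixes a b :: "'a::euclidean_space"
  assumes "box a b \<noteq> {}"
  shows "vol (box a b) > 0"
  using assms by (auto simp: measure_lborel_box_eq box_ne_empty less_imp_le inner_diff_left intro!: prod_pos)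

locale h_convex_domain =
  fixes K :: "'n::finite minkowski set"
  assumes dom: "uniformly_h_convex_domain K"
begin

lemma smooth: "smooth_bounded_domain K"
  using dom by (simp add: uniformly_h_convex_domain_def)

lemmas K_props = smooth_bounded_domainD[OF smooth]
lemmas gauss = gauss_dir_props[OF smooth]

lemma K_nonempty: "K \<noteq> {}"
proof -
  have "top_of_set hyp_space interior_of K \<subseteq> K" by (rule interior_of_subset)
  then show ?thesis using smooth unfolding smooth_bounded_domain_def by blast
qed

lemma height_pos: "Y \<in> K \<Longrightarrow> norm z = 1 \<Longrightarrow> - mink Y (z, 1) > 0"
  using mink_hyp_null_neg[of Y z] K_props(1) by fastforce

lemma horo_phi_eq:
  assumes z: "norm z = 1" and X: "X \<in> K" "\<And>Y. Y \<in> K \<Longrightarrow> - mink Y (z, 1) \<le> - mink X (z, 1)"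
  shows "horo_phi K z = - mink X (z, 1)"
proof -
  have "(SUP Y\<in>K. ln (- mink Y (z, 1))) = ln (- mink X (z, 1))"
  proof (rule cSup_eq_maximum)
    show "ln (- mink X (z, 1)) \<in> (\<lambda>Y. ln (- mink Y (z, 1))) ` K" using X(1) by (rule imageI)
    fix y assume "y \<in> (\<lambda>Y. ln (- mink Y (z, 1))) ` K"
    then obtain Y where Y: "Y \<in> K" "y = ln (- mink Y (z, 1))" by blast
    show "y \<le> ln (- mink X (z, 1))" unfolding Y(2)
      using X(2)[OF Y(1)] height_pos[OF Y(1) z] by (intro ln_mono) simp_all
  qed
  then show ?thesis unfolding horo_phi_def horo_support_def using height_pos[OF X(1) z] by (simp add: exp_ln)
qed

lemma maximizer_exists:
  assumes "norm z = 1"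
  obtains X where "X \<in> K" "\<And>Y. Y \<in> K \<Longrightarrow> - mink Y (z, 1) \<le> - mink X (z, 1)"
proof -
  have "continuous_on K (\<lambda>Y. - mink Y (z, 1))" by (intro continuous_intros)
  from continuous_attains_sup[OF K_props(2) K_nonempty this] show ?thesis using that by blast
qed

lemma horo_phi_ge: "norm z = 1 \<Longrightarrow> Y \<in> K \<Longrightarrow> - mink Y (z, 1) \<le> horo_phi K z"
  by (metis horo_phi_eq maximizer_exists)

lemma horo_phi_pos: "horo_phi K z > 0"
  by (simp add: horo_phi_def)

text \<open>\<open>horoball_support\<close> makes \<open>X\<close> a maximizer for its own Gauss
  image.\<close>

lemma horo_phi_gauss:
  assumes "X \<in> hyp_boundary K"
  shows "horo_phi K (gauss_dir K X) = inverse (gauss_speed K X)"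
  using horo_phi_eq[OF gauss(2)[OF assms] K_props(4)[OF assms] horoball_support[OF dom assms]] gauss(4)[OF assms]
  by simp

text \<open>The last coordinate of X - \<nu> determines the scalar factor, and then \<open>z\<close>
  as well.\<close>

lemma horo_gauss_eq:
  assumes X: "X \<in> hyp_boundary K"
  shows "horo_gauss K X = gauss_dir K X"
  unfolding horo_gauss_def
proof (rule the_equality)
  show "gauss_dir K X \<in> sphere 0 1 \<and> X - outward_normal K X = inverse (horo_phi K (gauss_dir K X)) *\<^sub>R (gauss_dir K X, 1)"
    using gauss(2,3)[OF X] horo_phi_gauss[OF X] by simp
  fix z assume z: "z \<in> sphere 0 1 \<and> X - outward_normal K X = inverse (horo_phi K z) *\<^sub>R (z, 1)"
  have zX: "inverse (horo_phi K z) *\<^sub>R (z, 1::real) = gauss_speed K X *\<^sub>R (gauss_dir K X, 1)"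
    by (rule trans[OF sym[OF conjunct2[OF z]] gauss(3)[OF X]])
  have e: "inverse (horo_phi K z) = gauss_speed K X" "inverse (horo_phi K z) *\<^sub>R z = gauss_speed K X *\<^sub>R gauss_dir K X"
    using arg_cong[OF zX, of snd] arg_cong[OF zX, of fst] by simp_all
  have "gauss_speed K X *\<^sub>R z = gauss_speed K X *\<^sub>R gauss_dir K X" using e(2) unfolding e(1) .
  then show "z = gauss_dir K X" using gauss(1)[OF X] by (simp only: scaleR_cancel_left) simp
qed

text \<open>Take the highest point \<open>X\<close> in direction \<open>z\<close>. The tangential
  part of \<open>- (z, 1)\<close> there is \<open>h *\<^sub>R X - (z, 1)\<close>, of length
  \<open>h\<close>; divided by \<open>h\<close> it is \<nu>, so X - \<nu> is a multiple of
  \<open>(z, 1)\<close>.\<close>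

lemma gauss_dir_surj:
  assumes z: "norm z = 1"
  shows "\<exists>X\<in>hyp_boundary K. gauss_dir K X = z"
proof -
  obtain X where X: "X \<in> K" "\<And>Y. Y \<in> K \<Longrightarrow> - mink Y (z, 1) \<le> - mink X (z, 1)"
    by (rule maximizer_exists[OF z]) (rule that)
  define h where "h = - mink X (z, 1)"
  have h: "h > 0" unfolding h_def by (rule height_pos[OF X(1) z])
  have XX: "mink X X = -1" using X(1) K_props(1) hyp_spaceD(1) by blast
  have zz: "mink (z, 1) (z, 1) = 0" using z by (simp add: mink_def norm_eq_1)
  define p where "p = - (z, 1) + h *\<^sub>R X"
  have pq: "p = - (z, 1) + mink (- (z, 1)) X *\<^sub>R X" by (simp only: p_def h_def mink_minus_left mink_commute[of "(z, 1)" X])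
  have pp: "mink p p = h\<^sup>2" unfolding p_def
    by (simp only: mink_simps zz XX mink_commute[of "(z, 1)" X]) (simp add: h_def power2_eq_square algebra_simps)
  have "p \<noteq> 0" using pp h by (auto simp: mink_zero)
  have mx: "mink Y (- (z, 1)) \<le> mink X (- (z, 1))" if "Y \<in> K" for Y
    using X(2)[OF that] by (simp only: mink_minus_right)
  note mn = maximizer_normal[OF smooth X(1) mx pq \<open>p \<noteq> 0\<close>]
  have nu: "outward_normal K X = (1 / h) *\<^sub>R p" using mn(2) h unfolding pp by simp
  have "(1 / h) *\<^sub>R p = X - (1 / h) *\<^sub>R (z, 1)" unfolding p_def scaleR_add_right using h by simp
  then have "X - outward_normal K X = (1 / h) *\<^sub>R (z, 1)" unfolding nu by (simp only: diff_diff_eq2) simp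
  from trans[OF sym[OF gauss(3)[OF mn(1)]] this]
  have gz: "gauss_speed K X *\<^sub>R (gauss_dir K X, 1::real) = (1 / h) *\<^sub>R (z, 1)" .
  have "gauss_speed K X = 1 / h" "gauss_speed K X *\<^sub>R gauss_dir K X = (1 / h) *\<^sub>R z"
    using arg_cong[OF gz, of snd] arg_cong[OF gz, of fst] by simp_all
  then have "gauss_dir K X = z" using h by simp
  then show ?thesis using mn(1) by blast
qed

text \<open>The heights are Lipschitz in \<open>z\<close> with a common constant, a bound for
  \<open>fst X\<close> on the compact set \<open>K\<close>; hence so is their maximum.\<close>

lemma continuous_on_horo_phi: "continuous_on (sphere 0 1) (horo_phi K)"
proof -
  have "compact (fst ` K)" by (intro compact_continuous_image K_props(2) continuous_intros)
  then obtain C where C: "C > 0" "\<And>x. x \<in> fst ` K \<Longrightarrow> norm x \<le> C"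
    using compact_imp_bounded bounded_pos by metis
  have le: "horo_phi K z \<le> horo_phi K z' + C * norm (z - z')" if z: "norm z = 1" "norm z' = 1" for z z'
  proof -
    obtain X where X: "X \<in> K" "\<And>Y. Y \<in> K \<Longrightarrow> - mink Y (z, 1) \<le> - mink X (z, 1)"
      by (rule maximizer_exists[OF z(1)]) (rule that)
    have "horo_phi K z = - mink X (z, 1)" by (rule horo_phi_eq[OF z(1) X])
    then have "horo_phi K z = - mink X (z', 1) + fst X \<bullet> (z' - z)"
      by (simp add: mink_def inner_diff_right)
    also have "- mink X (z', 1) \<le> horo_phi K z'" by (rule horo_phi_ge[OF z(2) X(1)])
    also have "fst X \<bullet> (z' - z) \<le> norm (fst X) * norm (z' - z)" by (rule norm_cauchy_schwarz)
    also have "\<dots> \<le> C * norm (z - z')" unfolding norm_minus_commute[of z']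
      using C(2) X(1) by (intro mult_right_mono) auto
    finally show ?thesis by simp
  qed
  have "C-lipschitz_on (sphere 0 1) (horo_phi K)"
  proof (rule lipschitz_onI)
    fix z z' :: "'n espace" assume "z \<in> sphere 0 1" "z' \<in> sphere 0 1"
    then show "dist (horo_phi K z) (horo_phi K z') \<le> C * dist z z'"
      using le[of z z'] le[of z' z] unfolding dist_norm by (simp add: norm_minus_commute[of z' z] abs_le_iff)
  qed (use C in simp)
  then show ?thesis by (rule lipschitz_on_continuous_on)
qed

lemma compact_boundary: "compact (hyp_boundary K)"
proof -
  have "closedin (top_of_set hyp_space) (hyp_boundary K)" by (rule closedin_frontier_of)
  then have "closedin (top_of_set K) (hyp_boundary K)"
    by (rule closedin_subset_trans) (use K_props(1,4) in blast)+
  then show ?thesis using closedin_compact[OF K_props(2)] by blast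
qed

lemma boundary_nonempty: "hyp_boundary K \<noteq> {}"
  using gauss_dir_surj[of "(0, 1)"] by auto

lemma continuous_on_outward_normal: "continuous_on (hyp_boundary K) (outward_normal K)"
  unfolding continuous_on_eq_continuous_within
  by (intro ballI) (rule has_derivative_continuous[OF outward_normal_has_derivative[OF smooth]])

lemma continuous_on_gauss_speed: "continuous_on (hyp_boundary K) (gauss_speed K)"
  unfolding gauss_speed_def by (intro continuous_intros continuous_on_outward_normal)

lemma continuous_on_gauss_dir: "continuous_on (hyp_boundary K) (gauss_dir K)"
proof -
  have "\<forall>X\<in>hyp_boundary K. gauss_speed K X \<noteq> 0" using gauss(1) by fastforce
  then show ?thesis unfolding gauss_dir_def
    by (intro continuous_intros continuous_on_outward_normal continuous_on_gauss_speed)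
qed

lemma continuous_on_horo_point: "continuous_on (hyp_boundary K) (horo_point K)"
  unfolding horo_point_def by (intro continuous_intros continuous_on_gauss_dir)

lemma horo_point_null_chart: "horo_point K X = null_chart (gauss_dir K X) X"
  by (simp add: horo_point_def null_chart_def)

lemma horo_point_inner_dir:
  assumes "X \<in> hyp_boundary K"
  shows "horo_point K X \<bullet> gauss_dir K X = horo_phi K (gauss_dir K X)"
  unfolding horo_point_null_chart null_chart_inner[OF gauss(2)[OF assms]]
  using gauss(4)[OF assms] horo_phi_gauss[OF assms] by simp

text \<open>Both sides are in fact equal. The last summand is nonpositive and vanishes only for
  \<open>z = gauss_dir K X\<close>; it makes the support inequality strict elsewhere, which gives
  injectivity.\<close>

lemma horo_point_inner_le':
  assumes X: "X \<in> hyp_boundary K" and z: "norm z = 1"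
  shows "horo_point K X \<bullet> z \<le> - mink X (z, 1) + snd X * (gauss_dir K X \<bullet> z - 1)"
  by (simp add: horo_point_def mink_def inner_diff_left algebra_simps)

lemma horo_point_inner_le:
  assumes X: "X \<in> hyp_boundary K" and z: "norm z = 1"
  shows "horo_point K X \<bullet> z \<le> horo_phi K z"
proof -
  have "gauss_dir K X \<bullet> z \<le> 1" using norm_cauchy_schwarz[of "gauss_dir K X" z] gauss(2)[OF X] z by simp
  moreover have "snd X > 0" using hyp_spaceD(2)[OF K_props(5)[OF X]] .
  ultimately have "snd X * (gauss_dir K X \<bullet> z - 1) \<le> 0" by (simp add: mult_le_0_iff)
  then show ?thesis using horo_point_inner_le'[OF X z] horo_phi_ge[OF z K_props(4)[OF X]] by linarith
qed

lemma horo_point_nonzero: "X \<in> hyp_boundary K \<Longrightarrow> horo_point K X \<noteq> 0"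
  using horo_point_inner_dir[of X] horo_phi_pos[of "gauss_dir K X"] by auto

text \<open>Testing with both Gauss directions gives \<open>r = s\<close>. Equality in the support
  inequality then forces the directions to agree, and for a fixed direction the null chart is
  injective.\<close>

lemma horo_point_scaled_inj:
  assumes X: "X \<in> hyp_boundary K" "Y \<in> hyp_boundary K" and r: "r > 0" "s > 0"
    and eq: "r *\<^sub>R horo_point K X = s *\<^sub>R horo_point K Y"
  shows "r = s" "X = Y"
proof -
  have le: "r \<le> s" if X: "X \<in> hyp_boundary K" "Y \<in> hyp_boundary K" and r: "s > 0"
    and eq: "r *\<^sub>R horo_point K X = s *\<^sub>R horo_point K Y" for X Y r s
  proof -
    have "r * horo_phi K (gauss_dir K X) = s * (horo_point K Y \<bullet> gauss_dir K X)"
      using arg_cong[OF eq, of "\<lambda>p. p \<bullet> gauss_dir K X"] horo_point_inner_dir[OF X(1)] by simp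
    also have "\<dots> \<le> s * horo_phi K (gauss_dir K X)"
      using horo_point_inner_le[OF X(2) gauss(2)[OF X(1)]] r by (intro mult_left_mono) auto
    finally show ?thesis using horo_phi_pos by (simp add: mult_le_cancel_right)
  qed
  show rs: "r = s" using le[OF X r(2) eq] le[OF X(2,1) r(1) eq[symmetric]] by simp
  then have eq': "horo_point K X = horo_point K Y" using eq r by simp
  let ?z = "gauss_dir K X" and ?z' = "gauss_dir K Y"
  have "horo_phi K ?z' \<le> - mink X (?z', 1) + snd X * (?z \<bullet> ?z' - 1)"
    using horo_point_inner_le'[OF X(1) gauss(2)[OF X(2)]] horo_point_inner_dir[OF X(2)] eq' by simp
  also have "- mink X (?z', 1) \<le> horo_phi K ?z'" by (rule horo_phi_ge[OF gauss(2)[OF X(2)] K_props(4)[OF X(1)]])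
  finally have "snd X * (?z \<bullet> ?z' - 1) \<ge> 0" by simp
  then have "?z \<bullet> ?z' \<ge> 1" using hyp_spaceD(2)[OF K_props(5)[OF X(1)]] by (simp add: zero_le_mult_iff)
  moreover have "(?z - ?z') \<bullet> (?z - ?z') = 2 - 2 * (?z \<bullet> ?z')"
    using gauss(2)[OF X(1)] gauss(2)[OF X(2)]
    by (simp add: inner_diff_left inner_diff_right norm_eq_1 inner_commute)
  ultimately have "(?z - ?z') \<bullet> (?z - ?z') \<le> 0" by simp
  then have "(?z - ?z') \<bullet> (?z - ?z') = 0" using inner_ge_zero[of "?z - ?z'"] by linarith
  then have zz: "?z = ?z'" by simp
  then have "null_chart ?z X = null_chart ?z Y" using eq' by (simp add: horo_point_null_chart)
  then show "X = Y" using null_lift_chart[OF gauss(2)[OF X(1)]] K_props(5)[OF X(1)] K_props(5)[OF X(2)] by metis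
qed

text \<open>
  The ray through \<open>P\<close> is the ray of the boundary point at which the linear function \<open>P \<bullet> fst X\<close> is
  minimal on \<open>K\<close>.
\<close>
lemma horo_point_ray:
  assumes P: "P \<noteq> 0"
  shows "\<exists>X\<in>hyp_boundary K. \<exists>r>0. P = r *\<^sub>R horo_point K X"
proof -
  have "continuous_on K (\<lambda>Y. - (fst Y \<bullet> P))" by (intro continuous_intros)
  from continuous_attains_sup[OF K_props(2) K_nonempty this]
  obtain X where X: "X \<in> K" "\<And>Y. Y \<in> K \<Longrightarrow> - (fst Y \<bullet> P) \<le> - (fst X \<bullet> P)" by blast
  define b where "b = fst X \<bullet> P"
  have XH: "X \<in> hyp_space" using X(1) K_props(1) by blast
  have XX: "mink X X = -1" by (rule hyp_spaceD(1)[OF XH])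
  \<comment> \<open>The tangential part of \<open>(- P, 0)\<close> at \<open>X\<close> has square
    \<open>P \<bullet> P + b\<^sup>2\<close>, so \<open>c\<close> is its length; in the end
    \<open>c + b\<close> is the radial factor.\<close>
  define c where "c = sqrt (P \<bullet> P + b\<^sup>2)"
  have PP: "P \<bullet> P > 0" using P by simp
  then have "sqrt (b\<^sup>2) < c" unfolding c_def by (intro real_sqrt_less_mono) simp
  then have cb: "c > \<bar>b\<bar>" by simp
  then have c0: "c > 0" by simp
  let ?q = "(- P, 0) :: 'n minkowski"
  define p where "p = ?q + (- b) *\<^sub>R X"
  have qX: "mink ?q X = - b" by (simp add: mink_def b_def inner_commute)
  have pq: "p = ?q + mink ?q X *\<^sub>R X" unfolding p_def qX ..
  have pp: "mink p p = P \<bullet> P + b\<^sup>2" unfolding p_def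
    by (simp only: mink_simps XX qX mink_commute[of X ?q]) (simp add: mink_def power2_eq_square)
  have "p \<noteq> 0"
  proof
    assume "p = 0"
    then have "P \<bullet> P + b\<^sup>2 = 0" using pp by (simp add: mink_zero)
    then show False using PP by (smt (verit) zero_le_power2)
  qed
  have mx: "mink Y ?q \<le> mink X ?q" if "Y \<in> K" for Y
    using X(2)[OF that] by (simp add: mink_def)
  note mn = maximizer_normal[OF smooth X(1) mx pq \<open>p \<noteq> 0\<close>]
  have nu: "outward_normal K X = (1 / c) *\<^sub>R p" using mn(2) unfolding pp c_def .
  have x0: "snd X > 0" by (rule hyp_spaceD(2)[OF XH])
  have cbp: "c + b > 0" using cb by simp
  have gs: "gauss_speed K X = (c + b) * snd X / c"
    unfolding gauss_speed_def nu p_def using c0 by (simp add: field_simps)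
  have gd: "gauss_dir K X = inverse ((c + b) * snd X / c) *\<^sub>R (fst X - (1 / c) *\<^sub>R (- P - b *\<^sub>R fst X))"
    unfolding gauss_dir_def gs nu p_def by simp
  have "c *\<^sub>R (fst X - (1 / c) *\<^sub>R (- P - b *\<^sub>R fst X)) = c *\<^sub>R fst X - (c * (1 / c)) *\<^sub>R (- P - b *\<^sub>R fst X)"
    by (simp only: scaleR_diff_right[of c] scaleR_scaleR[of c "1 / c"])
  also have "\<dots> = (c + b) *\<^sub>R fst X + P" using c0 by (simp add: scaleR_add_left)
  finally have cl: "c *\<^sub>R (fst X - (1 / c) *\<^sub>R (- P - b *\<^sub>R fst X)) = (c + b) *\<^sub>R fst X + P" .
  have "snd X *\<^sub>R gauss_dir K X = (1 / (c + b)) *\<^sub>R (c *\<^sub>R (fst X - (1 / c) *\<^sub>R (- P - b *\<^sub>R fst X)))"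
  proof -
    have "s * inverse (m * s / d) = 1 / m * d" if "s \<noteq> 0" for s m d :: real
      using that by (simp add: field_simps)
    from this[of "snd X" "c + b" c] x0 have "snd X * inverse ((c + b) * snd X / c) = 1 / (c + b) * c" by simp
    then show ?thesis unfolding gd by (simp only: scaleR_scaleR)
  qed
  then have "snd X *\<^sub>R gauss_dir K X = (1 / (c + b)) *\<^sub>R ((c + b) *\<^sub>R fst X + P)" unfolding cl .
  then have "horo_point K X = (1 / (c + b)) *\<^sub>R P"
    unfolding horo_point_def using cbp by (simp add: scaleR_add_right)
  then have "P = (c + b) *\<^sub>R horo_point K X" using cbp by simp
  then show ?thesis using mn(1) cbp by blast
qed

lemma horo_foot_eq:
  assumes "X \<in> hyp_boundary K" "r > 0"
  shows "horo_foot K (r *\<^sub>R horo_point K X) = X"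
  unfolding horo_foot_def
proof (rule the_equality)
  show "X \<in> hyp_boundary K \<and> (\<exists>s>0. r *\<^sub>R horo_point K X = s *\<^sub>R horo_point K X)" using assms by blast
  fix Y assume "Y \<in> hyp_boundary K \<and> (\<exists>s>0. r *\<^sub>R horo_point K X = s *\<^sub>R horo_point K Y)"
  then show "Y = X" using horo_point_scaled_inj(2)[OF assms(1)] assms(2) by metis
qed

lemma horo_footE:
  assumes "P \<noteq> 0"
  obtains r where "r > 0" "horo_foot K P \<in> hyp_boundary K" "P = r *\<^sub>R horo_point K (horo_foot K P)"
proof -
  obtain X r where X: "X \<in> hyp_boundary K" "r > 0" "P = r *\<^sub>R horo_point K X" using horo_point_ray[OF assms] by blast
  then have "horo_foot K P = X" using horo_foot_eq by simp
  then show ?thesis using that X by simp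
qed

text \<open>The direction of the horo point is a continuous injective function on the compact
  boundary, so its inverse is continuous. As the foot depends on the ray only, it is enough to
  compose with \<open>sgn\<close>.\<close>

lemma continuous_on_horo_foot: "continuous_on (- {0}) (horo_foot K)"
proof -
  let ?d = "\<lambda>X. sgn (horo_point K X)"
  have cd: "continuous_on (hyp_boundary K) ?d"
    using horo_point_nonzero by (intro continuous_on_sgn continuous_on_horo_point) auto
  have ft: "horo_foot K (?d X) = X" if "X \<in> hyp_boundary K" for X
    unfolding sgn_div_norm using horo_point_nonzero[OF that] by (intro horo_foot_eq that) simp
  have "continuous_on (?d ` hyp_boundary K) (horo_foot K)"
    by (rule continuous_on_inv[OF cd compact_boundary]) (use ft in blast)
  moreover have sg: "sgn P \<in> ?d ` hyp_boundary K \<and> horo_foot K (sgn P) = horo_foot K P" if P0: "P \<noteq> 0" for P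
  proof -
    obtain r where r: "r > 0" "horo_foot K P \<in> hyp_boundary K" "P = r *\<^sub>R horo_point K (horo_foot K P)"
      by (rule horo_footE[OF P0])
    have "sgn P = ?d (horo_foot K P)" by (subst r(3)) (use r(1) in \<open>simp add: sgn_scaleR\<close>)
    then show ?thesis using r(2) ft by simp
  qed
  ultimately have "continuous_on (- {0}) (\<lambda>P. horo_foot K (sgn P))"
  proof (intro continuous_on_compose2[of "?d ` hyp_boundary K" "horo_foot K" "- {0}" sgn])
    show "continuous_on (- {0 :: 'n espace}) sgn" by (intro continuous_on_sgn continuous_on_id) blast
    show "sgn ` (- {0}) \<subseteq> ?d ` hyp_boundary K" using sg by blast
  qed
  then show ?thesis by (rule continuous_on_eq) (use sg in simp)
qed

lemma zero_in_horo_body: "0 \<in> horo_body K"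
  unfolding horo_body_def using horo_phi_pos by (simp add: less_imp_le)

lemma scaled_horo_point_in_body_iff:
  assumes X: "X \<in> hyp_boundary K" and r: "r \<ge> 0"
  shows "r *\<^sub>R horo_point K X \<in> horo_body K \<longleftrightarrow> r \<le> 1"
proof
  assume "r *\<^sub>R horo_point K X \<in> horo_body K"
  then have "(r *\<^sub>R horo_point K X) \<bullet> gauss_dir K X \<le> horo_phi K (gauss_dir K X)"
    unfolding horo_body_def using gauss(2)[OF X] by simp
  then have "r * horo_phi K (gauss_dir K X) \<le> 1 * horo_phi K (gauss_dir K X)"
    using horo_point_inner_dir[OF X] by simp
  then show "r \<le> 1" using horo_phi_pos mult_le_cancel_right_pos by blast
next
  assume r1: "r \<le> 1"
  show "r *\<^sub>R horo_point K X \<in> horo_body K" unfolding horo_body_def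
  proof (intro CollectI ballI)
    fix w :: "'n espace" assume "w \<in> sphere 0 1"
    then have w: "norm w = 1" by simp
    have "r * (horo_point K X \<bullet> w) \<le> r * horo_phi K w" using horo_point_inner_le[OF X w] r by (rule mult_left_mono)
    also have "\<dots> \<le> 1 * horo_phi K w" using r1 horo_phi_pos[of w] by (intro mult_right_mono) auto
    finally show "(r *\<^sub>R horo_point K X) \<bullet> w \<le> horo_phi K w" by simp
  qed
qed

text \<open>On the ray of \<open>X\<close> the half-space for \<open>gauss_dir K X\<close> bounds
  the radial factor by 1, and no other half-space cuts off more.\<close>

lemma horo_body_eq: "horo_body K = (\<lambda>p. fst p *\<^sub>R horo_point K (snd p)) ` ({0..1} \<times> hyp_boundary K)"
proof (intro set_eqI iffI)
  fix P assume P: "P \<in> horo_body K"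
  show "P \<in> (\<lambda>p. fst p *\<^sub>R horo_point K (snd p)) ` ({0..1} \<times> hyp_boundary K)"
  proof (cases "P = 0")
    case True
    obtain X where "X \<in> hyp_boundary K" using boundary_nonempty by blast
    then show ?thesis using True by (intro image_eqI[of _ _ "(0, X)"]) auto
  next
    case False
    obtain r where r: "r > 0" "horo_foot K P \<in> hyp_boundary K" "P = r *\<^sub>R horo_point K (horo_foot K P)"
      by (rule horo_footE[OF False])
    then have "r \<le> 1" using scaled_horo_point_in_body_iff[OF r(2), of r] P by simp
    then show ?thesis using r by (intro image_eqI[of _ _ "(r, horo_foot K P)"]) auto
  qed
next
  fix P assume "P \<in> (\<lambda>p. fst p *\<^sub>R horo_point K (snd p)) ` ({0..1} \<times> hyp_boundary K)"
  then show "P \<in> horo_body K" using scaled_horo_point_in_body_iff by force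
qed

lemma compact_horo_body: "compact (horo_body K)"
  unfolding horo_body_eq
  by (intro compact_continuous_image compact_Times compact_boundary continuous_intros
      continuous_on_compose2[OF continuous_on_horo_point]) auto

lemma horo_phi_lower_bound: "\<exists>c>0. \<forall>z. norm z = 1 \<longrightarrow> c \<le> horo_phi K z"
proof -
  have "sphere (0 :: 'n espace) 1 \<noteq> {}" by auto
  from continuous_attains_inf[OF compact_sphere this continuous_on_horo_phi]
  obtain z where "\<forall>y\<in>sphere 0 1. horo_phi K z \<le> horo_phi K y" by blast
  then show ?thesis using horo_phi_pos[of z] by (intro exI[of _ "horo_phi K z"]) auto
qed

text \<open>Shrinking \<open>P\<close> by the factor \<open>s\<close> leaves slack
  \<open>(1 - s) * c\<close> in every support inequality.\<close>

lemma ball_in_horo_body: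
  assumes "0 \<le> s" "s \<le> 1" and c: "\<And>z. norm z = 1 \<Longrightarrow> c \<le> horo_phi K z" and P: "P \<in> horo_body K"
  shows "ball (s *\<^sub>R P) ((1 - s) * c) \<subseteq> horo_body K"
proof
  fix Q assume "Q \<in> ball (s *\<^sub>R P) ((1 - s) * c)"
  then have n: "norm (Q - s *\<^sub>R P) \<le> (1 - s) * c" by (simp add: dist_norm norm_minus_commute)
  show "Q \<in> horo_body K" unfolding horo_body_def
  proof (intro CollectI ballI)
    fix w :: "'n espace" assume "w \<in> sphere 0 1"
    then have w: "norm w = 1" by simp
    have "Q \<bullet> w = s * (P \<bullet> w) + (Q - s *\<^sub>R P) \<bullet> w" by (simp add: inner_diff_left)
    also have "P \<bullet> w \<le> horo_phi K w" using P w by (simp add: horo_body_def)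
    then have "s * (P \<bullet> w) \<le> s * horo_phi K w" using assms(1) by (intro mult_left_mono)
    moreover have "(Q - s *\<^sub>R P) \<bullet> w \<le> (1 - s) * horo_phi K w"
    proof -
      have "(Q - s *\<^sub>R P) \<bullet> w \<le> norm (Q - s *\<^sub>R P)" using norm_cauchy_schwarz[of "Q - s *\<^sub>R P" w] w by simp
      also have "\<dots> \<le> (1 - s) * horo_phi K w" using n c[OF w] assms(2) by (meson diff_ge_0_iff_ge mult_left_mono order_trans)
      finally show ?thesis .
    qed
    ultimately show "Q \<bullet> w \<le> horo_phi K w" by (simp add: algebra_simps)
  qed
qed

subsection \<open>The cone measure\<close>

lemma sets_boundary: "A \<in> sets (restrict_space borel (hyp_boundary K)) \<longleftrightarrow> A \<subseteq> hyp_boundary K \<and> A \<in> sets borel"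
  using compact_boundary by (subst sets_restrict_space_iff) (auto intro: borel_compact)

lemma sets_cone_measure [simp]: "sets (cone_measure K) = sets (restrict_space borel (hyp_boundary K))"
  by (simp add: cone_measure_def)

lemma space_cone_measure [simp]: "space (cone_measure K) = hyp_boundary K"
  by (simp add: cone_measure_def space_restrict_space)

lemma horo_body_borel: "horo_body K \<in> sets borel"
  using compact_horo_body by (rule borel_compact)

lemma measurable_horo_foot:
  "horo_foot K \<in> measurable (restrict_space lborel (horo_body K - {0})) (restrict_space borel (hyp_boundary K))"
proof (rule measurable_restrict_space2)
  show "horo_foot K \<in> space (restrict_space lborel (horo_body K - {0})) \<rightarrow> hyp_boundary K"
    using horo_footE by (auto simp: space_restrict_space)
  have "horo_foot K \<in> borel_measurable (restrict_space borel (horo_body K - {0}))"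
    by (intro borel_measurable_continuous_on_restrict continuous_on_subset[OF continuous_on_horo_foot]) auto
  then show "horo_foot K \<in> borel_measurable (restrict_space lborel (horo_body K - {0}))"
    by (simp cong: measurable_cong_sets add: sets_restrict_space)
qed

text \<open>The origin is left out, so that cones over disjoint subsets of the boundary are
  disjoint.\<close>

definition cone :: "real \<Rightarrow> 'n minkowski set \<Rightarrow> 'n espace set" where
  "cone s A = {r *\<^sub>R horo_point K X |r X. 0 < r \<and> r \<le> s \<and> X \<in> A}"

lemma cone_1: "A \<subseteq> hyp_boundary K \<Longrightarrow> cone 1 A = (horo_body K - {0}) \<inter> horo_foot K -` A"
proof (intro set_eqI iffI)
  fix P assume A: "A \<subseteq> hyp_boundary K" and P: "P \<in> cone 1 A"
  then obtain r X where X: "P = r *\<^sub>R horo_point K X" "0 < r" "r \<le> 1" "X \<in> A" unfolding cone_def by blast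
  then have Xb: "X \<in> hyp_boundary K" using A by blast
  then show "P \<in> (horo_body K - {0}) \<inter> horo_foot K -` A"
    using X horo_point_nonzero[OF Xb] scaled_horo_point_in_body_iff[OF Xb, of r] horo_foot_eq[OF Xb X(2)] by simp
next
  fix P assume P: "P \<in> (horo_body K - {0}) \<inter> horo_foot K -` A"
  obtain r where r: "r > 0" "horo_foot K P \<in> hyp_boundary K" "P = r *\<^sub>R horo_point K (horo_foot K P)"
    by (rule horo_footE[of P]) (use P in auto)
  then have "r \<le> 1" using scaled_horo_point_in_body_iff[OF r(2), of r] P by simp
  then show "P \<in> cone 1 A" unfolding cone_def using r P by blast
qed

lemma cone_scale: "s > 0 \<Longrightarrow> cone s A = (\<lambda>P. s *\<^sub>R P) ` cone 1 A"
proof (intro set_eqI iffI)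
  fix P assume s: "s > 0" and "P \<in> cone s A"
  then obtain r X where X: "P = r *\<^sub>R horo_point K X" "0 < r" "r \<le> s" "X \<in> A" unfolding cone_def by blast
  then have "(r / s) *\<^sub>R horo_point K X \<in> cone 1 A" unfolding cone_def using s
    by (intro CollectI exI[of _ "r / s"] exI[of _ X]) simp
  moreover have "P = s *\<^sub>R ((r / s) *\<^sub>R horo_point K X)" using X s by simp
  ultimately show "P \<in> (\<lambda>P. s *\<^sub>R P) ` cone 1 A" by (rule image_eqI[rotated])
next
  fix P assume s: "s > 0" and "P \<in> (\<lambda>P. s *\<^sub>R P) ` cone 1 A"
  then obtain r X where X: "P = s *\<^sub>R (r *\<^sub>R horo_point K X)" "0 < r" "r \<le> 1" "X \<in> A" unfolding cone_def by blast
  then show "P \<in> cone s A" unfolding cone_def using s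
    by (intro CollectI exI[of _ "s * r"] exI[of _ X]) (simp add: mult_le_cancel_left1)
qed

lemma emeasure_cone_measure:
  assumes "A \<subseteq> hyp_boundary K" "A \<in> sets borel"
  shows "cone 1 A \<in> sets borel" "emeasure (cone_measure K) A = emeasure lborel (cone 1 A)"
proof -
  have A: "A \<in> sets (restrict_space borel (hyp_boundary K))" using assms sets_boundary by simp
  have B: "horo_body K - {0} \<in> sets borel" using horo_body_borel by auto
  have e: "horo_foot K -` A \<inter> space (restrict_space lborel (horo_body K - {0})) = cone 1 A"
    unfolding cone_1[OF assms(1)] by (auto simp: space_restrict_space)
  have "cone 1 A \<in> sets (restrict_space lborel (horo_body K - {0}))"
    using measurable_sets[OF measurable_horo_foot A] unfolding e .
  then show c: "cone 1 A \<in> sets borel" using B by (simp add: sets_restrict_space_iff)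
  have "emeasure (cone_measure K) A = emeasure (restrict_space lborel (horo_body K - {0})) (cone 1 A)"
    unfolding cone_measure_def by (subst emeasure_distr[OF measurable_horo_foot A]) (simp only: e)
  also have "\<dots> = emeasure lborel (cone 1 A)"
    using B by (intro emeasure_restrict_space) (auto simp: cone_1[OF assms(1)])
  finally show "emeasure (cone_measure K) A = emeasure lborel (cone 1 A)" .
qed

lemma cone_1_boundary: "cone 1 (hyp_boundary K) = horo_body K - {0}"
  unfolding cone_1[OF subset_refl] using horo_footE by auto

lemma boundary_borel: "hyp_boundary K \<in> sets borel"
  using compact_boundary by (rule borel_compact)

lemma bounded_horo_body: "bounded (horo_body K)"
  using compact_horo_body by (rule compact_imp_bounded)

lemma vol_horo_body_minus: "vol (horo_body K - {0}) = vol (horo_body K)"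
  using horo_body_borel by (subst measure_Diff_null_set) auto

lemma finite_cone_measure: "finite_measure (cone_measure K)"
proof
  have "emeasure (cone_measure K) (hyp_boundary K) = emeasure lborel (horo_body K - {0})"
    using emeasure_cone_measure(2)[OF subset_refl boundary_borel] cone_1_boundary by simp
  also have "\<dots> < top" by (rule emeasure_lborel_bounded) (use bounded_horo_body bounded_subset in blast)
  finally show "emeasure (cone_measure K) (space (cone_measure K)) \<noteq> \<infinity>" by simp
qed

lemma measure_cone_measure:
  assumes "A \<subseteq> hyp_boundary K" "A \<in> sets borel"
  shows "measure (cone_measure K) A = vol (cone 1 A)"
  using emeasure_cone_measure(2)[OF assms] by (simp add: measure_def)

lemma measure_cone_measure_space: "measure (cone_measure K) (hyp_boundary K) = vol (horo_body K)"
  using measure_cone_measure[OF subset_refl boundary_borel] cone_1_boundary vol_horo_body_minus by simp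

lemma vol_horo_body_pos: "vol (horo_body K) > 0"
proof -
  obtain c where c: "c > 0" "\<And>z. norm z = 1 \<Longrightarrow> c \<le> horo_phi K z" using horo_phi_lower_bound by blast
  have "ball 0 c \<subseteq> horo_body K" using ball_in_horo_body[OF _ _ c(2) zero_in_horo_body, of 0] by simp
  moreover obtain a b :: "'n espace" where "box a b \<subseteq> ball 0 c" "box a b \<noteq> {}"
    using open_contains_box[of "ball 0 c" 0] c(1) by (metis centre_in_ball emptyE open_ball)
  moreover have "vol (box a b) > 0" using calculation(3) by (rule vol_box_pos)
  moreover have "vol (box a b) \<le> vol (horo_body K)"
    using calculation by (intro vol_mono bounded_horo_body horo_body_borel) auto
  ultimately show ?thesis by linarith
qed

text \<open>The cone over a relatively open set contains an open subset of a small ball around 0. In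
  the equality case this turns a statement that holds almost everywhere into one at every boundary
  point.\<close>

lemma cone_measure_open_pos:
  assumes "openin (top_of_set (hyp_boundary K)) A" "A \<noteq> {}"
  shows "measure (cone_measure K) A > 0"
proof -
  obtain O' where O': "open O'" "A = hyp_boundary K \<inter> O'" using assms(1) by (auto simp: openin_open)
  obtain X where X: "X \<in> A" using assms(2) by blast
  have Ab: "A \<subseteq> hyp_boundary K" "A \<in> sets borel" using O' boundary_borel by auto
  obtain c where c: "c > 0" "\<And>z. norm z = 1 \<Longrightarrow> c \<le> horo_phi K z" using horo_phi_lower_bound by blast
  have oF: "open (horo_foot K -` O' \<inter> - {0})"
    using continuous_on_horo_foot O'(1) by (simp add: continuous_on_open_vimage open_Compl)
  define T where "T = (horo_foot K -` O' \<inter> - {0}) \<inter> ball 0 c"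
  have "open T" unfolding T_def using oF by blast
  define Y where "Y = horo_point K X"
  have Xb: "X \<in> hyp_boundary K" using X Ab by blast
  have Y0: "Y \<noteq> 0" unfolding Y_def by (rule horo_point_nonzero[OF Xb])
  define r where "r = c / (2 * norm Y)"
  have r: "r > 0" using c(1) Y0 by (simp add: r_def)
  have "horo_foot K (r *\<^sub>R Y) = X" unfolding Y_def by (rule horo_foot_eq[OF Xb r])
  then have "r *\<^sub>R Y \<in> T" unfolding T_def using X O'(2) r Y0 c(1) by (simp add: r_def)
  then obtain a b where ab: "box a b \<subseteq> T" "box a b \<noteq> {}" using \<open>open T\<close> open_contains_box by (metis emptyE)
  have "T \<subseteq> cone 1 A"
  proof
    fix P assume P: "P \<in> T"
    have "ball 0 c \<subseteq> horo_body K" using ball_in_horo_body[OF _ _ c(2) zero_in_horo_body, of 0] by simp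
    then have "P \<in> horo_body K - {0}" using P by (auto simp: T_def)
    moreover have "horo_foot K P \<in> A" using P O'(2) horo_footE[of P] unfolding T_def by (metis Compl_iff IntE IntI insertCI vimageD)
    ultimately show "P \<in> cone 1 A" unfolding cone_1[OF Ab(1)] by simp
  qed
  then have "vol (box a b) \<le> vol (cone 1 A)"
    using ab emeasure_cone_measure(1)[OF Ab] bounded_subset[OF bounded_horo_body, of "cone 1 A"] cone_1[OF Ab(1)]
    by (intro vol_mono) auto
  moreover have "vol (box a b) > 0" using ab(2) by (rule vol_box_pos)
  ultimately show ?thesis using measure_cone_measure[OF Ab] by simp
qed

end

section \<open>Minkowski's inequality for the cone measure\<close>

lemma scaleR_image_borel:
  fixes S :: "'a::euclidean_space set"
  assumes "S \<in> sets borel" "s > 0"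
  shows "(\<lambda>P. s *\<^sub>R P) ` S \<in> sets borel"
proof -
  have "(\<lambda>P. s *\<^sub>R P) ` S = (\<lambda>P. (1 / s) *\<^sub>R P) -` S"
  proof (intro set_eqI iffI)
    fix P assume "P \<in> (\<lambda>P. (1 / s) *\<^sub>R P) -` S"
    then show "P \<in> (\<lambda>P. s *\<^sub>R P) ` S" using assms(2) by (intro image_eqI[of _ _ "(1 / s) *\<^sub>R P"]) auto
  qed (use assms(2) in auto)
  moreover have "(\<lambda>P::'a. (1 / s) *\<^sub>R P) \<in> borel_measurable borel" by measurable
  ultimately show ?thesis using measurable_sets_borel[OF _ assms(1)] by metis
qed

lemma vol_scaleR:
  fixes S :: "'a::euclidean_space set"
  assumes "S \<in> sets borel" "s > 0"
  shows "vol ((\<lambda>P. s *\<^sub>R P) ` S) = s ^ DIM('a) * vol S"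
proof -
  have "measure lebesgue ((\<lambda>P. s *\<^sub>R P) ` S) = s ^ DIM('a) * measure lebesgue S"
    using measure_lebesgue_affine[of s 0 S] assms(2) by simp
  then show ?thesis using assms scaleR_image_borel[OF assms] by simp
qed

text \<open>A quadratic remainder with a constant uniform on [0, M]; it lets the expansion be
  integrated before \<open>t\<close> tends to 0.\<close>

lemma one_plus_power_le:
  fixes M :: real
  assumes "M \<ge> 0"
  shows "\<exists>C\<ge>0. \<forall>y. 0 \<le> y \<longrightarrow> y \<le> M \<longrightarrow> (1 + y) ^ n \<le> 1 + real n * y + C * y\<^sup>2"
proof (induction n)
  case 0
  then show ?case by (intro exI[of _ 0]) simp
next
  case (Suc n)
  then obtain C where C: "C \<ge> 0" "\<And>y. 0 \<le> y \<Longrightarrow> y \<le> M \<Longrightarrow> (1 + y) ^ n \<le> 1 + real n * y + C * y\<^sup>2" by blast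
  show ?case
  proof (intro exI[of _ "real n + C + C * M"] conjI allI impI)
    show "0 \<le> real n + C + C * M" using C(1) assms by simp
    fix y :: real assume y: "0 \<le> y" "y \<le> M"
    have "(1 + y) ^ Suc n \<le> (1 + y) * (1 + real n * y + C * y\<^sup>2)"
      using mult_left_mono[OF C(2)[OF y], of "1 + y"] y by simp
    also have "\<dots> = 1 + real (Suc n) * y + (real n + C + C * y) * y\<^sup>2"
      by (simp add: algebra_simps power2_eq_square)
    also have "\<dots> \<le> 1 + real (Suc n) * y + (real n + C + C * M) * y\<^sup>2"
      using C(1) y by (intro add_left_mono mult_right_mono mult_left_mono) auto
    finally show "(1 + y) ^ Suc n \<le> 1 + real (Suc n) * y + (real n + C + C * M) * y\<^sup>2" .
  qed
qed

text \<open>The pointwise form of Jensen's inequality: integrated with \<open>A\<close> the mean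
  value it gives the inequality, and its strict version gives the equality case.\<close>

lemma powr_above_tangent:
  fixes y A p :: real
  assumes "y > 0" "A > 0" "p \<ge> 1"
  shows "y powr p \<ge> A powr p + p * A powr (p - 1) * (y - A)"
    and "p > 1 \<Longrightarrow> y \<noteq> A \<Longrightarrow> y powr p > A powr p + p * A powr (p - 1) * (y - A)"
proof -
  have der: "DERIV (\<lambda>x. x powr p) x :> p * x powr (p - 1)" if "x > 0" for x
    using that by (auto intro!: derivative_eq_intros)
  have main: "y powr p \<ge> A powr p + p * A powr (p - 1) * (y - A) \<and>
      (p > 1 \<longrightarrow> y powr p > A powr p + p * A powr (p - 1) * (y - A))" if ne: "y \<noteq> A"
  proof (cases "A < y")
    case True
    obtain x where x: "A < x" "x < y" "y powr p - A powr p = (y - A) * (p * x powr (p - 1))"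
      using MVT2[OF True, of "\<lambda>x. x powr p" "\<lambda>x. p * x powr (p - 1)"] der assms by fastforce
    have "A powr (p - 1) \<le> x powr (p - 1)" using x assms by (intro powr_mono2) auto
    then have "(y - A) * (p * A powr (p - 1)) \<le> (y - A) * (p * x powr (p - 1))"
      using True assms by (intro mult_left_mono) auto
    moreover have "(y - A) * (p * A powr (p - 1)) < (y - A) * (p * x powr (p - 1))" if "p > 1"
    proof -
      have "A powr (p - 1) < x powr (p - 1)" using x assms that by (intro powr_less_mono2) auto
      then show ?thesis using True that by simp
    qed
    ultimately show ?thesis using x(3) by (auto simp: algebra_simps)
  next
    case False
    then have yA: "y < A" using ne by simp
    obtain x where x: "y < x" "x < A" "A powr p - y powr p = (A - y) * (p * x powr (p - 1))"
      using MVT2[OF yA, of "\<lambda>x. x powr p" "\<lambda>x. p * x powr (p - 1)"] der assms by fastforce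
    have "x powr (p - 1) \<le> A powr (p - 1)" using x assms by (intro powr_mono2) auto
    then have "(A - y) * (p * x powr (p - 1)) \<le> (A - y) * (p * A powr (p - 1))"
      using yA assms by (intro mult_left_mono) auto
    moreover have "(A - y) * (p * x powr (p - 1)) < (A - y) * (p * A powr (p - 1))" if "p > 1"
    proof -
      have "x powr (p - 1) < A powr (p - 1)" using x assms that by (intro powr_less_mono2) auto
      then show ?thesis using yA that by simp
    qed
    ultimately show ?thesis using x(3) by (auto simp: algebra_simps)
  qed
  show "y powr p \<ge> A powr p + p * A powr (p - 1) * (y - A)" using main by (cases "y = A") auto
  show "p > 1 \<Longrightarrow> y \<noteq> A \<Longrightarrow> y powr p > A powr p + p * A powr (p - 1) * (y - A)" using main by blast
qed

context h_convex_domain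
begin

lemma continuous_measurable:
  fixes g :: "'n minkowski \<Rightarrow> real"
  assumes "continuous_on (hyp_boundary K) g"
  shows "g \<in> borel_measurable (cone_measure K)"
  using borel_measurable_continuous_on_restrict[OF assms] by (simp cong: measurable_cong_sets)

lemma continuous_bounded:
  fixes g :: "'n minkowski \<Rightarrow> real"
  assumes "continuous_on (hyp_boundary K) g"
  shows "\<exists>B>0. \<forall>X\<in>hyp_boundary K. \<bar>g X\<bar> \<le> B"
proof -
  have "bounded (g ` hyp_boundary K)"
    by (intro compact_imp_bounded compact_continuous_image assms compact_boundary)
  then obtain B where "B > 0" "\<And>x. x \<in> g ` hyp_boundary K \<Longrightarrow> norm x \<le> B" using bounded_pos by metis
  then show ?thesis by (intro exI[of _ B]) auto
qed

lemma continuous_integrable: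
  fixes g :: "'n minkowski \<Rightarrow> real"
  assumes "continuous_on (hyp_boundary K) g"
  shows "integrable (cone_measure K) g"
proof -
  obtain B where B: "\<forall>X\<in>hyp_boundary K. \<bar>g X\<bar> \<le> B" using continuous_bounded[OF assms] by blast
  have "AE X in cone_measure K. norm (g X) \<le> B"
  proof (rule AE_I2)
    fix X assume "X \<in> space (cone_measure K)"
    then show "norm (g X) \<le> B" using B by simp
  qed
  then show ?thesis
    by (rule finite_measure.integrable_const_bound[OF finite_cone_measure _ continuous_measurable[OF assms]])
qed

text \<open>\<open>S\<close> is covered by finitely many cones, one over each set on which \<open>g\<close> varies by at most \<open>e\<close>.\<close>
lemma vol_star_le:
  fixes g :: "'n minkowski \<Rightarrow> real"
  assumes g: "continuous_on (hyp_boundary K) g" "\<And>X. X \<in> hyp_boundary K \<Longrightarrow> g X > 0"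
    and S: "S \<in> sets borel"
    and SE: "\<And>P. P \<in> S \<Longrightarrow> P \<noteq> 0 \<Longrightarrow> \<exists>X\<in>hyp_boundary K. \<exists>r>0. r \<le> g X \<and> P = r *\<^sub>R horo_point K X"
    and e: "e > 0"
  shows "vol S \<le> (\<integral>X. (g X + e) ^ (CARD('n) + 1) \<partial>cone_measure K)"
proof -
  let ?N = "CARD('n) + 1" and ?m = "cone_measure K"
  have gm: "g \<in> borel_measurable ?m" by (rule continuous_measurable[OF g(1)])
  obtain B where B: "B > 0" "\<forall>X\<in>hyp_boundary K. \<bar>g X\<bar> \<le> B" using continuous_bounded[OF g(1)] by blast
  \<comment> \<open>Level sets of \<open>g\<close> with step \<open>e\<close>. Over the k-th one the
    radial factor is at most \<open>s k = (real k + 1) * e\<close>, which exceeds \<open>g\<close>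
    by at most \<open>e\<close>.\<close>
  define A where "A = (\<lambda>k::nat. {X \<in> hyp_boundary K. real k * e \<le> g X \<and> g X < (real k + 1) * e})"
  define n where "n = nat \<lfloor>B / e\<rfloor> + 1"
  have Am: "A k \<in> sets ?m" for k
  proof -
    have "{X \<in> space ?m. real k * e \<le> g X \<and> g X < (real k + 1) * e} \<in> sets ?m" using gm by measurable
    then show ?thesis by (simp add: A_def)
  qed
  then have Ab: "A k \<subseteq> hyp_boundary K" "A k \<in> sets borel" for k using sets_boundary by auto
  have ix: "X \<in> A k \<longleftrightarrow> k = nat \<lfloor>g X / e\<rfloor>" if X: "X \<in> hyp_boundary K" for X k
  proof -
    have p: "g X / e \<ge> 0" using g(2)[OF X] e by simp
    have "X \<in> A k \<longleftrightarrow> real k \<le> g X / e \<and> g X / e < real k + 1"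
      using X e by (simp add: A_def pos_le_divide_eq pos_divide_less_eq)
    also have "\<dots> \<longleftrightarrow> \<lfloor>g X / e\<rfloor> = int k" by (simp add: floor_eq_iff)
    also have "\<dots> \<longleftrightarrow> k = nat \<lfloor>g X / e\<rfloor>" using p by (auto simp: nat_eq_iff2)
    finally show ?thesis .
  qed
  have kn: "nat \<lfloor>g X / e\<rfloor> < n" if X: "X \<in> hyp_boundary K" for X
  proof -
    have "g X / e \<le> B / e" using B(2) X e by (intro divide_right_mono) auto
    then show ?thesis unfolding n_def by (meson floor_mono less_add_one nat_mono order_le_less_trans)
  qed
  define s where "s = (\<lambda>k::nat. (real k + 1) * e)"
  have s0: "s k > 0" for k unfolding s_def using e by simp
  have cb: "cone (s k) (A k) \<in> sets borel" for k
    unfolding cone_scale[OF s0] by (intro scaleR_image_borel s0 emeasure_cone_measure(1) Ab)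
  have cv: "vol (cone (s k) (A k)) = s k ^ ?N * measure ?m (A k)" for k
    unfolding cone_scale[OF s0] vol_scaleR[OF emeasure_cone_measure(1)[OF Ab] s0] measure_cone_measure[OF Ab] by simp
  have cbd: "bounded (cone (s k) (A k))" for k
    unfolding cone_scale[OF s0] cone_1[OF Ab(1)] using bounded_horo_body
    by (intro bounded_scaling) (auto intro: bounded_subset)
  let ?U = "insert 0 (\<Union>k<n. cone (s k) (A k))"
  have "S \<subseteq> ?U"
  proof
    fix P assume P: "P \<in> S"
    show "P \<in> ?U"
    proof (cases "P = 0")
      case False
      then obtain X r where X: "X \<in> hyp_boundary K" "r > 0" "r \<le> g X" "P = r *\<^sub>R horo_point K X" using SE[OF P] by blast
      let ?k = "nat \<lfloor>g X / e\<rfloor>"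
      have XA: "X \<in> A ?k" using ix[OF X(1)] by simp
      then have "r \<le> s ?k" using X(3) by (simp add: A_def s_def)
      then have "P \<in> cone (s ?k) (A ?k)" unfolding cone_def using X XA by blast
      then show ?thesis using kn[OF X(1)] by blast
    qed simp
  qed
  moreover have "?U \<in> sets borel" using cb by auto
  moreover have "bounded ?U" using cbd by (simp add: bounded_UN)
  ultimately have "vol S \<le> vol ?U" using S by (intro vol_mono)
  also have "vol ?U \<le> vol {0 :: 'n espace} + vol (\<Union>k<n. cone (s k) (A k))"
    unfolding insert_is_Un[of 0 "\<Union>k<n. cone (s k) (A k)"] using cb by (intro measure_Un_le) auto
  also have "\<dots> \<le> (\<Sum>k<n. vol (cone (s k) (A k)))"
    using measure_UNION_le[of "{..<n}" "\<lambda>k. cone (s k) (A k)" lborel] cb by simp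
  also have "\<dots> = (\<Sum>k<n. \<integral>X. s k ^ ?N * indicator (A k) X \<partial>?m)"
    unfolding cv using Am Ab(1) by (intro sum.cong refl) (simp add: Int_absorb2)
  also have "\<dots> = (\<integral>X. (\<Sum>k<n. s k ^ ?N * indicator (A k) X) \<partial>?m)"
    using Am finite_measure.emeasure_finite[OF finite_cone_measure]
    by (intro Bochner_Integration.integral_sum[symmetric] integrable_mult_right integrable_real_indicator) (auto simp: less_top)
  also have "\<dots> \<le> (\<integral>X. (g X + e) ^ ?N \<partial>?m)"
  proof (rule integral_mono)
    show "integrable ?m (\<lambda>X. \<Sum>k<n. s k ^ ?N * indicator (A k) X)"
      using Am finite_measure.emeasure_finite[OF finite_cone_measure]
      by (intro Bochner_Integration.integrable_sum integrable_mult_right integrable_real_indicator) (auto simp: less_top)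
    show "integrable ?m (\<lambda>X. (g X + e) ^ ?N)" by (intro continuous_integrable continuous_intros g)
    fix X assume "X \<in> space ?m"
    then have X: "X \<in> hyp_boundary K" by simp
    let ?k = "nat \<lfloor>g X / e\<rfloor>"
    have "(\<Sum>k<n. s k ^ ?N * indicator (A k) X) = (\<Sum>k<n. if k = ?k then s k ^ ?N else 0)"
      by (intro sum.cong refl) (simp add: indicator_def ix[OF X])
    also have "\<dots> = s ?k ^ ?N" using kn[OF X] by simp
    also have "\<dots> \<le> (g X + e) ^ ?N"
    proof (rule power_mono)
      have "X \<in> A ?k" using ix[OF X] by simp
      then show "s ?k \<le> g X + e" by (simp add: A_def s_def algebra_simps)
    qed (use s0 in \<open>simp add: less_imp_le\<close>)
    finally show "(\<Sum>k<n. s k ^ ?N * indicator (A k) X) \<le> (g X + e) ^ ?N" .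
  qed
  finally show ?thesis .
qed

text \<open>Prepares the use of \<open>Brunn_Minkowski\<close>, which speaks about open sets: for
  \<open>s < 1\<close> the shrunken body lies in the interior, and \<open>s\<close> tends to
  1.\<close>

lemma vol_interior_horo_body: "vol (interior (horo_body K)) = vol (horo_body K)" "interior (horo_body K) \<noteq> {}"
proof -
  obtain c where c: "c > 0" "\<And>z. norm z = 1 \<Longrightarrow> c \<le> horo_phi K z" using horo_phi_lower_bound by blast
  have int: "(\<lambda>P. s *\<^sub>R P) ` horo_body K \<subseteq> interior (horo_body K)" if s: "0 \<le> s" "s < 1" for s
  proof
    fix Q assume "Q \<in> (\<lambda>P. s *\<^sub>R P) ` horo_body K"
    then obtain P where P: "P \<in> horo_body K" "Q = s *\<^sub>R P" by blast
    have "ball Q ((1 - s) * c) \<subseteq> horo_body K" unfolding P(2) using ball_in_horo_body[OF s(1) _ c(2) P(1)] s by simp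
    moreover have "Q \<in> ball Q ((1 - s) * c)" using s c(1) by simp
    ultimately show "Q \<in> interior (horo_body K)" by (meson interiorI open_ball)
  qed
  show "interior (horo_body K) \<noteq> {}" using int[of 0] zero_in_horo_body by auto
  let ?v = "vol (horo_body K)" and ?w = "vol (interior (horo_body K))"
  have le: "?w \<le> ?v" by (intro vol_mono interior_subset borel_open horo_body_borel bounded_horo_body open_interior)
  have "s ^ (CARD('n) + 1) * ?v \<le> ?w" if s: "0 < s" "s < 1" for s
  proof -
    have "s ^ DIM('n espace) * ?v = vol ((\<lambda>P. s *\<^sub>R P) ` horo_body K)"
      by (rule vol_scaleR[OF horo_body_borel s(1), symmetric])
    also have "\<dots> \<le> ?w"
      using s by (intro vol_mono int scaleR_image_borel horo_body_borel borel_open open_interior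
          bounded_subset[OF bounded_horo_body interior_subset]) auto
    finally show ?thesis by simp
  qed
  then have "\<forall>\<^sub>F s in at_left 1. s ^ (CARD('n) + 1) * ?v \<le> ?w"
    by (intro eventually_at_leftI[of 0]) auto
  moreover have "((\<lambda>s::real. s ^ (CARD('n) + 1) * ?v) \<longlongrightarrow> 1 ^ (CARD('n) + 1) * ?v) (at_left 1)"
    by (intro tendsto_intros)
  ultimately have "1 ^ (CARD('n) + 1) * ?v \<le> ?w"
    by (intro tendsto_upperbound) auto
  then show "?w = ?v" using le by simp
qed

end

text \<open>Both bodies are tested in the single direction \<open>gauss_dir K X\<close> belonging to
  the ray of the sum; there the support value of the horo point is attained, which bounds the radial
  factor.\<close>

lemma horo_body_sum_subset:
  assumes "h_convex_domain K" "h_convex_domain L"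
    and P: "A \<in> horo_body K" "B \<in> horo_body L" "A + t *\<^sub>R B \<noteq> 0" "t \<ge> 0"
  shows "\<exists>X\<in>hyp_boundary K. \<exists>r>0. r \<le> 1 + t * (horo_phi L (gauss_dir K X) / horo_phi K (gauss_dir K X))
    \<and> A + t *\<^sub>R B = r *\<^sub>R horo_point K X"
proof -
  interpret K: h_convex_domain K by fact
  interpret L: h_convex_domain L by fact
  obtain X r where X: "X \<in> hyp_boundary K" "r > 0" "A + t *\<^sub>R B = r *\<^sub>R horo_point K X"
    using K.horo_point_ray[OF P(3)] by blast
  let ?z = "gauss_dir K X"
  have z: "?z \<in> sphere 0 1" using K.gauss(2)[OF X(1)] by simp
  have "r * horo_phi K ?z = (A + t *\<^sub>R B) \<bullet> ?z" unfolding X(3) using K.horo_point_inner_dir[OF X(1)] by simp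
  also have "\<dots> = A \<bullet> ?z + t * (B \<bullet> ?z)" by (simp add: inner_add_left)
  also have "\<dots> \<le> horo_phi K ?z + t * horo_phi L ?z"
    using P(1,2,4) z unfolding horo_body_def by (intro add_mono mult_left_mono) auto
  finally have "r \<le> (horo_phi K ?z + t * horo_phi L ?z) / horo_phi K ?z"
    using K.horo_phi_pos by (simp add: pos_le_divide_eq)
  also have "\<dots> = 1 + t * (horo_phi L ?z / horo_phi K ?z)"
    using K.horo_phi_pos[of ?z] by (simp add: add_divide_distrib)
  finally show ?thesis using X by blast
qed

definition phi_ratio :: "'n::finite minkowski set \<Rightarrow> 'n minkowski set \<Rightarrow> 'n minkowski \<Rightarrow> real" where
  "phi_ratio K L X = horo_phi L (gauss_dir K X) / horo_phi K (gauss_dir K X)"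

lemma phi_ratio_pos: "phi_ratio K L X > 0"
  by (simp add: phi_ratio_def horo_phi_def)

lemma continuous_on_phi_ratio:
  assumes "h_convex_domain K" "h_convex_domain L"
  shows "continuous_on (hyp_boundary K) (phi_ratio K L)"
proof -
  interpret K: h_convex_domain K by fact
  interpret L: h_convex_domain L by fact
  have sub: "gauss_dir K ` hyp_boundary K \<subseteq> sphere 0 1" using K.gauss(2) by auto
  have nz: "\<forall>X\<in>hyp_boundary K. horo_phi K (gauss_dir K X) \<noteq> 0" by (simp add: horo_phi_def)
  show ?thesis unfolding phi_ratio_def
    by (intro continuous_on_divide nz continuous_on_compose2[OF L.continuous_on_horo_phi K.continuous_on_gauss_dir sub]
        continuous_on_compose2[OF K.continuous_on_horo_phi K.continuous_on_gauss_dir sub])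
qed

text \<open>The volume of the sum is at least \<open>(a + t * b) ^ (n + 1)\<close> by
  Brunn-Minkowski and at most the integral of \<open>(1 + t * f) ^ (n + 1)\<close>, up to higher
  order in \<open>t\<close>, by the star-shaped superset. Both agree at \<open>t = 0\<close>; the
  claim compares the linear terms.\<close>

theorem Minkowski_inequality:
  fixes K L :: "'n::finite minkowski set"
  assumes hK: "h_convex_domain K" and hL: "h_convex_domain L"
  shows "(vol (horo_body K) powr (1 / (real CARD('n) + 1))) ^ CARD('n) * vol (horo_body L) powr (1 / (real CARD('n) + 1))
    \<le> (\<integral>X. phi_ratio K L X \<partial>cone_measure K)"
proof -
  interpret K: h_convex_domain K by fact
  interpret L: h_convex_domain L by fact
  let ?N = "CARD('n) + 1" and ?m = "cone_measure K"
  define f where "f = phi_ratio K L"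
  have cf: "continuous_on (hyp_boundary K) f" unfolding f_def by (rule continuous_on_phi_ratio[OF hK hL])
  have f0: "f X > 0" for X unfolding f_def by (rule phi_ratio_pos)
  obtain B where B: "B > 0" "\<forall>X\<in>hyp_boundary K. \<bar>f X\<bar> \<le> B" using K.continuous_bounded[OF cf] by blast
  have "B + 1 \<ge> 0" using B by simp
  from one_plus_power_le[OF this, of ?N]
  obtain C where C: "C \<ge> 0" "\<And>y. 0 \<le> y \<Longrightarrow> y \<le> B + 1 \<Longrightarrow> (1 + y) ^ ?N \<le> 1 + real ?N * y + C * y\<^sup>2" by blast
  define v l I where "v = vol (horo_body K)" and "l = vol (horo_body L)" and "I = (\<integral>X. f X \<partial>?m)"
  have v: "v > 0" unfolding v_def by (rule K.vol_horo_body_pos)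
  have l: "l > 0" unfolding l_def by (rule L.vol_horo_body_pos)
  define a b where "a = v powr (1 / real ?N)" and "b = l powr (1 / real ?N)"
  have a1: "a > 0" using v by (simp add: a_def)
  have "a ^ ?N = v powr (1 / real ?N * real ?N)" by (simp only: powr_realpow[OF a1, symmetric]) (simp only: a_def powr_powr)
  also have "1 / real ?N * real ?N = 1" by simp
  finally have a: "a > 0" "a ^ ?N = v" using v a1 by simp_all
  have b: "b > 0" using l by (simp add: b_def)
  define D where "D = (real ?N + C * (B + 1)\<^sup>2) * v"
  have key: "real ?N * (a ^ CARD('n) * b) \<le> real ?N * I + D * t" if t: "0 < t" "t < 1" for t
  proof -
    let ?A = "interior (horo_body K)" and ?B = "(\<lambda>P. t *\<^sub>R P) ` interior (horo_body L)"
    have oB: "open ?B" using t by (intro open_scaling) auto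
    have bA: "bounded ?A" "bounded (interior (horo_body L))"
      using K.bounded_horo_body L.bounded_horo_body bounded_subset interior_subset by blast+
    have bB: "bounded ?B" by (rule bounded_scaling[OF bA(2)])
    have volB: "vol ?B = t ^ ?N * l"
      using vol_scaleR[of "interior (horo_body L)" t] t L.vol_interior_horo_body(1) by (simp add: l_def)
    have "(v powr (1 / real ?N) + vol ?B powr (1 / real ?N)) powr real ?N \<le> vol (set_sum ?A ?B)"
      using Brunn_Minkowski[OF open_interior oB bA(1) bB] K.vol_interior_horo_body L.vol_interior_horo_body(2)
      by (simp add: v_def add.commute)
    moreover have "vol ?B powr (1 / real ?N) = t * b"
    proof -
      have "(t ^ ?N) powr (1 / real ?N) = t" using t by (simp only: powr_realpow[symmetric] powr_powr) simp
      then show ?thesis unfolding volB b_def using t l by (simp only: powr_mult)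
    qed
    ultimately have bm: "(a + t * b) powr real ?N \<le> vol (set_sum ?A ?B)" unfolding a_def by simp
    have ab: "a + t * b > 0" using a b t by (simp add: add_pos_pos)
    \<comment> \<open>The discretization error of \<open>vol_star_le\<close> is taken to be
      \<open>t\<^sup>2\<close>, which still tends to 0 after division by \<open>t\<close>.\<close>
    have "vol (set_sum ?A ?B) \<le> (\<integral>X. ((1 + t * f X) + t\<^sup>2) ^ ?N \<partial>?m)"
    proof (rule K.vol_star_le)
      show "continuous_on (hyp_boundary K) (\<lambda>X. 1 + t * f X)" by (intro continuous_intros cf)
      show "1 + t * f X > 0" for X using t f0[of X] by (simp add: add_pos_pos)
      show "set_sum ?A ?B \<in> sets borel" by (intro borel_open open_set_sum open_interior)
      fix P assume "P \<in> set_sum ?A ?B" and P0: "P \<noteq> 0"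
      then obtain x y where xy: "P = x + t *\<^sub>R y" "x \<in> horo_body K" "y \<in> horo_body L"
        using interior_subset by blast
      show "\<exists>X\<in>hyp_boundary K. \<exists>r>0. r \<le> 1 + t * f X \<and> P = r *\<^sub>R horo_point K X"
        using horo_body_sum_subset[OF hK hL xy(2,3), of t] P0 t unfolding xy(1) f_def phi_ratio_def by simp
    qed (use t in simp)
    also have "\<dots> \<le> (\<integral>X. (1 + real ?N * t\<^sup>2 + C * (t * (B + 1))\<^sup>2) + (real ?N * t) * f X \<partial>?m)"
    proof (rule integral_mono)
      show "integrable ?m (\<lambda>X. ((1 + t * f X) + t\<^sup>2) ^ ?N)" by (intro K.continuous_integrable continuous_intros cf)
      show "integrable ?m (\<lambda>X. (1 + real ?N * t\<^sup>2 + C * (t * (B + 1))\<^sup>2) + (real ?N * t) * f X)"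
        by (intro K.continuous_integrable continuous_intros cf)
      fix X assume "X \<in> space ?m"
      then have fB: "f X \<le> B" using B(2) by auto
      let ?y = "t * f X + t\<^sup>2"
      have y0: "0 \<le> ?y" using t f0[of X] by (simp add: less_imp_le)
      have "t\<^sup>2 \<le> t" using t by (simp add: power2_eq_square mult_le_one)
      have yt: "?y \<le> t * (B + 1)"
      proof -
        have "t * f X \<le> t * B" using fB t by (intro mult_left_mono) auto
        moreover have "t\<^sup>2 \<le> t * 1" using t by (simp add: power2_eq_square)
        ultimately show ?thesis by (simp add: distrib_left)
      qed
      also have "\<dots> \<le> 1 * (B + 1)" using t B by (intro mult_right_mono) auto
      finally have "(1 + ?y) ^ ?N \<le> 1 + real ?N * ?y + C * ?y\<^sup>2" using C(2)[OF y0] by simp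
      also have "\<dots> \<le> 1 + real ?N * ?y + C * (t * (B + 1))\<^sup>2"
        using yt y0 C(1) by (intro add_left_mono mult_left_mono power_mono)
      finally show "((1 + t * f X) + t\<^sup>2) ^ ?N \<le> (1 + real ?N * t\<^sup>2 + C * (t * (B + 1))\<^sup>2) + (real ?N * t) * f X"
        by (simp add: algebra_simps)
    qed
    also have "\<dots> = v * (1 + real ?N * t\<^sup>2 + C * (t * (B + 1))\<^sup>2) + (real ?N * t) * I"
    proof -
      have "(\<integral>X. (1 + real ?N * t\<^sup>2 + C * (t * (B + 1))\<^sup>2) + (real ?N * t) * f X \<partial>?m)
          = (\<integral>X. (1 + real ?N * t\<^sup>2 + C * (t * (B + 1))\<^sup>2) \<partial>?m) + (\<integral>X. (real ?N * t) * f X \<partial>?m)"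
        by (intro Bochner_Integration.integral_add K.continuous_integrable continuous_intros cf)
      then show ?thesis unfolding I_def v_def K.measure_cone_measure_space[symmetric] by simp
    qed
    also have "\<dots> = v + t * (real ?N * I + D * t)" unfolding D_def by (simp add: power2_eq_square algebra_simps)
    finally have up: "vol (set_sum ?A ?B) \<le> v + t * (real ?N * I + D * t)" .
    \<comment> \<open>Bernoulli's inequality extracts the linear term of
      \<open>(a + t * b) ^ ?N\<close> from below, with no remainder.\<close>
    have "v + t * (real ?N * (a ^ CARD('n) * b)) = a ^ ?N * (1 + real ?N * (t * b / a))"
      unfolding a(2)[symmetric] using a(1) by (simp add: field_simps)
    also have "\<dots> \<le> a ^ ?N * (1 + t * b / a) ^ ?N"
      using a b t by (intro mult_left_mono Bernoulli_inequality) (auto intro: order_trans[of _ 0])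
    also have "\<dots> = (a + t * b) ^ ?N"
    proof -
      have "a * (1 + t * b / a) = a + t * b" using a(1) by (simp add: field_simps)
      then show ?thesis by (simp only: power_mult_distrib[symmetric])
    qed
    also have "\<dots> = (a + t * b) powr real ?N" using powr_realpow[OF ab, of ?N] by simp
    finally have "v + t * (real ?N * (a ^ CARD('n) * b)) \<le> v + t * (real ?N * I + D * t)" using bm up by linarith
    then have "t * (real ?N * (a ^ CARD('n) * b)) \<le> t * (real ?N * I + D * t)" by simp
    then show ?thesis using t(1) by (simp only: mult_le_cancel_left_pos)
  qed
  have "\<forall>\<^sub>F t in at_right 0. real ?N * (a ^ CARD('n) * b) \<le> real ?N * I + D * t"
    using key by (intro eventually_at_rightI[of 0 1]) auto
  moreover have "((\<lambda>t. real ?N * I + D * t) \<longlongrightarrow> real ?N * I + D * 0) (at_right 0)" by (intro tendsto_intros)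
  ultimately have "real ?N * (a ^ CARD('n) * b) \<le> real ?N * I + D * 0"
    by (intro tendsto_lowerbound) auto
  then have "a ^ CARD('n) * b \<le> I" by (simp add: mult_le_cancel_left_pos del: of_nat_add of_nat_Suc)
  then show ?thesis unfolding a_def b_def v_def l_def I_def f_def by (simp add: add.commute)
qed

lemma Lp_Minkowski_inequality:
  fixes K L :: "'n::finite minkowski set"
  assumes hK: "h_convex_domain K" and hL: "h_convex_domain L" and p: "p \<ge> 1"
  defines "J \<equiv> \<integral>X. phi_ratio K L X powr p \<partial>cone_measure K"
    and "R \<equiv> vol (horo_body K) powr ((real CARD('n) + 1 - p) / (real CARD('n) + 1)) *
        vol (horo_body L) powr (p / (real CARD('n) + 1))"
  shows "J \<ge> R"
    and "p > 1 \<Longrightarrow> J = R \<Longrightarrow> \<exists>c>0. \<forall>X\<in>hyp_boundary K. phi_ratio K L X = c"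
proof -
  interpret K: h_convex_domain K by fact
  interpret L: h_convex_domain L by fact
  let ?n = "real CARD('n)" and ?m = "cone_measure K"
  define f where "f = phi_ratio K L"
  have cf: "continuous_on (hyp_boundary K) f" unfolding f_def by (rule continuous_on_phi_ratio[OF hK hL])
  have f0: "f X > 0" for X unfolding f_def by (rule phi_ratio_pos)
  define v l I where "v = vol (horo_body K)" and "l = vol (horo_body L)" and "I = (\<integral>X. f X \<partial>?m)"
  have v: "v > 0" unfolding v_def by (rule K.vol_horo_body_pos)
  have l: "l > 0" unfolding l_def by (rule L.vol_horo_body_pos)
  have mI: "(v powr (1 / (?n + 1))) ^ CARD('n) * l powr (1 / (?n + 1)) \<le> I"
    unfolding v_def l_def I_def f_def by (rule Minkowski_inequality[OF hK hL])
  have e: "(v powr (1 / (?n + 1))) ^ CARD('n) = v powr (?n / (?n + 1))"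
    using v by (simp add: powr_realpow[symmetric] powr_powr)
  \<comment> \<open>\<open>A\<close> is the mean of the ratio over the cone measure, whose total
    mass is \<open>v\<close>; \<open>q\<close> below is the value of the ratio when the two bodies
    are homothetic about 0.\<close>
  define A where "A = I / v"
  have "v powr (?n / (?n + 1)) * l powr (1 / (?n + 1)) > 0" using v l by simp
  then have I0: "I > 0" using mI unfolding e by linarith
  have A0: "A > 0" unfolding A_def using I0 v by simp
  define q where "q = v powr (- 1 / (?n + 1)) * l powr (1 / (?n + 1))"
  have q0: "q > 0" unfolding q_def using v l by simp
  have Aq: "A \<ge> q"
  proof -
    have "v powr (?n / (?n + 1)) = v powr (- 1 / (?n + 1)) * v powr 1"
      unfolding powr_add[symmetric] by (rule arg_cong[of _ _ "\<lambda>x. v powr x"]) (simp add: field_simps)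
    then have "q * v \<le> I" using mI v unfolding e q_def by (simp add: mult_ac)
    then show ?thesis unfolding A_def using v by (simp add: pos_le_divide_eq)
  qed
  have Rq: "R = v * q powr p"
  proof -
    have "q powr p = v powr (- p / (?n + 1)) * l powr (p / (?n + 1))"
      unfolding q_def using v l by (simp add: powr_mult powr_powr)
    moreover have "v powr ((?n + 1 - p) / (?n + 1)) = v powr 1 * v powr (- p / (?n + 1))"
      unfolding powr_add[symmetric] by (rule arg_cong[of _ _ "\<lambda>x. v powr x"]) (simp add: field_simps)
    ultimately show ?thesis unfolding R_def v_def[symmetric] l_def[symmetric] using v by simp
  qed
  \<comment> \<open>The gap between the power and its tangent at \<open>A\<close>. The linear part
    integrates to 0, so the integral of \<open>h\<close> is \<open>J - v * A powr p\<close>; if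
    \<open>J = R\<close>, it is 0 and \<open>h\<close> vanishes almost everywhere.\<close>
  define h where "h = (\<lambda>X. f X powr p - (A powr p + p * A powr (p - 1) * (f X - A)))"
  have h0: "h X \<ge> 0" for X unfolding h_def using powr_above_tangent(1)[OF f0[of X] A0 p] by simp
  have ch: "continuous_on (hyp_boundary K) h"
  proof -
    have "\<forall>X\<in>hyp_boundary K. f X \<noteq> 0" using f0 by (metis less_irrefl)
    then show ?thesis unfolding h_def by (intro continuous_intros cf)
  qed
  have Ih: "(\<integral>X. h X \<partial>?m) = J - v * A powr p"
  proof -
    have cp: "continuous_on (hyp_boundary K) (\<lambda>X. f X powr p)"
      using f0 by (intro continuous_on_powr cf continuous_intros) (metis less_irrefl)
    have "(\<integral>X. h X \<partial>?m) = (\<integral>X. f X powr p \<partial>?m) - (\<integral>X. A powr p + p * A powr (p - 1) * (f X - A) \<partial>?m)"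
      unfolding h_def by (intro Bochner_Integration.integral_diff K.continuous_integrable cp continuous_intros cf)
    also have "(\<integral>X. A powr p + p * A powr (p - 1) * (f X - A) \<partial>?m)
        = (\<integral>X. A powr p \<partial>?m) + (\<integral>X. p * A powr (p - 1) * (f X - A) \<partial>?m)"
      by (intro Bochner_Integration.integral_add K.continuous_integrable continuous_intros cf)
    also have "(\<integral>X. p * A powr (p - 1) * (f X - A) \<partial>?m) = p * A powr (p - 1) * ((\<integral>X. f X \<partial>?m) - (\<integral>X. A \<partial>?m))"
    proof -
      have "(\<integral>X. f X - A \<partial>?m) = (\<integral>X. f X \<partial>?m) - (\<integral>X. A \<partial>?m)"
        by (intro Bochner_Integration.integral_diff K.continuous_integrable continuous_intros cf)
      then show ?thesis by simp
    qed
    also have "(\<integral>X. f X \<partial>?m) - (\<integral>X. A \<partial>?m) = 0"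
      unfolding I_def[symmetric] A_def using v K.measure_cone_measure_space by (simp add: v_def)
    finally show ?thesis unfolding J_def f_def using K.measure_cone_measure_space by (simp add: v_def)
  qed
  have "(\<integral>X. h X \<partial>?m) \<ge> 0" using h0 by (intro integral_nonneg_AE) simp
  then have J1: "J \<ge> v * A powr p" using Ih by simp
  have AR: "v * A powr p \<ge> R" unfolding Rq using v Aq q0 p by (intro mult_left_mono powr_mono2) auto
  show "J \<ge> R" using J1 AR by linarith
  show "\<exists>c>0. \<forall>X\<in>hyp_boundary K. phi_ratio K L X = c" if p1: "p > 1" and JR: "J = R"
  proof -
    have "(\<integral>X. h X \<partial>?m) = 0" using Ih J1 AR JR by linarith
    then have "AE X in ?m. h X = 0"
      using integral_nonneg_eq_0_iff_AE[OF K.continuous_integrable[OF ch]] h0 by simp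
    have "f X = A" if X: "X \<in> hyp_boundary K" for X
    proof (rule ccontr)
      assume "f X \<noteq> A"
      then have "h X > 0" unfolding h_def using powr_above_tangent(2)[OF f0[of X] A0 p p1] by simp
      let ?O = "hyp_boundary K \<inter> h -` {0<..}"
      have "openin (top_of_set (hyp_boundary K)) ?O" using ch by (rule continuous_openin_preimage_gen) simp
      moreover have "?O \<noteq> {}" using X \<open>h X > 0\<close> by auto
      ultimately have "measure ?m ?O > 0" by (rule K.cone_measure_open_pos)
      moreover have "measure ?m ?O = 0"
      proof -
        have "AE X in ?m. X \<notin> ?O" using \<open>AE X in ?m. h X = 0\<close> by eventually_elim auto
        moreover have "?O \<in> sets ?m"
        proof -
          have "h -` {0<..} \<inter> space ?m \<in> sets ?m" using K.continuous_measurable[OF ch] by (rule measurable_sets) simp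
          then show ?thesis by (simp add: Int_commute)
        qed
        ultimately have "?O \<in> null_sets ?m" by (simp add: AE_iff_null_sets)
        then show ?thesis by (simp add: measure_def null_setsD1)
      qed
      ultimately show False by simp
    qed
    then show ?thesis using A0 unfolding f_def by blast
  qed
qed

section \<open>The area measure\<close>

lemma cosh_hyp_radius: "X \<in> hyp_space \<Longrightarrow> cosh (hyp_radius X) = snd X"
  and sinh_hyp_radius: "X \<in> hyp_space \<Longrightarrow> sinh (hyp_radius X) = norm (fst X)"
proof -
  assume X: "X \<in> hyp_space"
  have h: "fst X \<bullet> fst X = (snd X)\<^sup>2 - 1" "snd X > 0" using X by (simp_all add: hyp_space_def mink_def power2_eq_square)
  have s1: "snd X \<ge> 1" by (rule hyp_spaceD(5)[OF X])
  have r: "hyp_radius X = arcosh (snd X)" by (simp add: hyp_dist_def hyp_origin_def mink_def)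
  show c: "cosh (hyp_radius X) = snd X" unfolding r using s1 by simp
  have "(sinh (hyp_radius X))\<^sup>2 = (norm (fst X))\<^sup>2"
    using cosh_square_eq[of "hyp_radius X"] h(1) unfolding c by (simp add: power2_norm_eq_inner)
  moreover have "sinh (hyp_radius X) \<ge> 0" unfolding r using s1 by simp
  ultimately show "sinh (hyp_radius X) = norm (fst X)" by (simp add: power2_eq_iff_nonneg)
qed

text \<open>The radial field times sinh r is \<open>snd X *\<^sub>R X\<close> minus the origin
  \<open>(0, 1)\<close>, also at the origin itself. As \<nu> is orthogonal to \<open>X\<close>, only
  its last coordinate survives.\<close>

lemma u_tilde_eq:
  assumes "smooth_bounded_domain K" "X \<in> hyp_boundary K"
  shows "u_tilde K X = snd (outward_normal K X)"
proof -
  have X: "X \<in> hyp_space" using smooth_bounded_domainD(5)[OF assms] .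
  let ?N = "outward_normal K X"
  have orth: "fst X \<bullet> fst ?N = snd X * snd ?N" using outward_normal_props(3)[OF assms] by (simp add: mink_def)
  have "norm (fst X) *\<^sub>R sgn (fst X) = fst X" by (cases "fst X = 0") (simp_all add: sgn_div_norm)
  then have "fst X \<bullet> fst ?N = norm (fst X) * (sgn (fst X) \<bullet> fst ?N)" by (metis inner_scaleR_left)
  then have "u_tilde K X = snd X * (fst X \<bullet> fst ?N) - (norm (fst X))\<^sup>2 * snd ?N"
    unfolding u_tilde_def radial_field_def mink_def cosh_hyp_radius[OF X] sinh_hyp_radius[OF X]
    by (simp add: power2_eq_square)
  also have "(norm (fst X))\<^sup>2 = (snd X)\<^sup>2 - 1"
    using hyp_spaceD(3)[OF X] by (simp add: power2_norm_eq_inner power2_eq_square[of "snd X"])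
  finally show ?thesis unfolding orth by (simp add: power2_eq_square algebra_simps)
qed

text \<open>So the denominators in both functionals are powers of the last coordinate of X -
  \<nu>.\<close>

lemma gauss_speed_eq:
  assumes "smooth_bounded_domain K" "X \<in> hyp_boundary K"
  shows "cosh (hyp_radius X) - u_tilde K X = gauss_speed K X"
  using cosh_hyp_radius[OF smooth_bounded_domainD(5)[OF assms]] u_tilde_eq[OF assms] by (simp add: gauss_speed_def)

lemma shifted_curvature_product_eq:
  fixes K :: "'n::finite minkowski set"
  assumes "smooth_bounded_domain K" "X \<in> hyp_boundary K"
    and "principal_curvatures K X = image_mset k (mset_set (UNIV :: 'n set))"
  shows "shifted_curvature_product K X = (\<Prod>i\<in>UNIV. snd X * k i - snd (outward_normal K X))"
  unfolding shifted_curvature_product_def assms(3) u_tilde_eq[OF assms(1,2)]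
    cosh_hyp_radius[OF smooth_bounded_domainD(5)[OF assms(1,2)]]
  by (simp add: image_mset.compositionality o_def prod_unfold_prod_mset)

text \<open>As curvatures exceed 1, each factor exceeds the last coordinate of X - \<nu>, which is
  positive.\<close>

lemma shifted_curvature_product_pos:
  assumes dom: "uniformly_h_convex_domain K" and X: "X \<in> hyp_boundary K"
  shows "shifted_curvature_product K X > 0"
proof -
  have sm: "smooth_bounded_domain K" and h: "uniformly_h_convex K"
    using dom by (simp_all add: uniformly_h_convex_domain_def)
  obtain d where d: "d > 0" "\<forall>X\<in>hyp_boundary K. \<forall>k\<in>#principal_curvatures K X. k > 1 + d"
    using h unfolding uniformly_h_convex_def by blast
  have s: "snd X > 0" using smooth_bounded_domainD(5)[OF sm X] by (simp add: hyp_space_def)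
  have a: "snd X - snd (outward_normal K X) > 0" using gauss_dir_props(1)[OF sm X] by (simp add: gauss_speed_def)
  have pos: "snd X * k - snd (outward_normal K X) > 0" if "k \<in># principal_curvatures K X" for k
  proof -
    have "k > 1" using d(1) bspec[OF bspec[OF d(2) X] that] by linarith
    then have "snd X * k > snd X" using s by simp
    then show ?thesis using a by simp
  qed
  have prod: "(\<Prod>k\<in>#M. snd X * k - snd (outward_normal K X)) > 0" if "set_mset M \<subseteq> set_mset (principal_curvatures K X)" for M
    using that by (induction M) (auto intro!: mult_pos_pos pos)
  show ?thesis unfolding shifted_curvature_product_def u_tilde_eq[OF sm X]
      cosh_hyp_radius[OF smooth_bounded_domainD(5)[OF sm X]] by (rule prod[OF subset_refl])
qed

text \<open>The density of the cone measure with respect to area. One factor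
  \<open>gauss_speed K X\<close> in the denominator comes from the support number, the other n from
  the differential of the horo point; n + 1 is the usual divisor in the volume of a cone.\<close>

definition cone_density :: "'n::finite minkowski set \<Rightarrow> 'n minkowski \<Rightarrow> real" where
  "cone_density K X = shifted_curvature_product K X / ((real CARD('n) + 1) * gauss_speed K X ^ (CARD('n) + 1))"

context
  fixes K :: "'n::finite minkowski set" and U F and x :: "real ^ 'n"
  assumes dom: "smooth_bounded_domain K" and F: "regular_param (hyp_boundary K) U F" and x: "x \<in> U"
begin

text \<open>The horo point is a quotient in the coordinates of the null vector X - \<nu>. The terms
  of its derivative combine into a \<open>tangent_proj\<close> of a tangent vector, so the
  differential is orthogonal to \<open>z\<close>, as it must be at a point with normal
  \<open>z\<close>.\<close>

lemma param_horo_point_derivative: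
  "((\<lambda>y. horo_point K (F y)) has_derivative (\<lambda>v. - inverse (gauss_speed K (F x)) *\<^sub>R
     tangent_proj (gauss_dir K (F x)) (snd (F x) *\<^sub>R shape_operator K (F x) (DF F x v) - snd (outward_normal K (F x)) *\<^sub>R DF F x v))) (at x)"
proof -
  note Fx = regular_paramD(2)[OF F x]
  let ?W = "\<lambda>v. shape_operator K (F x) (DF F x v)"
  define l where "l = (\<lambda>y. F y - outward_normal K (F y))"
  define a where "a = gauss_speed K (F x)"
  define z where "z = gauss_dir K (F x)"
  have a0: "a > 0" unfolding a_def by (rule gauss_dir_props(1)[OF dom Fx])
  have "l x = a *\<^sub>R (z, 1)" unfolding l_def a_def z_def by (rule gauss_dir_props(3)[OF dom Fx])
  then have zl: "fst (l x) = a *\<^sub>R z" and al: "snd (l x) = a" by simp_all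
  have l: "(l has_derivative (\<lambda>v. DF F x v - ?W v)) (at x)"
    unfolding l_def by (intro has_derivative_diff regular_paramD(3)[OF F x] param_normal_derivative[OF dom F x])
  have Y: "horo_point K (F y) = (snd (F y) * inverse (snd (l y))) *\<^sub>R fst (l y) - fst (F y)" for y
    by (simp add: horo_point_def gauss_dir_def gauss_speed_def l_def)
  have "((\<lambda>y. (snd (F y) * inverse (snd (l y))) *\<^sub>R fst (l y) - fst (F y)) has_derivative
     (\<lambda>v. ((snd (F x) * inverse (snd (l x))) *\<^sub>R fst (DF F x v - ?W v) +
        (snd (F x) * (- (inverse (snd (l x)) * snd (DF F x v - ?W v) * inverse (snd (l x)))) + snd (DF F x v) * inverse (snd (l x))) *\<^sub>R fst (l x)) - fst (DF F x v))) (at x)"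
    by (intro has_derivative_diff has_derivative_scaleR has_derivative_mult has_derivative_fst has_derivative_snd l
        regular_paramD(3)[OF F x] Deriv.has_derivative_inverse) (use a0 al in simp)
  moreover have "((snd (F x) * inverse (snd (l x))) *\<^sub>R fst (DF F x v - ?W v) +
        (snd (F x) * (- (inverse (snd (l x)) * snd (DF F x v - ?W v) * inverse (snd (l x)))) + snd (DF F x v) * inverse (snd (l x))) *\<^sub>R fst (l x)) - fst (DF F x v)
     = - inverse a *\<^sub>R tangent_proj z (snd (F x) *\<^sub>R ?W v - snd (outward_normal K (F x)) *\<^sub>R DF F x v)" for v
  proof -
    have n: "snd (outward_normal K (F x)) = snd (F x) - a" unfolding a_def gauss_speed_def by simp
    have "inverse a *\<^sub>R a *\<^sub>R u = u" for u :: "'n espace" using a0 by simp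
    show ?thesis unfolding zl al n tangent_proj_def
      using a0 by (simp add: prod_eq_iff vec_eq_iff field_simps)
  qed
  ultimately show ?thesis unfolding Y a_def z_def by simp
qed

text \<open>In isometric coordinates the induced metric is a Gram matrix, so its determinant is a
  square.\<close>

lemma area_density_eq: "area_density F x = \<bar>det (matrix (tangent_coord (gauss_dir K (F x)) \<circ> DF F x))\<bar>"
proof -
  note Fx = regular_paramD(2)[OF F x]
  let ?B = "tangent_coord (gauss_dir K (F x)) \<circ> DF F x"
  have "(\<chi> i j. mink (DF F x (axis i 1)) (DF F x (axis j 1))) = transpose (matrix ?B) ** matrix ?B"
    unfolding vec_eq_iff
  proof (intro allI)
    fix i j
    have "(transpose (matrix ?B) ** matrix ?B) $ i $ j = ?B (axis i 1) \<bullet> ?B (axis j 1)"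
      by (simp add: matrix_matrix_mult_def transpose_def matrix_def inner_vec_def)
    also have "\<dots> = mink (DF F x (axis i 1)) (DF F x (axis j 1))"
      using tangent_coord_inner[OF dom Fx param_derivative_tangent[OF dom F x] param_derivative_tangent[OF dom F x]] by simp
    finally show "(\<chi> i j. mink (DF F x (axis i 1)) (DF F x (axis j 1))) $ i $ j = (transpose (matrix ?B) ** matrix ?B) $ i $ j" by simp
  qed
  then show ?thesis unfolding area_density_def by (simp add: det_mul)
qed

lemma area_density_pos: "area_density F x > 0"
proof -
  note Fx = regular_paramD(2)[OF F x]
  let ?B = "tangent_coord (gauss_dir K (F x)) \<circ> DF F x"
  have linB: "linear ?B"
    by (intro linear_compose linear_tangent_coord has_derivative_linear[OF regular_paramD(3)[OF F x]])
  have "inj ?B"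
  proof (rule injI)
    fix a b assume "?B a = ?B b"
    then have "DF F x a = DF F x b"
      using tangent_coord_inj[OF dom Fx param_derivative_tangent[OF dom F x] param_derivative_tangent[OF dom F x]] by simp
    then show "a = b" using regular_paramD(4)[OF F x] by (simp add: inj_eq)
  qed
  then have "det (matrix ?B) \<noteq> 0" using det_nz_iff_inj[OF linB] by simp
  then show ?thesis unfolding area_density_eq by simp
qed

lemma param_cone_derivative:
  "((\<lambda>p. snd p *\<^sub>R horo_point K (F (fst p))) has_derivative (\<lambda>q. s *\<^sub>R (- inverse (gauss_speed K (F x)) *\<^sub>R
     tangent_proj (gauss_dir K (F x)) (snd (F x) *\<^sub>R shape_operator K (F x) (DF F x (fst q)) - snd (outward_normal K (F x)) *\<^sub>R DF F x (fst q)))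
     + snd q *\<^sub>R horo_point K (F x))) (at (x, s))"
proof -
  have "((\<lambda>p. horo_point K (F (fst p))) has_derivative (\<lambda>q. - inverse (gauss_speed K (F x)) *\<^sub>R
     tangent_proj (gauss_dir K (F x)) (snd (F x) *\<^sub>R shape_operator K (F x) (DF F x (fst q)) - snd (outward_normal K (F x)) *\<^sub>R DF F x (fst q)))) (at (x, s))"
    by (rule has_derivative_compose[OF has_derivative_fst[OF has_derivative_ident]]) (use param_horo_point_derivative in simp)
  from has_derivative_scaleR[OF has_derivative_snd[OF has_derivative_ident] this] show ?thesis
    by (simp only: fst_conv snd_conv)
qed

text \<open>
  After composition with the reflection \<open>swap_to z\<close>, the differential of the cone map is block
  triangular, because \<open>z\<close> is orthogonal to the image of the differential of \<open>Y\<close>.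
\<close>
lemma param_cone_jacobian:
  assumes K: "uniformly_h_convex_domain K" and s: "s \<ge> 0"
    and D: "((\<lambda>p. snd p *\<^sub>R horo_point K (F (fst p))) has_derivative D) (at (x, s))"
  shows "\<bar>prod_det D\<bar> = (real CARD('n) + 1) * s ^ CARD('n) * (cone_density K (F x) * area_density F x)"
proof -
  note Fx = regular_paramD(2)[OF F x]
  define X a z m where "X = F x" and "a = gauss_speed K (F x)" and "z = gauss_dir K (F x)" and "m = snd (outward_normal K (F x))"
  let ?Q = "tangent_coord z"
  have a0: "a > 0" and nz: "norm z = 1" using gauss_dir_props[OF dom Fx] by (simp_all add: a_def z_def)
  obtain S :: "real^'n \<Rightarrow> real^'n" and e k where S: "linear S"
    "\<And>w. w \<in> boundary_tangent K X \<Longrightarrow> ?Q (shape_operator K X w) = S (?Q w)"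
    and e: "\<And>i j. e i \<bullet> e j = (if i = j then 1 else 0)" and k: "\<And>i. S (e i) = k i *\<^sub>R e i"
    and pc: "principal_curvatures K X = image_mset k (mset_set (UNIV :: 'n set))"
    using shape_operator_spectrum[OF dom Fx] unfolding X_def z_def by blast
  \<comment> \<open>The shifted Weingarten map in coordinates; its eigenvalues
    \<open>snd X * k i - m\<close> are the factors of
    \<open>shifted_curvature_product\<close>.\<close>
  define T where "T = (\<lambda>v. snd X *\<^sub>R S v - m *\<^sub>R v)"
  have linT: "linear T" unfolding T_def
    by (intro linear_compose_sub linear_compose_scale_right S(1) linear_id[unfolded id_def])
  have "T (e i) = (snd X * k i - m) *\<^sub>R e i" for i unfolding T_def k by (simp add: scaleR_diff_left)
  from det_eigenbasis[OF linT e this] have detT: "det (matrix T) = shifted_curvature_product K X"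
    using shifted_curvature_product_eq[OF dom Fx pc[unfolded X_def]] by (simp add: X_def m_def)
  define B where "B = ?Q \<circ> DF F x"
  have linDF: "linear (DF F x)" by (rule has_derivative_linear[OF regular_paramD(3)[OF F x]])
  have linB: "linear B" unfolding B_def by (intro linear_compose linear_tangent_coord linDF)
  define M where "M = (\<lambda>v. (- s / a) *\<^sub>R (T \<circ> B) v)"
  have linTB: "linear (T \<circ> B)" by (intro linear_compose linT linB)
  have linM: "linear M" unfolding M_def by (intro linear_compose_scale_right linTB)
  have linc: "linear ((*\<^sub>R) (- s / a) :: real^'n \<Rightarrow> real^'n)"
    by (intro linear_compose_scale_right linear_id[unfolded id_def])
  have "M = (*\<^sub>R) (- s / a) \<circ> (T \<circ> B)" by (simp add: M_def fun_eq_iff)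
  then have "det (matrix M) = (- s / a) ^ CARD('n) * det (matrix (T \<circ> B))"
    by (simp only: matrix_compose[OF linTB linc] det_mul det_matrix_scaleR)
  also have "det (matrix (T \<circ> B)) = shifted_curvature_product K X * det (matrix B)"
    by (simp add: matrix_compose[OF linB linT] det_mul detT)
  finally have "\<bar>det (matrix M)\<bar> = (s / a) ^ CARD('n) * (\<bar>shifted_curvature_product K X\<bar> * area_density F x)"
    unfolding area_density_eq B_def z_def using s a0 by (simp add: abs_mult power_abs)
  then have detM: "\<bar>det (matrix M)\<bar> = (s / a) ^ CARD('n) * (shifted_curvature_product K X * area_density F x)"
    using shifted_curvature_product_pos[OF K Fx] unfolding X_def by simp
  define w where "w = (\<lambda>v. snd X *\<^sub>R shape_operator K X (DF F x v) - m *\<^sub>R DF F x v)"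
  have t: "DF F x v \<in> boundary_tangent K X" "shape_operator K X (DF F x v) \<in> boundary_tangent K X" "w v \<in> boundary_tangent K X" for v
    unfolding w_def X_def using param_derivative_tangent[OF dom F x] param_shape_tangent[OF dom F x]
    by (auto intro!: subspace_diff subspace_scale subspace_boundary_tangent)
  have Qw: "?Q (w v) = T (B v)" for v
    unfolding w_def T_def B_def using S(2)[OF t(1)]
    by (simp add: linear_diff[OF linear_tangent_coord] linear_scale[OF linear_tangent_coord])
  have Deq: "D = (\<lambda>q. s *\<^sub>R (- inverse a *\<^sub>R tangent_proj z (w (fst q))) + snd q *\<^sub>R horo_point K X)"
    using has_derivative_unique[OF D param_cone_derivative] unfolding w_def a_def z_def X_def m_def .
  have sw: "swap_to z (tangent_proj z (w v)) = (T (B v), 0)" for v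
    using snd_swap_tangent_proj[OF dom Fx t(3)[of v, unfolded X_def], folded z_def] Qw[of v]
    by (simp add: prod_eq_iff tangent_coord_def)
  have sY: "snd (swap_to z (horo_point K X)) = inverse a"
  proof -
    interpret h_convex_domain K by unfold_locales (rule K)
    have "horo_point K X \<bullet> z = inverse a"
      using horo_point_inner_dir[OF Fx] horo_phi_gauss[OF Fx] by (simp add: X_def z_def a_def)
    then show ?thesis using snd_swap_to[OF nz] by (simp add: inner_commute)
  qed
  have "swap_to z \<circ> D = (\<lambda>p. (M (fst p) + snd p *\<^sub>R fst (swap_to z (horo_point K X)), inverse a * snd p))"
    unfolding Deq o_def linear_add[OF linear_swap_to] linear_scale[OF linear_swap_to] sw
    by (rule ext) (simp add: prod_eq_iff M_def sY divide_inverse)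
  then have "prod_det (swap_to z \<circ> D) = inverse a * det (matrix M)" using prod_det_block[OF linM] by simp
  moreover have "prod_det (swap_to z \<circ> D) = prod_det (swap_to z) * prod_det D"
    by (intro prod_det_compose linear_swap_to has_derivative_linear[OF D])
  moreover have "\<bar>prod_det (swap_to z)\<bar> = 1" by (rule prod_det_orthogonal[OF linear_swap_to swap_to_inner])
  ultimately have "\<bar>prod_det D\<bar> = inverse a * \<bar>det (matrix M)\<bar>"
    using a0 by (metis abs_mult abs_of_pos mult_1 positive_imp_inverse_positive)
  moreover have "inverse a * ((s / a) ^ CARD('n) * (c * d)) = r * s ^ CARD('n) * (c / (r * a ^ (CARD('n) + 1)) * d)"
    if "r > 0" for c d r using that a0 by (simp add: field_simps power_divide)
  moreover have "real CARD('n) + 1 > 0" by simp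
  ultimately show ?thesis unfolding detM cone_density_def X_def a_def by (simp only:)
qed

end

section \<open>Measurability of Jacobians\<close>

text \<open>A directional derivative is a pointwise limit of difference quotients, hence measurable
  even where its continuity is not assumed. Extending \<open>g\<close> by 0 makes the quotients
  defined everywhere; for small steps this changes nothing, as \<open>V\<close> is open.\<close>

lemma borel_measurable_derivative:
  fixes g :: "'a::euclidean_space \<Rightarrow> 'b::euclidean_space"
  assumes V: "open V" and der: "\<And>p. p \<in> V \<Longrightarrow> (g has_derivative g' p) (at p)"
  shows "(\<lambda>p. indicator V p *\<^sub>R g' p q) \<in> borel_measurable borel"
proof (subst borel_measurable_euclidean_space, rule ballI)
  fix b :: 'b assume "b \<in> Basis"
  define G where "G = (\<lambda>p. indicator V p *\<^sub>R g p)"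
  have cont: "continuous_on V g"
    by (intro continuous_at_imp_continuous_on ballI) (rule has_derivative_continuous[OF der])
  have [measurable]: "G \<in> borel_measurable borel"
    unfolding G_def by (intro borel_measurable_continuous_on_indicator cont borel_open V)
  have [measurable]: "V \<in> sets borel" by (rule borel_open[OF V])
  define h where "h = (\<lambda>n. inverse (real (Suc n)))"
  have h0: "h \<longlonglongrightarrow> 0" unfolding h_def by (rule LIMSEQ_inverse_real_of_nat)
  define u where "u = (\<lambda>n p. indicator V p * ((G (p + h n *\<^sub>R q) \<bullet> b - G p \<bullet> b) / h n))"
  have "u n \<in> borel_measurable borel" for n unfolding u_def by measurable
  moreover have "(\<lambda>n. u n p) \<longlonglongrightarrow> (indicator V p *\<^sub>R g' p q) \<bullet> b" for p
  proof (cases "p \<in> V")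
    case True
    have "((\<lambda>t. g (p + t *\<^sub>R q) \<bullet> b) has_derivative (\<lambda>t. g' p (t *\<^sub>R q) \<bullet> b)) (at 0)"
      by (rule has_derivative_inner_left, rule has_derivative_compose[where g = g and f = "\<lambda>t. p + t *\<^sub>R q"])
         (use der[OF True] in \<open>auto intro!: derivative_eq_intros\<close>)
    moreover have "(\<lambda>t. g' p (t *\<^sub>R q) \<bullet> b) = (*) (g' p q \<bullet> b)"
      using linear_scale[OF has_derivative_linear[OF der[OF True]]] by (simp add: fun_eq_iff)
    ultimately have "((\<lambda>t. g (p + t *\<^sub>R q) \<bullet> b) has_real_derivative g' p q \<bullet> b) (at 0)"
      by (simp add: has_field_derivative_def)
    then have lim: "(\<lambda>t. (g (p + t *\<^sub>R q) \<bullet> b - g p \<bullet> b) / t) \<midarrow>0\<rightarrow> g' p q \<bullet> b"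
      by (simp add: DERIV_def)
    have "filterlim h (at 0) sequentially"
      using h0 by (intro filterlim_atI) (auto simp: h_def)
    from filterlim_compose[OF lim this]
    have "(\<lambda>n. (g (p + h n *\<^sub>R q) \<bullet> b - g p \<bullet> b) / h n) \<longlonglongrightarrow> g' p q \<bullet> b" .
    moreover have "(\<lambda>n. p + h n *\<^sub>R q) \<longlonglongrightarrow> p + 0 *\<^sub>R q" by (intro tendsto_intros h0)
    then have "\<forall>\<^sub>F n in sequentially. p + h n *\<^sub>R q \<in> V" using V True by (intro topological_tendstoD) auto
    then have "\<forall>\<^sub>F n in sequentially. (g (p + h n *\<^sub>R q) \<bullet> b - g p \<bullet> b) / h n = u n p"
      by eventually_elim (simp add: u_def G_def True)
    ultimately have "(\<lambda>n. u n p) \<longlonglongrightarrow> g' p q \<bullet> b" by (rule Lim_transform_eventually)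
    then show ?thesis using True by simp
  qed (simp add: u_def)
  ultimately show "(\<lambda>p. (indicator V p *\<^sub>R g' p q) \<bullet> b) \<in> borel_measurable borel"
    by (rule borel_measurable_LIMSEQ_real[where u = u, rotated])
qed

lemma borel_measurable_vec_nth: "(\<lambda>v :: real ^ 'm::finite. v $ i) \<in> borel_measurable borel"
  by (intro borel_measurable_continuous_onI continuous_intros)

lemma borel_measurable_prod_det:
  fixes L :: "'a \<Rightarrow> (real, 'n::finite) vec \<times> real \<Rightarrow> (real, 'n) vec \<times> real"
  assumes "\<And>q. (\<lambda>x. L x q) \<in> borel_measurable M"
  shows "(\<lambda>x. prod_det (L x)) \<in> borel_measurable M"
proof -
  have "(\<lambda>x. to_ext (L x q) $ i) \<in> borel_measurable M" for q i
    by (rule measurable_compose[OF borel_measurable_continuous_on[OF continuous_on_to_ext assms] borel_measurable_vec_nth])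
  then show ?thesis unfolding prod_det_def det_def matrix_def by simp
qed

lemma borel_measurable_det:
  fixes A :: "'a \<Rightarrow> real ^ 'n::finite ^ 'n"
  assumes "\<And>i j. (\<lambda>x. A x $ i $ j) \<in> borel_measurable M"
  shows "(\<lambda>x. det (A x)) \<in> borel_measurable M"
  unfolding det_def using assms by simp

text \<open>The radial integral, which cancels the factor n + 1 of the cone Jacobian.\<close>

lemma nn_integral_power_unit: "(\<integral>\<^sup>+s. ennreal (indicator {0<..1} s * s ^ n) \<partial>lborel) = ennreal (1 / (real n + 1))"
proof -
  have "(\<integral>\<^sup>+s. ennreal (s ^ n) * indicator {0..1} s \<partial>lborel) = ennreal (1 ^ Suc n / (real n + 1) - 0 ^ Suc n / (real n + 1))"
  proof (rule nn_integral_FTC_Icc)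
    fix s :: real
    have "((\<lambda>s. s ^ Suc n / (real n + 1)) has_real_derivative real (Suc n) * s ^ n / (real n + 1)) (at s)"
      by (auto intro!: derivative_eq_intros simp del: power_Suc)
    moreover have "real (Suc n) * s ^ n / (real n + 1) = s ^ n"
    proof -
      have "real (Suc n) = real n + 1" "real n + 1 \<noteq> 0" by linarith+
      then show ?thesis by (simp only: nonzero_mult_div_cancel_left not_False_eq_True)
    qed
    ultimately show "((\<lambda>s. s ^ Suc n / (real n + 1)) has_real_derivative s ^ n) (at s)" by (simp only:)
  qed auto
  moreover have "(\<integral>\<^sup>+s. ennreal (indicator {0<..1} s * s ^ n) \<partial>lborel) = (\<integral>\<^sup>+s. ennreal (s ^ n) * indicator {0..1} s \<partial>lborel)"
  proof (rule nn_integral_cong_AE)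
    show "AE s in lborel. ennreal (indicator {0<..1} s * s ^ n) = ennreal (s ^ n) * indicator {0..1} s"
      using AE_lborel_singleton[of "0::real"] by eventually_elim (auto simp: indicator_def)
  qed
  ultimately show ?thesis by simp
qed

context h_convex_domain
begin

lemma cone_density_pos: "X \<in> hyp_boundary K \<Longrightarrow> cone_density K X > 0"
  unfolding cone_density_def
  by (intro divide_pos_pos mult_pos_pos zero_less_power shifted_curvature_product_pos dom gauss_dir_props(1) smooth) auto

section \<open>The cone measure in a chart\<close>

context
  fixes U F assumes F: "regular_param (hyp_boundary K) U F"
begin

text \<open>The image is the preimage under the continuous inverse chart, taken inside a relatively
  open subset of the compact boundary.\<close>

lemma chart_borel_image: "B \<in> sets borel \<Longrightarrow> B \<subseteq> U \<Longrightarrow> F ` B \<in> sets borel"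
proof -
  assume B: "B \<in> sets borel" "B \<subseteq> U"
  obtain G where G: "homeomorphism U (F ` U) F G" using F by (auto simp: regular_param_def)
  obtain V where "open V" "F ` U = hyp_boundary K \<inter> V" using F by (auto simp: regular_param_def openin_open)
  then have FU: "F ` U \<in> sets borel" using boundary_borel by auto
  have "G \<in> borel_measurable (restrict_space borel (F ` U))"
    using G by (intro borel_measurable_continuous_on_restrict) (simp add: homeomorphism_def)
  then have "G -` B \<inter> space (restrict_space borel (F ` U)) \<in> sets (restrict_space borel (F ` U))"
    using B(1) by (rule measurable_sets)
  moreover have "G -` B \<inter> space (restrict_space borel (F ` U)) = F ` B"
  proof (intro set_eqI iffI)
    fix X assume "X \<in> F ` B"
    then obtain x where "x \<in> B" "X = F x" by blast
    then show "X \<in> G -` B \<inter> space (restrict_space borel (F ` U))"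
      using homeomorphism_apply1[OF G, of x] B(2) by (simp add: space_restrict_space subset_eq)
  next
    fix X assume "X \<in> G -` B \<inter> space (restrict_space borel (F ` U))"
    then have "G X \<in> B" "X \<in> F ` U" by (simp_all add: space_restrict_space)
    then show "X \<in> F ` B" using homeomorphism_apply2[OF G, of X] by (metis imageI)
  qed
  ultimately show "F ` B \<in> sets borel" using FU by (simp add: sets_restrict_space_iff)
qed

lemma chart_inj: "inj_on F U"
  using F homeomorphism_apply1 unfolding regular_param_def by (metis inj_onI)

lemma chart_subset: "F ` U \<subseteq> hyp_boundary K"
  using regular_paramD(2)[OF F] by blast

lemma chart_measurable: "F \<in> measurable (restrict_space lborel U) (restrict_space borel (hyp_boundary K))"
proof (rule measurable_restrict_space2)
  show "F \<in> space (restrict_space lborel U) \<rightarrow> hyp_boundary K"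
    using chart_subset by (auto simp: space_restrict_space)
  show "F \<in> borel_measurable (restrict_space lborel U)"
    using borel_measurable_continuous_on_restrict[OF regular_paramD(5)[OF F]]
      measurable_cong_sets[OF sets_restrict_space_cong[OF sets_lborel] refl] by blast
qed

lemma chart_area_density_measurable: "(\<lambda>x. indicator U x * area_density F x) \<in> borel_measurable borel"
proof -
  note [measurable] = borel_open[OF regular_paramD(1)[OF F]]
  define D where "D = (\<lambda>x v. indicator U x *\<^sub>R frechet_derivative F (at x) v)"
  have [measurable]: "(\<lambda>x. D x v) \<in> borel_measurable borel" for v
    unfolding D_def by (intro borel_measurable_derivative[where g = F, OF regular_paramD(1)[OF F]] regular_paramD(3)[OF F])
  have "(\<lambda>x. det (\<chi> i j. mink (D x (axis i 1)) (D x (axis j 1)))) \<in> borel_measurable borel"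
  proof (rule borel_measurable_det)
    fix i j
    have "continuous_on UNIV (\<lambda>p. mink (fst p) (snd p))" unfolding mink_def by (intro continuous_intros)
    then have "(\<lambda>x. mink (D x (axis i 1)) (D x (axis j 1))) \<in> borel_measurable borel"
      by (intro borel_measurable_continuous_Pair[where H = mink]) auto
    then show "(\<lambda>x. (\<chi> i j. mink (D x (axis i 1)) (D x (axis j 1))) $ i $ j) \<in> borel_measurable borel" by simp
  qed
  then have "(\<lambda>x. indicator U x * sqrt (det (\<chi> i j. mink (D x (axis i 1)) (D x (axis j 1))))) \<in> borel_measurable borel"
    by measurable
  moreover have "indicator U x * sqrt (det (\<chi> i j. mink (D x (axis i 1)) (D x (axis j 1)))) = indicator U x * area_density F x" for x
    by (cases "x \<in> U") (simp_all add: D_def area_density_def)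
  ultimately show ?thesis by simp
qed

text \<open>The indicator sits inside the determinant, so that every column is a globally measurable
  function.\<close>

definition "cone_jacobian p = \<bar>prod_det (\<lambda>q. indicator (U \<times> UNIV) p *\<^sub>R
   frechet_derivative (\<lambda>p. snd p *\<^sub>R horo_point K (F (fst p))) (at p) q)\<bar>"

lemma cone_chart_derivative:
  assumes "x \<in> U"
  shows "((\<lambda>p. snd p *\<^sub>R horo_point K (F (fst p))) has_derivative
    frechet_derivative (\<lambda>p. snd p *\<^sub>R horo_point K (F (fst p))) (at (x, s))) (at (x, s))"
  using param_cone_derivative[OF smooth F assms, of s] frechet_derivative_works differentiableI by blast

lemma cone_jacobian_measurable: "cone_jacobian \<in> borel_measurable borel"
proof -
  have "open (U \<times> (UNIV :: real set))" by (intro open_Times regular_paramD(1)[OF F] open_UNIV)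
  then have "(\<lambda>p. prod_det (\<lambda>q. indicator (U \<times> UNIV) p *\<^sub>R
     frechet_derivative (\<lambda>p. snd p *\<^sub>R horo_point K (F (fst p))) (at p) q)) \<in> borel_measurable borel"
    by (intro borel_measurable_prod_det borel_measurable_derivative) (auto simp del: frechet_derivative_works intro: cone_chart_derivative)
  then show ?thesis unfolding cone_jacobian_def by measurable
qed

lemma cone_jacobian_eq:
  assumes "x \<in> U" "s \<ge> 0"
  shows "cone_jacobian (x, s) = (real CARD('n) + 1) * s ^ CARD('n) * (cone_density K (F x) * area_density F x)"
    "cone_jacobian (x, s) = \<bar>prod_det (frechet_derivative (\<lambda>p. snd p *\<^sub>R horo_point K (F (fst p))) (at (x, s)))\<bar>"
  using param_cone_jacobian[OF smooth F assms(1) dom assms(2) cone_chart_derivative[OF assms(1)]] assms(1)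
  unfolding cone_jacobian_def by simp_all

text \<open>Curvatures are given through eigenspaces and are not visibly measurable; the density is
  therefore read off from the Jacobian of the cone map at radius 1.\<close>

lemma chart_cone_density_measurable:
  "(\<lambda>x. indicator U x * (cone_density K (F x) * area_density F x)) \<in> borel_measurable borel"
proof -
  note [measurable] = borel_open[OF regular_paramD(1)[OF F]] cone_jacobian_measurable
  have "(\<lambda>x. indicator U x * (cone_jacobian (x, 1) / (real CARD('n) + 1))) \<in> borel_measurable borel"
    by measurable
  moreover have "indicator U x * (cone_jacobian (x, 1) / (real CARD('n) + 1)) = indicator U x * (cone_density K (F x) * area_density F x)" for x
    using cone_jacobian_eq(1)[of x 1] by (cases "x \<in> U") (simp_all add: add_nonneg_eq_0_iff)
  ultimately show ?thesis by (simp only:)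
qed

text \<open>The cone over the image of \<open>B\<close> is the injective image of
  \<open>B \<times> {0<..1}\<close> under the cone map. The Jacobian is a power of the radius times
  a function of the parameter, and integrating out the radius leaves the density.\<close>

lemma chart_cone_measure:
  assumes B: "B \<in> sets borel" "B \<subseteq> U"
  shows "emeasure (cone_measure K) (F ` B) = (\<integral>\<^sup>+x. ennreal (indicator B x * (cone_density K (F x) * area_density F x)) \<partial>lborel)"
proof -
  let ?g = "\<lambda>p. snd p *\<^sub>R horo_point K (F (fst p))" and ?g' = "\<lambda>p. frechet_derivative (\<lambda>p. snd p *\<^sub>R horo_point K (F (fst p))) (at p)"
  let ?S = "B \<times> {0<..1::real}" and ?N = "real CARD('n) + 1"
  let ?w = "\<lambda>x. cone_density K (F x) * area_density F x"
  have FB: "F ` B \<in> sets borel" "F ` B \<subseteq> hyp_boundary K"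
    using chart_borel_image[OF B] chart_subset B(2) by blast+
  have img: "cone 1 (F ` B) = ?g ` ?S"
  proof (intro set_eqI iffI)
    fix P assume "P \<in> cone 1 (F ` B)"
    then obtain r x where "0 < r" "r \<le> 1" "x \<in> B" "P = r *\<^sub>R horo_point K (F x)" unfolding cone_def by blast
    then show "P \<in> ?g ` ?S" by (intro image_eqI[of _ _ "(x, r)"]) auto
  next
    fix P assume "P \<in> ?g ` ?S"
    then obtain r x where "0 < r" "r \<le> 1" "x \<in> B" "P = r *\<^sub>R horo_point K (F x)" by auto
    then show "P \<in> cone 1 (F ` B)" unfolding cone_def by blast
  qed
  have [measurable]: "B \<in> sets borel" by (rule B)
  have SB: "?S \<in> sets borel" using B by (simp add: borel_Times)
  have J: "indicator ?S p * \<bar>prod_det (?g' p)\<bar> = indicator ?S p * cone_jacobian p" for p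
    using cone_jacobian_eq(2)[of "fst p" "snd p"] B(2) by (cases "p \<in> ?S") auto
  note [measurable] = SB cone_jacobian_measurable
  have "emeasure lborel (?g ` ?S) = (\<integral>\<^sup>+p. ennreal (indicator ?S p * \<bar>prod_det (?g' p)\<bar>) \<partial>lborel)"
  proof (rule emeasure_differentiable_image[OF SB])
    show "?g ` ?S \<in> sets borel" using emeasure_cone_measure(1)[OF FB(2,1)] unfolding img .
    show "bounded (?g ` ?S)" using bounded_horo_body cone_1[OF FB(2)] unfolding img by (auto intro: bounded_subset)
    show "(?g has_derivative ?g' p) (at p within ?S)" if "p \<in> ?S" for p
    proof -
      have "fst p \<in> U" using that B(2) by auto
      from has_derivative_at_withinI[OF cone_chart_derivative[OF this, of "snd p"], of ?S] show ?thesis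
        by (simp only: prod.collapse)
    qed
    show "inj_on ?g ?S"
    proof (rule inj_onI)
      fix p q assume p: "p \<in> ?S" and q: "q \<in> ?S" and eq: "?g p = ?g q"
      have in': "fst p \<in> U" "fst q \<in> U" "snd p > 0" "snd q > 0" using p q B(2) by auto
      have "snd p = snd q" "F (fst p) = F (fst q)"
        using horo_point_scaled_inj[OF regular_paramD(2)[OF F in'(1)] regular_paramD(2)[OF F in'(2)] in'(3,4) eq] by blast+
      then show "p = q" using inj_onD[OF chart_inj _ in'(1,2)] by (simp add: prod_eq_iff)
    qed
    show "(\<lambda>p. indicator ?S p * \<bar>prod_det (?g' p)\<bar>) \<in> borel_measurable borel" unfolding J by measurable
  qed
  also have "\<dots> = (\<integral>\<^sup>+p. ennreal (indicator ?S p * cone_jacobian p) \<partial>(lborel \<Otimes>\<^sub>M lborel))"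
    unfolding J lborel_prod ..
  also have "\<dots> = (\<integral>\<^sup>+x. \<integral>\<^sup>+s. ennreal (indicator ?S (x, s) * cone_jacobian (x, s)) \<partial>lborel \<partial>lborel)"
    by (rule lborel.nn_integral_fst[symmetric]) (simp add: lborel_prod)
  also have "\<dots> = (\<integral>\<^sup>+x. ennreal (indicator B x * ?w x) \<partial>lborel)"
  proof (rule nn_integral_cong)
    fix x
    show "(\<integral>\<^sup>+s. ennreal (indicator ?S (x, s) * cone_jacobian (x, s)) \<partial>lborel) = ennreal (indicator B x * ?w x)"
    proof (cases "x \<in> B")
      case True
      then have xU: "x \<in> U" using B(2) by blast
      have w: "?w x \<ge> 0"
        using cone_density_pos[OF regular_paramD(2)[OF F xU]] area_density_pos[OF smooth F xU] by simp
      have "ennreal (indicator ?S (x, s) * cone_jacobian (x, s)) = ennreal (?N * ?w x) * ennreal (indicator {0<..1} s * s ^ CARD('n))" for s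
      proof -
        have "indicator ?S (x, s) * cone_jacobian (x, s) = (?N * ?w x) * (indicator {0<..1} s * s ^ CARD('n))"
          using True cone_jacobian_eq(1)[OF xU, of s] by (cases "s \<in> {0<..1}") simp_all
        moreover have "?N * ?w x \<ge> 0" by (intro mult_nonneg_nonneg[OF _ w]) auto
        ultimately show ?thesis by (simp only: ennreal_mult')
      qed
      then have "(\<integral>\<^sup>+s. ennreal (indicator ?S (x, s) * cone_jacobian (x, s)) \<partial>lborel)
          = ennreal (?N * ?w x) * (\<integral>\<^sup>+s. ennreal (indicator {0<..1} s * s ^ CARD('n)) \<partial>lborel)"
        by (simp only:) (rule nn_integral_cmult, measurable)
      also have "\<dots> = ennreal (?N * ?w x * (1 / ?N))"
        unfolding nn_integral_power_unit using w by (intro ennreal_mult[symmetric]) auto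
      also have "?N * ?w x * (1 / ?N) = ?w x" by (simp add: add_nonneg_eq_0_iff)
      finally show ?thesis using True by simp
    qed simp
  qed
  finally show ?thesis unfolding emeasure_cone_measure(2)[OF FB(2,1)] img .
qed

lemma chart_cone_measure_integral:
  assumes B: "B \<in> sets borel" "B \<subseteq> U" and h: "h \<in> borel_measurable (cone_measure K)"
  shows "(\<integral>\<^sup>+X\<in>F ` B. h X \<partial>cone_measure K)
    = (\<integral>\<^sup>+x\<in>B. h (F x) * ennreal (cone_density K (F x) * area_density F x) \<partial>lborel)"
proof -
  let ?R = "restrict_space borel (hyp_boundary K)" and ?w = "\<lambda>x. cone_density K (F x) * area_density F x"
  let ?f = "\<lambda>x. ennreal (indicator U x * ?w x)"
  note U = borel_open[OF regular_paramD(1)[OF F]]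
  have U': "U \<inter> space lborel \<in> sets lborel" using U by simp
  have f: "?f \<in> borel_measurable borel" using chart_cone_density_measurable by measurable
  have f': "?f \<in> borel_measurable (restrict_space lborel U)" by (rule measurable_restrict_space1) (use f in simp)
  \<comment> \<open>The measure with the expected density, transported to the boundary. It agrees
    with the cone measure on subsets of the chart, and the formula for integrals follows.\<close>
  define M where "M = distr (density (restrict_space lborel U) ?f) ?R F"
  have Fm: "F \<in> measurable (density (restrict_space lborel U) ?f) ?R" using chart_measurable by simp
  have FU: "F ` U \<in> sets (cone_measure K)" using chart_borel_image[OF U order_refl] chart_subset sets_boundary by simp
  have FUi: "indicator (F ` U) \<in> borel_measurable (cone_measure K)" by (rule borel_measurable_indicator[OF FU])
  have FBs: "F ` B \<in> sets (cone_measure K)"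
    using chart_borel_image[OF B] order_trans[OF image_mono[OF B(2)] chart_subset] sets_boundary by simp
  have int: "(\<integral>\<^sup>+X. k X \<partial>M) = (\<integral>\<^sup>+x\<in>U. k (F x) * ennreal (?w x) \<partial>lborel)" if k: "k \<in> borel_measurable ?R" for k
  proof -
    have kF: "(\<lambda>x. k (F x)) \<in> borel_measurable (restrict_space lborel U)" by (rule measurable_compose[OF chart_measurable k])
    have "(\<integral>\<^sup>+X. k X \<partial>M) = (\<integral>\<^sup>+x. k (F x) \<partial>density (restrict_space lborel U) ?f)"
      unfolding M_def by (rule nn_integral_distr[OF Fm]) (use k in simp)
    also have "\<dots> = (\<integral>\<^sup>+x. ?f x * k (F x) \<partial>restrict_space lborel U)" by (rule nn_integral_density[OF f' kF])
    also have "\<dots> = (\<integral>\<^sup>+x. ?f x * k (F x) * indicator U x \<partial>lborel)" by (rule nn_integral_restrict_space[OF U'])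
    also have "\<dots> = (\<integral>\<^sup>+x\<in>U. k (F x) * ennreal (?w x) \<partial>lborel)"
      by (intro nn_integral_cong) (simp add: indicator_def mult.commute)
    finally show ?thesis .
  qed
  have "M = density (cone_measure K) (indicator (F ` U))"
  proof (rule measure_eqI)
    show "sets M = sets (density (cone_measure K) (indicator (F ` U)))" by (simp add: M_def)
    fix A assume "A \<in> sets M"
    then have A: "A \<in> sets ?R" by (simp add: M_def)
    let ?B = "U \<inter> F -` A"
    have "?B \<in> sets borel"
    proof -
      have "F -` A \<inter> space (restrict_space lborel U) \<in> sets (restrict_space lborel U)"
        by (rule measurable_sets[OF chart_measurable A])
      then show ?thesis using U by (simp add: sets_restrict_space_iff space_restrict_space Int_commute)
    qed
    have "emeasure M A = (\<integral>\<^sup>+X. indicator A X \<partial>M)" using A by (simp add: M_def)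
    also have "\<dots> = (\<integral>\<^sup>+x\<in>U. indicator A (F x) * ennreal (?w x) \<partial>lborel)" by (rule int) (use A in simp)
    also have "\<dots> = (\<integral>\<^sup>+x. ennreal (indicator ?B x * ?w x) \<partial>lborel)"
      by (intro nn_integral_cong) (simp add: indicator_def)
    also have "\<dots> = emeasure (cone_measure K) (F ` ?B)"
      by (rule chart_cone_measure[symmetric]) (use \<open>?B \<in> sets borel\<close> in auto)
    also have "F ` ?B = F ` U \<inter> A" by blast
    also have "emeasure (cone_measure K) (F ` U \<inter> A) = (\<integral>\<^sup>+X. indicator (F ` U \<inter> A) X \<partial>cone_measure K)"
      by (rule nn_integral_indicator[symmetric]) (use A FU in simp)
    also have "\<dots> = (\<integral>\<^sup>+X. indicator (F ` U) X * indicator A X \<partial>cone_measure K)"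
      by (simp only: indicator_inter_arith)
    also have "\<dots> = emeasure (density (cone_measure K) (indicator (F ` U))) A"
      by (rule emeasure_density[symmetric, OF FUi]) (use A in simp)
    finally show "emeasure M A = emeasure (density (cone_measure K) (indicator (F ` U))) A" .
  qed
  note Meq = this
  have k: "(\<lambda>X. h X * indicator (F ` B) X) \<in> borel_measurable (cone_measure K)"
    by (rule borel_measurable_times_ennreal[OF h borel_measurable_indicator[OF FBs]])
  then have k': "(\<lambda>X. h X * indicator (F ` B) X) \<in> borel_measurable ?R"
    by (simp only: measurable_cong_sets[OF sets_cone_measure refl])
  have "(\<integral>\<^sup>+X\<in>F ` B. h X \<partial>cone_measure K) = (\<integral>\<^sup>+X. indicator (F ` U) X * (h X * indicator (F ` B) X) \<partial>cone_measure K)"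
  proof (rule nn_integral_cong)
    fix X
    have "X \<in> F ` B \<Longrightarrow> X \<in> F ` U" using B(2) by blast
    then show "h X * indicator (F ` B) X = indicator (F ` U) X * (h X * indicator (F ` B) X)"
      by (cases "X \<in> F ` B") (simp_all only: indicator_def of_bool_eq simp_thms mult_zero_right mult_1_left)
  qed
  also have "\<dots> = (\<integral>\<^sup>+X. h X * indicator (F ` B) X \<partial>M)"
    unfolding Meq by (rule nn_integral_density[OF FUi k, symmetric])
  also have "\<dots> = (\<integral>\<^sup>+x\<in>U. (h (F x) * indicator (F ` B) (F x)) * ennreal (?w x) \<partial>lborel)"
    by (rule int[OF k'])
  also have "\<dots> = (\<integral>\<^sup>+x\<in>B. h (F x) * ennreal (?w x) \<partial>lborel)"
  proof (rule nn_integral_cong)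
    fix x
    show "h (F x) * indicator (F ` B) (F x) * ennreal (?w x) * indicator U x = h (F x) * ennreal (?w x) * indicator B x"
    proof (cases "x \<in> U")
      case True
      have "F x \<in> F ` B \<longleftrightarrow> x \<in> B" by (rule inj_on_image_mem_iff[OF chart_inj True B(2)])
      then have "indicator (F ` B) (F x) = (indicator B x :: ennreal)" unfolding indicator_def by (simp only:)
      then show ?thesis using True by (simp add: mult_ac)
    next
      case False
      then have "x \<notin> B" using B(2) by blast
      then show ?thesis using False by simp
    qed
  qed
  finally show ?thesis .
qed

end

end

section \<open>The area measure as a reweighted cone measure\<close>

context h_convex_domain
begin

lemma finite_chart_cover:
  obtains \<C> where "finite \<C>" "\<Union>\<C> = hyp_boundary K"
    "\<forall>C\<in>\<C>. \<exists>U F. regular_param (hyp_boundary K) U F \<and> C = F ` U"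
proof -
  let ?T = "{T. open T \<and> (\<exists>U F. regular_param (hyp_boundary K) U F \<and> F ` U = hyp_boundary K \<inter> T)}"
  have "hyp_boundary K \<subseteq> \<Union>?T"
  proof
    fix X assume "X \<in> hyp_boundary K"
    then obtain U F where F: "regular_param (hyp_boundary K) U F" "X \<in> F ` U" using boundary_chart[OF smooth] by blast
    then obtain T where "open T" "F ` U = hyp_boundary K \<inter> T" by (auto simp: regular_param_def openin_open)
    then show "X \<in> \<Union>?T" using F by blast
  qed
  then obtain D where D: "D \<subseteq> ?T" "finite D" "hyp_boundary K \<subseteq> \<Union>D"
    using compactE[OF compact_boundary, of ?T] by (metis (no_types, lifting) mem_Collect_eq)
  show ?thesis
  proof (rule that)
    show "finite ((\<lambda>T. hyp_boundary K \<inter> T) ` D)" using D(2) by (rule finite_imageI)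
    show "\<Union>((\<lambda>T. hyp_boundary K \<inter> T) ` D) = hyp_boundary K" using D(3) by blast
    show "\<forall>C\<in>(\<lambda>T. hyp_boundary K \<inter> T) ` D. \<exists>U F. regular_param (hyp_boundary K) U F \<and> C = F ` U"
    proof
    fix C assume "C \<in> (\<lambda>T. hyp_boundary K \<inter> T) ` D"
    then obtain T where T: "C = hyp_boundary K \<inter> T" "T \<in> D" by blast
    have "\<exists>U F. regular_param (hyp_boundary K) U F \<and> F ` U = hyp_boundary K \<inter> T"
      using subsetD[OF D(1) T(2)] by (rule CollectE) (erule conjunct2)
    then show "\<exists>U F. regular_param (hyp_boundary K) U F \<and> C = F ` U"
      unfolding T(1) by (elim exE conjE) (intro exI conjI, assumption, erule sym)
    qed
  qed
qed

lemma chart_vimage_borel: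
  assumes F: "regular_param (hyp_boundary K) U F" and A: "A \<in> sets (restrict_space borel (hyp_boundary K))"
  shows "U \<inter> F -` A \<in> sets borel"
proof -
  have "F -` A \<inter> space (restrict_space lborel U) \<in> sets (restrict_space lborel U)"
    by (rule measurable_sets[OF chart_measurable[OF F] A])
  then show ?thesis using borel_open[OF regular_paramD(1)[OF F]]
    by (simp add: sets_restrict_space_iff space_restrict_space Int_commute)
qed

lemma measurable_cone_density: "cone_density K \<in> borel_measurable (cone_measure K)"
proof (rule borel_measurableI_greater)
  fix a
  obtain \<C> where C: "finite \<C>" "\<Union>\<C> = hyp_boundary K"
    "\<forall>C\<in>\<C>. \<exists>U F. regular_param (hyp_boundary K) U F \<and> C = F ` U" using finite_chart_cover .
  have "{X \<in> C. a < cone_density K X} \<in> sets borel" if mem: "C \<in> \<C>" for C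
  proof -
    obtain U F where F: "regular_param (hyp_boundary K) U F" "C = F ` U" using bspec[OF C(3) mem] by blast
    note [measurable] = chart_area_density_measurable[OF F(1)] chart_cone_density_measurable[OF F(1)]
      borel_open[OF regular_paramD(1)[OF F(1)]]
    \<comment> \<open>Multiplying the condition by the positive area density brings in the product
      \<open>cone_density K (F x) * area_density F x\<close>, whose measurability in the chart is
      known.\<close>
    have "{x \<in> U. a * (indicator U x * area_density F x) < indicator U x * (cone_density K (F x) * area_density F x)} \<in> sets borel"
      by measurable
    also have "{x \<in> U. a * (indicator U x * area_density F x) < indicator U x * (cone_density K (F x) * area_density F x)}
        = {x \<in> U. a < cone_density K (F x)}"
      using area_density_pos[OF smooth F(1)] by auto
    finally have "F ` {x \<in> U. a < cone_density K (F x)} \<in> sets borel" by (rule chart_borel_image[OF F(1)]) blast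
    moreover have "F ` {x \<in> U. a < cone_density K (F x)} = {X \<in> C. a < cone_density K X}" unfolding F(2) by blast
    ultimately show ?thesis by simp
  qed
  then have "(\<Union>C\<in>\<C>. {X \<in> C. a < cone_density K X}) \<in> sets borel" by (intro sets.finite_UN C(1))
  moreover have "(\<Union>C\<in>\<C>. {X \<in> C. a < cone_density K X}) = {X \<in> space (cone_measure K). a < cone_density K X}"
    using C(2) unfolding space_cone_measure by blast
  moreover have "{X \<in> space (cone_measure K). a < cone_density K X} \<subseteq> hyp_boundary K"
    unfolding space_cone_measure by blast
  ultimately show "{X \<in> space (cone_measure K). a < cone_density K X} \<in> sets (cone_measure K)"
    unfolding sets_cone_measure sets_boundary by (simp only:)
qed

text \<open>Defined globally from the cone measure: existence of the area measure then amounts to a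
  cancellation of the density in every chart.\<close>

definition "boundary_area = density (cone_measure K) (\<lambda>X. ennreal (1 / cone_density K X))"

lemma sets_boundary_area: "sets boundary_area = sets (restrict_space borel (hyp_boundary K))"
  by (simp add: boundary_area_def)

lemma chart_boundary_area:
  assumes F: "regular_param (hyp_boundary K) U F" and B: "B \<in> sets borel" "B \<subseteq> U"
  shows "emeasure boundary_area (F ` B) = (\<integral>\<^sup>+x\<in>B. ennreal (area_density F x) \<partial>lborel)"
proof -
  have FB: "F ` B \<in> sets (cone_measure K)"
    using chart_borel_image[OF F B] order_trans[OF image_mono[OF B(2)] chart_subset[OF F]] sets_boundary by simp
  have h: "(\<lambda>X. ennreal (1 / cone_density K X)) \<in> borel_measurable (cone_measure K)"
    using measurable_cone_density by measurable
  have "emeasure boundary_area (F ` B) = (\<integral>\<^sup>+X\<in>F ` B. ennreal (1 / cone_density K X) \<partial>cone_measure K)"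
    unfolding boundary_area_def by (rule emeasure_density[OF h FB])
  also have "\<dots> = (\<integral>\<^sup>+x\<in>B. ennreal (1 / cone_density K (F x)) * ennreal (cone_density K (F x) * area_density F x) \<partial>lborel)"
    by (rule chart_cone_measure_integral[OF F B h])
  also have "\<dots> = (\<integral>\<^sup>+x\<in>B. ennreal (area_density F x) \<partial>lborel)"
  proof (rule nn_integral_cong)
    fix x
    show "ennreal (1 / cone_density K (F x)) * ennreal (cone_density K (F x) * area_density F x) * indicator B x
        = ennreal (area_density F x) * indicator B x"
    proof (cases "x \<in> B")
      case True
      then have "x \<in> U" using B(2) by blast
      from cone_density_pos[OF regular_paramD(2)[OF F this]] area_density_pos[OF smooth F this]
      show ?thesis by (simp add: ennreal_mult[symmetric])
    qed simp
  qed
  finally show ?thesis .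
qed

text \<open>Induction over a finite atlas: a set is split into its part inside the new chart, where
  the formula decides, and the rest, which the other charts cover.\<close>

lemma area_measure_unique:
  assumes \<mu>: "sets \<mu> = sets (restrict_space borel (hyp_boundary K))"
    and chart: "\<And>U F B. regular_param (hyp_boundary K) U F \<Longrightarrow> B \<in> sets borel \<Longrightarrow> B \<subseteq> U \<Longrightarrow>
      emeasure \<mu> (F ` B) = (\<integral>\<^sup>+x\<in>B. ennreal (area_density F x) \<partial>lborel)"
  shows "\<mu> = boundary_area"
proof (rule measure_eqI)
  let ?R = "restrict_space borel (hyp_boundary K)"
  show "sets \<mu> = sets boundary_area" unfolding \<mu> sets_boundary_area ..
  obtain \<C> where C: "finite \<C>" "\<Union>\<C> = hyp_boundary K"
    "\<forall>C\<in>\<C>. \<exists>U F. regular_param (hyp_boundary K) U F \<and> C = F ` U" using finite_chart_cover .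
  have "\<forall>A. A \<in> sets ?R \<longrightarrow> A \<subseteq> \<Union>\<D> \<longrightarrow> emeasure \<mu> A = emeasure boundary_area A"
    if "finite \<D>" "\<D> \<subseteq> \<C>" for \<D>
    using that
  proof (induction \<D> rule: finite_induct)
    case (insert C \<D>)
    obtain U F where F: "regular_param (hyp_boundary K) U F" "C = F ` U" using bspec[OF C(3), of C] insert.prems by blast
    have CR: "C \<in> sets ?R" unfolding F(2) sets_boundary
      using chart_subset[OF F(1)] chart_borel_image[OF F(1) borel_open[OF regular_paramD(1)[OF F(1)]] order_refl] by blast
    show ?case
    proof (intro allI impI)
      fix A assume A: "A \<in> sets ?R" "A \<subseteq> \<Union>(insert C \<D>)"
      let ?B = "U \<inter> F -` A"
      have B: "?B \<in> sets borel" "?B \<subseteq> U" using chart_vimage_borel[OF F(1) A(1)] by blast+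
      have AC: "A \<inter> C = F ` ?B" unfolding F(2) by blast
      have 1: "emeasure \<mu> (A \<inter> C) = emeasure boundary_area (A \<inter> C)"
        unfolding AC chart[OF F(1) B] chart_boundary_area[OF F(1) B] ..
      have s: "A \<inter> C \<in> sets ?R" "A - C \<in> sets ?R" by (rule sets.Int[OF A(1) CR], rule sets.Diff[OF A(1) CR])
      have "A - C \<subseteq> \<Union>\<D>" using A(2) by blast
      then have 2: "emeasure \<mu> (A - C) = emeasure boundary_area (A - C)"
        using insert.IH insert.prems s(2) by blast
      have d: "(A \<inter> C) \<inter> (A - C) = {}" "(A \<inter> C) \<union> (A - C) = A" by blast+
      have "emeasure \<mu> A = emeasure \<mu> (A \<inter> C) + emeasure \<mu> (A - C)"
        using plus_emeasure[of "A \<inter> C" \<mu> "A - C"] s d unfolding \<mu> by simp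
      also have "\<dots> = emeasure boundary_area A"
        using plus_emeasure[of "A \<inter> C" boundary_area "A - C"] s d unfolding sets_boundary_area 1 2 by simp
      finally show "emeasure \<mu> A = emeasure boundary_area A" .
    qed
  qed simp
  from this[OF C(1) order_refl] show "emeasure \<mu> A = emeasure boundary_area A" if "A \<in> sets \<mu>" for A
    using that C(2) unfolding \<mu> sets_boundary by blast
qed

lemma area_measure_boundary: "area_measure (hyp_boundary K) = boundary_area"
  unfolding area_measure_def
proof (rule the_equality)
  show "sets boundary_area = sets (restrict_space borel (hyp_boundary K)) \<and>
    (\<forall>U F B. regular_param (hyp_boundary K) U F \<and> B \<in> sets borel \<and> B \<subseteq> U \<longrightarrow>
        emeasure boundary_area (F ` B) = (\<integral>\<^sup>+x\<in>B. ennreal (area_density F x) \<partial>lborel))"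
    using sets_boundary_area chart_boundary_area by (intro conjI allI impI) auto
qed (intro area_measure_unique, auto)

text \<open>The density of the cone measure with respect to area cancels against the weight in
  \<open>boundary_area\<close>.\<close>

lemma integral_area_measure:
  assumes f: "f \<in> borel_measurable (cone_measure K)"
    and g: "\<And>X. X \<in> hyp_boundary K \<Longrightarrow> g X = cone_density K X * f X"
  shows "(\<integral>X. g X \<partial>area_measure (hyp_boundary K)) = (\<integral>X. f X \<partial>cone_measure K)"
proof -
  have "(\<integral>X. g X \<partial>area_measure (hyp_boundary K)) = (\<integral>X. cone_density K X * f X \<partial>boundary_area)"
    unfolding area_measure_boundary by (intro Bochner_Integration.integral_cong g) (simp_all add: boundary_area_def)
  also have "\<dots> = (\<integral>X. (1 / cone_density K X) *\<^sub>R (cone_density K X * f X) \<partial>cone_measure K)"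
    unfolding boundary_area_def
  proof (rule integral_density)
    show "(\<lambda>X. cone_density K X * f X) \<in> borel_measurable (cone_measure K)"
      "(\<lambda>X. 1 / cone_density K X) \<in> borel_measurable (cone_measure K)"
      using f measurable_cone_density by measurable
    show "AE X in cone_measure K. 0 \<le> 1 / cone_density K X"
      using cone_density_pos by (intro AE_I2) (simp only: space_cone_measure zero_le_divide_1_iff less_imp_le)
  qed
  also have "\<dots> = (\<integral>X. f X \<partial>cone_measure K)"
    by (rule Bochner_Integration.integral_cong[OF refl]) (use cone_density_pos in \<open>simp add: less_imp_neq[symmetric]\<close>)
  finally show ?thesis .
qed

lemma cone_density_eq:
  assumes X: "X \<in> hyp_boundary K"
  shows "shifted_curvature_product K X / gauss_speed K X ^ (CARD('n) + 1) = (real CARD('n) + 1) * cone_density K X"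
  by (simp add: cone_density_def add_nonneg_eq_0_iff)

text \<open>The integrand is n + 1 times the density, so the integral is n + 1 times the total mass
  of the cone measure.\<close>

lemma hyp_V_eq: "hyp_V K = vol (horo_body K)"
proof -
  have "(\<integral>X. shifted_curvature_product K X / (cosh (hyp_radius X) - u_tilde K X) ^ (CARD('n) + 1) \<partial>area_measure (hyp_boundary K))
      = (\<integral>X. real CARD('n) + 1 \<partial>cone_measure K)"
  proof (rule integral_area_measure)
    fix X assume X: "X \<in> hyp_boundary K"
    show "shifted_curvature_product K X / (cosh (hyp_radius X) - u_tilde K X) ^ (CARD('n) + 1) = cone_density K X * (real CARD('n) + 1)"
      unfolding gauss_speed_eq[OF smooth X] cone_density_eq[OF X] by simp
  qed simp
  then show ?thesis unfolding hyp_V_def using measure_cone_measure_space by (simp add: add_nonneg_eq_0_iff)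
qed

end

text \<open>The factor \<open>a powr p\<close> split off the denominator joins
  \<open>horo_phi L\<close> to form the ratio of support functions, since \<open>a\<close> is the
  reciprocal of \<open>horo_phi K\<close> at the Gauss image.\<close>

lemma hyp_Vp_eq:
  assumes hK: "h_convex_domain K" and hL: "h_convex_domain L"
  shows "hyp_Vp p K L = (\<integral>X. phi_ratio K L X powr p \<partial>cone_measure K)"
proof -
  interpret K: h_convex_domain K by fact
  interpret L: h_convex_domain L by fact
  let ?N = "real CARD('a) + 1"
  have "(\<integral>X. horo_phi L (horo_gauss K X) powr p *
          (shifted_curvature_product K X / (cosh (hyp_radius X) - u_tilde K X) powr (?N - p)) \<partial>area_measure (hyp_boundary K))
      = (\<integral>X. ?N * phi_ratio K L X powr p \<partial>cone_measure K)"
  proof (rule K.integral_area_measure)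
    show "(\<lambda>X. ?N * phi_ratio K L X powr p) \<in> borel_measurable (cone_measure K)"
      using K.continuous_measurable[OF continuous_on_phi_ratio[OF hK hL]] by measurable
    fix X assume X: "X \<in> hyp_boundary K"
    define a where "a = gauss_speed K X"
    define l where "l = horo_phi L (gauss_dir K X)"
    have a: "a > 0" using gauss_dir_props(1)[OF K.smooth X] by (simp add: a_def)
    have l: "l > 0" unfolding l_def by (rule L.horo_phi_pos)
    have r: "phi_ratio K L X = l * a"
      unfolding phi_ratio_def K.horo_phi_gauss[OF X] a_def l_def by (simp add: divide_inverse)
    have "shifted_curvature_product K X = ?N * cone_density K X * a powr ?N"
    proof -
      have "a powr ?N = a ^ (CARD('a) + 1)" using powr_realpow[OF a, of "CARD('a) + 1"] by (simp add: add.commute)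
      then show ?thesis using K.cone_density_eq[OF X] a unfolding a_def[symmetric] by (simp add: field_simps)
    qed
    moreover have "a powr ?N / a powr (?N - p) = a powr p" using a by (simp add: powr_diff[symmetric])
    ultimately have "shifted_curvature_product K X / a powr (?N - p) = ?N * cone_density K X * a powr p"
      by (metis times_divide_eq_right)
    then show "horo_phi L (horo_gauss K X) powr p * (shifted_curvature_product K X / (cosh (hyp_radius X) - u_tilde K X) powr (?N - p))
        = cone_density K X * (?N * phi_ratio K L X powr p)"
      unfolding gauss_speed_eq[OF K.smooth X] K.horo_gauss_eq[OF X] r a_def[symmetric] l_def[symmetric]
      using a l by (simp add: powr_mult)
  qed
  then show ?thesis unfolding hyp_Vp_def by (simp add: add_nonneg_eq_0_iff)
qed

text \<open>A free positive factor absorbs the two alternatives: when it is less than 1 the roles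
  are exchanged and its inverse is used.\<close>

lemma hyp_dilates_iff:
  assumes K: "uniformly_h_convex_domain K" and L: "uniformly_h_convex_domain L"
  shows "hyp_dilates K L \<longleftrightarrow> (\<exists>c>0. \<forall>z\<in>sphere 0 1. horo_phi L z = c * horo_phi K z)"
proof -
  have supp: "horo_support M z = horo_support M' z + ln c \<longleftrightarrow> horo_phi M z = c * horo_phi M' z" if "c > 0"
    for M M' :: "'a minkowski set" and c z
  proof -
    have "c * horo_phi M' z = exp (horo_support M' z + ln c)" using that by (simp add: horo_phi_def exp_add)
    then show ?thesis by (simp add: horo_phi_def)
  qed
  show ?thesis
  proof
    assume "hyp_dilates K L"
    then obtain c where c: "c \<ge> 1" "is_hyp_dilation c L K \<or> is_hyp_dilation c K L" by (auto simp: hyp_dilates_def)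
    then have c0: "c > 0" by simp
    from c(2) show "\<exists>c>0. \<forall>z\<in>sphere 0 1. horo_phi L z = c * horo_phi K z"
    proof
      assume "is_hyp_dilation c L K"
      then have "\<forall>z\<in>sphere 0 1. horo_phi K z = c * horo_phi L z" unfolding is_hyp_dilation_def supp[OF c0] by blast
      then show ?thesis using c0 by (intro exI[of _ "1 / c"]) auto
    next
      assume "is_hyp_dilation c K L"
      then show ?thesis unfolding is_hyp_dilation_def supp[OF c0] using c0 by blast
    qed
  next
    assume "\<exists>c>0. \<forall>z\<in>sphere 0 1. horo_phi L z = c * horo_phi K z"
    then obtain c where c: "c > 0" "\<forall>z\<in>sphere 0 1. horo_phi L z = c * horo_phi K z" by blast
    show "hyp_dilates K L"
    proof (cases "c \<ge> 1")
      case True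
      have "is_hyp_dilation c K L" unfolding is_hyp_dilation_def supp[OF c(1)] using L c(2) by blast
      then show ?thesis using True by (auto simp: hyp_dilates_def)
    next
      case False
      have c': "1 / c > 0" "1 / c \<ge> 1" using False c(1) by simp_all
      have "\<forall>z\<in>sphere 0 1. horo_phi K z = 1 / c * horo_phi L z" using c by auto
      then have "is_hyp_dilation (1 / c) L K" unfolding is_hyp_dilation_def supp[OF c'(1)] using K by blast
      then show ?thesis using c'(2) unfolding hyp_dilates_def by blast
    qed
  qed
qed

text \<open>For every \<open>p\<close> the ratio is the constant \<open>c\<close> and the body of
  \<open>L\<close> is the \<open>c\<close>-fold of that of \<open>K\<close>, so both sides equal
  \<open>v * c powr p\<close>.\<close>

lemma hyp_Vp_dilates:
  fixes K L :: "'n::finite minkowski set"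
  assumes K: "uniformly_h_convex_domain K" and L: "uniformly_h_convex_domain L" and dil: "hyp_dilates K L"
  shows "hyp_Vp p K L = hyp_V K powr ((real CARD('n) + 1 - p) / (real CARD('n) + 1)) *
           hyp_V L powr (p / (real CARD('n) + 1))"
proof -
  have hK: "h_convex_domain K" and hL: "h_convex_domain L" using K L by (unfold_locales)
  interpret K: h_convex_domain K by fact
  interpret L: h_convex_domain L by fact
  let ?N = "real CARD('n) + 1"
  obtain c where c: "c > 0" "\<forall>z\<in>sphere 0 1. horo_phi L z = c * horo_phi K z"
    using dil unfolding hyp_dilates_iff[OF K L] by blast
  define v where "v = vol (horo_body K)"
  have v: "v > 0" unfolding v_def by (rule K.vol_horo_body_pos)
  have "phi_ratio K L X = c" if X: "X \<in> hyp_boundary K" for X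
  proof -
    have "horo_phi L (gauss_dir K X) = c * horo_phi K (gauss_dir K X)"
      by (rule bspec[OF c(2)]) (use K.gauss(2)[OF X] in simp)
    then show ?thesis unfolding phi_ratio_def using K.horo_phi_pos[of "gauss_dir K X"] by simp
  qed
  then have "hyp_Vp p K L = (\<integral>X. c powr p \<partial>cone_measure K)"
    unfolding hyp_Vp_eq[OF hK hL] by (intro Bochner_Integration.integral_cong refl) (simp only: K.space_cone_measure)
  then have J: "hyp_Vp p K L = v * c powr p" using K.measure_cone_measure_space by (simp add: v_def)
  have "horo_body L = (\<lambda>P. c *\<^sub>R P) ` horo_body K"
  proof (intro set_eqI iffI)
    fix P assume P: "P \<in> horo_body L"
    have "(1 / c) *\<^sub>R P \<in> horo_body K"
      unfolding horo_body_def
    proof (intro CollectI ballI)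
      fix z :: "'n espace" assume z: "z \<in> sphere 0 1"
      have "P \<bullet> z \<le> c * horo_phi K z" using P z c(2) unfolding horo_body_def by fastforce
      then show "(1 / c) *\<^sub>R P \<bullet> z \<le> horo_phi K z" using c(1) by (simp add: pos_divide_le_eq mult.commute)
    qed
    then show "P \<in> (\<lambda>P. c *\<^sub>R P) ` horo_body K" using c(1) by (intro image_eqI[of _ _ "(1 / c) *\<^sub>R P"]) auto
  next
    fix P assume "P \<in> (\<lambda>P. c *\<^sub>R P) ` horo_body K"
    then obtain Q where Q: "Q \<in> horo_body K" "P = c *\<^sub>R Q" by blast
    show "P \<in> horo_body L" unfolding horo_body_def
    proof (intro CollectI ballI)
      fix z :: "'n espace" assume z: "z \<in> sphere 0 1"
      have "Q \<bullet> z \<le> horo_phi K z" using Q(1) z unfolding horo_body_def by blast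
      then show "P \<bullet> z \<le> horo_phi L z" using c z Q(2) by simp
    qed
  qed
  then have "vol (horo_body L) = c ^ (CARD('n) + 1) * v"
    using vol_scaleR[OF K.horo_body_borel c(1)] by (simp add: v_def)
  also have "\<dots> = c powr ?N * v" using powr_realpow[OF c(1), of "CARD('n) + 1"] by (simp add: add.commute)
  finally have l: "hyp_V L = c powr ?N * v" unfolding L.hyp_V_eq .
  have N: "?N \<noteq> 0" by linarith
  have "(c powr ?N * v) powr (p / ?N) = c powr p * v powr (p / ?N)"
    using c(1) v N by (simp add: powr_mult powr_powr)
  moreover have "v powr ((?N - p) / ?N) * v powr (p / ?N) = v"
  proof -
    have "(?N - p) / ?N + p / ?N = 1" unfolding add_divide_distrib[symmetric] using N by simp
    then show ?thesis unfolding powr_add[symmetric] using v by simp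
  qed
  ultimately show ?thesis unfolding J l K.hyp_V_eq v_def[symmetric] by (simp add: mult_ac)
qed

theorem theorem12p5:
  fixes K L :: "'n::finite minkowski set" and p :: real
  assumes "p \<ge> 1" and "uniformly_h_convex_domain K" and "uniformly_h_convex_domain L"
  shows "hyp_Vp p K L \<ge>
           hyp_V K powr ((real CARD('n) + 1 - p) / (real CARD('n) + 1)) *
           hyp_V L powr (p / (real CARD('n) + 1)) \<and>
         (p = 1 \<longrightarrow> hyp_dilates K L \<longrightarrow>
           hyp_Vp p K L =
             hyp_V K powr ((real CARD('n) + 1 - p) / (real CARD('n) + 1)) *
             hyp_V L powr (p / (real CARD('n) + 1))) \<and>
         (p > 1 \<longrightarrow>
           (hyp_Vp p K L =
             hyp_V K powr ((real CARD('n) + 1 - p) / (real CARD('n) + 1)) *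
             hyp_V L powr (p / (real CARD('n) + 1)) \<longleftrightarrow> hyp_dilates K L))"
proof -
  have hK: "h_convex_domain K" and hL: "h_convex_domain L" using assms(2,3) by (unfold_locales)
  interpret K: h_convex_domain K by fact
  interpret L: h_convex_domain L by fact
  let ?R = "hyp_V K powr ((real CARD('n) + 1 - p) / (real CARD('n) + 1)) * hyp_V L powr (p / (real CARD('n) + 1))"
  have "hyp_Vp p K L \<ge> ?R"
    unfolding hyp_Vp_eq[OF hK hL] K.hyp_V_eq L.hyp_V_eq by (rule Lp_Minkowski_inequality(1)[OF hK hL assms(1)])
  moreover have "hyp_dilates K L" if p: "p > 1" "hyp_Vp p K L = ?R"
  proof -
    obtain c where c: "c > 0" "\<forall>X\<in>hyp_boundary K. phi_ratio K L X = c"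
      using Lp_Minkowski_inequality(2)[OF hK hL assms(1) p(1)] p(2)
      unfolding hyp_Vp_eq[OF hK hL] K.hyp_V_eq L.hyp_V_eq by blast
    \<comment> \<open>The Gauss map is onto, so a ratio that is constant on the boundary is constant
      over all directions.\<close>
    have "horo_phi L z = c * horo_phi K z" if "z \<in> sphere 0 1" for z
    proof -
      obtain X where X: "X \<in> hyp_boundary K" "gauss_dir K X = z" using K.gauss_dir_surj[of z] \<open>z \<in> sphere 0 1\<close> by auto
      have "horo_phi L z / horo_phi K z = c" using bspec[OF c(2) X(1)] X(2) by (simp add: phi_ratio_def)
      then show ?thesis using K.horo_phi_pos[of z] by (simp add: field_simps)
    qed
    then show ?thesis unfolding hyp_dilates_iff[OF assms(2,3)] using c(1) by blast
  qed
  ultimately show ?thesis using hyp_Vp_dilates[OF assms(2,3)] by blast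
qed

end
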